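(* Let $V$ be a grading-restricted vertex superalgebra, $g$ an automorphism of $V$, and $\{\phi^i(x)\}_{i\in I}$ generating fields satisfying the generation assumption in the context. Let $W$, $\phi_W^i$ ($i\in I$), $\psi_W^a$ ($a\in A$), $L_W(0)$, $L_W(-1)$, $g,\mathcal L_g,\mathcal S_g,\mathcal N_g$ be data as in the context satisfying properties 1–7 listed there. Then for $v\in V$, $w'\in W'$, $p\in\mathbb Z$ and $\sigma\in S_k$, $$F^p(\langle w',\varphi_1(z_1)\cdots\varphi_k(z_k)v\rangle)=\pm F^p(\langle w',\varphi_{\sigma(1)}(z_{\sigma(1)})\cdots\varphi_{\sigma(k)}(z_{\sigma(k)})v\rangle),$$ where exactly one of $\varphi_1,\dots,\varphi_k$ is a generator twist field $\psi_W^a$ for some $a\in A$ and each of the others is a generating field with index in $I$ (interpreted, in each of the two products, as $\phi_W^i$ if it stands to the left of $\psi_W^a$ and as $\phi^i$ if it stands to the right of $\psi_W^a$), and the sign $\pm$ is uniquely determined by $\sigma$ and $|\varphi_1|,\dots,|\varphi_k|$.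
   Context: **Conventions.** $\mathbb N=\{0,1,2,\dots\}$. For $z\in\mathbb C^\times$, $\arg z\in[0,2\pi)$ and $l_p(z)=\log|z|+i\arg z+2\pi i p$, $p\in\mathbb Z$. For $W=\coprod_nW_{[n]}$, $W'=\coprod_nW_{[n]}^*$. The $p$-th branch $\phi^p(z)$ of a series $\phi(x)$ in complex powers of $x$ and nonnegative integral powers of $\log x$ is obtained by $x^n\mapsto e^{nl_p(z)}$, $\log x\mapsto l_p(z)$. $(x_1-x_2)^\beta$ and $\log(x_1-x_2)=\log x_1+\log(1-x_2/x_1)$ are expanded in nonnegative powers of $x_2$; $(-x_2+x_1)^\beta=e^{\pi i\beta}(x_2-x_1)^\beta$ and $\log(-x_2+x_1)=\pi i+\log x_2+\log(1-x_1/x_2)$ are expanded in nonnegative powers of $x_1$; $y^{\pm\mathcal N}=e^{\pm(\log y)\mathcal N}$. **Vertex superalgebras.** A grading-restricted vertex superalgebra is a $\frac12\mathbb Z\times\mathbb Z_2$-graded space $V=\coprod_{n,s}V_{(n)}^s$ ($|v|=s$ is the $\mathbb Z_2$-fermion number) with a map $Y_V:V\otimes V\to V((x))$, compatible with the $\mathbb Z_2$-grading, and a vacuum $\mathbf 1\in V_{(0)}^0$ such that: $\dim V_{(n)}<\infty$ and $V_{(n)}=0$ for $n$ sufficiently negative; $Y_V(\mathbf 1,x)=1_V$, $Y_V(u,x)\mathbf 1\in V[[x]]$ with constant term $u$; with $L_V(0)v=nv$ for $v\in V_{(n)}$, $[L_V(0),Y_V(v,x)]=x\frac{d}{dx}Y_V(v,x)+Y_V(L_V(0)v,x)$;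 with $L_V(-1)v=\mathrm{Res}_xx^{-2}Y_V(v,x)\mathbf 1$, $\frac{d}{dx}Y_V(v,x)=Y_V(L_V(-1)v,x)=[L_V(-1),Y_V(v,x)]$; and for $u_1,u_2,v\in V$, $v'\in V'$, the series $\langle v',Y_V(u_1,z_1)Y_V(u_2,z_2)v\rangle$, $(-1)^{|u_1||u_2|}\langle v',Y_V(u_2,z_2)Y_V(u_1,z_1)v\rangle$, $\langle v',Y_V(Y_V(u_1,z_1-z_2)u_2,z_2)v\rangle$ converge absolutely in $|z_1|>|z_2|>0$, $|z_2|>|z_1|>0$, $|z_2|>|z_1-z_2|>0$, respectively, to a common rational function with only possible poles $z_1=0$, $z_2=0$, $z_1=z_2$. An automorphism $g$ is a grading-preserving linear automorphism with $g\mathbf 1=\mathbf 1$, $gY_V(u,x)v=Y_V(gu,x)gv$. Then $V=\coprod_{\alpha\in P_V}V^{[\alpha]}$, $V^{[\alpha]}$ the generalized eigenspace of $g$ with eigenvalue $e^{2\pi i\alpha}$, $P_V=\{\alpha:\Re\alpha\in[0,1),\ e^{2\pi i\alpha}\text{ an eigenvalue of }g\}$; $g=e^{2\pi i\mathcal L_g}$, $\mathcal L_g=\mathcal S_g+\mathcal N_g$, $\mathcal S_g=\alpha$ on $V^{[\alpha]}$, $\mathcal N_g$ (locally) nilpotent commuting with $\mathcal S_g$. **Generation assumption.** $V$ is generated by fields $\phi^i(x)=Y_V(\phi^i_{-1}\mathbf 1,x)$, $i\in I$, with $\phi^i_{-1}\mathbf 1$ homogeneous of weight $\mathrm{wt}\,\phi^i$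 and fermion number $|\phi^i|$, a generalized eigenvector of $g$ with eigenvalue $e^{2\pi i\alpha^i}$, $\alpha^i\in P_V$. For each $i\in I$ either $\mathcal N_g\phi^i_{-1}\mathbf 1=0$ or $\mathcal N_g\phi^i_{-1}\mathbf 1=\phi^{\mathcal N_g(i)}_{-1}\mathbf 1$ for some $\mathcal N_g(i)\in I$; in the former case $\phi^{\mathcal N_g(i)}$ and $\phi_W^{\mathcal N_g(i)}$ denote $0$. **Data.** (a) $W=\coprod_{n\in\mathbb C,s\in\mathbb Z_2,\alpha\in P_W}W_{[n]}^{s;[\alpha]}$, graded by weight, fermion number and $g$-weight ($P_W\subset\{\Re\alpha\in[0,1)\}$), with $W_{[n]}=0$ when $\Re n$ is sufficiently negative. (b) Maps $\phi_W^i:W\to x^{-\alpha^i}W((x))[\log x]$, $\phi_W^i(x)w=\sum_{k\in\mathbb N}\sum_{n\in\alpha^i+\mathbb Z}(\phi_W^i)_{n,k}w\,x^{-n-1}(\log x)^k$, $i\in I$, of parity $|\phi^i|$. (c) Maps $\psi_W^a:V\to\sum_{\alpha\in P_V}x^{-\alpha}W((x))[\log x]$, $a\in A$, of parity $|\psi_W^a|$, with $\psi_W^a(x)v=\sum_{k\in\mathbb N}\sum_{n\in\alpha+\mathbb Z}(\psi_W^a)_{n,k}v\,x^{-n-1}(\log x)^k\in x^{-\alpha}W((x))[\log x]$ for $v\in V^{[\alpha]}$. (d) Operators $L_W(0),L_W(-1)$ on $W$. (e) An action of $g$ on $W$ with $g=e^{2\pi i\mathcal L_g}$, $\mathcal L_g=\mathcal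 S_g+\mathcal N_g$ (semisimple and nilpotent parts). The weight and $g$-weight gradings are by generalized eigenspaces of $L_W(0)$ (eigenvalue $n$) and $g$ (eigenvalue $e^{2\pi i\alpha}$). **Properties.** 1. $L_W(0)=L_W(0)_S+L_W(0)_N$ (semisimple and nilpotent parts); $[L_W(0),\phi_W^i(x)]=x\frac{d}{dx}\phi_W^i(x)+(\mathrm{wt}\,\phi^i)\phi_W^i(x)$; for $a\in A$ there is $\mathrm{wt}\,\psi_W^a\in\mathbb C$ and, when $L_W(0)_N\psi_W^a(x)\ne0$, an index $L_W(0)_N(a)\in A$ with $L_W(0)\psi_W^a(x)-\psi_W^a(x)L_V(0)=x\frac{d}{dx}\psi_W^a(x)+(\mathrm{wt}\,\psi_W^a)\psi_W^a(x)+\psi_W^{L_W(0)_N(a)}(x)$, the last term being $0$ when $L_W(0)_N\psi_W^a(x)=0$. 2. $[L_W(-1),\phi_W^i(x)]=\frac{d}{dx}\phi_W^i(x)$; $L_W(-1)\psi_W^a(x)-\psi_W^a(x)L_V(-1)=\frac{d}{dx}\psi_W^a(x)$. 3. $\psi_W^a(x)\mathbf 1\in W[[x]]$ and its constant term is homogeneous in weight, fermion number and $g$-weight. 4. $W$ is spanned by $(\phi_W^{i_1})_{n_1,l_1}\cdots(\phi_W^{i_k})_{n_k,l_k}(\psi_W^a)_{n,l}v$ for $i_j\in I$, $a\in A$, $n_j\in\alpha^{i_j}+\mathbb Z$, $n\in\mathbb C$, $l_j,l\in\mathbb N$, $v\in V$. 5. (i) $g\phi_W^{i;p+1}(z)g^{-1}=\phi_W^{i;p}(z)$.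 (ii) $\phi_W^i(x)=x^{-\mathcal N_g}(\phi_W^i)_0(x)x^{\mathcal N_g}$ and $\psi_W^a(x)=(\psi_W^a)_0(x)x^{-\mathcal N_g}$, subscript $0$ meaning the constant term as a power series in $\log x$. (iii) $e^{2\pi i\mathcal S_g}\phi_W^i(x)e^{-2\pi i\mathcal S_g}=e^{2\pi i\alpha^i}\phi_W^i(x)$, $[\mathcal N_g,\phi_W^i(x)]=\phi_W^{\mathcal N_g(i)}(x)$. (iv) For $a\in A$ there is $\alpha^a\in P_W$ such that $(\psi_W^a)_{n,0}\mathbf 1$, $n\in-\mathbb N-1$, are generalized eigenvectors of $g$ with eigenvalue $e^{2\pi i\alpha^a}$. 6. For $i,j\in I$ there is $M_{ij}\in\mathbb Z_+$ with $(x_1-x_2)^{M_{ij}}\phi_W^i(x_1)\phi_W^j(x_2)=(-1)^{|\phi^i||\phi^j|}(x_1-x_2)^{M_{ij}}\phi_W^j(x_2)\phi_W^i(x_1)$. 7. For $i\in I$, $a\in A$ there is $M_{ia}\in\mathbb Z_+$ with $(x_1-x_2)^{\alpha^i+M_{ia}}(x_1-x_2)^{\mathcal N_g}\phi_W^i(x_1)(x_1-x_2)^{-\mathcal N_g}\psi_W^a(x_2)=(-1)^{|\phi^i||\psi_W^a|}(-x_2+x_1)^{\alpha^i+M_{ia}}\psi_W^a(x_2)(-x_2+x_1)^{\mathcal N_g}\phi^i(x_1)(-x_2+x_1)^{-\mathcal N_g}$. **Correlation functions.** Under properties 1–7, for $v\in V^{[\alpha]}$ the series $\langle w',\phi_W^{i_1;p}(z_1)\cdots\phi_W^{i_k;p}(z_k)\psi_W^{a;p}(z)\phi^{i_{k+1}}(z_{k+1})\cdots\phi^{i_{k+l}}(z_{k+l})v\rangle$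 converges absolutely in $|z_1|>\cdots>|z_k|>|z|>|z_{k+1}|>\cdots>|z_{k+l}|>0$, and its sum equals, when moreover $|\arg(z_i-z)-\arg z_i|<\frac\pi2$ for $i\le k$ and $\frac\pi2<\arg(z_i-z)-\arg z<\frac{3\pi}2$ for $i>k$, a function of the form $\sum_{n_1,\dots,n_{k+l},n=0}^Nf_{n_1\cdots n_{k+l}n}(z_1,\dots,z_{k+l},z)\big(\prod_je^{-\alpha^{i_j}l_p(z_j-z)}l_p(z_j-z)^{n_j}\big)e^{-\alpha l_p(z)}l_p(z)^n$ with $f_{n_1\cdots n_{k+l}n}$ rational with only possible poles $z_i=0$, $z=0$, $z_i=z_j$, $z_i=z$. This function, for all values of the variables away from those poles, is denoted $F^p(\langle w',\phi_W^{i_1}(z_1)\cdots\psi_W^a(z)\cdots\phi^{i_{k+l}}(z_{k+l})v\rangle)$ (extended linearly in $v\in V$). *)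

theory Defs
  imports
    "HOL-Analysis.Analysis"
    "HOL-Library.Z2"
    "HOL-Library.Groups_Big_Fun"
    "HOL-Library.Product_Plus"
    "HOL-Combinatorics.Permutations"
begin

section \<open>Complex vector spaces and gradings\<close>

class complex_vector = ab_group_add +
  fixes scaleC :: "complex \<Rightarrow> 'a \<Rightarrow> 'a"  (infixr \<open>*\<^sub>C\<close> 75)
  assumes scaleC_add_right: "a *\<^sub>C (x + y) = a *\<^sub>C x + a *\<^sub>C y"
    and scaleC_add_left: "(a + b) *\<^sub>C x = a *\<^sub>C x + b *\<^sub>C x"
    and scaleC_scaleC: "a *\<^sub>C (b *\<^sub>C x) = (a * b) *\<^sub>C x"
    and scaleC_one: "1 *\<^sub>C x = x"

global_interpretation complex_vector:
  vector_space "scaleC :: complex \<Rightarrow> 'a \<Rightarrow> 'a::complex_vector"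
  by unfold_locales
    (rule scaleC_add_right scaleC_add_left scaleC_scaleC scaleC_one)+

instantiation complex :: complex_vector
begin
definition scaleC_complex :: "complex \<Rightarrow> complex \<Rightarrow> complex"
  where "scaleC_complex a x = a * x"
instance
  by standard (simp_all add: scaleC_complex_def algebra_simps)
end

abbreviation clinear :: "('a::complex_vector \<Rightarrow> 'b::complex_vector) \<Rightarrow> bool"
  where "clinear \<equiv> Vector_Spaces.linear scaleC scaleC"

abbreviation csubspace :: "'a::complex_vector set \<Rightarrow> bool"
  where "csubspace \<equiv> module.subspace scaleC"

abbreviation cspan :: "'a::complex_vector set \<Rightarrow> 'a set"
  where "cspan \<equiv> module.span scaleC"

definition decomposes :: "('k \<Rightarrow> 'u::complex_vector set) \<Rightarrow> 'u \<Rightarrow> ('k \<Rightarrow> 'u) \<Rightarrow> bool"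
  where "decomposes E u f \<longleftrightarrow>
    (\<forall>k. f k \<in> E k) \<and> finite {k. f k \<noteq> 0} \<and> u = Sum_any f"

definition direct_sum :: "('k \<Rightarrow> 'u::complex_vector set) \<Rightarrow> bool"
  where "direct_sum E \<longleftrightarrow> (\<forall>k. csubspace (E k)) \<and> (\<forall>u. \<exists>!f. decomposes E u f)"

definition component :: "('k \<Rightarrow> 'u::complex_vector set) \<Rightarrow> 'u \<Rightarrow> 'k \<Rightarrow> 'u"
  where "component E u = (THE f. decomposes E u f)"

text \<open>The operator acting on \<open>E k\<close> as the scalar \<open>c k\<close>.\<close>
definition diag_op :: "('k \<Rightarrow> complex) \<Rightarrow> ('k \<Rightarrow> 'u::complex_vector set) \<Rightarrow> 'u \<Rightarrow> 'u"
  where "diag_op c E u = Sum_any (\<lambda>k. c k *\<^sub>C component E u k)"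

definition graded_dual :: "('k \<Rightarrow> 'u::complex_vector set) \<Rightarrow> ('u \<Rightarrow> complex) set"
  where "graded_dual E = {u'. clinear u' \<and> finite {k. \<exists>u\<in>E k. u' u \<noteq> 0}}"

definition gen_eigenspace :: "('u::complex_vector \<Rightarrow> 'u) \<Rightarrow> complex \<Rightarrow> 'u set"
  where "gen_eigenspace T c = {u. \<exists>K. ((\<lambda>x. T x - c *\<^sub>C x) ^^ K) u = 0}"

definition locally_nilpotent :: "('u::complex_vector \<Rightarrow> 'u) \<Rightarrow> bool"
  where "locally_nilpotent N \<longleftrightarrow> (\<forall>u. \<exists>K. (N ^^ K) u = 0)"

text \<open>\<open>exp_nil t N\<close> is the operator \<open>exp (t N)\<close> for locally nilpotent \<open>N\<close>.\<close>
definition exp_nil :: "complex \<Rightarrow> ('u::complex_vector \<Rightarrow> 'u) \<Rightarrow> 'u \<Rightarrow> 'u"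
  where "exp_nil t N u = Sum_any (\<lambda>r. (t ^ r / fact r) *\<^sub>C (N ^^ r) u)"

text \<open>\<open>N\<close> is the nilpotent part of the logarithm of \<open>g\<close>: if \<open>S\<close> is the operator acting as
  \<open>\<alpha>\<close> on \<open>E \<alpha>\<close>, then \<open>N\<close> commutes with \<open>S\<close> and
  \<open>g = exp (2 \<pi> i (S + N)) = exp (2 \<pi> i S) exp (2 \<pi> i N)\<close>.\<close>
definition log_nilpotent_part ::
    "('u::complex_vector \<Rightarrow> 'u) \<Rightarrow> (complex \<Rightarrow> 'u set) \<Rightarrow> ('u \<Rightarrow> 'u) \<Rightarrow> bool"
  where "log_nilpotent_part g E N \<longleftrightarrow>
    clinear N \<and> locally_nilpotent N \<and>
    (\<forall>u. N (diag_op (\<lambda>\<alpha>. \<alpha>) E u) = diag_op (\<lambda>\<alpha>. \<alpha>) E (N u)) \<and>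
    (\<forall>u. g u = diag_op (\<lambda>\<alpha>. exp (2 * pi * \<i> * \<alpha>)) E (exp_nil (2 * pi * \<i>) N u))"

text \<open>The sign \<open>(-1)^(s t)\<close>.\<close>
definition parity_sign :: "bit \<Rightarrow> bit \<Rightarrow> complex"
  where "parity_sign s t = (if s = 1 \<and> t = 1 then - 1 else 1)"

section \<open>Rational functions\<close>

inductive poly_fun :: "nat \<Rightarrow> ((nat \<Rightarrow> complex) \<Rightarrow> complex) \<Rightarrow> bool" for n :: nat where
  "poly_fun n (\<lambda>z. c)"
| "j < n \<Longrightarrow> poly_fun n (\<lambda>z. z j)"
| "poly_fun n P \<Longrightarrow> poly_fun n Q \<Longrightarrow> poly_fun n (\<lambda>z. P z + Q z)"
| "poly_fun n P \<Longrightarrow> poly_fun n Q \<Longrightarrow> poly_fun n (\<lambda>z. P z * Q z)"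

definition config :: "nat \<Rightarrow> (nat \<Rightarrow> complex) set"
  where "config n = {z. (\<forall>i<n. z i \<noteq> 0) \<and> (\<forall>i<n. \<forall>j<i. z i \<noteq> z j)}"

text \<open>Rational in \<open>z 0, ..., z (n - 1)\<close>, with poles at most at \<open>z i = 0\<close> and \<open>z i = z j\<close>.
  Values outside \<open>config n\<close> are irrelevant.\<close>
definition rat_fun :: "nat \<Rightarrow> ((nat \<Rightarrow> complex) \<Rightarrow> complex) \<Rightarrow> bool"
  where "rat_fun n f \<longleftrightarrow> (\<exists>P M. poly_fun n P \<and>
    (\<forall>z\<in>config n. f z = P z / ((\<Prod>i<n. z i ^ M) * (\<Prod>i<n. \<Prod>j<i. (z i - z j) ^ M))))"

section \<open>Vertex superalgebras and their automorphisms\<close>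

text \<open>\<open>V_gr V n s\<close> is the space of weight \<open>n\<close> and fermion number \<open>s\<close>;
  \<open>Y_op V u n v\<close> is the coefficient of \<open>x^(-n-1)\<close> in \<open>Y(u,x)v\<close>.\<close>
record 'v vertex_data =
  V_gr :: "real \<Rightarrow> bit \<Rightarrow> 'v set"
  Y_op :: "'v \<Rightarrow> int \<Rightarrow> 'v \<Rightarrow> 'v"
  vac :: 'v

definition V_wt :: "'v::complex_vector vertex_data \<Rightarrow> real \<Rightarrow> 'v set"
  where "V_wt V n = cspan (\<Union>s. V_gr V n s)"

definition V_par :: "'v::complex_vector vertex_data \<Rightarrow> bit \<Rightarrow> 'v set"
  where "V_par V s = cspan (\<Union>n. V_gr V n s)"

definition L0_V :: "'v::complex_vector vertex_data \<Rightarrow> 'v \<Rightarrow> 'v"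
  where "L0_V V = diag_op complex_of_real (V_wt V)"

definition Lm1_V :: "'v vertex_data \<Rightarrow> 'v \<Rightarrow> 'v"
  where "Lm1_V V v = Y_op V v (- 2) (vac V)"

definition vsa_duality :: "'v::complex_vector vertex_data \<Rightarrow> bool"
  where "vsa_duality V \<longleftrightarrow>
    (\<forall>s t. \<forall>u1\<in>V_par V s. \<forall>u2\<in>V_par V t. \<forall>v. \<forall>v'\<in>graded_dual (V_wt V).
      \<exists>f. rat_fun 2 f \<and>
       (\<forall>z. norm (z 0) > norm (z 1) \<and> norm (z 1) > 0 \<longrightarrow>
          ((\<lambda>(m, n). v' (Y_op V u1 m (Y_op V u2 n v)) * z 0 powi (- m - 1) * z 1 powi (- n - 1))
            has_sum f z) UNIV) \<and>
       (\<forall>z. norm (z 1) > norm (z 0) \<and> norm (z 0) > 0 \<longrightarrow>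
          ((\<lambda>(m, n). parity_sign s t * v' (Y_op V u2 n (Y_op V u1 m v))
              * z 0 powi (- m - 1) * z 1 powi (- n - 1))
            has_sum f z) UNIV) \<and>
       (\<forall>z. norm (z 1) > norm (z 0 - z 1) \<and> norm (z 0 - z 1) > 0 \<longrightarrow>
          ((\<lambda>(m, n). v' (Y_op V (Y_op V u1 m u2) n v)
              * (z 0 - z 1) powi (- m - 1) * z 1 powi (- n - 1))
            has_sum f z) UNIV))"

definition vertex_superalgebra :: "'v::complex_vector vertex_data \<Rightarrow> bool"
  where "vertex_superalgebra V \<longleftrightarrow>
    direct_sum (\<lambda>(n, s). V_gr V n s) \<and>
    (\<forall>n s. 2 * n \<notin> \<int> \<longrightarrow> V_gr V n s = {0}) \<and>
    (\<forall>n. \<exists>B. finite B \<and> V_wt V n \<subseteq> cspan B) \<and>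
    (\<exists>b. \<forall>n<b. \<forall>s. V_gr V n s = {0}) \<and>
    (\<forall>n v. clinear (\<lambda>u. Y_op V u n v)) \<and> (\<forall>u n. clinear (Y_op V u n)) \<and>
    (\<forall>u v. \<exists>b. \<forall>n\<ge>b. Y_op V u n v = 0) \<and>
    (\<forall>s t u n v. u \<in> V_par V s \<and> v \<in> V_par V t \<longrightarrow> Y_op V u n v \<in> V_par V (s + t)) \<and>
    vac V \<in> V_gr V 0 0 \<and>
    (\<forall>n v. Y_op V (vac V) n v = (if n = - 1 then v else 0)) \<and>
    (\<forall>u. Y_op V u (- 1) (vac V) = u \<and> (\<forall>n\<ge>0. Y_op V u n (vac V) = 0)) \<and>
    (\<forall>u n v. L0_V V (Y_op V u n v) - Y_op V u n (L0_V V v)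
        = of_int (- n - 1) *\<^sub>C Y_op V u n v + Y_op V (L0_V V u) n v) \<and>
    (\<forall>u n v. Y_op V (Lm1_V V u) n v = of_int (- n) *\<^sub>C Y_op V u (n - 1) v) \<and>
    (\<forall>u n v. Lm1_V V (Y_op V u n v) - Y_op V u n (Lm1_V V v)
        = of_int (- n) *\<^sub>C Y_op V u (n - 1) v) \<and>
    vsa_duality V"

definition vsa_automorphism :: "'v::complex_vector vertex_data \<Rightarrow> ('v \<Rightarrow> 'v) \<Rightarrow> bool"
  where "vsa_automorphism V g \<longleftrightarrow>
    clinear g \<and> bij g \<and> (\<forall>n s. g ` V_gr V n s \<subseteq> V_gr V n s) \<and> g (vac V) = vac V \<and>
    (\<forall>u n v. g (Y_op V u n v) = Y_op V (g u) n (g v))"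

text \<open>\<open>P_V g\<close> is the set of exponents, \<open>V_g g \<alpha>\<close> the generalized eigenspace of \<open>g\<close> with
  eigenvalue \<open>exp (2 \<pi> i \<alpha>)\<close>.\<close>
definition P_V :: "('v::complex_vector \<Rightarrow> 'v) \<Rightarrow> complex set"
  where "P_V g = {\<alpha>. 0 \<le> Re \<alpha> \<and> Re \<alpha> < 1 \<and> (\<exists>v. v \<noteq> 0 \<and> g v = exp (2 * pi * \<i> * \<alpha>) *\<^sub>C v)}"

definition V_g :: "('v::complex_vector \<Rightarrow> 'v) \<Rightarrow> complex \<Rightarrow> 'v set"
  where "V_g g \<alpha> = (if \<alpha> \<in> P_V g then gen_eigenspace g (exp (2 * pi * \<i> * \<alpha>)) else {0})"

section \<open>Generating fields\<close>

text \<open>\<open>gvec G i\<close> is the vector whose vertex operator is the \<open>i\<close>-th generating field;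
  \<open>gN G i\<close> is the index of the generating field given by \<open>N_g\<close> applied to that vector, which is
  meaningful only if the result is nonzero.\<close>
record ('v, 'i) generators =
  I_set :: "'i set"
  gvec :: "'i \<Rightarrow> 'v"
  gwt :: "'i \<Rightarrow> real"
  gpar :: "'i \<Rightarrow> bit"
  gal :: "'i \<Rightarrow> complex"
  gN :: "'i \<Rightarrow> 'i"

inductive_set gen_products ::
    "'v vertex_data \<Rightarrow> ('v, 'i) generators \<Rightarrow> 'v set"
  for V :: "'v vertex_data" and G :: "('v, 'i) generators" where
  "vac V \<in> gen_products V G"
| "u \<in> gen_products V G \<Longrightarrow> i \<in> I_set G \<Longrightarrow> Y_op V (gvec G i) n u \<in> gen_products V G"

definition generation_assumption ::
    "'v::complex_vector vertex_data \<Rightarrow> ('v \<Rightarrow> 'v) \<Rightarrow> ('v \<Rightarrow> 'v) \<Rightarrow> ('v, 'i) generators \<Rightarrow> bool"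
  where "generation_assumption V g N G \<longleftrightarrow>
    cspan (gen_products V G) = UNIV \<and>
    (\<forall>i\<in>I_set G. gvec G i \<in> V_gr V (gwt G i) (gpar G i) \<and>
       gal G i \<in> P_V g \<and> gvec G i \<in> V_g g (gal G i) \<and>
       (N (gvec G i) \<noteq> 0 \<longrightarrow> gN G i \<in> I_set G \<and> N (gvec G i) = gvec G (gN G i)))"

section \<open>Formal series with logarithms\<close>

text \<open>A function \<open>c :: complex \<Rightarrow> nat \<Rightarrow> 'u\<close> stands for the one-variable series
  \<open>\<Sum> c n k x^(-n-1) (log x)^k\<close>. The following says that it lies in
  \<open>x^(-\<alpha>) U((x))[log x]\<close>.\<close>
definition log_laurent :: "complex \<Rightarrow> (complex \<Rightarrow> nat \<Rightarrow> 'u::complex_vector) \<Rightarrow> bool"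
  where "log_laurent \<alpha> c \<longleftrightarrow>
    (\<forall>n k. c n k \<noteq> 0 \<longrightarrow> n - \<alpha> \<in> \<int>) \<and>
    (\<exists>b. \<forall>n k. c n k \<noteq> 0 \<longrightarrow> Re n \<le> b) \<and>
    (\<exists>K. \<forall>n k. c n k \<noteq> 0 \<longrightarrow> k \<le> K)"

definition ddx :: "(complex \<Rightarrow> nat \<Rightarrow> 'u::complex_vector) \<Rightarrow> complex \<Rightarrow> nat \<Rightarrow> 'u"
  where "ddx c n k = (- n) *\<^sub>C c (n - 1) k + of_nat (k + 1) *\<^sub>C c (n - 1) (k + 1)"

text \<open>\<open>x d/dx\<close>\<close>
definition xddx :: "(complex \<Rightarrow> nat \<Rightarrow> 'u::complex_vector) \<Rightarrow> complex \<Rightarrow> nat \<Rightarrow> 'u"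
  where "xddx c n k = (- n - 1) *\<^sub>C c n k + of_nat (k + 1) *\<^sub>C c n (k + 1)"

text \<open>A two-variable series \<open>\<Sum> F (a,j,b,l) x1^a (log x1)^j x2^b (log x2)^l\<close>. Products and
  operator applications below are used only where each coefficient is a finite sum.\<close>
type_synonym 'u ser2 = "complex \<times> nat \<times> complex \<times> nat \<Rightarrow> 'u"

definition const2 :: "'u::complex_vector \<Rightarrow> 'u ser2"
  where "const2 u = (\<lambda>e. if e = 0 then u else 0)"

definition smult2 :: "complex ser2 \<Rightarrow> 'u::complex_vector ser2 \<Rightarrow> 'u ser2"
  where "smult2 c F e = Sum_any (\<lambda>(e1, e2). if e1 + e2 = e then c e1 *\<^sub>C F e2 else 0)"

definition power2 :: "complex ser2 \<Rightarrow> nat \<Rightarrow> complex ser2"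
  where "power2 c r = (smult2 c ^^ r) (const2 1)"

text \<open>\<open>y^N F = exp ((log y) N) F\<close>, where \<open>L\<close> is the series \<open>log y\<close>\<close>
definition exp2 ::
    "complex ser2 \<Rightarrow> ('u::complex_vector \<Rightarrow> 'u) \<Rightarrow> 'u ser2 \<Rightarrow> 'u ser2"
  where "exp2 L N F e = Sum_any (\<lambda>r. (1 / fact r) *\<^sub>C smult2 (power2 L r) (\<lambda>e'. (N ^^ r) (F e')) e)"

text \<open>Application of a field in the variable \<open>x1\<close>, respectively \<open>x2\<close>\<close>
definition act1 ::
    "(complex \<Rightarrow> nat \<Rightarrow> 'u::complex_vector \<Rightarrow> 't::complex_vector) \<Rightarrow> 'u ser2 \<Rightarrow> 't ser2"
  where "act1 T F e = Sum_any (\<lambda>(n, k, e'). if (- n - 1, k, 0, 0) + e' = e then T n k (F e') else 0)"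

definition act2 ::
    "(complex \<Rightarrow> nat \<Rightarrow> 'u::complex_vector \<Rightarrow> 't::complex_vector) \<Rightarrow> 'u ser2 \<Rightarrow> 't ser2"
  where "act2 T F e = Sum_any (\<lambda>(n, k, e'). if (0, 0, - n - 1, k) + e' = e then T n k (F e') else 0)"

text \<open>\<open>(x1 - x2)^\<beta>\<close> and \<open>log (x1 - x2)\<close>, in nonnegative powers of \<open>x2\<close>\<close>
definition pow12 :: "complex \<Rightarrow> complex ser2"
  where "pow12 \<beta> e = Sum_any (\<lambda>m. if e = (\<beta> - of_nat m, 0, of_nat m, 0)
    then (- 1) ^ m * (\<beta> gchoose m) else 0)"

definition log12 :: "complex ser2"
  where "log12 e = (if e = (0, 1, 0, 0) then 1 else 0)
    - Sum_any (\<lambda>m. if m > 0 \<and> e = (- of_nat m, 0, of_nat m, 0) then 1 / of_nat m else 0)"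

text \<open>\<open>(-x2 + x1)^\<beta>\<close> and \<open>log (-x2 + x1)\<close>, in nonnegative powers of \<open>x1\<close>\<close>
definition pow21 :: "complex \<Rightarrow> complex ser2"
  where "pow21 \<beta> e = exp (pi * \<i> * \<beta>) * Sum_any (\<lambda>m. if e = (of_nat m, 0, \<beta> - of_nat m, 0)
    then (- 1) ^ m * (\<beta> gchoose m) else 0)"

definition log21 :: "complex ser2"
  where "log21 e = (if e = 0 then pi * \<i> else 0) + (if e = (0, 0, 0, 1) then 1 else 0)
    - Sum_any (\<lambda>m. if m > 0 \<and> e = (of_nat m, 0, - of_nat m, 0) then 1 / of_nat m else 0)"

section \<open>Twist fields\<close>

text \<open>\<open>W_gr W n s \<alpha>\<close> is the space of weight \<open>n\<close>, fermion number \<open>s\<close> and \<open>g\<close>-weight \<open>\<alpha>\<close>;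
  \<open>phi_W W i n k\<close> and \<open>psi_W W a n k\<close> are coefficients of \<open>x^(-n-1) (log x)^k\<close>.\<close>
record ('v, 'w, 'i, 'a) twist_data =
  P_W :: "complex set"
  W_gr :: "complex \<Rightarrow> bit \<Rightarrow> complex \<Rightarrow> 'w set"
  phi_W :: "'i \<Rightarrow> complex \<Rightarrow> nat \<Rightarrow> 'w \<Rightarrow> 'w"
  A_set :: "'a set"
  psi_W :: "'a \<Rightarrow> complex \<Rightarrow> nat \<Rightarrow> 'v \<Rightarrow> 'w"
  psi_par :: "'a \<Rightarrow> bit"
  L0_W :: "'w \<Rightarrow> 'w"
  Lm1_W :: "'w \<Rightarrow> 'w"
  g_W :: "'w \<Rightarrow> 'w"
  N_W :: "'w \<Rightarrow> 'w"

definition W_wt :: "('v, 'w::complex_vector, 'i, 'a) twist_data \<Rightarrow> complex \<Rightarrow> 'w set"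
  where "W_wt W n = cspan (\<Union>s \<alpha>. W_gr W n s \<alpha>)"

definition W_par :: "('v, 'w::complex_vector, 'i, 'a) twist_data \<Rightarrow> bit \<Rightarrow> 'w set"
  where "W_par W s = cspan (\<Union>n \<alpha>. W_gr W n s \<alpha>)"

definition W_g :: "('v, 'w::complex_vector, 'i, 'a) twist_data \<Rightarrow> complex \<Rightarrow> 'w set"
  where "W_g W \<alpha> = cspan (\<Union>n s. W_gr W n s \<alpha>)"

text \<open>The nilpotent part of \<open>L_W(0)\<close>\<close>
definition L0_W_nil :: "('v, 'w::complex_vector, 'i, 'a) twist_data \<Rightarrow> 'w \<Rightarrow> 'w"
  where "L0_W_nil W w = L0_W W w - diag_op (\<lambda>n. n) (W_wt W) w"

text \<open>The field \<open>\<phi>^i(x)\<close> on \<open>V\<close>, as a series of the same shape as the fields on \<open>W\<close>\<close>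
definition phi_V ::
    "'v::zero vertex_data \<Rightarrow> ('v, 'i) generators \<Rightarrow> 'i \<Rightarrow> complex \<Rightarrow> nat \<Rightarrow> 'v \<Rightarrow> 'v"
  where "phi_V V G i n k v =
    (if n \<in> \<int> \<and> k = 0 then Y_op V (gvec G i) \<lfloor>Re n\<rfloor> v else 0)"

definition twist_structure ::
    "'v::complex_vector vertex_data \<Rightarrow> ('v \<Rightarrow> 'v) \<Rightarrow> ('v, 'i) generators
      \<Rightarrow> ('v, 'w::complex_vector, 'i, 'a) twist_data \<Rightarrow> bool"
  where "twist_structure V g G W \<longleftrightarrow>
    P_W W \<subseteq> {\<alpha>. 0 \<le> Re \<alpha> \<and> Re \<alpha> < 1} \<and>
    direct_sum (\<lambda>(n, s, \<alpha>). W_gr W n s \<alpha>) \<and>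
    (\<forall>n s \<alpha>. \<alpha> \<notin> P_W W \<longrightarrow> W_gr W n s \<alpha> = {0}) \<and>
    (\<exists>b. \<forall>n. Re n < b \<longrightarrow> W_wt W n = {0}) \<and>
    (\<forall>i\<in>I_set G. (\<forall>n k. clinear (phi_W W i n k)) \<and>
       (\<forall>w. log_laurent (gal G i) (\<lambda>n k. phi_W W i n k w)) \<and>
       (\<forall>n k s. \<forall>w\<in>W_par W s. phi_W W i n k w \<in> W_par W (gpar G i + s))) \<and>
    (\<forall>a\<in>A_set W. (\<forall>n k. clinear (psi_W W a n k)) \<and>
       (\<forall>\<alpha>\<in>P_V g. \<forall>v\<in>V_g g \<alpha>. log_laurent \<alpha> (\<lambda>n k. psi_W W a n k v)) \<and>
       (\<forall>n k s. \<forall>v\<in>V_par V s. psi_W W a n k v \<in> W_par W (psi_par W a + s))) \<and>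
    clinear (L0_W W) \<and> clinear (Lm1_W W) \<and> clinear (g_W W) \<and>
    (\<forall>n. W_wt W n = gen_eigenspace (L0_W W) n) \<and>
    (\<forall>\<alpha>\<in>P_W W. W_g W \<alpha> = gen_eigenspace (g_W W) (exp (2 * pi * \<i> * \<alpha>))) \<and>
    log_nilpotent_part (g_W W) (W_g W) (N_W W)"

definition weight_property ::
    "'v::complex_vector vertex_data \<Rightarrow> ('v, 'i) generators
      \<Rightarrow> ('v, 'w::complex_vector, 'i, 'a) twist_data \<Rightarrow> bool"
  where "weight_property V G W \<longleftrightarrow>
    (\<forall>i\<in>I_set G. \<forall>n k w. L0_W W (phi_W W i n k w) - phi_W W i n k (L0_W W w)
       = xddx (\<lambda>n k. phi_W W i n k w) n k + complex_of_real (gwt G i) *\<^sub>C phi_W W i n k w) \<and>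
    (\<forall>a\<in>A_set W. \<exists>h.
       if \<forall>n k v. L0_W_nil W (psi_W W a n k v) = 0
       then \<forall>n k v. L0_W W (psi_W W a n k v) - psi_W W a n k (L0_V V v)
         = xddx (\<lambda>n k. psi_W W a n k v) n k + h *\<^sub>C psi_W W a n k v
       else \<exists>b\<in>A_set W. \<forall>n k v. L0_W W (psi_W W a n k v) - psi_W W a n k (L0_V V v)
         = xddx (\<lambda>n k. psi_W W a n k v) n k + h *\<^sub>C psi_W W a n k v + psi_W W b n k v)"

definition derivative_property ::
    "'v::complex_vector vertex_data \<Rightarrow> ('v, 'i) generators
      \<Rightarrow> ('v, 'w::complex_vector, 'i, 'a) twist_data \<Rightarrow> bool"
  where "derivative_property V G W \<longleftrightarrow>
    (\<forall>i\<in>I_set G. \<forall>n k w. Lm1_W W (phi_W W i n k w) - phi_W W i n k (Lm1_W W w)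
       = ddx (\<lambda>n k. phi_W W i n k w) n k) \<and>
    (\<forall>a\<in>A_set W. \<forall>n k v. Lm1_W W (psi_W W a n k v) - psi_W W a n k (Lm1_V V v)
       = ddx (\<lambda>n k. psi_W W a n k v) n k)"

definition vacuum_property ::
    "'v vertex_data \<Rightarrow> ('v, 'w::complex_vector, 'i, 'a) twist_data \<Rightarrow> bool"
  where "vacuum_property V W \<longleftrightarrow>
    (\<forall>a\<in>A_set W.
      (\<forall>n k. psi_W W a n k (vac V) \<noteq> 0 \<longrightarrow> k = 0 \<and> - n - 1 \<in> \<nat>) \<and>
      (\<exists>n s \<alpha>. psi_W W a (- 1) 0 (vac V) \<in> W_gr W n s \<alpha>))"

inductive_set twist_products ::
    "('v, 'i) generators \<Rightarrow> ('v, 'w, 'i, 'a) twist_data \<Rightarrow> 'w set"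
  for G :: "('v, 'i) generators" and W :: "('v, 'w, 'i, 'a) twist_data" where
  "a \<in> A_set W \<Longrightarrow> psi_W W a n l v \<in> twist_products G W"
| "w \<in> twist_products G W \<Longrightarrow> i \<in> I_set G \<Longrightarrow> n - gal G i \<in> \<int>
    \<Longrightarrow> phi_W W i n l w \<in> twist_products G W"

definition spanning_property ::
    "('v, 'i) generators \<Rightarrow> ('v, 'w::complex_vector, 'i, 'a) twist_data \<Rightarrow> bool"
  where "spanning_property G W \<longleftrightarrow> cspan (twist_products G W) = UNIV"

definition l_branch :: "int \<Rightarrow> complex \<Rightarrow> complex"
  where "l_branch p z = of_real (ln (norm z)) + \<i> * of_real (Arg2pi z) + 2 * pi * \<i> * of_int p"

text \<open>The \<open>p\<close>-th branch of \<open>x^(-n-1) (log x)^k\<close> at \<open>z\<close>\<close>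
definition mono_branch :: "int \<Rightarrow> complex \<Rightarrow> complex \<Rightarrow> nat \<Rightarrow> complex"
  where "mono_branch p z n k = exp ((- n - 1) * l_branch p z) * l_branch p z ^ k"

text \<open>In the first clause the identity \<open>g \<phi>^{p+1}(z) = \<phi>^p(z) g\<close> is read separately for each
  power of \<open>x\<close>; the operator \<open>exp (\<plusminus> 2 \<pi> i S_g)\<close> is a \<open>diag_op\<close>.\<close>
definition g_property ::
    "'v::complex_vector vertex_data \<Rightarrow> ('v \<Rightarrow> 'v) \<Rightarrow> ('v, 'i) generators
      \<Rightarrow> ('v, 'w::complex_vector, 'i, 'a) twist_data \<Rightarrow> bool"
  where "g_property V N G W \<longleftrightarrow>
    (\<forall>i\<in>I_set G. \<forall>p z n w. z \<noteq> 0 \<longrightarrow>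
       Sum_any (\<lambda>k. mono_branch (p + 1) z n k *\<^sub>C g_W W (phi_W W i n k w))
       = Sum_any (\<lambda>k. mono_branch p z n k *\<^sub>C phi_W W i n k (g_W W w))) \<and>
    (\<forall>i\<in>I_set G. \<forall>n k w. phi_W W i n k w =
       (\<Sum>r\<le>k. ((- 1) ^ r / (fact r * fact (k - r))) *\<^sub>C
          (N_W W ^^ r) (phi_W W i n 0 ((N_W W ^^ (k - r)) w)))) \<and>
    (\<forall>a\<in>A_set W. \<forall>n k v. psi_W W a n k v =
       ((- 1) ^ k / fact k) *\<^sub>C psi_W W a n 0 ((N ^^ k) v)) \<and>
    (\<forall>i\<in>I_set G. \<forall>n k w.
       diag_op (\<lambda>\<alpha>. exp (2 * pi * \<i> * \<alpha>)) (W_g W)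
         (phi_W W i n k (diag_op (\<lambda>\<alpha>. exp (- 2 * pi * \<i> * \<alpha>)) (W_g W) w))
       = exp (2 * pi * \<i> * gal G i) *\<^sub>C phi_W W i n k w) \<and>
    (\<forall>i\<in>I_set G. \<forall>n k w. N_W W (phi_W W i n k w) - phi_W W i n k (N_W W w)
       = (if N (gvec G i) = 0 then 0 else phi_W W (gN G i) n k w)) \<and>
    (\<forall>a\<in>A_set W. \<exists>\<alpha>\<in>P_W W. \<forall>m::nat.
       psi_W W a (- of_nat m - 1) 0 (vac V)
         \<in> gen_eigenspace (g_W W) (exp (2 * pi * \<i> * \<alpha>)))"

definition weak_commutativity_phi ::
    "('v, 'i) generators \<Rightarrow> ('v, 'w::complex_vector, 'i, 'a) twist_data \<Rightarrow> bool"
  where "weak_commutativity_phi G W \<longleftrightarrow>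
    (\<forall>i\<in>I_set G. \<forall>j\<in>I_set G. \<exists>M::nat. M > 0 \<and> (\<forall>w e.
       smult2 (pow12 (of_nat M)) (act1 (phi_W W i) (act2 (phi_W W j) (const2 w))) e
       = parity_sign (gpar G i) (gpar G j) *\<^sub>C
         smult2 (pow12 (of_nat M)) (act2 (phi_W W j) (act1 (phi_W W i) (const2 w))) e))"

definition weak_commutativity_psi ::
    "'v::complex_vector vertex_data \<Rightarrow> ('v \<Rightarrow> 'v) \<Rightarrow> ('v, 'i) generators
      \<Rightarrow> ('v, 'w::complex_vector, 'i, 'a) twist_data \<Rightarrow> bool"
  where "weak_commutativity_psi V N G W \<longleftrightarrow>
    (\<forall>i\<in>I_set G. \<forall>a\<in>A_set W. \<exists>M::nat. M > 0 \<and> (\<forall>v e.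
       smult2 (pow12 (gal G i + of_nat M))
         (exp2 log12 (N_W W)
           (act1 (phi_W W i)
             (exp2 log12 (\<lambda>w. - N_W W w)
               (act2 (psi_W W a) (const2 v))))) e
       = parity_sign (gpar G i) (psi_par W a) *\<^sub>C
         smult2 (pow21 (gal G i + of_nat M))
           (act2 (psi_W W a)
             (exp2 log21 N
               (act1 (phi_V V G i)
                 (exp2 log21 (\<lambda>u. - N u) (const2 v))))) e))"

section \<open>Correlation functions\<close>

datatype ('i, 'a) field_label = Gen 'i | Twist 'a

text \<open>Mode \<open>(n, k)\<close> stands for the coefficient of \<open>x^(-n-1) (log x)^k\<close>. A generator stands for
  its field on \<open>W\<close> to the left of the twist field and for its field on \<open>V\<close> to the right of it.
  The catch-all equations are irrelevant for words with exactly one \<open>Twist\<close> and as many modes as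
  fields.\<close>
fun modes_V :: "'v::zero vertex_data \<Rightarrow> ('v, 'i) generators \<Rightarrow> ('i, 'a) field_label list
    \<Rightarrow> (complex \<times> nat) list \<Rightarrow> 'v \<Rightarrow> 'v" where
  "modes_V V G [] [] v = v"
| "modes_V V G (Gen i # fs) ((n, k) # ms) v = phi_V V G i n k (modes_V V G fs ms v)"
| "modes_V V G _ _ v = 0"

fun modes_W :: "'v::zero vertex_data \<Rightarrow> ('v, 'i) generators \<Rightarrow> ('v, 'w::zero, 'i, 'a) twist_data
    \<Rightarrow> ('i, 'a) field_label list \<Rightarrow> (complex \<times> nat) list \<Rightarrow> 'v \<Rightarrow> 'w" where
  "modes_W V G W (Gen i # fs) ((n, k) # ms) v = phi_W W i n k (modes_W V G W fs ms v)"
| "modes_W V G W (Twist a # fs) ((n, k) # ms) v = psi_W W a n k (modes_V V G fs ms v)"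
| "modes_W V G W _ _ v = 0"

definition labels_in ::
    "('v, 'i) generators \<Rightarrow> ('v, 'w, 'i, 'a) twist_data \<Rightarrow> ('i, 'a) field_label list \<Rightarrow> bool"
  where "labels_in G W fs \<longleftrightarrow> set fs \<subseteq> Gen ` I_set G \<union> Twist ` A_set W"

definition is_twist :: "('i, 'a) field_label \<Rightarrow> bool"
  where "is_twist f \<longleftrightarrow> (\<exists>a. f = Twist a)"

definition twist_pos :: "('i, 'a) field_label list \<Rightarrow> nat"
  where "twist_pos fs = (THE m. m < length fs \<and> is_twist (fs ! m))"

fun label_al :: "('v, 'i) generators \<Rightarrow> ('i, 'a) field_label \<Rightarrow> complex" where
  "label_al G (Gen i) = gal G i"
| "label_al G (Twist a) = 0"

fun label_par ::
    "('v, 'i) generators \<Rightarrow> ('v, 'w, 'i, 'a) twist_data \<Rightarrow> ('i, 'a) field_label \<Rightarrow> bit" where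
  "label_par G W (Gen i) = gpar G i"
| "label_par G W (Twist a) = psi_par W a"

definition corr_region :: "nat \<Rightarrow> nat \<Rightarrow> (nat \<Rightarrow> complex) set"
  where "corr_region m n = {z.
    (\<forall>i<n. z i \<noteq> 0) \<and> (\<forall>i j. i < j \<and> j < n \<longrightarrow> norm (z i) > norm (z j)) \<and>
    (\<forall>i<m. \<bar>Arg2pi (z i - z m) - Arg2pi (z i)\<bar> < pi / 2) \<and>
    (\<forall>i. m < i \<and> i < n \<longrightarrow> pi / 2 < Arg2pi (z i - z m) - Arg2pi (z m) \<and>
        Arg2pi (z i - z m) - Arg2pi (z m) < 3 * pi / 2)}"

text \<open>The variable of the field at position \<open>j\<close> of the word \<open>fs\<close> is \<open>z j\<close>, so that of the twist
  field is \<open>z m\<close>, \<open>m = twist_pos fs\<close>. For \<open>v\<close> of \<open>g\<close>-weight \<open>\<alpha>\<close>, the function \<open>F\<close> has the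
  required form on \<open>config (length fs)\<close> and is the sum of the (absolutely convergent) correlation
  series on \<open>corr_region\<close>; \<open>has_sum\<close> in the complex numbers is absolute convergence.\<close>
definition is_correlation ::
    "'v::complex_vector vertex_data \<Rightarrow> ('v, 'i) generators
      \<Rightarrow> ('v, 'w::complex_vector, 'i, 'a) twist_data
      \<Rightarrow> int \<Rightarrow> ('w \<Rightarrow> complex) \<Rightarrow> ('i, 'a) field_label list \<Rightarrow> complex \<Rightarrow> 'v
      \<Rightarrow> ((nat \<Rightarrow> complex) \<Rightarrow> complex) \<Rightarrow> bool"
  where "is_correlation V G W p w' fs \<alpha> v F \<longleftrightarrow>
    (let n = length fs; m = twist_pos fs in
      (\<exists>K f. (\<forall>r. rat_fun n (f r)) \<and>
        (\<forall>z\<in>config n. F z =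
          (\<Sum>r \<in> {..<n} \<rightarrow>\<^sub>E {..K::nat}. f r z *
             (\<Prod>j\<in>{..<n} - {m}. exp (- label_al G (fs ! j) * l_branch p (z j - z m))
                * l_branch p (z j - z m) ^ r j) *
             exp (- \<alpha> * l_branch p (z m)) * l_branch p (z m) ^ r m))) \<and>
      (\<forall>z\<in>corr_region m n.
        ((\<lambda>ms. w' (modes_W V G W fs ms v) *
            (\<Prod>j<n. mono_branch p (z j) (fst (ms ! j)) (snd (ms ! j))))
          has_sum F z) {ms. length ms = n}))"

text \<open>The value at \<open>z \<in> config (length fs)\<close> of
  \<open>F^p(\<langle>w', \<phi>_0(z_0) ... \<phi>_{n-1}(z_{n-1}) v\<rangle>)\<close>, defined through the components of \<open>v\<close> in the
  generalized eigenspaces of \<open>g\<close>\<close>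
definition correlation ::
    "'v::complex_vector vertex_data \<Rightarrow> ('v \<Rightarrow> 'v) \<Rightarrow> ('v, 'i) generators
      \<Rightarrow> ('v, 'w::complex_vector, 'i, 'a) twist_data
      \<Rightarrow> int \<Rightarrow> ('w \<Rightarrow> complex) \<Rightarrow> ('i, 'a) field_label list \<Rightarrow> 'v \<Rightarrow> (nat \<Rightarrow> complex) \<Rightarrow> complex"
  where "correlation V g G W p w' fs v z =
    (\<Sum>\<alpha> | component (V_g g) v \<alpha> \<noteq> 0.
      THE c. \<exists>F. is_correlation V G W p w' fs \<alpha> (component (V_g g) v \<alpha>) F \<and> c = F z)"

text \<open>The sign of reordering \<open>\<phi>_0 ... \<phi>_{k-1}\<close> into \<open>\<phi>_{\<sigma> 0} ... \<phi>_{\<sigma> (k-1)}\<close>, where \<open>par j\<close> is the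
  parity of \<open>\<phi>_j\<close>\<close>
definition koszul_sign :: "nat \<Rightarrow> (nat \<Rightarrow> nat) \<Rightarrow> (nat \<Rightarrow> bit) \<Rightarrow> complex"
  where "koszul_sign k \<sigma> par =
    (\<Prod>(i, j) \<in> {(i, j). i < j \<and> j < k \<and> \<sigma> i > \<sigma> j}. parity_sign (par (\<sigma> i)) (par (\<sigma> j)))"

end

theory Submission
  imports Defs "HOL-Complex_Analysis.Complex_Analysis"
begin

text \<open>
  Expanding the logarithms by means of the nilpotent operators \<open>N\<close> turns a product of fields into a
  finite family of formal series without logarithms, indexed by the powers \<open>r j\<close> of \<open>N_g\<close> applied to
  the individual fields. On this family weak commutativity becomes an identity between series
  multiplied by the kernels \<open>(1 - x_j / x_i)^\<alpha> exp (log (1 - x_j / x_i) N)\<close> and by powers of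
  \<open>x_i - x_j\<close>. After multiplication by the kernels of all generators with the twist field and by a
  high power of all differences, the series of all orderings coincide up to the Koszul sign; since
  each of them is truncated with respect to its own ordering, the common series is a Laurent
  polynomial. Dividing it by the differences and by the kernels, now as convergent series, sums the
  original series for each ordering and exhibits the same function, because \<open>l_p(z) + log (1 - w / z)\<close>
  is \<open>l_p(z - w)\<close> in the region in question. In terms of the logarithms of \<open>z\<close> and \<open>z_j - z\<close> that
  function is entire up to a denominator, so it is determined by its values on the region.
\<close>

section \<open>Complex linear algebra\<close>

text \<open>\<open>correlation\<close> is a definite description, so convergence and the form of the
  correlation functions are proved along with the symmetry: one function of the labelled variables
  has to serve every order.

  Truncation: division by \<open>x_i - x_j\<close> is unambiguous only on series bounded with
  respect to one order, and such bounds come from weights. The weights of a twist field are directly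
  accessible on the vacuum only; they are carried to all of V by solving weak commutativity for its
  lowest term.

  Uniformity: the exponent in weak commutativity depends on the pair of fields, and applying
  \<open>N_g\<close> changes the field. Its iterates on generators are again generators or zero, so
  finitely many exponents occur and one large \<open>M\<close> serves all exchanges.

  Order: two generators are exchanged only while both stand to the left of the twist field, so all
  orders are compared through those in which the twist field is last.

  Logarithms: they enter through an exponential generating function in the powers of
  \<open>N_g\<close>. Dividing by a kernel translates its argument, and the translations add up to
  the logarithms of \<open>z_m\<close> and \<open>z_j - z_m\<close>.\<close>

lemma scaleC_complex [simp]: "c *\<^sub>C (x::complex) = c * x"
  by (simp add: scaleC_complex_def)

lemmas scaleC_diff_left = complex_vector.scale_left_diff_distrib
lemmas scaleC_diff_right = complex_vector.scale_right_diff_distrib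
lemmas scaleC_sum_right = complex_vector.scale_sum_right
lemmas scaleC_sum_left = complex_vector.scale_sum_left
lemmas csubspace_0 = complex_vector.subspace_0
lemmas csubspace_add = complex_vector.subspace_add
lemmas csubspace_diff = complex_vector.subspace_diff
lemmas csubspace_scale = complex_vector.subspace_scale
lemmas csubspace_sum = complex_vector.subspace_sum

lemma csubspace_scale_iff: "csubspace S \<Longrightarrow> c \<noteq> 0 \<Longrightarrow> c *\<^sub>C x \<in> S \<longleftrightarrow> x \<in> S"
  using csubspace_scale[of S x c] csubspace_scale[of S "c *\<^sub>C x" "1 / c"] by auto

lemma csubspace_singleton_0 [simp]: "csubspace {0}"
  by (simp add: complex_vector.subspace_def)

lemma csubspace_Sum_any: "csubspace S \<Longrightarrow> (\<And>x. f x \<in> S) \<Longrightarrow> Sum_any f \<in> S"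
  by (simp add: Sum_any.expand_set csubspace_sum)

lemma clinear_iff:
  "clinear f \<longleftrightarrow> (\<forall>x y. f (x + y) = f x + f y) \<and> (\<forall>c x. f (c *\<^sub>C x) = c *\<^sub>C f x)"
  by (simp add: Vector_Spaces.linear_iff complex_vector.vector_space_axioms)

lemma clinearI:
  "\<lbrakk>\<And>x y. f (x + y) = f x + f y; \<And>c x. f (c *\<^sub>C x) = c *\<^sub>C f x\<rbrakk> \<Longrightarrow> clinear f"
  by (simp add: clinear_iff)

lemma clinear_add: "clinear f \<Longrightarrow> f (x + y) = f x + f y"
  by (simp add: clinear_iff)

lemma clinear_scale: "clinear f \<Longrightarrow> f (c *\<^sub>C x) = c *\<^sub>C f x"
  by (simp add: clinear_iff)

lemma clinear_0: "clinear f \<Longrightarrow> f 0 = 0"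
  using clinear_scale[of f 0 0] by simp

lemma clinear_neg: "clinear f \<Longrightarrow> f (- x) = - f x"
  using clinear_scale[of f "- 1" x] by simp

lemma clinear_diff: "clinear f \<Longrightarrow> f (x - y) = f x - f y"
  using clinear_add[of f x "- y"] by (simp add: clinear_neg)

lemma clinear_sum: "clinear f \<Longrightarrow> f (sum h A) = (\<Sum>x\<in>A. f (h x))"
  by (induction A rule: infinite_finite_induct) (simp_all add: clinear_0 clinear_add)

lemma clinear_id: "clinear (\<lambda>x. x)"
  by (simp add: clinear_iff)

lemma clinear_uminus: "clinear f \<Longrightarrow> clinear (\<lambda>x. - f x)"
  by (simp add: clinear_iff)

lemma clinear_compose: "clinear f \<Longrightarrow> clinear h \<Longrightarrow> clinear (\<lambda>x. f (h x))"
  by (simp add: clinear_iff)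

lemma clinear_minus: "clinear f \<Longrightarrow> clinear h \<Longrightarrow> clinear (\<lambda>x. f x - h x)"
  by (rule clinearI) (simp_all add: clinear_add clinear_scale scaleC_diff_right)

lemma clinear_plus: "clinear f \<Longrightarrow> clinear h \<Longrightarrow> clinear (\<lambda>x. f x + h x)"
  by (rule clinearI) (simp_all add: clinear_add clinear_scale scaleC_add_right add_ac)

lemma clinear_scaleC: "clinear f \<Longrightarrow> clinear (\<lambda>x. c *\<^sub>C f x)"
  by (rule clinearI) (simp_all add: clinear_add clinear_scale scaleC_add_right mult.commute)

lemma clinear_funpow: "clinear f \<Longrightarrow> clinear (f ^^ n)" for f :: "'a::complex_vector \<Rightarrow> 'a"
  by (induction n) (simp_all add: clinear_iff)

lemma funpow_uminus: "clinear f \<Longrightarrow> ((\<lambda>x. - f x) ^^ n) u = (- 1) ^ n *\<^sub>C (f ^^ n) u"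
  for f :: "'a::complex_vector \<Rightarrow> 'a"
  by (induction n) (simp_all add: clinear_scale)

lemma clinear_cspan_image:
  assumes "clinear f" "csubspace S" "\<And>x. x \<in> B \<Longrightarrow> f x \<in> S" "x \<in> cspan B"
  shows "f x \<in> S"
  using assms(4)
proof (induction rule: complex_vector.span_induct_alt)
  case base
  then show ?case using assms by (simp add: clinear_0 csubspace_0)
next
  case (step c x y)
  then show ?case using assms
    by (simp add: clinear_add clinear_scale csubspace_add csubspace_scale)
qed

text \<open>If \<open>p(t)\<close> has degree \<open>R\<close> then \<open>p(2t) - 2^R p(t)\<close> has smaller degree.\<close>
lemma csubspace_poly_coeff:
  assumes S: "csubspace S"
    and "\<And>t::nat. (\<Sum>r\<le>R. of_nat t ^ r *\<^sub>C a r) \<in> S" "r \<le> R"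
  shows "a r \<in> S"
  using assms(2,3)
proof (induction R arbitrary: a r)
  case 0
  then show ?case using 0(1)[of 1] by simp
next
  case (Suc R)
  have small: "a q \<in> S" if "q \<le> R" for q
  proof -
    let ?b = "\<lambda>q. (2 ^ q - 2 ^ Suc R) *\<^sub>C a q"
    have "?b q \<in> S"
    proof (rule Suc.IH[OF _ that])
      fix t :: nat
      have tm: "of_nat (2 * t) ^ r *\<^sub>C a r - 2 ^ Suc R *\<^sub>C (of_nat t ^ r *\<^sub>C a r) = of_nat t ^ r *\<^sub>C ?b r" for r
      proof -
        have "of_nat (2 * t) ^ r - 2 ^ Suc R * of_nat t ^ r = (of_nat t ^ r * (2 ^ r - 2 ^ Suc R) :: complex)"
          by (simp add: power_mult_distrib algebra_simps)
        then show ?thesis by (simp only: complex_vector.scale_scale scaleC_diff_left[symmetric])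
      qed
      have "(\<Sum>r\<le>R. of_nat t ^ r *\<^sub>C ?b r) = (\<Sum>r\<le>Suc R. of_nat t ^ r *\<^sub>C ?b r)"
        by simp
      also have "\<dots>
        = (\<Sum>r\<le>Suc R. of_nat (2 * t) ^ r *\<^sub>C a r) - 2 ^ Suc R *\<^sub>C (\<Sum>r\<le>Suc R. of_nat t ^ r *\<^sub>C a r)"
        by (simp only: scaleC_sum_right sum_subtractf[symmetric] tm)
      also have "\<dots> \<in> S"
        using Suc.prems(1) by (intro csubspace_diff csubspace_scale S)
      finally show "(\<Sum>r\<le>R. of_nat t ^ r *\<^sub>C ?b r) \<in> S" .
    qed
    moreover have "(2::complex) ^ q - 2 ^ Suc R \<noteq> 0"
    proof -
      have "(2::nat) ^ q < 2 ^ Suc R"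
        using that by (intro power_strict_increasing) auto
      then have "of_nat (2 ^ q) \<noteq> (of_nat (2 ^ Suc R) :: complex)"
        unfolding of_nat_eq_iff by simp
      then show ?thesis by simp
    qed
    ultimately show ?thesis using csubspace_scale_iff[OF S] by blast
  qed
  show ?case
  proof (cases "r \<le> R")
    case False
    with Suc.prems have r: "r = Suc R" by simp
    have "(\<Sum>r\<le>Suc R. of_nat 1 ^ r *\<^sub>C a r) - (\<Sum>r\<le>R. a r) \<in> S"
      by (intro csubspace_diff S Suc.prems(1) csubspace_sum) (auto intro: small)
    then show ?thesis by (simp add: r)
  qed (rule small)
qed

section \<open>Generalized eigenspaces and direct sums\<close>

abbreviation shiftop :: "('u::complex_vector \<Rightarrow> 'u) \<Rightarrow> complex \<Rightarrow> 'u \<Rightarrow> 'u"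
  where "shiftop T c \<equiv> \<lambda>x. T x - c *\<^sub>C x"

lemma clinear_shiftop: "clinear T \<Longrightarrow> clinear (shiftop T c)"
  by (intro clinear_minus clinear_scaleC clinear_id)

lemma shiftop_pow_mono:
  assumes "clinear T" "(shiftop T c ^^ K) u = 0" "K \<le> L"
  shows "(shiftop T c ^^ L) u = 0"
proof -
  have "(shiftop T c ^^ (L - K)) 0 = 0"
    by (intro clinear_0 clinear_funpow clinear_shiftop assms)
  then show ?thesis
    using fun_cong[OF funpow_add[of "L - K" K "shiftop T c"], of u] assms by simp
qed

lemma gen_eigenspace_iff: "u \<in> gen_eigenspace T c \<longleftrightarrow> (\<exists>K. (shiftop T c ^^ K) u = 0)"
  by (simp add: gen_eigenspace_def)

lemma csubspace_gen_eigenspace: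
  assumes T: "clinear T"
  shows "csubspace (gen_eigenspace T c)"
proof -
  note lin = clinear_funpow[OF clinear_shiftop[OF T]]
  show ?thesis
  proof (rule complex_vector.subspaceI)
    show "0 \<in> gen_eigenspace T c"
      unfolding gen_eigenspace_iff by (metis lin clinear_0)
  next
    fix x y assume "x \<in> gen_eigenspace T c" "y \<in> gen_eigenspace T c"
    then obtain K L where "(shiftop T c ^^ K) x = 0" "(shiftop T c ^^ L) y = 0"
      by (auto simp: gen_eigenspace_iff)
    then have "(shiftop T c ^^ (max K L)) x = 0" "(shiftop T c ^^ (max K L)) y = 0"
      using shiftop_pow_mono[OF T] by (meson max.cobounded1 max.cobounded2)+
    then have "(shiftop T c ^^ (max K L)) (x + y) = 0"
      by (simp add: clinear_add[OF lin])
    then show "x + y \<in> gen_eigenspace T c" by (auto simp: gen_eigenspace_iff)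
  next
    fix a x assume "x \<in> gen_eigenspace T c"
    then obtain K where "(shiftop T c ^^ K) x = 0"
      by (auto simp: gen_eigenspace_iff)
    then have "(shiftop T c ^^ K) (a *\<^sub>C x) = 0"
      by (simp add: clinear_scale[OF lin])
    then show "a *\<^sub>C x \<in> gen_eigenspace T c" by (auto simp: gen_eigenspace_iff)
  qed
qed

lemma funpow_commute_apply:
  assumes "\<And>x. f (h x) = h (f x)"
  shows "f ((h ^^ n) x) = (h ^^ n) (f x)"
  by (induction n) (simp_all add: assms)

lemma shiftop_commute:
  "clinear S \<Longrightarrow> (\<And>x. T (S x) = S (T x)) \<Longrightarrow> S (shiftop T c x) = shiftop T c (S x)"
  by (simp add: clinear_diff clinear_scale)

lemma gen_eigenspace_invariant:
  assumes "clinear T" "clinear S" "\<And>x. T (S x) = S (T x)" "u \<in> gen_eigenspace T c"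
  shows "S u \<in> gen_eigenspace T c"
proof -
  obtain K where "(shiftop T c ^^ K) u = 0" using assms(4) by (auto simp: gen_eigenspace_iff)
  moreover have "S ((shiftop T c ^^ K) u) = (shiftop T c ^^ K) (S u)"
    by (intro funpow_commute_apply shiftop_commute assms(2,3))
  ultimately have "(shiftop T c ^^ K) (S u) = 0"
    using clinear_0[OF assms(2)] by simp
  then show ?thesis by (auto simp: gen_eigenspace_iff)
qed

text \<open>Induction on \<open>L\<close>: the vector \<open>?w = (T - c)^L u\<close> is an
  eigenvector for \<open>c\<close>, so \<open>T - a\<close> acts on it by the nonzero scalar
  \<open>c - a\<close>. Being killed by a power of \<open>T - a\<close> as well, it
  vanishes.\<close>

lemma gen_eigenspace_disjoint:
  assumes T: "clinear T" and "(shiftop T a ^^ K) u = 0" "(shiftop T c ^^ L) u = 0" "a \<noteq> c"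
  shows "u = 0"
  using assms(2,3)
proof (induction L arbitrary: u)
  case 0
  then show ?case by simp
next
  case (Suc L)
  let ?w = "(shiftop T c ^^ L) u"
  note linc = clinear_funpow[OF clinear_shiftop[OF T, of c], of L]
  have "shiftop T c ?w = 0" using Suc.prems(2) by simp
  then have Tw: "T ?w = c *\<^sub>C ?w" by simp
  have "(shiftop T a ^^ n) ?w = (c - a) ^ n *\<^sub>C ?w" for n
  proof (induction n)
    case (Suc n)
    have "(shiftop T a ^^ Suc n) ?w = shiftop T a ((shiftop T a ^^ n) ?w)" by simp
    also have "\<dots> = (c - a) ^ n *\<^sub>C T ?w - (a * (c - a) ^ n) *\<^sub>C ?w"
      unfolding Suc.IH clinear_scale[OF T] by simp
    also have "\<dots> = ((c - a) ^ n * c - a * (c - a) ^ n) *\<^sub>C ?w"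
      unfolding Tw scaleC_diff_left by simp
    also have "(c - a) ^ n * c - a * (c - a) ^ n = (c - a) ^ Suc n" by (simp add: algebra_simps)
    finally show ?case .
  qed simp
  moreover have "(shiftop T a ^^ K) ?w = 0"
  proof -
    have "shiftop T a (shiftop T c x) = shiftop T c (shiftop T a x)" for x
      by (simp add: clinear_diff[OF T] clinear_scale[OF T] scaleC_diff_right mult.commute)
    then have "(shiftop T a ^^ K) (shiftop T c x) = shiftop T c ((shiftop T a ^^ K) x)" for x
      using funpow_commute_apply[of "shiftop T c" "shiftop T a" K x] by metis
    then have "(shiftop T a ^^ K) ?w = (shiftop T c ^^ L) ((shiftop T a ^^ K) u)"
      by (rule funpow_commute_apply)
    then show ?thesis using Suc.prems(1) clinear_0[OF linc] by simp
  qed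
  ultimately have "?w = 0" using assms(4) by simp
  then show ?case using Suc by blast
qed

lemma gen_eigenspace_independent:
  assumes T: "clinear T" and "finite A" "\<And>c. c \<in> A \<Longrightarrow> f c \<in> gen_eigenspace T c" "sum f A = 0" "c \<in> A"
  shows "f c = 0"
  using assms(2-)
proof (induction A arbitrary: f c rule: finite_induct)
  case empty
  then show ?case by simp
next
  case (insert a A)
  obtain K where K: "(shiftop T a ^^ K) (f a) = 0"
    using insert.prems(1)[of a] by (auto simp: gen_eigenspace_iff)
  \<comment> \<open>The power that kills \<open>f a\<close> commutes with \<open>T\<close> and keeps
    the other summands in their eigenspaces. The induction hypothesis for the images puts each
    \<open>f c\<close> into the eigenspace of \<open>a\<close> too.\<close>
  let ?X = "shiftop T a ^^ K"
  note lin = clinear_funpow[OF clinear_shiftop[OF T, of a], of K]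
  have comm: "T (?X x) = ?X (T x)" for x
    by (rule funpow_commute_apply) (simp add: clinear_diff[OF T] clinear_scale[OF T])
  have "(\<Sum>c\<in>A. ?X (f c)) = ?X (sum f (insert a A))"
    using insert.hyps by (simp add: clinear_add[OF lin] clinear_sum[OF lin] K)
  then have "(\<Sum>c\<in>A. ?X (f c)) = 0" using insert.prems(2) clinear_0[OF lin] by simp
  then have X0: "?X (f c) = 0" if "c \<in> A" for c
    using insert.IH[of "\<lambda>c. ?X (f c)" c] gen_eigenspace_invariant[OF T lin comm] insert.prems(1) that
    by blast
  have A0: "f c = 0" if "c \<in> A" for c
  proof -
    obtain L where "(shiftop T c ^^ L) (f c) = 0"
      using insert.prems(1)[of c] \<open>c \<in> A\<close> unfolding gen_eigenspace_iff by blast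
    then show ?thesis
      using gen_eigenspace_disjoint[OF T X0[OF that]] that insert.hyps by blast
  qed
  then have "f a = 0" using insert.prems(2) insert.hyps by simp
  with A0 insert.prems(3) show ?case by blast
qed

lemma direct_sum_decomposes: "direct_sum E \<Longrightarrow> decomposes E u (component E u)"
  unfolding direct_sum_def component_def by (metis theI')

lemma direct_sum_subspace: "direct_sum E \<Longrightarrow> csubspace (E k)"
  by (simp add: direct_sum_def)

lemma component_eqI: "direct_sum E \<Longrightarrow> decomposes E u f \<Longrightarrow> component E u = f"
  using direct_sum_decomposes unfolding direct_sum_def by blast

lemma component_in: "direct_sum E \<Longrightarrow> component E u k \<in> E k"
  using direct_sum_decomposes unfolding decomposes_def by blast

lemma component_finite: "direct_sum E \<Longrightarrow> finite {k. component E u k \<noteq> 0}"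
  using direct_sum_decomposes unfolding decomposes_def by blast

lemma component_sum: "direct_sum E \<Longrightarrow> (\<Sum>k | component E u k \<noteq> 0. component E u k) = u"
  using direct_sum_decomposes[of E u] unfolding decomposes_def Sum_any.expand_set by simp

lemma component_single:
  assumes "direct_sum E" "u \<in> E k"
  shows "component E u = (\<lambda>k'. if k' = k then u else 0)"
proof (rule component_eqI[OF assms(1)])
  show "decomposes E u (\<lambda>k'. if k' = k then u else 0)"
    unfolding decomposes_def
    using assms csubspace_0[OF direct_sum_subspace[OF assms(1)]]
    by (auto intro!: finite_subset[of _ "{k}"] simp: Sum_any.expand_superset[of "{k}"])
qed

lemma diag_op_single:
  assumes "direct_sum E" "u \<in> E k"
  shows "diag_op c E u = c k *\<^sub>C u"
  unfolding diag_op_def component_single[OF assms]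
  by (subst Sum_any.expand_superset[of "{k}"]) auto

lemma decomposes_diag_op:
  assumes "direct_sum E"
  shows "decomposes E (diag_op c E u) (\<lambda>k. c k *\<^sub>C component E u k)"
  unfolding decomposes_def diag_op_def
  using assms component_in[OF assms] component_finite[OF assms]
  by (auto intro: csubspace_scale[OF direct_sum_subspace] elim!: rev_finite_subset)

lemma decomposes_scale:
  assumes "direct_sum E"
  shows "decomposes E (c *\<^sub>C u) (\<lambda>k. c *\<^sub>C component E u k)"
proof -
  have "c *\<^sub>C u = (\<Sum>k | component E u k \<noteq> 0. c *\<^sub>C component E u k)"
    by (subst component_sum[OF assms, symmetric]) (simp add: scaleC_sum_right)
  also have "\<dots> = Sum_any (\<lambda>k. c *\<^sub>C component E u k)"
    using component_finite[OF assms, of u] by (intro Sum_any.expand_superset[symmetric]) auto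
  finally show ?thesis
    unfolding decomposes_def
    using assms component_in[OF assms] component_finite[OF assms]
    by (auto intro: csubspace_scale[OF direct_sum_subspace] elim!: rev_finite_subset)
qed

text \<open>Turns membership in a summand into an eigenvalue equation, so that any operator
  commuting with the diagonal operator preserves the summands. Injectivity of \<open>c\<close>
  separates the components.\<close>

lemma mem_iff_diag_op:
  assumes ds: "direct_sum E" and inj: "inj c"
  shows "u \<in> E k \<longleftrightarrow> diag_op c E u = c k *\<^sub>C u"
proof
  assume "diag_op c E u = c k *\<^sub>C u"
  then have "(\<lambda>j. c j *\<^sub>C component E u j) = (\<lambda>j. c k *\<^sub>C component E u j)"
    using component_eqI[OF ds decomposes_diag_op[OF ds]]
      component_eqI[OF ds decomposes_scale[OF ds]] by metis
  then have "component E u j = 0" if "j \<noteq> k" for j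
    using that inj by (metis complex_vector.scale_cancel_right injD)
  then have "{j. component E u j \<noteq> 0} \<subseteq> {k}" by auto
  then have "Sum_any (component E u) = component E u k"
    by (subst Sum_any.expand_superset[of "{k}"]) auto
  then have "u = component E u k"
    using direct_sum_decomposes[OF ds, of u] by (simp add: decomposes_def)
  then show "u \<in> E k" using component_in[OF ds, of u k] by simp
qed (simp add: diag_op_single[OF ds])

lemma direct_sumI:
  assumes sub: "\<And>k. csubspace (E k)" and ex: "\<And>u. \<exists>f. decomposes E u f"
    and ind: "\<And>A f k. finite A \<Longrightarrow> (\<And>k. k \<in> A \<Longrightarrow> f k \<in> E k) \<Longrightarrow> sum f A = 0 \<Longrightarrow> k \<in> A \<Longrightarrow> f k = 0"
  shows "direct_sum E"
  unfolding direct_sum_def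
proof (intro conjI allI ex_ex1I)
  fix u f h assume f: "decomposes E u f" and h: "decomposes E u h"
  let ?A = "{k. f k \<noteq> 0} \<union> {k. h k \<noteq> 0}"
  have fin: "finite ?A" using f h by (simp add: decomposes_def)
  have "(\<Sum>k\<in>?A. f k - h k) = Sum_any f - Sum_any h"
    using fin by (simp add: sum_subtractf Sum_any.expand_superset[of ?A])
  also have "\<dots> = 0" using f h by (simp add: decomposes_def)
  finally have "f k - h k = 0" if "k \<in> ?A" for k
    by (rule ind[OF fin, of "\<lambda>k. f k - h k", rotated]) (use f h that in \<open>auto simp: decomposes_def intro: csubspace_diff[OF sub]\<close>)
  then show "f = h" by (intro ext) force
qed (use sub ex in auto)

lemma decomposes_of_span:
  assumes sub: "\<And>k. csubspace (E k)" and "\<And>x. x \<in> B \<Longrightarrow> \<exists>k. x \<in> E k" "u \<in> cspan B"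
  shows "\<exists>f. decomposes E u f"
  using assms(3)
proof (induction rule: complex_vector.span_induct_alt)
  case base
  show ?case
    by (rule exI[of _ "\<lambda>_. 0"]) (simp add: decomposes_def csubspace_0[OF sub])
next
  case (step c x y)
  then obtain f where f: "decomposes E y f" by blast
  obtain k where k: "x \<in> E k" using assms(2) step by blast
  let ?h = "\<lambda>j. (if j = k then c *\<^sub>C x else 0)"
  have fin: "finite {j. ?h j \<noteq> 0}" "finite {j. f j \<noteq> 0}"
    using f by (auto simp: decomposes_def)
  have "decomposes E (c *\<^sub>C x + y) (\<lambda>j. ?h j + f j)"
    unfolding decomposes_def
  proof (intro conjI allI)
    show "?h j + f j \<in> E j" for j
      using f k by (auto simp: decomposes_def csubspace_0[OF sub] csubspace_scale[OF sub] intro!: csubspace_add[OF sub])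
    show "finite {j. ?h j + f j \<noteq> 0}"
      by (rule finite_subset[of _ "{j. ?h j \<noteq> 0} \<union> {j. f j \<noteq> 0}"]) (use fin in auto)
    show "c *\<^sub>C x + y = Sum_any (\<lambda>j. ?h j + f j)"
      using f by (simp add: Sum_any.distrib[OF fin] decomposes_def)
  qed
  then show ?case by blast
qed

text \<open>Used to pass from the grading by weight and fermion number to the grading by weight,
  through which \<open>L0_V\<close> is defined. Elements of distinct coarse pieces have their fine
  components over disjoint index sets.\<close>

lemma direct_sum_coarse:
  assumes ds: "direct_sum E"
  shows "direct_sum (\<lambda>k. cspan (\<Union>x\<in>{x. h x = k}. E x))" (is "direct_sum ?F")
proof (rule direct_sumI)
  show "\<exists>f. decomposes ?F u f" for u
  proof (rule decomposes_of_span[where B = "\<Union>x. E x"])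
    show "\<exists>k. x \<in> ?F k" if "x \<in> (\<Union>x. E x)" for x
      using that by (auto intro: complex_vector.span_base)
    have "(\<Sum>k | component E u k \<noteq> 0. component E u k) \<in> cspan (\<Union>x. E x)"
      by (rule complex_vector.span_sum, rule complex_vector.span_base) (use component_in[OF ds] in blast)
    then show "u \<in> cspan (\<Union>x. E x)" by (simp add: component_sum[OF ds])
  qed auto
next
  fix A f k assume fin: "finite A" and f: "\<And>k. k \<in> A \<Longrightarrow> f k \<in> ?F k" and s: "sum f A = 0" and k: "k \<in> A"
  have "\<exists>d. decomposes E x d \<and> (\<forall>j. h j \<noteq> k \<longrightarrow> d j = 0)" if "x \<in> ?F k" for x k
  proof -
    let ?E = "\<lambda>j. if h j = k then E j else {0}"
    have "\<exists>d. decomposes ?E x d"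
      by (rule decomposes_of_span[OF _ _ that])
         (auto simp: direct_sum_subspace[OF ds] intro: exI)
    then obtain d where d: "decomposes ?E x d" by blast
    then have "d j \<in> ?E j" for j by (simp add: decomposes_def)
    then have "\<forall>j. h j \<noteq> k \<longrightarrow> d j = 0" "\<forall>j. d j \<in> E j"
      by (metis singletonD, metis csubspace_0[OF direct_sum_subspace[OF ds]] singletonD)
    then show ?thesis using d by (auto simp: decomposes_def)
  qed
  then have "\<forall>k. k \<in> A \<longrightarrow> (\<exists>d. decomposes E (f k) d \<and> (\<forall>j. h j \<noteq> k \<longrightarrow> d j = 0))"
    using f by blast
  then obtain d where d: "\<And>k. k \<in> A \<Longrightarrow> decomposes E (f k) (d k)"
      "\<And>k j. k \<in> A \<Longrightarrow> h j \<noteq> k \<Longrightarrow> d k j = 0" by metis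
  let ?B = "\<Union>k\<in>A. {j. d k j \<noteq> 0}"
  have finB: "finite ?B" using fin d(1) by (auto simp: decomposes_def)
  have fd: "f k = (\<Sum>j\<in>?B. d k j)" if "k \<in> A" for k
    using d(1)[OF that] Sum_any.expand_superset[OF finB, of "d k"] that by (auto simp: decomposes_def)
  have dec: "decomposes E 0 (\<lambda>j. \<Sum>k\<in>A. d k j)"
    unfolding decomposes_def
  proof (intro conjI allI)
    show "(\<Sum>k\<in>A. d k j) \<in> E j" for j
      using d(1) by (intro csubspace_sum direct_sum_subspace[OF ds]) (auto simp: decomposes_def)
    have sup: "{j. (\<Sum>k\<in>A. d k j) \<noteq> 0} \<subseteq> ?B" by (auto intro: sum.neutral)
    then show "finite {j. (\<Sum>k\<in>A. d k j) \<noteq> 0}" using finB finite_subset by blast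
    have "Sum_any (\<lambda>j. \<Sum>k\<in>A. d k j) = (\<Sum>j\<in>?B. \<Sum>k\<in>A. d k j)"
      by (rule Sum_any.expand_superset[OF finB sup])
    also have "\<dots> = (\<Sum>k\<in>A. f k)"
      by (subst sum.swap) (auto intro!: sum.cong simp: fd)
    finally show "0 = Sum_any (\<lambda>j. \<Sum>k\<in>A. d k j)" using s by simp
  qed
  have "decomposes E 0 (\<lambda>_. 0)"
    by (auto simp: decomposes_def csubspace_0[OF direct_sum_subspace[OF ds]])
  with dec have z: "(\<lambda>j. \<Sum>k\<in>A. d k j) = (\<lambda>_. 0)"
    using component_eqI[OF ds] by metis
  have "d k j = 0" for j
  proof (cases "h j = k")
    case True
    have "(\<Sum>k\<in>A. d k j) = (\<Sum>k\<in>{k}. d k j)"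
      using fin k True d(2) by (intro sum.mono_neutral_right) (auto, metis)
    then show ?thesis using fun_cong[OF z, of j] by simp
  qed (use d(2) k in auto)
  then show "f k = 0" using fd[OF k] by simp
qed auto

section \<open>The generalized eigenspaces of the automorphism\<close>

text \<open>Cauchy products occur below with ranges cut off for unrelated reasons, mostly
  nilpotency. If \<open>f\<close> vanishes wherever box and triangle differ, the sum over the box
  can be arranged by total degree.\<close>

lemma sum_box_triangle:
  fixes f :: "nat \<Rightarrow> nat \<Rightarrow> 'a::comm_monoid_add"
  assumes "\<And>r q. r < R \<Longrightarrow> q < Q \<Longrightarrow> T \<le> r + q \<Longrightarrow> f r q = 0"
    and "\<And>r q. r + q < T \<Longrightarrow> R \<le> r \<or> Q \<le> q \<Longrightarrow> f r q = 0"
  shows "(\<Sum>r<R. \<Sum>q<Q. f r q) = (\<Sum>p<T. \<Sum>r\<le>p. f r (p - r))"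
proof -
  have fin: "finite {(i, j). i + j < T}"
    by (rule finite_subset[of _ "{..<T} \<times> {..<T}"]) auto
  have "(\<Sum>p<T. \<Sum>r\<le>p. f r (p - r)) = (\<Sum>(i,j)\<in>{(i,j). i + j < T}. f i j)"
    by (rule sum.triangle_reindex[symmetric])
  also have "\<dots> = (\<Sum>(i,j)\<in>{(i,j). i + j < T} \<inter> {..<R} \<times> {..<Q}. f i j)"
    by (rule sum.mono_neutral_right[OF fin]) (auto intro!: assms(2) simp: not_less)
  also have "\<dots> = (\<Sum>(i,j)\<in>{..<R} \<times> {..<Q}. f i j)"
    by (rule sum.mono_neutral_left) (auto intro!: assms(1) simp: not_less)
  finally show ?thesis by (simp add: sum.cartesian_product)
qed

section \<open>Exponentials of locally nilpotent operators\<close>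

lemma funpow_zero_mono:
  fixes N :: "'a::complex_vector \<Rightarrow> 'a"
  assumes "clinear N" "(N ^^ K) u = 0" "K \<le> L"
  shows "(N ^^ L) u = 0"
proof -
  have "(N ^^ (L - K)) 0 = 0" by (intro clinear_0 clinear_funpow assms)
  then show ?thesis using fun_cong[OF funpow_add[of "L - K" K N], of u] assms by simp
qed

lemma exp_nil_sum:
  assumes "clinear N" "(N ^^ K) u = 0"
  shows "exp_nil t N u = (\<Sum>r<K. (t ^ r / fact r) *\<^sub>C (N ^^ r) u)"
  unfolding exp_nil_def
proof (rule Sum_any.expand_superset)
  have "(N ^^ r) u = 0" if "\<not> r < K" for r
    using funpow_zero_mono[OF assms] that by simp
  then show "{r. (t ^ r / fact r) *\<^sub>C (N ^^ r) u \<noteq> 0} \<subseteq> {..<K}"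
    by (intro subsetI) (rule ccontr, simp)
qed simp

lemma binomial_fact_sum:
  "(\<Sum>r\<le>p. s ^ r / fact r * (t ^ (p - r) / fact (p - r))) = (s + t) ^ p / fact p" for s t :: complex
proof -
  have "(s + t) ^ p / fact p = (\<Sum>r\<le>p. of_nat (p choose r) * s ^ r * t ^ (p - r)) / fact p"
    by (simp add: binomial_ring)
  also have "\<dots> = (\<Sum>r\<le>p. s ^ r / fact r * (t ^ (p - r) / fact (p - r)))"
    unfolding sum_divide_distrib by (rule sum.cong) (simp_all add: binomial_fact)
  finally show ?thesis ..
qed

lemma exp_nil_add:
  assumes N: "clinear N" and nil: "locally_nilpotent N"
  shows "exp_nil s N (exp_nil t N u) = exp_nil (s + t) N u"
proof -
  obtain K where K: "(N ^^ K) u = 0" using nil by (auto simp: locally_nilpotent_def)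
  note lin = clinear_funpow[OF N]
  have K': "(N ^^ K) (exp_nil t N u) = 0"
  proof -
    have "(N ^^ K) ((N ^^ r) u) = 0" for r
      using funpow_zero_mono[OF N K, of "K + r"] by (simp add: funpow_add)
    then show ?thesis by (simp add: exp_nil_sum[OF N K] clinear_sum[OF lin] clinear_scale[OF lin])
  qed
  have "exp_nil s N (exp_nil t N u)
      = (\<Sum>r<K. \<Sum>q<K. (s ^ r / fact r * (t ^ q / fact q)) *\<^sub>C (N ^^ (r + q)) u)"
    unfolding exp_nil_sum[OF N K']
    unfolding exp_nil_sum[OF N K]
    by (simp add: clinear_sum[OF lin] clinear_scale[OF lin] scaleC_sum_right funpow_add)
  also have "\<dots> = (\<Sum>p<K. \<Sum>r\<le>p. (s ^ r / fact r * (t ^ (p - r) / fact (p - r))) *\<^sub>C (N ^^ (r + (p - r))) u)"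
    by (rule sum_box_triangle) (use funpow_zero_mono[OF N K] in auto)
  also have "\<dots> = (\<Sum>p<K. ((s + t) ^ p / fact p) *\<^sub>C (N ^^ p) u)"
    by (rule sum.cong) (simp_all add: binomial_fact_sum[symmetric] scaleC_sum_left)
  finally show ?thesis by (simp add: exp_nil_sum[OF N K])
qed

section \<open>Exponents modulo the integers\<close>

lemma exp_2pi_i_eq_iff: "exp (2 * complex_of_real pi * \<i> * a) = exp (2 * complex_of_real pi * \<i> * b) \<longleftrightarrow> a - b \<in> \<int>"
proof -
  have "exp (2 * complex_of_real pi * \<i> * a) = exp (2 * complex_of_real pi * \<i> * b) \<longleftrightarrow>
      (\<exists>n::int. 2 * complex_of_real pi * \<i> * a = 2 * complex_of_real pi * \<i> * b + complex_of_real (of_int (2 * n) * pi) * \<i>)"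
    by (rule exp_eq)
  also have "\<dots> \<longleftrightarrow> (\<exists>n::int. 2 * complex_of_real pi * \<i> * a = 2 * complex_of_real pi * \<i> * (b + of_int n))"
    by (rule ex_cong1) (simp add: algebra_simps)
  also have "\<dots> \<longleftrightarrow> (\<exists>n::int. a = b + of_int n)"
    by simp
  also have "\<dots> \<longleftrightarrow> a - b \<in> \<int>"
    by (auto simp: Ints_def algebra_simps)
  finally show ?thesis .
qed

lemma strip_unique:
  assumes "0 \<le> Re a" "Re a < 1" "0 \<le> Re b" "Re b < 1" "a - b \<in> \<int>"
  shows "a = b"
proof -
  obtain n where n: "a - b = of_int n" using assms(5) by (auto elim: Ints_cases)
  then have "Re a - Re b = of_int n" by (metis Re_complex_of_real minus_complex.sel(1) of_real_of_int_eq)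
  then have "n = 0" using assms by linarith
  then show ?thesis using n by simp
qed

text \<open>The representative modulo the integers in the strip to which the exponents in
  \<open>P_V\<close> are normalized; exponents of products add only modulo integers.\<close>

definition frac_part :: "complex \<Rightarrow> complex"
  where "frac_part a = a - of_int \<lfloor>Re a\<rfloor>"

lemma frac_part_strip: "0 \<le> Re (frac_part a)" "Re (frac_part a) < 1"
  unfolding frac_part_def by (simp_all, linarith)

lemma frac_part_diff: "a - frac_part a \<in> \<int>" "frac_part a - a \<in> \<int>"
  by (simp_all add: frac_part_def)

lemma frac_part_cong:
  assumes "a - b \<in> \<int>"
  shows "frac_part a = frac_part b"
proof (rule strip_unique[OF frac_part_strip frac_part_strip])
  have "frac_part a - frac_part b = (frac_part a - a) + (a - b) + (b - frac_part b)" by simp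
  also have "\<dots> \<in> \<int>" by (intro Ints_add assms frac_part_diff)
  finally show "frac_part a - frac_part b \<in> \<int>" .
qed

lemma exp_frac_part: "exp (2 * complex_of_real pi * \<i> * frac_part a) = exp (2 * complex_of_real pi * \<i> * a)"
  by (simp add: exp_2pi_i_eq_iff frac_part_diff)

section \<open>The automorphism of a generated vertex superalgebra and its logarithm\<close>

locale vsa_generated =
  fixes V :: "'v::complex_vector vertex_data"
    and g N :: "'v \<Rightarrow> 'v"
    and G :: "('v, 'i) generators"
  assumes vsa: "vertex_superalgebra V"
    and aut: "vsa_automorphism V g"
    and lognil: "log_nilpotent_part g (V_g g) N"
    and gen: "generation_assumption V g N G"
begin

lemma g_lin: "clinear g" and g_vac: "g (vac V) = vac V"
  and g_gr: "u \<in> V_gr V n s \<Longrightarrow> g u \<in> V_gr V n s"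
  and g_Y: "g (Y_op V u m v) = Y_op V (g u) m (g v)"
  using aut unfolding vsa_automorphism_def bij_def by blast+

lemma Y_lin1: "clinear (\<lambda>u. Y_op V u m v)" and Y_lin2: "clinear (Y_op V u m)"
  using vsa by (simp_all add: vertex_superalgebra_def)

lemma N_lin: "clinear N" and N_nil: "locally_nilpotent N"
  using lognil by (simp_all add: log_nilpotent_part_def)

lemma V_gr_subspace: "csubspace (V_gr V n s)"
  using vsa direct_sum_subspace[of "\<lambda>(n, s). V_gr V n s" "(n, s)"]
  by (simp add: vertex_superalgebra_def)

text \<open>A nonzero generalized eigenspace contains an eigenvector, so for exponents outside
  \<open>P_V\<close> both sides are zero. Exponents can thus be added without checking that the
  result occurs.\<close>

lemma V_g_eq:
  assumes "0 \<le> Re a" "Re a < 1"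
  shows "V_g g a = gen_eigenspace g (exp (2 * pi * \<i> * a))"
proof (cases "a \<in> P_V g")
  case False
  have "(shiftop g (exp (2 * pi * \<i> * a)) ^^ K) u = 0 \<Longrightarrow> u = 0" for K u
  proof (induction K)
    case (Suc K)
    let ?w = "(shiftop g (exp (2 * pi * \<i> * a)) ^^ K) u"
    from Suc.prems have "g ?w = exp (2 * pi * \<i> * a) *\<^sub>C ?w" by simp
    then have "?w = 0" using False assms unfolding P_V_def by blast
    then show ?case by (rule Suc.IH)
  qed simp
  then show ?thesis
    using False csubspace_0[OF csubspace_gen_eigenspace[OF g_lin]]
    by (auto simp: V_g_def gen_eigenspace_iff)
qed (simp add: V_g_def)

lemma P_V_strip: "a \<in> P_V g \<Longrightarrow> 0 \<le> Re a" "a \<in> P_V g \<Longrightarrow> Re a < 1"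
  by (simp_all add: P_V_def)

lemma V_g_subspace: "csubspace (V_g g a)"
  by (simp add: V_g_def csubspace_gen_eigenspace g_lin)

text \<open>As \<open>g\<close> is an automorphism,
  \<open>(g - ab) Y(u)v = Y((g - a)u) gv + a Y(u)(g - b)v\<close>, and \<open>gv\<close> is killed
  by the same power of \<open>g - b\<close> as \<open>v\<close>. Each application lowers
  \<open>K + L\<close>.\<close>

lemma gen_eigenspace_Y:
  assumes "u \<in> gen_eigenspace g a" "v \<in> gen_eigenspace g b"
  shows "Y_op V u m v \<in> gen_eigenspace g (a * b)"
proof -
  have "(shiftop g a ^^ K) u = 0 \<Longrightarrow> (shiftop g b ^^ L) v = 0
      \<Longrightarrow> (shiftop g (a * b) ^^ (K + L)) (Y_op V u m v) = 0" for K L u v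
  proof (induction "K + L" arbitrary: K L u v)
    case 0
    then show ?case using clinear_0[OF Y_lin2] by simp
  next
    case (Suc n)
    note lin = clinear_funpow[OF clinear_shiftop[OF g_lin]]
    have ginv: "(shiftop g b ^^ L) (g v) = 0"
      using funpow_commute_apply[of g "shiftop g b" L v] Suc.prems(2)
      by (simp add: clinear_0[OF g_lin] clinear_diff[OF g_lin] clinear_scale[OF g_lin])
    have split: "shiftop g (a * b) (Y_op V u m v)
        = Y_op V (shiftop g a u) m (g v) + a *\<^sub>C Y_op V u m (shiftop g b v)"
      by (simp add: g_Y clinear_diff[OF Y_lin1] clinear_scale[OF Y_lin1] clinear_diff[OF Y_lin2]
          clinear_scale[OF Y_lin2] scaleC_diff_right)
    have 1: "(shiftop g (a * b) ^^ n) (Y_op V (shiftop g a u) m (g v)) = 0"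
    proof (cases K)
      case 0
      then have "u = 0" using Suc.prems(1) by simp
      then show ?thesis by (simp add: clinear_0[OF g_lin] clinear_0[OF Y_lin1] clinear_0[OF lin])
    next
      case (Suc K')
      then have "(shiftop g a ^^ K') (shiftop g a u) = 0"
        using Suc.prems(1) by (simp only: funpow_Suc_right o_apply)
      then show ?thesis using Suc.hyps(1)[of K' L] Suc.hyps(2) ginv Suc by simp
    qed
    have 2: "(shiftop g (a * b) ^^ n) (Y_op V u m (shiftop g b v)) = 0"
    proof (cases L)
      case 0
      then have "v = 0" using Suc.prems(2) by simp
      then show ?thesis by (simp add: clinear_0[OF g_lin] clinear_0[OF Y_lin2] clinear_0[OF lin])
    next
      case (Suc L')
      then have "(shiftop g b ^^ L') (shiftop g b v) = 0"
        using Suc.prems(2) by (simp only: funpow_Suc_right o_apply)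
      then show ?thesis using Suc.hyps(1)[of K L'] Suc.hyps(2) Suc.prems(1) Suc by simp
    qed
    have "(shiftop g (a * b) ^^ Suc n) (Y_op V u m v)
        = (shiftop g (a * b) ^^ n) (shiftop g (a * b) (Y_op V u m v))"
      by (simp only: funpow_Suc_right o_apply)
    also have "\<dots> = 0"
      unfolding split by (simp add: clinear_add[OF lin] clinear_scale[OF lin] 1 2)
    finally show ?case using Suc.hyps(2) by simp
  qed
  then show ?thesis using assms unfolding gen_eigenspace_iff by blast
qed

lemma V_g_Y:
  assumes "u \<in> V_g g a" "v \<in> V_g g b" "0 \<le> Re a" "Re a < 1" "0 \<le> Re b" "Re b < 1"
  shows "Y_op V u m v \<in> V_g g (frac_part (a + b))"
proof -
  have "exp (2 * pi * \<i> * frac_part (a + b)) = exp (2 * pi * \<i> * a) * exp (2 * pi * \<i> * b)"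
    by (simp add: exp_frac_part distrib_left exp_add)
  then show ?thesis
    using gen_eigenspace_Y[of u _ v] assms frac_part_strip[of "a + b"] by (simp add: V_g_eq)
qed

lemma gvec: "i \<in> I_set G \<Longrightarrow> gvec G i \<in> V_gr V (gwt G i) (gpar G i)"
  "i \<in> I_set G \<Longrightarrow> gal G i \<in> P_V g" "i \<in> I_set G \<Longrightarrow> gvec G i \<in> V_g g (gal G i)"
  "i \<in> I_set G \<Longrightarrow> N (gvec G i) \<noteq> 0 \<Longrightarrow> gN G i \<in> I_set G"
  "i \<in> I_set G \<Longrightarrow> N (gvec G i) \<noteq> 0 \<Longrightarrow> gvec G (gN G i) = N (gvec G i)"
  using gen unfolding generation_assumption_def by (blast | metis)+

lemma vac_V_g: "vac V \<in> V_g g 0"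
  unfolding V_g_eq[of 0, simplified] gen_eigenspace_iff
  by (rule exI[of _ 1]) (simp add: g_vac)

lemma gen_products_V_g: "u \<in> gen_products V G \<Longrightarrow> \<exists>a. 0 \<le> Re a \<and> Re a < 1 \<and> u \<in> V_g g a"
proof (induction rule: gen_products.induct)
  case 1
  then show ?case using vac_V_g by (intro exI[of _ 0]) simp
next
  case (2 u i n)
  then obtain b where "0 \<le> Re b" "Re b < 1" "u \<in> V_g g b" by blast
  with 2 show ?case
    using V_g_Y[OF gvec(3) _ P_V_strip[OF gvec(2)], of i u b n] frac_part_strip by blast
qed

lemma span_gen_products: "cspan (gen_products V G) = UNIV"
  using gen unfolding generation_assumption_def by (elim conjE)

text \<open>The products of generators are homogeneous and span V; independence is that of
  generalized eigenspaces, because the exponential is injective on the strip.\<close>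

lemma V_g_direct_sum: "direct_sum (V_g g)"
proof (rule direct_sumI[OF V_g_subspace])
  fix u
  have "u \<in> cspan (gen_products V G)" by (simp add: span_gen_products)
  then show "\<exists>f. decomposes (V_g g) u f"
    by (rule decomposes_of_span[OF V_g_subspace, rotated]) (use gen_products_V_g in blast)
next
  fix A f k assume A: "finite A" "\<And>k. k \<in> A \<Longrightarrow> f k \<in> V_g g k" "sum f A = 0" "k \<in> A"
  let ?e = "\<lambda>a. exp (2 * pi * \<i> * a)" and ?A = "A \<inter> P_V g"
  have inj: "inj_on ?e ?A"
    by (rule inj_onI) (auto simp: exp_2pi_i_eq_iff intro: strip_unique P_V_strip)
  have f0: "f k = 0" if "k \<in> A" "k \<notin> P_V g" for k
    using A(2)[OF that(1)] that(2) by (simp add: V_g_def)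
  let ?h = "\<lambda>c. f (the_inv_into ?A ?e c)"
  have "sum ?h (?e ` ?A) = (\<Sum>k\<in>?A. f k)"
    by (subst sum.reindex[OF inj]) (intro sum.cong refl, simp only: o_apply the_inv_into_f_f[OF inj])
  also have "\<dots> = 0" using A(1,3) f0 by (subst sum.mono_neutral_left[of A ?A f]) auto
  finally have s: "sum ?h (?e ` ?A) = 0" .
  show "f k = 0"
  proof (cases "k \<in> P_V g")
    case True
    have "?h (?e k) = 0"
    proof (rule gen_eigenspace_independent[OF g_lin _ _ s])
      show "finite (?e ` ?A)" using A(1) by simp
      show "?h c \<in> gen_eigenspace g c" if "c \<in> ?e ` ?A" for c
      proof -
        from that obtain a where a: "c = ?e a" "a \<in> ?A" by blast
        then show ?thesis
          using A(2)[of a] by (simp only: the_inv_into_f_f[OF inj] V_g_def) simp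
      qed
    qed (use True A(4) in auto)
    then show ?thesis using True A(4) by (simp only: the_inv_into_f_f[OF inj] IntI)
  qed (use f0 A(4) in auto)
qed

lemma N_V_g: assumes "u \<in> V_g g a" shows "N u \<in> V_g g a"
proof -
  have inj: "inj (\<lambda>x::complex. x)" by (simp add: inj_def)
  have "diag_op (\<lambda>\<alpha>. \<alpha>) (V_g g) (N u) = N (diag_op (\<lambda>\<alpha>. \<alpha>) (V_g g) u)"
    using lognil by (simp add: log_nilpotent_part_def)
  then show ?thesis
    using assms unfolding mem_iff_diag_op[OF V_g_direct_sum inj]
    by (simp add: clinear_scale[OF N_lin])
qed

lemma N_pow_V_g: "u \<in> V_g g a \<Longrightarrow> (N ^^ r) u \<in> V_g g a"
  by (induction r) (simp_all add: N_V_g)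

text \<open>On a homogeneous vector all powers of \<open>g\<close> are under control at once: up to
  a scalar, \<open>g^t u\<close> is a polynomial in \<open>t\<close> whose coefficients are nonzero
  multiples of the \<open>N^r u\<close>. Comparing coefficients transfers properties of
  \<open>g\<close> to \<open>N\<close>.\<close>

lemma g_pow_V_g:
  assumes u: "u \<in> V_g g a"
  shows "(g ^^ t) u = exp (2 * pi * \<i> * a * of_nat t) *\<^sub>C exp_nil (2 * pi * \<i> * of_nat t) N u"
proof -
  have E: "exp_nil c N u \<in> V_g g a" for c
    unfolding exp_nil_def
    by (intro csubspace_Sum_any V_g_subspace csubspace_scale N_pow_V_g u)
  have g: "g x = exp (2 * pi * \<i> * a) *\<^sub>C exp_nil (2 * pi * \<i>) N x" if "exp_nil (2 * pi * \<i>) N x \<in> V_g g a" for x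
  proof -
    have "g x = diag_op (\<lambda>\<alpha>. exp (2 * pi * \<i> * \<alpha>)) (V_g g) (exp_nil (2 * pi * \<i>) N x)"
      using lognil unfolding log_nilpotent_part_def by blast
    then show ?thesis using diag_op_single[OF V_g_direct_sum that] by simp
  qed
  show ?thesis
  proof (induction t)
    case 0
    obtain K where "(N ^^ K) u = 0" using N_nil by (auto simp: locally_nilpotent_def)
    then have "exp_nil 0 N u = (\<Sum>r<K. (0 ^ r / fact r) *\<^sub>C (N ^^ r) u)"
      by (rule exp_nil_sum[OF N_lin])
    also have "\<dots> = (\<Sum>r<K. if r = 0 then u else 0)" by (rule sum.cong) (auto simp: power_0_left)
    also have "\<dots> = u" using \<open>(N ^^ K) u = 0\<close> by (cases K) (auto simp: sum.lessThan_Suc_shift)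
    finally show ?case by simp
  next
    case (Suc t)
    have "(g ^^ Suc t) u = exp (2 * pi * \<i> * a * of_nat t) *\<^sub>C g (exp_nil (2 * pi * \<i> * of_nat t) N u)"
      using Suc by (simp add: clinear_scale[OF g_lin])
    also have "\<dots> = (exp (2 * pi * \<i> * a * of_nat t) * exp (2 * pi * \<i> * a)) *\<^sub>C
        exp_nil (2 * pi * \<i> + 2 * pi * \<i> * of_nat t) N u"
      by (subst g) (simp_all add: exp_nil_add[OF N_lin N_nil] E)
    also have "\<dots> = exp (2 * pi * \<i> * a * of_nat (Suc t)) *\<^sub>C exp_nil (2 * pi * \<i> * of_nat (Suc t)) N u"
      by (simp add: exp_add[symmetric] algebra_simps)
    finally show ?case .
  qed
qed

lemma exp_nil_poly:
  assumes "(N ^^ Suc K) u = 0"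
  shows "exp_nil (c * of_nat t) N u = (\<Sum>r\<le>K. of_nat t ^ r *\<^sub>C ((c ^ r / fact r) *\<^sub>C (N ^^ r) u))"
  unfolding exp_nil_sum[OF N_lin assms] lessThan_Suc_atMost
  by (rule sum.cong) (simp_all add: power_mult_distrib mult.commute)

text \<open>All \<open>g^t u\<close> lie in the same bigraded piece, hence so do the coefficients of
  the polynomial in \<open>t\<close>; the linear one is a nonzero multiple of
  \<open>N u\<close>.\<close>

lemma N_gr:
  assumes a: "u \<in> V_g g a" and u: "u \<in> V_gr V n s"
  shows "N u \<in> V_gr V n s"
proof -
  obtain K0 where "(N ^^ K0) u = 0" using N_nil by (auto simp: locally_nilpotent_def)
  \<comment> \<open>The exponent \<open>Suc (Suc K0)\<close> makes the sum run up to at least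
    \<open>r = 1\<close>, the coefficient that is extracted.\<close>
  then have K: "(N ^^ Suc (Suc K0)) u = 0" by (rule funpow_zero_mono[OF N_lin]) simp
  let ?c = "2 * pi * \<i>"
  have gt: "(g ^^ t) u \<in> V_gr V n s" for t
    by (induction t) (simp_all add: g_gr u)
  have "(\<Sum>r\<le>Suc K0. of_nat t ^ r *\<^sub>C ((?c ^ r / fact r) *\<^sub>C (N ^^ r) u)) \<in> V_gr V n s" for t
    using gt[of t] unfolding g_pow_V_g[OF a] exp_nil_poly[OF K]
    by (subst (asm) csubspace_scale_iff[OF V_gr_subspace]) auto
  then have "(?c ^ 1 / fact 1) *\<^sub>C (N ^^ 1) u \<in> V_gr V n s"
    by (rule csubspace_poly_coeff[OF V_gr_subspace]) simp
  then show ?thesis by (subst (asm) csubspace_scale_iff[OF V_gr_subspace]) auto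
qed

text \<open>Compare the coefficients of \<open>t\<close> in \<open>g^t Y(u,x) v = Y(g^t u,x) g^t v\<close>.\<close>
lemma N_Y_homogeneous:
  assumes u: "u \<in> V_g g a" "0 \<le> Re a" "Re a < 1" and v: "v \<in> V_g g b" "0 \<le> Re b" "Re b < 1"
  shows "N (Y_op V u m v) = Y_op V (N u) m v + Y_op V u m (N v)"
proof -
  let ?w = "Y_op V u m v" and ?c = "2 * pi * \<i>"
  obtain K1 K2 K3 where "(N ^^ K1) u = 0" "(N ^^ K2) v = 0" "(N ^^ K3) ?w = 0"
    using N_nil unfolding locally_nilpotent_def by metis
  then have K: "(N ^^ Suc (Suc (K1 + K2 + K3))) u = 0" "(N ^^ Suc (Suc (K1 + K2 + K3))) v = 0"
    "(N ^^ Suc (Suc (K1 + K2 + K3))) ?w = 0"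
    by (auto elim!: funpow_zero_mono[OF N_lin] simp del: funpow.simps)
  define R where "R = Suc (K1 + K2 + K3)"
  note K = K[folded R_def]
  let ?y = "\<lambda>p q. Y_op V ((?c ^ p / fact p) *\<^sub>C (N ^^ p) u) m ((?c ^ q / fact q) *\<^sub>C (N ^^ q) v)"
  \<comment> \<open>The coefficient of \<open>t^r\<close> in the difference of the two expansions;
    \<open>A 1 = 0\<close> is the derivation rule up to the factor \<open>2 pi i\<close>.\<close>
  define A where "A r = (?c ^ r / fact r) *\<^sub>C (N ^^ r) ?w - (\<Sum>p\<le>r. ?y p (r - p))" for r
  have zero: "(N ^^ p) u = 0" "(N ^^ p) v = 0" "(N ^^ p) ?w = 0" if "R < p" for p
    using funpow_zero_mono[OF N_lin K(1)] funpow_zero_mono[OF N_lin K(2)]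
      funpow_zero_mono[OF N_lin K(3)] that by (simp_all add: Suc_le_eq)
  have "A 1 \<in> {0}"
  proof (rule csubspace_poly_coeff[OF csubspace_singleton_0])
    fix t :: nat
    have "(g ^^ t) ?w = Y_op V ((g ^^ t) u) m ((g ^^ t) v)"
      by (induction t) (simp_all add: g_Y)
    \<comment> \<open>For integral \<open>t\<close> the integer dropped by \<open>frac_part\<close>
      contributes the factor 1.\<close>
    moreover have "exp (2 * pi * \<i> * frac_part (a + b) * of_nat t)
        = exp (2 * pi * \<i> * a * of_nat t) * exp (2 * pi * \<i> * b * of_nat t)"
    proof -
      have "exp (2 * pi * \<i> * x * of_nat t) = exp (2 * pi * \<i> * x) ^ t" for x
        by (simp add: exp_of_nat_mult[symmetric] mult.commute)
      then show ?thesis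
        by (simp add: exp_frac_part distrib_left exp_add power_mult_distrib)
    qed
    ultimately have E: "exp_nil (?c * of_nat t) N ?w = Y_op V (exp_nil (?c * of_nat t) N u) m (exp_nil (?c * of_nat t) N v)"
      unfolding g_pow_V_g[OF u(1)] g_pow_V_g[OF v(1)] g_pow_V_g[OF V_g_Y[OF u(1) v(1) u(2,3) v(2,3)]]
      by (simp add: clinear_scale[OF Y_lin1] clinear_scale[OF Y_lin2] mult.commute)
    have "Y_op V (exp_nil (?c * of_nat t) N u) m (exp_nil (?c * of_nat t) N v)
        = (\<Sum>p<Suc R. \<Sum>q<Suc R. of_nat t ^ (p + q) *\<^sub>C ?y p q)"
      unfolding exp_nil_poly[OF K(1)] exp_nil_poly[OF K(2)] lessThan_Suc_atMost clinear_sum[OF Y_lin1]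
      by (simp add: clinear_sum[OF Y_lin2] clinear_scale[OF Y_lin1]
          clinear_scale[OF Y_lin2] scaleC_sum_right power_add mult_ac)
    also have "\<dots> = (\<Sum>r<Suc (2 * R). \<Sum>p\<le>r. of_nat t ^ (p + (r - p)) *\<^sub>C ?y p (r - p))"
      by (rule sum_box_triangle)
         (auto simp: zero Suc_le_eq clinear_0[OF Y_lin1] clinear_0[OF Y_lin2])
    also have "\<dots> = (\<Sum>r\<le>2*R. of_nat t ^ r *\<^sub>C (\<Sum>p\<le>r. ?y p (r - p)))"
      unfolding lessThan_Suc_atMost by (simp add: scaleC_sum_right)
    finally have "(\<Sum>r\<le>2*R. of_nat t ^ r *\<^sub>C A r)
      = (\<Sum>r\<le>2*R. of_nat t ^ r *\<^sub>C ((?c ^ r / fact r) *\<^sub>C (N ^^ r) ?w)) - exp_nil (?c * of_nat t) N ?w"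
      unfolding A_def E scaleC_diff_right sum_subtractf by simp
    also have "(\<Sum>r\<le>2*R. of_nat t ^ r *\<^sub>C ((?c ^ r / fact r) *\<^sub>C (N ^^ r) ?w)) = exp_nil (?c * of_nat t) N ?w"
      by (rule exp_nil_poly[symmetric], rule funpow_zero_mono[OF N_lin K(3)]) simp
    finally show "(\<Sum>r\<le>2*R. of_nat t ^ r *\<^sub>C A r) \<in> {0}" by simp
  qed (simp add: R_def)
  then have "?c *\<^sub>C (N ?w) = ?c *\<^sub>C (Y_op V (N u) m v + Y_op V u m (N v))"
    by (simp add: A_def clinear_scale[OF Y_lin1] clinear_scale[OF Y_lin2] scaleC_add_right add.commute)
  then show ?thesis unfolding complex_vector.scale_cancel_left by simp
qed

end

context vsa_generated
begin

lemma vsa_direct_sum: "direct_sum (\<lambda>(n, s). V_gr V n s)"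
  using vsa unfolding vertex_superalgebra_def by (elim conjE)

lemma vsa_vac: "vac V \<in> V_gr V 0 0"
  using vsa unfolding vertex_superalgebra_def by (elim conjE)

lemma L0_V_Y: "L0_V V (Y_op V u n v) - Y_op V u n (L0_V V v)
    = of_int (- n - 1) *\<^sub>C Y_op V u n v + Y_op V (L0_V V u) n v"
proof -
  have "\<forall>u n v. L0_V V (Y_op V u n v) - Y_op V u n (L0_V V v)
      = of_int (- n - 1) *\<^sub>C Y_op V u n v + Y_op V (L0_V V u) n v"
    using vsa unfolding vertex_superalgebra_def by (elim conjE)
  then show ?thesis by (elim allE)
qed

lemma Y_truncation: "\<exists>b. \<forall>n\<ge>b. Y_op V u n v = 0"
proof -
  have "\<forall>u v. \<exists>b. \<forall>n\<ge>b. Y_op V u n v = 0"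
    using vsa unfolding vertex_superalgebra_def by (elim conjE)
  then show ?thesis by (elim allE)
qed

text \<open>Both sides are bilinear, and the products of generators, which span V, are
  homogeneous.\<close>

lemma N_Y: "N (Y_op V u m v) = Y_op V (N u) m v + Y_op V u m (N v)"
proof -
  define D where "D u v = N (Y_op V u m v) - (Y_op V (N u) m v + Y_op V u m (N v))" for u v
  have lin1: "clinear (\<lambda>u. D u v)" for v
    unfolding D_def
    by (rule clinear_minus[OF clinear_compose[OF N_lin Y_lin1]
          clinear_plus[OF clinear_compose[OF Y_lin1 N_lin] Y_lin1]])
  have lin2: "clinear (D u)" for u
    unfolding D_def[abs_def]
    by (rule clinear_minus[OF clinear_compose[OF N_lin Y_lin2]
          clinear_plus[OF Y_lin2 clinear_compose[OF Y_lin2 N_lin]]])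
  have gens: "D x y = 0" if x: "x \<in> gen_products V G" and y: "y \<in> gen_products V G" for x y
  proof -
    obtain a b where "0 \<le> Re a" "Re a < 1" "x \<in> V_g g a" "0 \<le> Re b" "Re b < 1" "y \<in> V_g g b"
      using gen_products_V_g[OF x] gen_products_V_g[OF y] by blast
    then show ?thesis using N_Y_homogeneous[of x a y b m] by (simp add: D_def)
  qed
  have 0: "D x v \<in> {0}" if "x \<in> gen_products V G" for x
    by (rule clinear_cspan_image[OF lin2 csubspace_singleton_0, where B = "gen_products V G"])
       (simp_all add: span_gen_products gens that)
  have "D u v \<in> {0}"
    by (rule clinear_cspan_image[OF lin1 csubspace_singleton_0, where B = "gen_products V G"])
       (use 0 in \<open>simp_all add: span_gen_products\<close>)
  then show ?thesis unfolding D_def by simp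
qed

text \<open>The generation assumption names the result of \<open>N\<close> one step at a time. As
  \<open>N\<close> preserves weight, fermion number and g-weight, and a nonzero vector has only one
  degree, the data attached to the index stay constant along the chain.\<close>

lemma N_chain:
  assumes "i \<in> I_set G" "(N ^^ r) (gvec G i) \<noteq> 0"
  shows "(gN G ^^ r) i \<in> I_set G" "gvec G ((gN G ^^ r) i) = (N ^^ r) (gvec G i)"
    "gal G ((gN G ^^ r) i) = gal G i" "gwt G ((gN G ^^ r) i) = gwt G i"
    "gpar G ((gN G ^^ r) i) = gpar G i"
proof -
  have "(gN G ^^ r) i \<in> I_set G \<and> gvec G ((gN G ^^ r) i) = (N ^^ r) (gvec G i) \<and>
    gal G ((gN G ^^ r) i) = gal G i \<and> gwt G ((gN G ^^ r) i) = gwt G i \<and>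
    gpar G ((gN G ^^ r) i) = gpar G i"
    using assms(2)
  proof (induction r)
    case (Suc r)
    let ?j = "(gN G ^^ r) i"
    have "(N ^^ r) (gvec G i) \<noteq> 0" using Suc.prems clinear_0[OF N_lin] by auto
    then have IH: "?j \<in> I_set G" "gvec G ?j = (N ^^ r) (gvec G i)" "gal G ?j = gal G i"
      "gwt G ?j = gwt G i" "gpar G ?j = gpar G i" using Suc.IH by auto
    have nz: "N (gvec G ?j) \<noteq> 0" using Suc.prems IH(2) by simp
    let ?k = "gN G ?j"
    have k: "?k \<in> I_set G" "gvec G ?k = N (gvec G ?j)" using gvec(4,5)[OF IH(1) nz] by auto
    have ds: "direct_sum (\<lambda>(n, s). V_gr V n s)" by (rule vsa_direct_sum)
    have single: "a = b" if "direct_sum E" "x \<in> E a" "x \<in> E b" "x \<noteq> 0"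
      for E :: "'b \<Rightarrow> 'v set" and a b x
      using fun_cong[OF trans[OF component_single[OF that(1,2), symmetric] component_single[OF that(1,3)]], of a] that(4)
      by (auto split: if_splits)
    have eq: "N (gvec G ?j) = gvec G ?k" using k by simp
    have "gvec G ?k \<in> V_g g (gal G ?j)" using N_V_g[OF gvec(3)[OF IH(1)]] unfolding eq .
    then have "gal G ?k = gal G ?j"
      using single[OF V_g_direct_sum gvec(3)[OF k(1)]] nz unfolding eq by blast
    moreover have "(gwt G ?k, gpar G ?k) = (gwt G ?j, gpar G ?j)"
    proof (rule single[OF ds])
      show "gvec G ?k \<in> (case (gwt G ?k, gpar G ?k) of (n, s) \<Rightarrow> V_gr V n s)"
        using gvec(1)[OF k(1)] by simp
      show "gvec G ?k \<in> (case (gwt G ?j, gpar G ?j) of (n, s) \<Rightarrow> V_gr V n s)"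
        using N_gr[OF gvec(3)[OF IH(1)] gvec(1)[OF IH(1)]] unfolding eq by simp
      show "gvec G ?k \<noteq> 0" using nz unfolding eq .
    qed
    ultimately show ?case using IH k(1) k(2)[unfolded IH(2)] by simp
  qed (use assms(1) in simp)
  then show "(gN G ^^ r) i \<in> I_set G" "gvec G ((gN G ^^ r) i) = (N ^^ r) (gvec G i)"
    "gal G ((gN G ^^ r) i) = gal G i" "gwt G ((gN G ^^ r) i) = gwt G i"
    "gpar G ((gN G ^^ r) i) = gpar G i" by auto
qed

section \<open>Products of generators\<close>

text \<open>Carries the weight and the unreduced g-exponent along, for inductions over products in
  which the degree enters. The vector may be zero, so \<open>d\<close> is a label and not determined
  by it.\<close>

inductive gen_product :: "real \<Rightarrow> complex \<Rightarrow> 'v \<Rightarrow> bool" where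
  vac: "gen_product 0 0 (vac V)"
| Y: "gen_product d a u \<Longrightarrow> i \<in> I_set G
    \<Longrightarrow> gen_product (d + gwt G i - of_int n - 1) (a + gal G i) (Y_op V (gvec G i) n u)"

lemma gen_products_gen_product: "u \<in> gen_products V G \<Longrightarrow> \<exists>d a. gen_product d a u"
proof (induction rule: gen_products.induct)
  case 1
  show ?case using gen_product.vac by blast
next
  case (2 u i n)
  then obtain d a where "gen_product d a u" by blast
  from gen_product.Y[OF this 2(2), of n] show ?case by blast
qed

lemma span_gen_product: "cspan {u. \<exists>d a. gen_product d a u} = UNIV"
  using span_gen_products gen_products_gen_product complex_vector.span_mono[of "gen_products V G" "{u. \<exists>d a. gen_product d a u}"]
  by blast

lemma V_wt_direct_sum: "direct_sum (V_wt V)"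
proof -
  have "(\<Union>x\<in>{x. fst x = k}. case x of (n, s) \<Rightarrow> V_gr V n s) = (\<Union>s. V_gr V k s)" for k
    by auto
  then show ?thesis
    using direct_sum_coarse[OF vsa_direct_sum, of fst] by (simp add: V_wt_def[abs_def])
qed

lemma V_wt_iff: "u \<in> V_wt V d \<longleftrightarrow> L0_V V u = complex_of_real d *\<^sub>C u"
  unfolding L0_V_def by (rule mem_iff_diag_op[OF V_wt_direct_sum]) (simp add: inj_def)

lemma V_gr_V_wt: "u \<in> V_gr V n s \<Longrightarrow> u \<in> V_wt V n"
  by (auto simp: V_wt_def intro: complex_vector.span_base)

lemma gen_product_weight: "gen_product d a u \<Longrightarrow> u \<in> V_wt V d"
proof (induction rule: gen_product.induct)
  case vac
  show ?case by (rule V_gr_V_wt[OF vsa_vac])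
next
  case (Y d a u i n)
  let ?w = "Y_op V (gvec G i) n u"
  have 1: "L0_V V (gvec G i) = complex_of_real (gwt G i) *\<^sub>C gvec G i"
    using V_gr_V_wt[OF gvec(1)[OF Y(2)]] by (simp add: V_wt_iff)
  have 2: "L0_V V u = complex_of_real d *\<^sub>C u" using Y(3) by (simp add: V_wt_iff)
  have "L0_V V ?w = of_int (- n - 1) *\<^sub>C ?w + complex_of_real (gwt G i) *\<^sub>C ?w + complex_of_real d *\<^sub>C ?w"
    using L0_V_Y[of "gvec G i" n u]
    unfolding 1 2 clinear_scale[OF Y_lin1] clinear_scale[OF Y_lin2] diff_eq_eq .
  also have "\<dots> = complex_of_real (d + gwt G i - of_int n - 1) *\<^sub>C ?w"
    unfolding scaleC_add_left[symmetric] by (rule arg_cong[of _ _ "\<lambda>c. c *\<^sub>C ?w"]) simp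
  finally show ?case unfolding V_wt_iff .
qed

lemma V_wt_bounded: "\<exists>b. \<forall>d u. u \<in> V_wt V d \<longrightarrow> u \<noteq> 0 \<longrightarrow> b \<le> d"
proof -
  have "\<exists>b. \<forall>n<b. \<forall>s. V_gr V n s = {0}"
    using vsa unfolding vertex_superalgebra_def by (elim conjE)
  then obtain b where "\<And>n s. n < b \<Longrightarrow> V_gr V n s = {0}" by blast
  then have "V_wt V n = {0}" if "n < b" for n
    using that by (simp add: V_wt_def)
  then show ?thesis by (intro exI[of _ b]) force
qed

end

section \<open>The logarithm-free part of two-variable series\<close>

lemma Sum_any_reindex_inj:
  assumes "inj h" "\<And>x. f x \<noteq> 0 \<Longrightarrow> x \<in> range h"
  shows "Sum_any f = Sum_any (\<lambda>m. f (h m))"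
proof -
  have "{x. f x \<noteq> 0} = h ` {m. f (h m) \<noteq> 0}" using assms(2) by blast
  then have "Sum_any f = sum f (h ` {m. f (h m) \<noteq> 0})" by (simp add: Sum_any.expand_set)
  also have "\<dots> = (\<Sum>m | f (h m) \<noteq> 0. f (h m))"
    using assms(1) by (subst sum.reindex) (auto simp: inj_on_def)
  finally show ?thesis by (simp add: Sum_any.expand_set)
qed

lemma Sum_any_single:
  assumes "\<And>x. x \<noteq> a \<Longrightarrow> f x = 0"
  shows "Sum_any f = f a"
  using assms by (subst Sum_any.expand_superset[of "{a}"]) auto

lemma Sum_any_lessThan:
  fixes f :: "nat \<Rightarrow> 'a::comm_monoid_add"
  assumes "\<And>m. B \<le> m \<Longrightarrow> f m = 0"
  shows "Sum_any f = (\<Sum>m<B. f m)"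
proof (rule Sum_any.expand_superset)
  show "{m. f m \<noteq> 0} \<subseteq> {..<B}"
    using assms by (intro subsetI) (rule ccontr, simp)
qed simp

text \<open>By property 5 the coefficients with logarithms are determined by those without, so weak
  commutativity is exploited only in logarithmic degree zero.\<close>

definition lf :: "'u ser2 \<Rightarrow> complex \<Rightarrow> complex \<Rightarrow> 'u"
  where "lf F a b = F (a, 0, b, 0)"

text \<open>Only the part without logarithms is constrained: for \<open>log12\<close> the summand
  \<open>log x1\<close> is invisible, and what remains is the one-variable series \<open>cf\<close>
  along a ray of exponents.\<close>

definition series_along :: "complex ser2 \<Rightarrow> complex \<times> complex \<Rightarrow> complex \<times> complex \<Rightarrow> complex fps \<Rightarrow> bool"
  where "series_along c base dir cf \<longleftrightarrow>
    (\<forall>m. lf c (fst base + of_nat m * fst dir) (snd base + of_nat m * snd dir) = fps_nth cf m) \<and>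
    (\<forall>a b. lf c a b \<noteq> 0 \<longrightarrow> (\<exists>m. a = fst base + of_nat m * fst dir \<and> b = snd base + of_nat m * snd dir))"

text \<open>The exponents of logarithms are natural numbers, so two of them add up to zero only if
  both are zero; hence \<open>lf\<close> is compatible with products. The condition
  \<open>d1 \<noteq> 0\<close> makes the parametrization of the ray injective.\<close>

lemma lf_smult2:
  assumes c: "series_along c (b1, b2) (d1, d2) cf" and d: "d1 \<noteq> 0"
  shows "lf (smult2 c F) a b
    = Sum_any (\<lambda>m. fps_nth cf m *\<^sub>C lf F (a - b1 - of_nat m * d1) (b - b2 - of_nat m * d2))"
proof -
  define h where "h m = ((b1 + of_nat m * d1, 0::nat, b2 + of_nat m * d2, 0::nat),
    (a - b1 - of_nat m * d1, 0::nat, b - b2 - of_nat m * d2, 0::nat))" for m :: nat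
  let ?f = "\<lambda>(e1, e2). if e1 + e2 = (a, 0, b, 0) then c e1 *\<^sub>C F e2 else 0"
  have "inj h" using d by (auto simp: inj_def h_def)
  moreover have "x \<in> range h" if "?f x \<noteq> 0" for x
  proof -
    obtain a1 j1 b1' l1 a2 j2 b2' l2 where x: "x = ((a1, j1, b1', l1), (a2, j2, b2', l2))"
      by (metis prod.exhaust)
    have s: "a1 + a2 = a" "j1 = 0" "j2 = 0" "b1' + b2' = b" "l1 = 0" "l2 = 0"
      "c (a1, 0, b1', 0) \<noteq> 0"
      using that unfolding x by (auto split: if_splits)
    have "\<exists>m. a1 = b1 + of_nat m * d1 \<and> b1' = b2 + of_nat m * d2"
      using c s(7) unfolding series_along_def lf_def by simp
    then obtain m where "a1 = b1 + of_nat m * d1" "b1' = b2 + of_nat m * d2" by blast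
    then have "x = h m" using s by (auto simp: x h_def)
    then show ?thesis by blast
  qed
  ultimately have "Sum_any ?f = Sum_any (\<lambda>m. ?f (h m))" by (rule Sum_any_reindex_inj)
  also have "\<dots> = Sum_any (\<lambda>m. fps_nth cf m *\<^sub>C lf F (a - b1 - of_nat m * d1) (b - b2 - of_nat m * d2))"
    using c by (intro Sum_any.cong) (simp add: h_def series_along_def lf_def)
  finally show ?thesis unfolding lf_def smult2_def .
qed

lemma lf_act1:
  assumes "\<And>n k. T n k 0 = 0"
  shows "lf (act1 T F) a b = Sum_any (\<lambda>n. T n 0 (lf F (a + n + 1) b))"
proof -
  define h where "h n = (n, 0::nat, (a + n + 1, 0::nat, b, 0::nat))" for n
  let ?f = "\<lambda>(n, k, e'). if (- n - 1, k, 0, 0) + e' = (a, 0, b, 0) then T n k (F e') else 0"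
  have "inj h" by (auto simp: inj_def h_def)
  moreover have "x \<in> range h" if "?f x \<noteq> 0" for x
  proof -
    obtain n k a2 j2 b2 l2 where x: "x = (n, k, (a2, j2, b2, l2))" by (metis prod.exhaust)
    have "- n - 1 + a2 = a" "k = 0" "j2 = 0" "b2 = b" "l2 = 0"
      using that unfolding x by (auto split: if_splits)
    then have "x = h n" by (auto simp: x h_def)
    then show ?thesis by blast
  qed
  ultimately have "Sum_any ?f = Sum_any (\<lambda>m. ?f (h m))" by (rule Sum_any_reindex_inj)
  also have "\<dots> = Sum_any (\<lambda>n. T n 0 (lf F (a + n + 1) b))"
    by (intro Sum_any.cong) (simp add: h_def lf_def)
  finally show ?thesis unfolding lf_def act1_def .
qed

lemma lf_act2:
  assumes "\<And>n k. T n k 0 = 0"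
  shows "lf (act2 T F) a b = Sum_any (\<lambda>n. T n 0 (lf F a (b + n + 1)))"
proof -
  define h where "h n = (n, 0::nat, (a, 0::nat, b + n + 1, 0::nat))" for n
  let ?f = "\<lambda>(n, k, e'). if (0, 0, - n - 1, k) + e' = (a, 0, b, 0) then T n k (F e') else 0"
  have "inj h" by (auto simp: inj_def h_def)
  moreover have "x \<in> range h" if "?f x \<noteq> 0" for x
  proof -
    obtain n k a2 j2 b2 l2 where x: "x = (n, k, (a2, j2, b2, l2))" by (metis prod.exhaust)
    have "- n - 1 + b2 = b" "k = 0" "j2 = 0" "a2 = a" "l2 = 0"
      using that unfolding x by (auto split: if_splits)
    then have "x = h n" by (auto simp: x h_def)
    then show ?thesis by blast
  qed
  ultimately have "Sum_any ?f = Sum_any (\<lambda>m. ?f (h m))" by (rule Sum_any_reindex_inj)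
  also have "\<dots> = Sum_any (\<lambda>n. T n 0 (lf F a (b + n + 1)))"
    by (intro Sum_any.cong) (simp add: h_def lf_def)
  finally show ?thesis unfolding lf_def act2_def .
qed

lemma lf_const2: "lf (const2 u) a b = (if a = 0 \<and> b = 0 then u else 0)"
  by (simp add: lf_def const2_def zero_prod_def)

lemma lf_act2_const2:
  assumes "\<And>n k. T n k 0 = 0"
  shows "lf (act2 T (const2 v)) a b = (if a = 0 then T (- b - 1) 0 v else 0)"
proof -
  have iff: "b + n + 1 = 0 \<longleftrightarrow> n = - b - 1" for n
    by (simp add: eq_diff_eq eq_neg_iff_add_eq_0 add_ac)
  show ?thesis
    by (subst lf_act2, rule assms, subst Sum_any_single[of "- b - 1"]) (auto simp: lf_const2 assms iff)
qed

lemma lf_act1_const2: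
  assumes "\<And>n k. T n k 0 = 0"
  shows "lf (act1 T (const2 v)) a b = (if b = 0 then T (- a - 1) 0 v else 0)"
proof -
  have iff: "a + n + 1 = 0 \<longleftrightarrow> n = - a - 1" for n
    by (simp add: eq_diff_eq eq_neg_iff_add_eq_0 add_ac)
  show ?thesis
    by (subst lf_act1, rule assms, subst Sum_any_single[of "- a - 1"]) (auto simp: lf_const2 assms iff)
qed

lemma series_along_power2:
  assumes L: "series_along L (0, 0) (d1, d2) l" and d: "d1 \<noteq> 0"
  shows "series_along (power2 L r) (0, 0) (d1, d2) (l ^ r)"
proof (induction r)
  case 0
  show ?case using d by (auto simp: series_along_def power2_def lf_const2 intro!: exI[of _ 0])
next
  case (Suc r)
  let ?P = "power2 L r"
  have eq: "lf (power2 L (Suc r)) a b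
      = Sum_any (\<lambda>m. fps_nth l m * lf ?P (a - of_nat m * d1) (b - of_nat m * d2))" for a b
    using lf_smult2[OF L d, of ?P a b] by (simp add: power2_def)
  have P: "lf ?P (of_nat m * d1) (of_nat m * d2) = fps_nth (l ^ r) m" for m
    using Suc by (simp add: series_along_def)
  have P0: "\<exists>m. a = of_nat m * d1 \<and> b = of_nat m * d2" if "lf ?P a b \<noteq> 0" for a b
    using Suc that by (simp add: series_along_def)
  show ?case unfolding series_along_def
  proof (intro conjI allI impI)
    fix k
    have z: "lf ?P (of_nat k * d1 - of_nat m * d1) (of_nat k * d2 - of_nat m * d2) = 0" if "Suc k \<le> m" for m
    proof (rule ccontr)
      assume "\<not> ?thesis"
      then obtain q where "of_nat k * d1 - of_nat m * d1 = of_nat q * d1" using P0 by blast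
      then have "of_nat k * d1 = of_nat (m + q) * d1" by (simp add: algebra_simps)
      then have "of_nat k = (of_nat (m + q) :: complex)" using d by simp
      then show False using that unfolding of_nat_eq_iff by simp
    qed
    have "lf (power2 L (Suc r)) (of_nat k * d1) (of_nat k * d2)
      = (\<Sum>m<Suc k. fps_nth l m * lf ?P (of_nat k * d1 - of_nat m * d1) (of_nat k * d2 - of_nat m * d2))"
      unfolding eq by (rule Sum_any_lessThan) (simp add: z)
    also have "\<dots> = (\<Sum>m\<le>k. fps_nth l m * fps_nth (l ^ r) (k - m))"
      unfolding lessThan_Suc_atMost
      by (rule sum.cong) (simp_all add: P[symmetric] of_nat_diff left_diff_distrib)
    finally show "lf (power2 L (Suc r)) (fst (0, 0) + of_nat k * fst (d1, d2)) (snd (0, 0) + of_nat k * snd (d1, d2))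
        = fps_nth (l ^ Suc r) k"
      by (simp add: fps_mult_nth atLeast0AtMost)
  next
    fix a b assume "lf (power2 L (Suc r)) a b \<noteq> 0"
    then obtain m where "fps_nth l m * lf ?P (a - of_nat m * d1) (b - of_nat m * d2) \<noteq> 0"
      unfolding eq by (rule Sum_any.not_neutral_obtains_not_neutral)
    then have "lf ?P (a - of_nat m * d1) (b - of_nat m * d2) \<noteq> 0" by simp
    then obtain q where "a - of_nat m * d1 = of_nat q * d1" "b - of_nat m * d2 = of_nat q * d2"
      using P0 by blast
    then show "\<exists>m. a = fst (0, 0) + of_nat m * fst (d1, d2) \<and> b = snd (0, 0) + of_nat m * snd (d1, d2)"
      by (intro exI[of _ "m + q"]) (simp add: algebra_simps)
  qed
qed

lemma lf_exp2:
  assumes L: "series_along L (0, 0) (d1, d2) l" and d: "d1 \<noteq> 0"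
  shows "lf (exp2 L N F) a b = Sum_any (\<lambda>r. (1 / fact r) *\<^sub>C
    Sum_any (\<lambda>m. fps_nth (l ^ r) m *\<^sub>C (N ^^ r) (lf F (a - of_nat m * d1) (b - of_nat m * d2))))"
proof -
  have "lf (smult2 (power2 L r) (\<lambda>e'. (N ^^ r) (F e'))) a b
    = Sum_any (\<lambda>m. fps_nth (l ^ r) m *\<^sub>C (N ^^ r) (lf F (a - of_nat m * d1) (b - of_nat m * d2)))" for r
    using lf_smult2[OF series_along_power2[OF L d] d, of r "\<lambda>e'. (N ^^ r) (F e')"] by (simp add: lf_def)
  then show ?thesis by (simp add: lf_def exp2_def)
qed

text \<open>The Taylor series of \<open>log (1 - X)\<close>; the next one is that of
  \<open>(1 - X)^\<beta>\<close>.\<close>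

definition fps_log1m :: "complex fps"
  where "fps_log1m = Abs_fps (\<lambda>m. if m = 0 then 0 else - 1 / of_nat m)"

definition fps_pow1m :: "complex \<Rightarrow> complex fps"
  where "fps_pow1m \<beta> = Abs_fps (\<lambda>m. (- 1) ^ m * (\<beta> gchoose m))"

lemma series_along_log12: "series_along log12 (0, 0) (- 1, 1) fps_log1m"
  unfolding series_along_def
proof (intro conjI allI impI)
  have s: "Sum_any (\<lambda>m. if 0 < m \<and> (a, 0::nat, b, 0::nat) = (- of_nat m, 0, of_nat m, 0) then 1 / of_nat m else 0 :: complex)
     = (if \<exists>m>0. a = - of_nat m \<and> b = of_nat m then 1 / b else 0)" for a b :: complex
  proof (cases "\<exists>m>0. a = - of_nat m \<and> b = of_nat m")
    case True
    then obtain m :: nat where "0 < m" "a = - of_nat m" "b = of_nat m" by blast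
    then show ?thesis by (subst Sum_any_single[of m]) auto
  next
    case False
    then show ?thesis by (subst Sum_any_single[of 0]) auto
  qed
  show "lf log12 (fst (0, 0) + of_nat m * fst (- 1, 1)) (snd (0, 0) + of_nat m * snd (- 1, 1)) = fps_nth fps_log1m m" for m
    unfolding lf_def log12_def fst_conv snd_conv s by (simp add: fps_log1m_def)
  show "\<exists>m. a = fst (0, 0) + of_nat m * fst (- 1, 1) \<and> b = snd (0, 0) + of_nat m * snd (- 1, 1)"
    if "lf log12 a b \<noteq> 0" for a b
    using that unfolding lf_def log12_def s by (auto split: if_splits)
qed

text \<open>In contrast to \<open>log x2\<close>, the constant \<open>pi * i\<close> has logarithmic
  degree zero and survives in \<open>lf\<close>.\<close>

lemma series_along_log21: "series_along log21 (0, 0) (1, - 1) (fps_const (pi * \<i>) + fps_log1m)"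
  unfolding series_along_def
proof (intro conjI allI impI)
  have s: "Sum_any (\<lambda>m. if 0 < m \<and> (a, 0::nat, b, 0::nat) = (of_nat m, 0, - of_nat m, 0) then 1 / of_nat m else 0 :: complex)
     = (if \<exists>m>0. a = of_nat m \<and> b = - of_nat m then 1 / a else 0)" for a b :: complex
  proof (cases "\<exists>m>0. a = of_nat m \<and> b = - of_nat m")
    case True
    then obtain m :: nat where "0 < m" "a = of_nat m" "b = - of_nat m" by blast
    then show ?thesis by (subst Sum_any_single[of m]) auto
  next
    case False
    then show ?thesis by (subst Sum_any_single[of 0]) auto
  qed
  show "lf log21 (fst (0, 0) + of_nat m * fst (1, - 1)) (snd (0, 0) + of_nat m * snd (1, - 1))
      = fps_nth (fps_const (pi * \<i>) + fps_log1m) m" for m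
    unfolding lf_def log21_def fst_conv snd_conv s by (auto simp add: fps_log1m_def zero_prod_def)
  show "\<exists>m. a = fst (0, 0) + of_nat m * fst (1, - 1) \<and> b = snd (0, 0) + of_nat m * snd (1, - 1)"
    if "lf log21 a b \<noteq> 0" for a b
    using that unfolding lf_def log21_def s by (auto simp: zero_prod_def intro: exI[of _ 0] split: if_splits)
qed

lemma series_along_pow12: "series_along (pow12 \<beta>) (\<beta>, 0) (- 1, 1) (fps_pow1m \<beta>)"
  unfolding series_along_def
proof (intro conjI allI impI)
  show "lf (pow12 \<beta>) (fst (\<beta>, 0) + of_nat m * fst (- 1, 1)) (snd (\<beta>, 0) + of_nat m * snd (- 1, 1)) = fps_nth (fps_pow1m \<beta>) m" for m
    unfolding lf_def pow12_def by (subst Sum_any_single[of m]) (auto simp: fps_pow1m_def)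
  fix a b assume "lf (pow12 \<beta>) a b \<noteq> 0"
  then have "Sum_any (\<lambda>m. if (a, 0::nat, b, 0::nat) = (\<beta> - of_nat m, 0, of_nat m, 0)
      then (- 1) ^ m * (\<beta> gchoose m) else 0) \<noteq> 0"
    unfolding lf_def pow12_def .
  then obtain m :: nat where "(if (a, 0::nat, b, 0::nat) = (\<beta> - of_nat m, 0, of_nat m, 0)
      then (- 1) ^ m * (\<beta> gchoose m) else 0) \<noteq> 0"
    by (rule Sum_any.not_neutral_obtains_not_neutral)
  then have "(a, 0::nat, b, 0::nat) = (\<beta> - of_nat m, 0, of_nat m, 0)" by (simp split: if_splits)
  then show "\<exists>m. a = fst (\<beta>, 0) + of_nat m * fst (- 1, 1) \<and> b = snd (\<beta>, 0) + of_nat m * snd (- 1, 1)"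
    by (intro exI[of _ m]) simp
qed

lemma series_along_pow21:
  "series_along (pow21 \<beta>) (0, \<beta>) (1, - 1) (fps_const (exp (pi * \<i> * \<beta>)) * fps_pow1m \<beta>)"
  unfolding series_along_def
proof (intro conjI allI impI)
  show "lf (pow21 \<beta>) (fst (0, \<beta>) + of_nat m * fst (1, - 1)) (snd (0, \<beta>) + of_nat m * snd (1, - 1))
      = fps_nth (fps_const (exp (pi * \<i> * \<beta>)) * fps_pow1m \<beta>) m" for m
    unfolding lf_def pow21_def by (subst Sum_any_single[of m]) (auto simp: fps_pow1m_def)
  fix a b assume "lf (pow21 \<beta>) a b \<noteq> 0"
  then have "Sum_any (\<lambda>m. if (a, 0::nat, b, 0::nat) = (of_nat m, 0, \<beta> - of_nat m, 0)
      then (- 1) ^ m * (\<beta> gchoose m) else 0) \<noteq> 0"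
    unfolding lf_def pow21_def by auto
  then obtain m :: nat where "(if (a, 0::nat, b, 0::nat) = (of_nat m, 0, \<beta> - of_nat m, 0)
      then (- 1) ^ m * (\<beta> gchoose m) else 0) \<noteq> 0"
    by (rule Sum_any.not_neutral_obtains_not_neutral)
  then have "(a, 0::nat, b, 0::nat) = (of_nat m, 0, \<beta> - of_nat m, 0)" by (simp split: if_splits)
  then show "\<exists>m. a = fst (0, \<beta>) + of_nat m * fst (1, - 1) \<and> b = snd (0, \<beta>) + of_nat m * snd (1, - 1)"
    by (intro exI[of _ m]) simp
qed

primrec ad_pow :: "('u::complex_vector \<Rightarrow> 'u) \<Rightarrow> ('u \<Rightarrow> 'u) \<Rightarrow> nat \<Rightarrow> 'u \<Rightarrow> 'u" where
  "ad_pow N T 0 = T"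
| "ad_pow N T (Suc r) = (\<lambda>w. N (ad_pow N T r w) - ad_pow N T r (N w))"

text \<open>This is the part of degree \<open>t\<close> in
  \<open>exp(N) T exp(-N) = exp(ad N) T\<close>.\<close>

lemma ad_pow_expand:
  assumes N: "clinear N" and T: "clinear T"
  shows "(1 / fact t) *\<^sub>C ad_pow N T t w
    = (\<Sum>s\<le>t. (1 / (fact (t - s) * fact s)) *\<^sub>C (N ^^ (t - s)) (T (((\<lambda>x. - N x) ^^ s) w)))"
proof (induction t arbitrary: w)
  case (Suc t)
  let ?M = "\<lambda>x. - N x"
  \<comment> \<open>Passing from \<open>t\<close> to \<open>t + 1\<close> either raises
    \<open>r\<close>, with factor \<open>r + 1\<close>, or raises \<open>s\<close>, with factor
    \<open>s + 1\<close>. A term of total degree \<open>t + 1\<close> therefore collects the factor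
    \<open>(t + 1 - s) + s\<close>.\<close>
  define a where "a r s = (1 / (fact r * fact s)) *\<^sub>C (N ^^ r) (T ((?M ^^ s) w))" for r s
  have Nsuc: "N ((1 / (fact r * fact s)) *\<^sub>C (N ^^ r) (T ((?M ^^ s) w))) = of_nat (Suc r) *\<^sub>C a (Suc r) s" for r s
    by (simp add: a_def clinear_scale[OF N] field_simps del: of_nat_Suc)
  have Msuc: "(1 / (fact r * fact s)) *\<^sub>C (N ^^ r) (T ((?M ^^ s) (?M w))) = of_nat (Suc s) *\<^sub>C a r (Suc s)" for r s
    unfolding a_def funpow_Suc_right o_apply by (simp add: field_simps del: of_nat_Suc)
  note lin = clinear_compose[OF clinear_funpow[OF N] clinear_compose[OF T clinear_funpow[OF clinear_uminus[OF N]]]]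
  have neg: "(N ^^ r) (T ((?M ^^ s) (N w))) = - (N ^^ r) (T ((?M ^^ s) (?M w)))" for r s
    using clinear_neg[OF lin, of r s "N w"] by simp
  have "of_nat (Suc t) *\<^sub>C ((1 / fact (Suc t)) *\<^sub>C ad_pow N T (Suc t) w) = (1 / fact t) *\<^sub>C ad_pow N T (Suc t) w"
    by (simp add: field_simps del: of_nat_Suc)
  also have "\<dots> = N ((1 / fact t) *\<^sub>C ad_pow N T t w) - (1 / fact t) *\<^sub>C ad_pow N T t (N w)"
    by (simp add: clinear_scale[OF N] scaleC_diff_right)
  also have "\<dots> = (\<Sum>s\<le>t. of_nat (Suc (t - s)) *\<^sub>C a (Suc (t - s)) s) + (\<Sum>s\<le>t. of_nat (Suc s) *\<^sub>C a (t - s) (Suc s))"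
    unfolding Suc.IH clinear_sum[OF N] Nsuc neg
    by (simp only: Msuc complex_vector.scale_minus_right sum_negf diff_minus_eq_add)
  also have "(\<Sum>s\<le>t. of_nat (Suc (t - s)) *\<^sub>C a (Suc (t - s)) s) = (\<Sum>s\<le>Suc t. of_nat (Suc t - s) *\<^sub>C a (Suc t - s) s)"
    unfolding sum.atMost_Suc by (simp add: Suc_diff_le del: of_nat_Suc of_nat_diff cong: sum.cong_simp)
  also have "(\<Sum>s\<le>t. of_nat (Suc s) *\<^sub>C a (t - s) (Suc s)) = (\<Sum>s\<le>Suc t. of_nat s *\<^sub>C a (Suc t - s) s)"
    by (simp add: sum.atMost_Suc_shift del: of_nat_Suc sum.atMost_Suc)
  also have "(\<Sum>s\<le>Suc t. of_nat (Suc t - s) *\<^sub>C a (Suc t - s) s) + (\<Sum>s\<le>Suc t. of_nat s *\<^sub>C a (Suc t - s) s)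
     = (\<Sum>s\<le>Suc t. of_nat (Suc t) *\<^sub>C a (Suc t - s) s)"
    unfolding sum.distrib[symmetric] scaleC_add_left[symmetric] of_nat_add[symmetric]
    by (rule sum.cong) auto
  finally have "of_nat (Suc t) *\<^sub>C ((1 / fact (Suc t)) *\<^sub>C ad_pow N T (Suc t) w)
     = of_nat (Suc t) *\<^sub>C (\<Sum>s\<le>Suc t. a (Suc t - s) s)"
    by (simp only: scaleC_sum_right)
  then have "(1 / fact (Suc t)) *\<^sub>C ad_pow N T (Suc t) w = (\<Sum>s\<le>Suc t. a (Suc t - s) s)"
    unfolding complex_vector.scale_cancel_left by (simp del: of_nat_Suc)
  then show ?case unfolding a_def .
qed simp

section \<open>Twist fields\<close>

text \<open>The variable of the power series acts as the shift of sequences that vanish from some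
  index on; by \<open>fconv_mult\<close> products of series act by composition.\<close>

definition fconv :: "complex fps \<Rightarrow> (nat \<Rightarrow> 'u::complex_vector) \<Rightarrow> nat \<Rightarrow> 'u"
  where "fconv c h K = Sum_any (\<lambda>m. fps_nth c m *\<^sub>C h (K + m))"

lemma fconv_sum:
  assumes "\<And>J. B \<le> J \<Longrightarrow> h J = 0"
  shows "fconv c h K = (\<Sum>m<B. fps_nth c m *\<^sub>C h (K + m))"
  unfolding fconv_def by (rule Sum_any_lessThan) (simp add: assms)

lemma fconv_zero: "(\<And>J. B \<le> J \<Longrightarrow> h J = 0) \<Longrightarrow> B \<le> K \<Longrightarrow> fconv c h K = 0"
  by (simp add: fconv_sum[where B = B])

lemma fconv_clinear:
  assumes T: "clinear T" and h: "\<And>J. B \<le> J \<Longrightarrow> h J = 0"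
  shows "T (fconv c h K) = fconv c (\<lambda>J. T (h J)) K"
  by (subst fconv_sum[where B = B], rule h, assumption, subst fconv_sum[where B = B])
     (simp_all add: h clinear_0[OF T] clinear_sum[OF T] clinear_scale[OF T])

lemma fconv_lincomb:
  assumes "\<And>r J. r \<in> S \<Longrightarrow> B \<le> J \<Longrightarrow> h r J = 0"
  shows "fconv c (\<lambda>J. \<Sum>r\<in>S. k r *\<^sub>C h r J) K = (\<Sum>r\<in>S. k r *\<^sub>C fconv c (h r) K)"
proof -
  have "(\<Sum>r\<in>S. k r *\<^sub>C fconv c (h r) K) = (\<Sum>r\<in>S. \<Sum>m<B. fps_nth c m *\<^sub>C (k r *\<^sub>C h r (K + m)))"
    by (intro sum.cong refl, subst fconv_sum[where B = B])
       (simp_all add: assms scaleC_sum_right mult.commute)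
  also have "\<dots> = (\<Sum>m<B. \<Sum>r\<in>S. fps_nth c m *\<^sub>C (k r *\<^sub>C h r (K + m)))"
    by (rule sum.swap)
  finally show ?thesis
    by (subst fconv_sum[where B = B]) (simp_all add: assms scaleC_sum_right)
qed

lemma fconv_scale:
  assumes "\<And>J. B \<le> J \<Longrightarrow> h J = 0"
  shows "fconv c (\<lambda>J. k *\<^sub>C h J) K = k *\<^sub>C fconv c h K"
  using fconv_lincomb[of "{()}" B "\<lambda>_. h" c "\<lambda>_. k" K] assms by simp

lemma fconv_mult:
  assumes "\<And>J. B \<le> J \<Longrightarrow> h J = 0"
  shows "fconv (c * d) h K = fconv c (fconv d h) K"
proof -
  have "fconv c (fconv d h) K = (\<Sum>m<B. \<Sum>l<B. (fps_nth c m * fps_nth d l) *\<^sub>C h (K + (m + l)))"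
    by (subst fconv_sum[where B = B])
       (simp_all add: fconv_zero[OF assms] fconv_sum[OF assms] scaleC_sum_right add.assoc assms)
  also have "\<dots> = (\<Sum>p<B. \<Sum>m\<le>p. (fps_nth c m * fps_nth d (p - m)) *\<^sub>C h (K + (m + (p - m))))"
    by (rule sum_box_triangle) (use assms in auto)
  also have "\<dots> = fconv (c * d) h K"
    by (subst fconv_sum[where B = B, OF assms])
       (simp_all add: fps_mult_nth atLeast0AtMost scaleC_sum_left)
  finally show ?thesis ..
qed

lemma finite_nilpotent_bound:
  assumes nil: "locally_nilpotent N" and N: "clinear N" and fin: "finite X"
  shows "\<exists>R. \<forall>x\<in>X. \<forall>r\<ge>R. (N ^^ r) x = 0"
proof -
  obtain K where K: "\<And>x. (N ^^ K x) x = 0" using nil unfolding locally_nilpotent_def by metis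
  have "(N ^^ r) x = 0" if "x \<in> X" "Max (insert 0 (K ` X)) \<le> r" for x r
    using that fin by (intro funpow_zero_mono[OF N K]) simp
  then show ?thesis by blast
qed

text \<open>With \<open>X = x2 / x1\<close>, the part without logarithms of
  \<open>(x1 - x2)^A (log (x1 - x2))^t\<close>, up to the factor \<open>x1^A\<close>.
  \<open>kerR\<close> is its counterpart for \<open>-x2 + x1\<close>, with
  \<open>X = x1 / x2\<close> and up to \<open>x2^A\<close>.\<close>

definition kerL :: "complex \<Rightarrow> nat \<Rightarrow> complex fps"
  where "kerL A t = fps_pow1m A * fps_log1m ^ t"

definition kerR :: "complex \<Rightarrow> nat \<Rightarrow> complex fps"
  where "kerR A t = fps_const (exp (pi * \<i> * A)) * fps_pow1m A * (fps_const (pi * \<i>) + fps_log1m) ^ t"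

locale twisted_data = vsa_generated V g N G
  for V :: "'v::complex_vector vertex_data" and g N :: "'v \<Rightarrow> 'v" and G :: "('v, 'i) generators" +
  fixes W :: "('v, 'w::complex_vector, 'i, 'a) twist_data"
  assumes struct: "twist_structure V g G W"
    and weight: "weight_property V G W"
    and deriv: "derivative_property V G W"
    and vacuum: "vacuum_property V W"
    and gprop: "g_property V N G W"
    and comm_phi: "weak_commutativity_phi G W"
    and comm_psi: "weak_commutativity_psi V N G W"
begin

section \<open>Generating fields on W and their commutators with the nilpotent operator\<close>

lemma twist_structure_phi: "\<forall>i\<in>I_set G. (\<forall>n k. clinear (phi_W W i n k)) \<and>
     (\<forall>w. log_laurent (gal G i) (\<lambda>n k. phi_W W i n k w)) \<and>
     (\<forall>n k s. \<forall>w\<in>W_par W s. phi_W W i n k w \<in> W_par W (gpar G i + s))"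
  using struct unfolding twist_structure_def by (elim conjE)

lemma twist_structure_psi: "\<forall>a\<in>A_set W. (\<forall>n k. clinear (psi_W W a n k)) \<and>
     (\<forall>\<alpha>\<in>P_V g. \<forall>v\<in>V_g g \<alpha>. log_laurent \<alpha> (\<lambda>n k. psi_W W a n k v)) \<and>
     (\<forall>n k s. \<forall>v\<in>V_par V s. psi_W W a n k v \<in> W_par W (psi_par W a + s))"
  using struct unfolding twist_structure_def by (elim conjE)

lemma phi_lin: "i \<in> I_set G \<Longrightarrow> clinear (phi_W W i n k)"
  using twist_structure_phi by blast

lemma phi_ll: "i \<in> I_set G \<Longrightarrow> log_laurent (gal G i) (\<lambda>n k. phi_W W i n k w)"
  using twist_structure_phi by blast

lemma psi_lin: "a \<in> A_set W \<Longrightarrow> clinear (psi_W W a n k)"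
  using twist_structure_psi by blast

lemma psi_ll: "a \<in> A_set W \<Longrightarrow> \<alpha> \<in> P_V g \<Longrightarrow> v \<in> V_g g \<alpha> \<Longrightarrow> log_laurent \<alpha> (\<lambda>n k. psi_W W a n k v)"
  using twist_structure_psi by blast

lemma L0_lin: "clinear (L0_W W)"
  using struct unfolding twist_structure_def by (elim conjE)

lemma W_wt_eigen: "W_wt W n = gen_eigenspace (L0_W W) n"
proof -
  have "\<forall>n. W_wt W n = gen_eigenspace (L0_W W) n"
    using struct unfolding twist_structure_def by (elim conjE)
  then show ?thesis by (elim allE)
qed

lemma W_wt_subspace: "csubspace (W_wt W n)"
  unfolding W_wt_eigen by (rule csubspace_gen_eigenspace[OF L0_lin])

lemma W_wt_bounded: "\<exists>b. \<forall>n w. w \<in> W_wt W n \<longrightarrow> w \<noteq> 0 \<longrightarrow> b \<le> Re n"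
proof -
  have "\<exists>b. \<forall>n. Re n < b \<longrightarrow> W_wt W n = {0}"
    using struct unfolding twist_structure_def by (elim conjE)
  then obtain b where b: "\<And>n. Re n < b \<Longrightarrow> W_wt W n = {0}" by blast
  show ?thesis
  proof (intro exI[of _ b] allI impI)
    fix n w assume "w \<in> W_wt W n" "w \<noteq> 0"
    then show "b \<le> Re n" using b[of n] by (cases "Re n < b") auto
  qed
qed

lemma NW_lin: "clinear (N_W W)"
  using struct unfolding twist_structure_def log_nilpotent_part_def by (elim conjE)

lemma NW_nil: "locally_nilpotent (N_W W)"
  using struct unfolding twist_structure_def log_nilpotent_part_def by (elim conjE)

text \<open>The \<open>r\<close>-fold commutator of \<open>N_g\<close> with the logarithm-free part of a generating field; it is the
  logarithm-free part of the field of \<open>N_g^r\<close> applied to the generator.\<close>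
definition phiN :: "'i \<Rightarrow> nat \<Rightarrow> complex \<Rightarrow> 'w \<Rightarrow> 'w"
  where "phiN i r n = ad_pow (N_W W) (phi_W W i n 0) r"

lemma phiN_lin: "i \<in> I_set G \<Longrightarrow> clinear (phiN i r n)"
proof (induction r)
  case (Suc r)
  then show ?case
    using clinear_minus[OF clinear_compose[OF NW_lin] clinear_compose[OF _ NW_lin], of "phiN i r n" "phiN i r n"]
    by (simp add: phiN_def)
qed (simp add: phiN_def phi_lin)

text \<open>Marks the range in which the iterated index is meaningful. The case \<open>r = 0\<close>
  is always included: the index \<open>i\<close> itself names a field even if its vector is
  zero.\<close>

definition alive :: "'i \<Rightarrow> nat \<Rightarrow> bool"
  where "alive i r \<longleftrightarrow> r = 0 \<or> (N ^^ r) (gvec G i) \<noteq> 0"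

lemma alive_chain:
  assumes "i \<in> I_set G" "alive i r"
  shows "(gN G ^^ r) i \<in> I_set G" "gvec G ((gN G ^^ r) i) = (N ^^ r) (gvec G i)"
    "gal G ((gN G ^^ r) i) = gal G i" "gwt G ((gN G ^^ r) i) = gwt G i"
    "gpar G ((gN G ^^ r) i) = gpar G i"
  using assms N_chain[OF assms(1), of r] unfolding alive_def by auto

text \<open>Property 5 identifies one commutator with \<open>N_g\<close> as the field of the next
  index, and a chain that has reached zero stays there. So every \<open>phiN\<close> is the
  logarithm-free part of a generating field or zero, and weak commutativity applies to it.\<close>

lemma phiN_chain:
  assumes i: "i \<in> I_set G"
  shows "phiN i r n w = (if alive i r then phi_W W ((gN G ^^ r) i) n 0 w else 0)"
proof (induction r arbitrary: w)
  case 0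
  show ?case by (simp add: phiN_def alive_def)
next
  case (Suc r)
  show ?case
  proof (cases "alive i r")
    case True
    let ?j = "(gN G ^^ r) i"
    note j = alive_chain[OF i True]
    have "\<forall>i\<in>I_set G. \<forall>n k w. N_W W (phi_W W i n k w) - phi_W W i n k (N_W W w)
       = (if N (gvec G i) = 0 then 0 else phi_W W (gN G i) n k w)"
      using gprop unfolding g_property_def by (elim conjE)
    then have "N_W W (phi_W W ?j n 0 w) - phi_W W ?j n 0 (N_W W w)
       = (if N (gvec G ?j) = 0 then 0 else phi_W W (gN G ?j) n 0 w)" using j(1) by blast
    then show ?thesis using Suc True j(2) by (simp add: phiN_def alive_def)
  next
    case False
    then have "\<not> alive i (Suc r)" using clinear_0[OF N_lin] by (auto simp: alive_def)
    then show ?thesis using Suc False by (simp add: phiN_def clinear_0[OF NW_lin])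
  qed
qed

lemma phiN_add:
  assumes "i \<in> I_set G" "alive i r"
  shows "phiN ((gN G ^^ r) i) s n w = phiN i (r + s) n w"
proof -
  have "phiN ((gN G ^^ r) i) s n w = phiN i (s + r) n w"
  proof (induction s arbitrary: w)
    case 0
    show ?case using assms by (simp add: phiN_chain[of i r] phiN_def[of _ 0])
  qed (simp add: phiN_def)
  then show ?thesis by (simp add: add.commute)
qed

lemma alive_bound: "\<exists>R>0. \<forall>r\<ge>R. (N ^^ r) (gvec G i) = 0"
  using finite_nilpotent_bound[OF N_nil N_lin, of "{gvec G i}"]
  by (metis insertI1 finite.intros Suc_leD zero_less_Suc)

lemma phiN_zero: "i \<in> I_set G \<Longrightarrow> 0 < r \<Longrightarrow> (N ^^ r) (gvec G i) = 0 \<Longrightarrow> phiN i r n w = 0"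
  by (simp add: phiN_chain alive_def)

text \<open>The expansion of \<open>x^(-N) \<phi>_0(x) x^N\<close> in powers of \<open>log x\<close>
  is that of \<open>exp(- log x ad N) \<phi>_0(x)\<close>.\<close>

lemma phi_W_phiN:
  assumes i: "i \<in> I_set G"
  shows "phi_W W i n k w = ((- 1) ^ k / fact k) *\<^sub>C phiN i k n w"
proof -
  have lin: "clinear (phi_W W i n 0)" by (rule phi_lin[OF i])
  have "\<forall>i\<in>I_set G. \<forall>n k w. phi_W W i n k w =
       (\<Sum>r\<le>k. ((- 1) ^ r / (fact r * fact (k - r))) *\<^sub>C
          (N_W W ^^ r) (phi_W W i n 0 ((N_W W ^^ (k - r)) w)))"
    using gprop unfolding g_property_def by (elim conjE)
  then have "phi_W W i n k w = (\<Sum>r\<le>k. ((- 1) ^ r / (fact r * fact (k - r))) *\<^sub>C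
          (N_W W ^^ r) (phi_W W i n 0 ((N_W W ^^ (k - r)) w)))" using i by blast
  also have "\<dots> = (\<Sum>s\<le>k. ((- 1) ^ (k - s) / (fact (k - s) * fact s)) *\<^sub>C
          (N_W W ^^ (k - s)) (phi_W W i n 0 ((N_W W ^^ s) w)))"
    by (rule sum.reindex_bij_witness[of _ "\<lambda>s. k - s" "\<lambda>s. k - s"]) auto
  also have "\<dots> = (- 1) ^ k *\<^sub>C (\<Sum>s\<le>k. (1 / (fact (k - s) * fact s)) *\<^sub>C
      (N_W W ^^ (k - s)) (phi_W W i n 0 (((\<lambda>x. - N_W W x) ^^ s) w)))"
    unfolding scaleC_sum_right
  proof (rule sum.cong)
    fix s assume "s \<in> {..k}"
    then have "(- 1) ^ k * (- 1) ^ s = ((- 1) ^ (k - s) :: complex)"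
      by (simp add: minus_one_power_iff)
    then show "((- 1) ^ (k - s) / (fact (k - s) * fact s)) *\<^sub>C
          (N_W W ^^ (k - s)) (phi_W W i n 0 ((N_W W ^^ s) w)) = (- 1) ^ k *\<^sub>C ((1 / (fact (k - s) * fact s)) *\<^sub>C
      (N_W W ^^ (k - s)) (phi_W W i n 0 (((\<lambda>x. - N_W W x) ^^ s) w)))"
      by (simp add: funpow_uminus[OF NW_lin] clinear_scale[OF lin] clinear_scale[OF clinear_funpow[OF NW_lin]])
  qed simp
  also have "\<dots> = (- 1) ^ k *\<^sub>C ((1 / fact k) *\<^sub>C phiN i k n w)"
    unfolding phiN_def ad_pow_expand[OF NW_lin lin] ..
  finally show ?thesis by simp
qed

lemma psi_W_log:
  assumes "a \<in> A_set W"
  shows "psi_W W a n k v = ((- 1) ^ k / fact k) *\<^sub>C psi_W W a n 0 ((N ^^ k) v)"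
proof -
  have "\<forall>a\<in>A_set W. \<forall>n k v. psi_W W a n k v =
       ((- 1) ^ k / fact k) *\<^sub>C psi_W W a n 0 ((N ^^ k) v)"
    using gprop unfolding g_property_def by (elim conjE)
  then show ?thesis using assms by blast
qed

text \<open>Truncation is given for vectors of a single g-weight; a general vector is a finite
  combination of such, and the largest bound serves.\<close>

lemma psi_truncation:
  assumes a: "a \<in> A_set W"
  shows "\<exists>b. \<forall>n. b < Re n \<longrightarrow> psi_W W a n 0 v = 0"
proof -
  have "v \<in> cspan (gen_products V G)" by (simp add: span_gen_products)
  then show ?thesis
  proof (induction rule: complex_vector.span_induct_alt)
    case base
    then show ?case by (simp add: clinear_0[OF psi_lin[OF a]])
  next
    case (step c x y)
    obtain \<alpha> where al: "0 \<le> Re \<alpha>" "Re \<alpha> < 1" "x \<in> V_g g \<alpha>" using gen_products_V_g step by blast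
    have "\<exists>b. \<forall>n. b < Re n \<longrightarrow> psi_W W a n 0 x = 0"
    proof (cases "\<alpha> \<in> P_V g")
      case True
      from psi_ll[OF a True al(3)] obtain b where b: "\<And>n k. psi_W W a n k x \<noteq> 0 \<Longrightarrow> Re n \<le> b"
        unfolding log_laurent_def by blast
      show ?thesis
      proof (intro exI[of _ b] allI impI)
        fix n assume "b < Re n"
        then show "psi_W W a n 0 x = 0" using b[of n 0] by (cases "psi_W W a n 0 x = 0") auto
      qed
    next
      case False
      then have "x = 0" using al(3) by (simp add: V_g_def)
      then show ?thesis by (simp add: clinear_0[OF psi_lin[OF a]])
    qed
    then obtain b where "\<And>n. b < Re n \<Longrightarrow> psi_W W a n 0 x = 0" by blast
    moreover obtain b' where "\<And>n. b' < Re n \<Longrightarrow> psi_W W a n 0 y = 0" using step by blast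
    ultimately show ?case
      by (intro exI[of _ "max b b'"]) (simp add: clinear_add[OF psi_lin[OF a]] clinear_scale[OF psi_lin[OF a]])
  qed
qed

section \<open>Weak commutativity in logarithmic degree zero\<close>

lemma ad_pow_Y: "ad_pow N (Y_op V u n) r w = Y_op V ((N ^^ r) u) n w"
proof (induction r arbitrary: w)
  case (Suc r)
  then show ?case using N_Y[of "(N ^^ r) u" n w] by simp
qed simp

lemma phi_V_0: "phi_V V G i n k 0 = 0"
  by (simp add: phi_V_def clinear_0[OF Y_lin2])

text \<open>Weak commutativity of a generating field and a twist field, logarithm-free part. The
  coefficient of \<open>x1^p x2^q\<close>.\<close>
lemma psi_swap_left:
  assumes i: "i \<in> I_set G" and a: "a \<in> A_set W"
  shows "lf (smult2 (pow12 A) (exp2 log12 (N_W W) (act1 (phi_W W i)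
             (exp2 log12 (\<lambda>w. - N_W W w) (act2 (psi_W W a) (const2 v)))))) p q
    = Sum_any (\<lambda>t. (1 / fact t) *\<^sub>C fconv (kerL A t)
        (\<lambda>J. phiN i t (A - p - 1 - of_nat J) (psi_W W a (of_nat J - q - 1) 0 v)) 0)"
proof -
  define f where "f J = psi_W W a (of_nat J - q - 1) 0 v" for J
  let ?M = "\<lambda>w. - N_W W w" and ?l = fps_log1m
  have Mlin: "clinear ?M" by (rule clinear_uminus[OF NW_lin])
  have psi0: "psi_W W a n k 0 = 0" for n k by (rule clinear_0[OF psi_lin[OF a]])
  have phi0: "phi_W W i n k 0 = 0" for n k by (rule clinear_0[OF phi_lin[OF i]])
  have pow0: "(T ^^ r) 0 = 0" if "clinear T" for T :: "'w \<Rightarrow> 'w" and r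
    by (rule clinear_0[OF clinear_funpow[OF that]])
  obtain b where b: "\<And>n. b < Re n \<Longrightarrow> psi_W W a n 0 v = 0" using psi_truncation[OF a] by blast
  \<comment> \<open>For fixed \<open>q\<close> only the modes with \<open>J < B\<close> act
    nontrivially on \<open>v\<close>. This makes the sums finite and allows uniform nilpotency
    bounds.\<close>
  obtain B :: nat where B: "b + Re q + 1 < real B" using reals_Archimedean2 by blast
  have fB: "f J = 0" if "B \<le> J" for J
    unfolding f_def by (rule b) (use B that in simp)
  obtain R1 where "\<And>x r. x \<in> f ` {..<B} \<Longrightarrow> R1 \<le> r \<Longrightarrow> (N_W W ^^ r) x = 0"
    using finite_nilpotent_bound[OF NW_nil NW_lin, of "f ` {..<B}"] by blast
  then have R1: "(?M ^^ r) (f J) = 0" if "R1 \<le> r" for r J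
    using that fB[of J] by (cases "J < B") (auto simp: funpow_uminus[OF NW_lin] pow0[OF NW_lin] not_less)
  define y where "y r J = phi_W W i (A - p - 1 - of_nat J) 0 ((?M ^^ r) (f J))" for r J
  have yB: "y r J = 0" if "B \<le> J" for r J by (simp add: y_def fB[OF that] pow0[OF Mlin] phi0)
  obtain R2 where R2': "\<And>x r. x \<in> (\<lambda>(r, J). y r J) ` ({..<R1} \<times> {..<B}) \<Longrightarrow> R2 \<le> r \<Longrightarrow> (N_W W ^^ r) x = 0"
    using finite_nilpotent_bound[OF NW_nil NW_lin, of "(\<lambda>(r, J). y r J) ` ({..<R1} \<times> {..<B})"] by blast
  have yR1: "y r J = 0" if "R1 \<le> r" for r J using R1[OF that] by (simp add: y_def phi0)
  have R2: "(N_W W ^^ r') (y r J) = 0" if "R2 \<le> r'" for r r' J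
  proof (cases "r < R1 \<and> J < B")
    case True
    then show ?thesis using R2'[of "y r J" r'] that by auto
  qed (use yB yR1 pow0[OF NW_lin] in \<open>auto simp: not_less\<close>)
  define X1 where "X1 = exp2 log12 ?M (act2 (psi_W W a) (const2 v))"
  \<comment> \<open>A series in \<open>x2\<close> alone acquires exponents \<open>-k\<close> of
    \<open>x1\<close> from the expansion of \<open>log (x1 - x2)\<close>; \<open>THE\<close>
    recovers \<open>k\<close> from the exponent.\<close>
  have X1: "lf X1 a' (q - of_nat K) = (if \<exists>k. a' = - of_nat k then
      (\<Sum>r<R1. (1 / fact r) *\<^sub>C (fps_nth (?l ^ r) (THE k. a' = - of_nat k) *\<^sub>C
        (?M ^^ r) (f (K + (THE k. a' = - of_nat k))))) else 0)" for a' K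
  proof (cases "\<exists>k. a' = - of_nat k")
    case True
    then obtain k where k: "a' = - of_nat k" by blast
    then have the: "(THE k. a' = - of_nat k) = k" by auto
    have "lf X1 a' (q - of_nat K) = Sum_any (\<lambda>r. (1 / fact r) *\<^sub>C (fps_nth (?l ^ r) k *\<^sub>C (?M ^^ r) (f (K + k))))"
      unfolding X1_def lf_exp2[OF series_along_log12, simplified] lf_act2_const2[of "psi_W W a", OF psi0]
      by (intro Sum_any.cong arg_cong[of _ _ "\<lambda>x. _ *\<^sub>C x"], subst Sum_any_single[of k])
         (auto simp: k pow0[OF Mlin] f_def algebra_simps eq_neg_iff_add_eq_0 simp flip: of_nat_add)
    also have "\<dots> = (\<Sum>r<R1. (1 / fact r) *\<^sub>C (fps_nth (?l ^ r) k *\<^sub>C (?M ^^ r) (f (K + k))))"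
      by (rule Sum_any_lessThan) (simp add: R1)
    finally show ?thesis using True the by simp
  next
    case False
    then have "a' + of_nat m \<noteq> 0" for m by (auto simp: add_eq_0_iff2)
    then show ?thesis using False
      unfolding X1_def lf_exp2[OF series_along_log12, simplified] lf_act2_const2[of "psi_W W a", OF psi0]
      by (simp add: pow0[OF Mlin])
  qed
  have X1k: "lf X1 (- of_nat k) (q - of_nat K)
     = (\<Sum>r<R1. (1 / fact r) *\<^sub>C (fps_nth (?l ^ r) k *\<^sub>C (?M ^^ r) (f (K + k))))" for k K
  proof -
    have "(THE k'. - of_nat k = - (of_nat k' :: complex)) = k" by auto
    then show ?thesis unfolding X1 by auto
  qed
  define X2 where "X2 = act1 (phi_W W i) X1"
  have X2: "lf X2 (p - A + of_nat K) (q - of_nat K) = (\<Sum>r<R1. (1 / fact r) *\<^sub>C fconv (?l ^ r) (y r) K)" for K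
  proof -
    let ?h = "\<lambda>k::nat. A - p - 1 - of_nat (K + k)"
    have "lf X2 (p - A + of_nat K) (q - of_nat K)
       = Sum_any (\<lambda>n. phi_W W i n 0 (lf X1 (p - A + of_nat K + n + 1) (q - of_nat K)))"
      unfolding X2_def by (rule lf_act1) (rule phi0)
    also have "\<dots> = Sum_any (\<lambda>k. phi_W W i (?h k) 0 (lf X1 (p - A + of_nat K + ?h k + 1) (q - of_nat K)))"
    proof (rule Sum_any_reindex_inj)
      fix n assume "phi_W W i n 0 (lf X1 (p - A + of_nat K + n + 1) (q - of_nat K)) \<noteq> 0"
      then have "lf X1 (p - A + of_nat K + n + 1) (q - of_nat K) \<noteq> 0" using phi0 by metis
      then obtain k where "p - A + of_nat K + n + 1 = - of_nat k" unfolding X1 by (auto split: if_splits)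
      then have "n = ?h k" by (simp add: algebra_simps eq_neg_iff_add_eq_0)
      then show "n \<in> range ?h" by blast
    qed (auto simp: inj_def)
    also have "\<dots> = Sum_any (\<lambda>k. \<Sum>r<R1. (1 / fact r) *\<^sub>C (fps_nth (?l ^ r) k *\<^sub>C y r (K + k)))"
    proof (rule Sum_any.cong)
      fix k
      have "p - A + of_nat K + ?h k + 1 = - of_nat k" by (simp add: algebra_simps)
      then show "phi_W W i (?h k) 0 (lf X1 (p - A + of_nat K + ?h k + 1) (q - of_nat K))
         = (\<Sum>r<R1. (1 / fact r) *\<^sub>C (fps_nth (?l ^ r) k *\<^sub>C y r (K + k)))"
        by (simp only: X1k clinear_sum[OF phi_lin[OF i]] clinear_scale[OF phi_lin[OF i]] y_def)
    qed
    also have "\<dots> = (\<Sum>k<B. \<Sum>r<R1. (1 / fact r) *\<^sub>C (fps_nth (?l ^ r) k *\<^sub>C y r (K + k)))"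
      by (rule Sum_any_lessThan) (simp add: yB)
    also have "\<dots> = (\<Sum>r<R1. (1 / fact r) *\<^sub>C fconv (?l ^ r) (y r) K)"
      by (subst sum.swap, rule sum.cong) (simp_all add: fconv_sum[OF yB] scaleC_sum_right)
    finally show ?thesis .
  qed
  have X2B: "lf X2 (p - A + of_nat K) (q - of_nat K) = 0" if "B \<le> K" for K
    unfolding X2 using fconv_zero[OF yB that] by simp
  define X3 where "X3 = exp2 log12 (N_W W) X2"
  have X3: "lf X3 (p - A + of_nat K) (q - of_nat K) = (\<Sum>r<R1. \<Sum>r'<R2. (1 / (fact r * fact r')) *\<^sub>C
     fconv (?l ^ (r + r')) (\<lambda>J. (N_W W ^^ r') (y r J)) K)" for K
  proof -
    have NX2: "(N_W W ^^ r') (lf X2 (p - A + of_nat K) (q - of_nat K))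
       = (\<Sum>r<R1. (1 / fact r) *\<^sub>C fconv (?l ^ r) (\<lambda>J. (N_W W ^^ r') (y r J)) K)" for r' K
      unfolding X2 clinear_sum[OF clinear_funpow[OF NW_lin]] clinear_scale[OF clinear_funpow[OF NW_lin]]
      by (simp add: fconv_clinear[OF clinear_funpow[OF NW_lin] yB])
    have NyB: "(N_W W ^^ r') (y r J) = 0" if "B \<le> J" for r r' J by (simp add: yB[OF that] pow0[OF NW_lin])
    have "lf X3 (p - A + of_nat K) (q - of_nat K) = Sum_any (\<lambda>r'. (1 / fact r') *\<^sub>C
        fconv (?l ^ r') (\<lambda>J. (N_W W ^^ r') (lf X2 (p - A + of_nat J) (q - of_nat J))) K)"
      unfolding X3_def lf_exp2[OF series_along_log12, simplified] fconv_def
      by (simp add: algebra_simps)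
    also have "\<dots> = (\<Sum>r'<R2. (1 / fact r') *\<^sub>C
        fconv (?l ^ r') (\<lambda>J. (N_W W ^^ r') (lf X2 (p - A + of_nat J) (q - of_nat J))) K)"
      by (rule Sum_any_lessThan) (simp add: NX2 R2 fconv_def)
    also have "\<dots> = (\<Sum>r'<R2. \<Sum>r<R1. (1 / (fact r * fact r')) *\<^sub>C
        fconv (?l ^ (r + r')) (\<lambda>J. (N_W W ^^ r') (y r J)) K)"
    proof (rule sum.cong)
      fix r'
      have "fconv (?l ^ r') (\<lambda>J. (N_W W ^^ r') (lf X2 (p - A + of_nat J) (q - of_nat J))) K
        = (\<Sum>r<R1. (1 / fact r) *\<^sub>C fconv (?l ^ r') (fconv (?l ^ r) (\<lambda>J. (N_W W ^^ r') (y r J))) K)"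
        unfolding NX2 by (rule fconv_lincomb[where B = B]) (rule fconv_zero[OF NyB])
      also have "\<dots> = (\<Sum>r<R1. (1 / fact r) *\<^sub>C fconv (?l ^ (r + r')) (\<lambda>J. (N_W W ^^ r') (y r J)) K)"
        by (intro sum.cong refl)
           (simp add: fconv_mult[OF NyB, symmetric] power_add mult.commute)
      finally show "(1 / fact r') *\<^sub>C fconv (?l ^ r') (\<lambda>J. (N_W W ^^ r') (lf X2 (p - A + of_nat J) (q - of_nat J))) K
        = (\<Sum>r<R1. (1 / (fact r * fact r')) *\<^sub>C fconv (?l ^ (r + r')) (\<lambda>J. (N_W W ^^ r') (y r J)) K)"
        by (simp add: scaleC_sum_right mult.commute)
    qed simp
    finally show ?thesis by (subst sum.swap)
  qed
  have NyB: "(N_W W ^^ r') (y r J) = 0" if "B \<le> J" for r r' J by (simp add: yB[OF that] pow0[OF NW_lin])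
  have "lf (smult2 (pow12 A) X3) p q = fconv (fps_pow1m A) (\<lambda>J. lf X3 (p - A + of_nat J) (q - of_nat J)) 0"
    unfolding lf_smult2[OF series_along_pow12, simplified] fconv_def by simp
  also have "\<dots> = (\<Sum>r<R1. \<Sum>r'<R2. (1 / (fact r * fact r')) *\<^sub>C
     fconv (fps_pow1m A) (fconv (?l ^ (r + r')) (\<lambda>J. (N_W W ^^ r') (y r J))) 0)"
    unfolding X3 sum.cartesian_product case_prod_beta
    by (rule fconv_lincomb[where B = B]) (rule fconv_zero[OF NyB])
  also have "\<dots> = (\<Sum>r<R1. \<Sum>r'<R2. (1 / (fact r * fact r')) *\<^sub>C
     fconv (kerL A (r + r')) (\<lambda>J. (N_W W ^^ r') (y r J)) 0)"
    unfolding kerL_def by (simp add: fconv_mult[OF NyB])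
  finally have main: "lf (smult2 (pow12 A) X3) p q = \<dots>" .
  obtain R0 where R0: "0 < R0" "\<And>r. R0 \<le> r \<Longrightarrow> (N ^^ r) (gvec G i) = 0" using alive_bound by blast
  \<comment> \<open>Large enough for the box of size \<open>R1\<close> by \<open>R2\<close> to lie
    in the triangle, and at least \<open>R0\<close>, from where on the iterated commutators
    vanish.\<close>
  define T where "T = R0 + R1 + R2"
  have "lf (smult2 (pow12 A) X3) p q = (\<Sum>t<T. \<Sum>r\<le>t. (1 / (fact r * fact (t - r))) *\<^sub>C
     fconv (kerL A (r + (t - r))) (\<lambda>J. (N_W W ^^ (t - r)) (y r J)) 0)"
    unfolding main by (rule sum_box_triangle) (auto simp: T_def yR1 R2 pow0[OF NW_lin] fconv_def)
  \<comment> \<open>For a fixed total power \<open>t\<close> of the nilpotent operator the inner sum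
    is the iterated commutator, by \<open>ad_pow_expand\<close>.\<close>
  also have "\<dots> = (\<Sum>t<T. (1 / fact t) *\<^sub>C fconv (kerL A t) (\<lambda>J. phiN i t (A - p - 1 - of_nat J) (f J)) 0)"
  proof (rule sum.cong)
    fix t
    have "(1 / fact t) *\<^sub>C fconv (kerL A t) (\<lambda>J. phiN i t (A - p - 1 - of_nat J) (f J)) 0
      = fconv (kerL A t) (\<lambda>J. (1 / fact t) *\<^sub>C phiN i t (A - p - 1 - of_nat J) (f J)) 0"
      by (rule fconv_scale[symmetric, where B = B]) (simp add: fB clinear_0[OF phiN_lin[OF i]])
    also have "\<dots> = fconv (kerL A t) (\<lambda>J. \<Sum>r\<le>t. (1 / (fact r * fact (t - r))) *\<^sub>C (N_W W ^^ (t - r)) (y r J)) 0"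
      unfolding phiN_def ad_pow_expand[OF NW_lin phi_lin[OF i]] y_def by (simp add: mult.commute)
    also have "\<dots> = (\<Sum>r\<le>t. (1 / (fact r * fact (t - r))) *\<^sub>C
        fconv (kerL A t) (\<lambda>J. (N_W W ^^ (t - r)) (y r J)) 0)"
      by (rule fconv_lincomb[where B = B]) (rule NyB)
    finally show "(\<Sum>r\<le>t. (1 / (fact r * fact (t - r))) *\<^sub>C
        fconv (kerL A (r + (t - r))) (\<lambda>J. (N_W W ^^ (t - r)) (y r J)) 0)
      = (1 / fact t) *\<^sub>C fconv (kerL A t) (\<lambda>J. phiN i t (A - p - 1 - of_nat J) (f J)) 0"
      by simp
  qed simp
  also have "\<dots> = Sum_any (\<lambda>t. (1 / fact t) *\<^sub>C fconv (kerL A t) (\<lambda>J. phiN i t (A - p - 1 - of_nat J) (f J)) 0)"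
    by (rule Sum_any_lessThan[symmetric])
       (use R0 in \<open>simp add: T_def phiN_zero[OF i] fconv_def\<close>)
  finally show ?thesis unfolding X3_def X2_def X1_def f_def .
qed

text \<open>Conjugation on V works as on W. The iterated commutators are vertex operators of
  \<open>N^t\<close> applied to the generator, because \<open>N\<close> is a derivation, and the
  exponent of \<open>x1\<close> is an integer, because fields on V are single-valued.\<close>

lemma psi_swap_right:
  assumes i: "i \<in> I_set G" and a: "a \<in> A_set W"
  shows "lf (smult2 (pow21 A) (act2 (psi_W W a) (exp2 log21 N (act1 (phi_V V G i)
             (exp2 log21 (\<lambda>w. - N w) (const2 v)))))) (of_int p) q
    = Sum_any (\<lambda>t. (1 / fact t) *\<^sub>C fconv (kerR A t)
        (\<lambda>J. psi_W W a (A - q - 1 - of_nat J) 0 (Y_op V ((N ^^ t) (gvec G i)) (int J - p - 1) v)) 0)"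
proof -
  let ?M = "\<lambda>w. - N w" and ?l = "fps_const (pi * \<i>) + fps_log1m" and ?u = "gvec G i"
  let ?psi = "psi_W W a"
  have Mlin: "clinear ?M" by (rule clinear_uminus[OF N_lin])
  have psi0: "?psi n k 0 = 0" for n k by (rule clinear_0[OF psi_lin[OF a]])
  have pow0: "(T ^^ r) 0 = 0" if "clinear T" for T :: "'v \<Rightarrow> 'v" and r
    by (rule clinear_0[OF clinear_funpow[OF that]])
  obtain R0 where R0: "0 < R0" "\<And>r. R0 \<le> r \<Longrightarrow> (N ^^ r) ?u = 0" using alive_bound by blast
  obtain R1 where R1': "\<And>r. R1 \<le> r \<Longrightarrow> (N ^^ r) v = 0"
    using finite_nilpotent_bound[OF N_nil N_lin, of "{v}"] by blast
  then have R1: "(?M ^^ r) v = 0" if "R1 \<le> r" for r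
    using that by (simp add: funpow_uminus[OF N_lin])
  have phiV: "phi_V V G i (of_int n) 0 w = Y_op V ?u n w" for n w by (simp add: phi_V_def)
  define Y1 where "Y1 = exp2 log21 ?M (const2 v)"
  have Y1k: "lf Y1 (of_nat k) (- of_nat k) = (\<Sum>r<R1. (1 / fact r) *\<^sub>C (fps_nth (?l ^ r) k *\<^sub>C (?M ^^ r) v))" for k
  proof -
    have "lf Y1 (of_nat k) (- of_nat k) = Sum_any (\<lambda>r. (1 / fact r) *\<^sub>C (fps_nth (?l ^ r) k *\<^sub>C (?M ^^ r) v))"
      unfolding Y1_def lf_exp2[OF series_along_log21, simplified] lf_const2
      by (intro Sum_any.cong arg_cong[of _ _ "\<lambda>x. _ *\<^sub>C x"], subst Sum_any_single[of k])
         (auto simp: pow0[OF Mlin])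
    also have "\<dots> = (\<Sum>r<R1. (1 / fact r) *\<^sub>C (fps_nth (?l ^ r) k *\<^sub>C (?M ^^ r) v))"
      by (rule Sum_any_lessThan) (simp add: R1)
    finally show ?thesis .
  qed
  have Y1z: "lf Y1 x y = 0" if "\<And>k. x = of_nat k \<Longrightarrow> y \<noteq> - of_nat k" for x y
  proof -
    have z: "\<not> (x - of_nat m = 0 \<and> y + of_nat m = 0)" for m
      using that[of m] by (auto simp: add_eq_0_iff2)
    show ?thesis
      unfolding Y1_def lf_exp2[OF series_along_log21, simplified] lf_const2
      by (simp only: z if_False pow0[OF Mlin] complex_vector.scale_zero_right Sum_any.neutral)
  qed
  define Y2 where "Y2 = act1 (phi_V V G i) Y1"
  have Y2k: "lf Y2 (of_int c) (- of_nat k) = Y_op V ?u (int k - c - 1) (lf Y1 (of_nat k) (- of_nat k))" for c k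
  proof -
    have "lf Y2 (of_int c) (- of_nat k)
       = Sum_any (\<lambda>n. phi_V V G i n 0 (lf Y1 (of_int c + n + 1) (- of_nat k)))"
      unfolding Y2_def by (rule lf_act1) (rule phi_V_0)
    also have "\<dots> = phi_V V G i (of_int (int k - c - 1)) 0 (lf Y1 (of_int c + of_int (int k - c - 1) + 1) (- of_nat k))"
    proof (rule Sum_any_single)
      fix n :: complex assume n: "n \<noteq> of_int (int k - c - 1)"
      have "lf Y1 (of_int c + n + 1) (- of_nat k) = 0"
        by (rule Y1z) (use n in \<open>auto simp: algebra_simps eq_diff_eq\<close>)
      then show "phi_V V G i n 0 (lf Y1 (of_int c + n + 1) (- of_nat k)) = 0" by (simp add: phi_V_0)
    qed
    finally show ?thesis unfolding phiV by (simp add: algebra_simps)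
  qed
  have Y2z: "lf Y2 x y = 0" if "\<And>k. y \<noteq> - of_nat k" for x y
  proof -
    have "lf Y2 x y = Sum_any (\<lambda>n. phi_V V G i n 0 (lf Y1 (x + n + 1) y))"
      unfolding Y2_def by (rule lf_act1) (rule phi_V_0)
    moreover have "lf Y1 x' y = 0" for x' by (rule Y1z) (use that in simp)
    ultimately show ?thesis by (simp add: phi_V_0)
  qed
  define Y3 where "Y3 = exp2 log21 N Y2"
  have Y3k: "lf Y3 (of_int c) (- of_nat K) = (\<Sum>t<R0. (fps_nth (?l ^ t) K / fact t) *\<^sub>C
       Y_op V ((N ^^ t) ?u) (int K - c - 1) v)" for c K
  proof -
    define z where "z r = Y_op V ?u (int K - c - 1) ((?M ^^ r) v)" for r
    obtain R2 where R2': "\<And>x r. x \<in> z ` {..<R1} \<Longrightarrow> R2 \<le> r \<Longrightarrow> (N ^^ r) x = 0"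
      using finite_nilpotent_bound[OF N_nil N_lin, of "z ` {..<R1}"] by blast
    have zR1: "z r = 0" if "R1 \<le> r" for r by (simp add: z_def R1[OF that] clinear_0[OF Y_lin2])
    have R2: "(N ^^ r') (z r) = 0" if "R2 \<le> r'" for r r'
      using R2'[of "z r" r'] zR1[of r] that by (cases "r < R1") (auto simp: pow0[OF N_lin] not_less)
    have Y2m: "(N ^^ r') (lf Y2 (of_int c - of_nat m) (- of_nat K + of_nat m))
       = (\<Sum>r<R1. (fps_nth (?l ^ r) (K - m) / fact r) *\<^sub>C (N ^^ r') (z r))" if "m \<le> K" for m r'
    proof -
      have e: "of_int c - of_nat m = (of_int (c - int m) :: complex)" "- of_nat K + of_nat m = (- of_nat (K - m) :: complex)"
        using that by (simp_all add: of_nat_diff)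
      have e2: "int (K - m) - (c - int m) - 1 = int K - c - 1" using that by (simp add: of_nat_diff)
      show ?thesis
        unfolding e Y2k Y1k e2 clinear_sum[OF Y_lin2] clinear_scale[OF Y_lin2]
          clinear_sum[OF clinear_funpow[OF N_lin]] clinear_scale[OF clinear_funpow[OF N_lin]]
        by (simp add: z_def)
    qed
    have Y2m0: "lf Y2 x (- of_nat K + of_nat m) = 0" if "K < m" for m x
    proof (rule Y2z, rule notI)
      fix k assume "- of_nat K + of_nat m = (- of_nat k :: complex)"
      then have "of_nat (m + k) = (of_nat K :: complex)" by (simp add: algebra_simps eq_neg_iff_add_eq_0)
      then show False using that unfolding of_nat_eq_iff by simp
    qed
    have inner: "Sum_any (\<lambda>m. fps_nth (?l ^ r') m *\<^sub>C (N ^^ r') (lf Y2 (of_int c - of_nat m) (- of_nat K + of_nat m)))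
      = (\<Sum>r<R1. (fps_nth (?l ^ (r + r')) K / fact r) *\<^sub>C (N ^^ r') (z r))" for r'
    proof -
      have "Sum_any (\<lambda>m. fps_nth (?l ^ r') m *\<^sub>C (N ^^ r') (lf Y2 (of_int c - of_nat m) (- of_nat K + of_nat m)))
        = (\<Sum>m<Suc K. fps_nth (?l ^ r') m *\<^sub>C (N ^^ r') (lf Y2 (of_int c - of_nat m) (- of_nat K + of_nat m)))"
        by (rule Sum_any_lessThan)
           (simp only: Y2m0[OF Suc_le_lessD] pow0[OF N_lin] complex_vector.scale_zero_right)
      also have "\<dots> = (\<Sum>m\<le>K. \<Sum>r<R1. (fps_nth (?l ^ r') m * fps_nth (?l ^ r) (K - m) / fact r) *\<^sub>C (N ^^ r') (z r))"
        unfolding lessThan_Suc_atMost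
        by (rule sum.cong)
           (simp_all only: atMost_iff Y2m scaleC_sum_right complex_vector.scale_scale times_divide_eq_right)
      also have "\<dots> = (\<Sum>r<R1. \<Sum>m\<le>K. (fps_nth (?l ^ r') m * fps_nth (?l ^ r) (K - m) / fact r) *\<^sub>C (N ^^ r') (z r))"
        by (rule sum.swap)
      also have "\<dots> = (\<Sum>r<R1. (fps_nth (?l ^ (r + r')) K / fact r) *\<^sub>C (N ^^ r') (z r))"
      proof (rule sum.cong)
        fix r
        have "fps_nth (?l ^ (r + r')) K = (\<Sum>m\<le>K. fps_nth (?l ^ r') m * fps_nth (?l ^ r) (K - m))"
          by (subst add.commute) (simp only: power_add fps_mult_nth atLeast0AtMost)
        then show "(\<Sum>m\<le>K. (fps_nth (?l ^ r') m * fps_nth (?l ^ r) (K - m) / fact r) *\<^sub>C (N ^^ r') (z r))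
          = (fps_nth (?l ^ (r + r')) K / fact r) *\<^sub>C (N ^^ r') (z r)"
          by (simp only: scaleC_sum_left[symmetric] sum_divide_distrib[symmetric])
      qed simp
      finally show ?thesis .
    qed
    define T where "T = R0 + R1 + R2"
    have "lf Y3 (of_int c) (- of_nat K) = Sum_any (\<lambda>r'. (1 / fact r') *\<^sub>C
        (\<Sum>r<R1. (fps_nth (?l ^ (r + r')) K / fact r) *\<^sub>C (N ^^ r') (z r)))"
      unfolding Y3_def lf_exp2[OF series_along_log21, simplified] inner[symmetric] by simp
    also have "\<dots> = (\<Sum>r'<R2. (1 / fact r') *\<^sub>C
        (\<Sum>r<R1. (fps_nth (?l ^ (r + r')) K / fact r) *\<^sub>C (N ^^ r') (z r)))"
      by (rule Sum_any_lessThan) (simp add: R2)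
    also have "\<dots> = (\<Sum>r<R1. \<Sum>r'<R2. (fps_nth (?l ^ (r + r')) K / (fact r * fact r')) *\<^sub>C (N ^^ r') (z r))"
      unfolding scaleC_sum_right by (subst sum.swap) (simp add: mult.commute)
    also have "\<dots> = (\<Sum>t<T. \<Sum>r\<le>t. (fps_nth (?l ^ (r + (t - r))) K / (fact r * fact (t - r))) *\<^sub>C (N ^^ (t - r)) (z r))"
      by (rule sum_box_triangle) (auto simp: T_def zR1 R2 pow0[OF N_lin])
    also have "\<dots> = (\<Sum>t<T. (fps_nth (?l ^ t) K / fact t) *\<^sub>C Y_op V ((N ^^ t) ?u) (int K - c - 1) v)"
    proof (rule sum.cong)
      fix t
      have "(fps_nth (?l ^ t) K / fact t) *\<^sub>C Y_op V ((N ^^ t) ?u) (int K - c - 1) v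
         = fps_nth (?l ^ t) K *\<^sub>C ((1 / fact t) *\<^sub>C ad_pow N (Y_op V ?u (int K - c - 1)) t v)"
        unfolding ad_pow_Y by simp
      then show "(\<Sum>r\<le>t. (fps_nth (?l ^ (r + (t - r))) K / (fact r * fact (t - r))) *\<^sub>C (N ^^ (t - r)) (z r))
        = (fps_nth (?l ^ t) K / fact t) *\<^sub>C Y_op V ((N ^^ t) ?u) (int K - c - 1) v"
        unfolding ad_pow_expand[OF N_lin Y_lin2] z_def scaleC_sum_right
        by (simp add: mult.commute)
    qed simp
    also have "\<dots> = (\<Sum>t<R0. (fps_nth (?l ^ t) K / fact t) *\<^sub>C Y_op V ((N ^^ t) ?u) (int K - c - 1) v)"
      by (rule sum.mono_neutral_right) (auto simp: T_def R0(2) clinear_0[OF Y_lin1])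
    finally show ?thesis .
  qed
  have Y3z: "lf Y3 x y = 0" if "\<And>k. y \<noteq> - of_nat k" for x y
  proof -
    have "y + of_nat m \<noteq> - of_nat k" for m k
      using that[of "m + k"] by (simp add: algebra_simps eq_neg_iff_add_eq_0)
    then have "lf Y2 x' (y + of_nat m) = 0" for x' m by (rule Y2z)
    then show ?thesis unfolding Y3_def lf_exp2[OF series_along_log21, simplified] by (simp add: pow0[OF N_lin])
  qed
  define h where "h t J = ?psi (A - q - 1 - of_nat J) 0 (Y_op V ((N ^^ t) ?u) (int J - p - 1) v)" for t J
  have "\<exists>B. \<forall>J\<ge>B. \<forall>t<R0. Y_op V ((N ^^ t) ?u) (int J - p - 1) v = 0"
  proof -
    have "\<forall>t. \<exists>b. \<forall>n\<ge>b. Y_op V ((N ^^ t) ?u) n v = 0" using Y_truncation by (rule allI)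
    from choice[OF this] obtain b where b: "\<And>t n. b t \<le> n \<Longrightarrow> Y_op V ((N ^^ t) ?u) n v = 0" by (elim exE) blast
    have "Y_op V ((N ^^ t) ?u) (int J - p - 1) v = 0" if "nat (Max (b ` {..<R0}) + p + 1) \<le> J" "t < R0" for J t
    proof (rule b)
      have "b t \<le> Max (b ` {..<R0})" using that(2) by (intro Max_ge) auto
      then show "b t \<le> int J - p - 1" using that(1) by linarith
    qed
    then show ?thesis by blast
  qed
  then obtain B where B: "\<And>J t. B \<le> J \<Longrightarrow> t < R0 \<Longrightarrow> Y_op V ((N ^^ t) ?u) (int J - p - 1) v = 0" by blast
  have hB: "h t J = 0" if "B \<le> J" for t J
    by (cases "t < R0") (simp_all add: h_def B[OF that] psi0 R0(2) clinear_0[OF Y_lin1])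
  define Y4 where "Y4 = act2 ?psi Y3"
  have Y4: "lf Y4 (of_int p - of_nat m) (q - A + of_nat m) = (\<Sum>t<R0. (1 / fact t) *\<^sub>C fconv (?l ^ t) (h t) m)" for m
  proof -
    let ?h = "\<lambda>K::nat. A - q - 1 - of_nat (m + K)"
    have "lf Y4 (of_int p - of_nat m) (q - A + of_nat m)
        = Sum_any (\<lambda>n. ?psi n 0 (lf Y3 (of_int p - of_nat m) (q - A + of_nat m + n + 1)))"
      unfolding Y4_def by (rule lf_act2) (rule psi0)
    also have "\<dots> = Sum_any (\<lambda>K. ?psi (?h K) 0 (lf Y3 (of_int p - of_nat m) (q - A + of_nat m + ?h K + 1)))"
    proof (rule Sum_any_reindex_inj)
      fix n assume "?psi n 0 (lf Y3 (of_int p - of_nat m) (q - A + of_nat m + n + 1)) \<noteq> 0"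
      then have "lf Y3 (of_int p - of_nat m) (q - A + of_nat m + n + 1) \<noteq> 0" using psi0 by metis
      then have "\<exists>K. q - A + of_nat m + n + 1 = - of_nat K"
        using Y3z[of "q - A + of_nat m + n + 1" "of_int p - of_nat m"] by (rule contrapos_np) blast
      then obtain K where "q - A + of_nat m + n + 1 = - of_nat K" by (elim exE)
      then have "n = ?h K" by (simp add: algebra_simps eq_neg_iff_add_eq_0)
      then show "n \<in> range ?h" by blast
    qed (auto simp: inj_def)
    also have "\<dots> = Sum_any (\<lambda>K. \<Sum>t<R0. (1 / fact t) *\<^sub>C (fps_nth (?l ^ t) K *\<^sub>C h t (m + K)))"
    proof (rule Sum_any.cong)
      fix K
      have e: "q - A + of_nat m + ?h K + 1 = - of_nat K" "of_int p - of_nat m = (of_int (p - int m) :: complex)"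
        "int K - (p - int m) - 1 = int (m + K) - p - 1"
        by (simp_all add: algebra_simps)
      show "?psi (?h K) 0 (lf Y3 (of_int p - of_nat m) (q - A + of_nat m + ?h K + 1))
        = (\<Sum>t<R0. (1 / fact t) *\<^sub>C (fps_nth (?l ^ t) K *\<^sub>C h t (m + K)))"
        unfolding e(1) unfolding e(2) Y3k e(3) clinear_sum[OF psi_lin[OF a]] clinear_scale[OF psi_lin[OF a]] h_def
        by simp
    qed
    also have "\<dots> = (\<Sum>K<B. \<Sum>t<R0. (1 / fact t) *\<^sub>C (fps_nth (?l ^ t) K *\<^sub>C h t (m + K)))"
      by (rule Sum_any_lessThan) (simp add: hB)
    also have "\<dots> = (\<Sum>t<R0. (1 / fact t) *\<^sub>C fconv (?l ^ t) (h t) m)"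
      by (subst sum.swap, rule sum.cong) (simp_all add: fconv_sum[OF hB] scaleC_sum_right)
    finally show ?thesis .
  qed
  have "lf (smult2 (pow21 A) Y4) (of_int p) q
     = fconv (fps_const (exp (pi * \<i> * A)) * fps_pow1m A) (\<lambda>m. lf Y4 (of_int p - of_nat m) (q - A + of_nat m)) 0"
    unfolding lf_smult2[OF series_along_pow21, simplified] fconv_def by (simp add: algebra_simps)
  also have "\<dots> = (\<Sum>t<R0. (1 / fact t) *\<^sub>C fconv (fps_const (exp (pi * \<i> * A)) * fps_pow1m A) (fconv (?l ^ t) (h t)) 0)"
    unfolding Y4 by (rule fconv_lincomb[where B = B]) (rule fconv_zero[OF hB])
  also have "\<dots> = (\<Sum>t<R0. (1 / fact t) *\<^sub>C fconv (kerR A t) (h t) 0)"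
    unfolding kerR_def by (simp add: fconv_mult[OF hB])
  also have "\<dots> = Sum_any (\<lambda>t. (1 / fact t) *\<^sub>C fconv (kerR A t) (h t) 0)"
    by (rule Sum_any_lessThan[symmetric])
       (simp add: h_def R0(2) clinear_0[OF Y_lin1] psi0 fconv_def)
  finally show ?thesis unfolding Y4_def Y3_def Y2_def Y1_def h_def .
qed

lemma psi_swap:
  assumes i: "i \<in> I_set G" and a: "a \<in> A_set W"
  shows "\<exists>M::nat. \<forall>v p q. let A = gal G i + of_nat M in
    Sum_any (\<lambda>t. (1 / fact t) *\<^sub>C fconv (kerL A t)
        (\<lambda>J. phiN i t (A - of_int p - 1 - of_nat J) (psi_W W a (of_nat J - q - 1) 0 v)) 0)
    = parity_sign (gpar G i) (psi_par W a) *\<^sub>C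
      Sum_any (\<lambda>t. (1 / fact t) *\<^sub>C fconv (kerR A t)
        (\<lambda>J. psi_W W a (A - q - 1 - of_nat J) 0 (Y_op V ((N ^^ t) (gvec G i)) (int J - p - 1) v)) 0)"
proof -
  have "\<exists>M::nat. M > 0 \<and> (\<forall>v e.
       smult2 (pow12 (gal G i + of_nat M))
         (exp2 log12 (N_W W) (act1 (phi_W W i)
             (exp2 log12 (\<lambda>w. - N_W W w) (act2 (psi_W W a) (const2 v))))) e
       = parity_sign (gpar G i) (psi_par W a) *\<^sub>C
         smult2 (pow21 (gal G i + of_nat M)) (act2 (psi_W W a)
             (exp2 log21 N (act1 (phi_V V G i) (exp2 log21 (\<lambda>u. - N u) (const2 v))))) e)"
    using comm_psi i a unfolding weak_commutativity_psi_def by blast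
  then obtain M where M: "\<And>v e.
       smult2 (pow12 (gal G i + of_nat M))
         (exp2 log12 (N_W W) (act1 (phi_W W i)
             (exp2 log12 (\<lambda>w. - N_W W w) (act2 (psi_W W a) (const2 v))))) e
       = parity_sign (gpar G i) (psi_par W a) *\<^sub>C
         smult2 (pow21 (gal G i + of_nat M)) (act2 (psi_W W a)
             (exp2 log21 N (act1 (phi_V V G i) (exp2 log21 (\<lambda>u. - N u) (const2 v))))) e"
    by blast
  show ?thesis
    unfolding Let_def psi_swap_left[OF i a, symmetric] psi_swap_right[OF i a, symmetric]
    by (intro exI[of _ M] allI) (simp only: lf_def M)
qed

lemma phi_swap:
  assumes i: "i \<in> I_set G" and j: "j \<in> I_set G"
  shows "\<exists>M::nat. \<forall>w p q.
    (\<Sum>m\<le>M. ((- 1) ^ m * of_nat (M choose m)) *\<^sub>C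
        phi_W W i (of_nat M - p - 1 - of_nat m) 0 (phi_W W j (of_nat m - q - 1) 0 w))
    = parity_sign (gpar G i) (gpar G j) *\<^sub>C (\<Sum>m\<le>M. ((- 1) ^ m * of_nat (M choose m)) *\<^sub>C
        phi_W W j (of_nat m - q - 1) 0 (phi_W W i (of_nat M - p - 1 - of_nat m) 0 w))"
proof -
  have "\<exists>M::nat. M > 0 \<and> (\<forall>w e.
       smult2 (pow12 (of_nat M)) (act1 (phi_W W i) (act2 (phi_W W j) (const2 w))) e
       = parity_sign (gpar G i) (gpar G j) *\<^sub>C
         smult2 (pow12 (of_nat M)) (act2 (phi_W W j) (act1 (phi_W W i) (const2 w))) e)"
    using comm_phi i j unfolding weak_commutativity_phi_def by blast
  then obtain M where M: "\<And>w e.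
       smult2 (pow12 (of_nat M)) (act1 (phi_W W i) (act2 (phi_W W j) (const2 w))) e
       = parity_sign (gpar G i) (gpar G j) *\<^sub>C
         smult2 (pow12 (of_nat M)) (act2 (phi_W W j) (act1 (phi_W W i) (const2 w))) e" by blast
  have 0: "phi_W W l n k 0 = 0" if "l \<in> I_set G" for l n k by (rule clinear_0[OF phi_lin[OF that]])
  have ij: "lf (act1 (phi_W W i) (act2 (phi_W W j) (const2 w))) a b = phi_W W i (- a - 1) 0 (phi_W W j (- b - 1) 0 w)" for w a b
  proof -
    have iff: "a + n + 1 = 0 \<longleftrightarrow> n = - a - 1" for n by (simp add: eq_diff_eq eq_neg_iff_add_eq_0 add_ac)
    show ?thesis
      by (subst lf_act1, rule 0[OF i], subst Sum_any_single[of "- a - 1"])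
         (auto simp: lf_act2_const2[of "phi_W W j", OF 0[OF j]] 0[OF i] iff)
  qed
  have ji: "lf (act2 (phi_W W j) (act1 (phi_W W i) (const2 w))) a b = phi_W W j (- b - 1) 0 (phi_W W i (- a - 1) 0 w)" for w a b
  proof -
    have iff: "b + n + 1 = 0 \<longleftrightarrow> n = - b - 1" for n by (simp add: eq_diff_eq eq_neg_iff_add_eq_0 add_ac)
    show ?thesis
      by (subst lf_act2, rule 0[OF j], subst Sum_any_single[of "- b - 1"])
         (auto simp: lf_act1_const2[of "phi_W W i", OF 0[OF i]] 0[OF j] iff)
  qed
  have sm: "lf (smult2 (pow12 (of_nat M)) F) p q
      = (\<Sum>m\<le>M. ((- 1) ^ m * of_nat (M choose m)) *\<^sub>C lf F (p - of_nat M + of_nat m) (q - of_nat m))" for F :: "'w ser2" and p q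
  proof -
    have "lf (smult2 (pow12 (of_nat M)) F) p q
        = Sum_any (\<lambda>m. ((- 1) ^ m * of_nat (M choose m)) *\<^sub>C lf F (p - of_nat M + of_nat m) (q - of_nat m))"
      unfolding lf_smult2[OF series_along_pow12, simplified] fps_pow1m_def by (simp add: binomial_gbinomial)
    also have "\<dots> = (\<Sum>m<Suc M. ((- 1) ^ m * of_nat (M choose m)) *\<^sub>C lf F (p - of_nat M + of_nat m) (q - of_nat m))"
      by (rule Sum_any_lessThan) (simp add: binomial_eq_0)
    finally show ?thesis by (simp only: lessThan_Suc_atMost)
  qed
  have "lf (smult2 (pow12 (of_nat M)) (act1 (phi_W W i) (act2 (phi_W W j) (const2 w)))) p q
     = parity_sign (gpar G i) (gpar G j) *\<^sub>C
       lf (smult2 (pow12 (of_nat M)) (act2 (phi_W W j) (act1 (phi_W W i) (const2 w)))) p q" for w p q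
    unfolding lf_def by (rule M)
  then show ?thesis
    unfolding sm ij ji by (intro exI[of _ M] allI) (simp add: algebra_simps)
qed

end

section \<open>Weights\<close>

context twisted_data
begin

lemma gvec_truncation: "\<exists>B. \<forall>J\<ge>B. \<forall>t. Y_op V ((N ^^ t) (gvec G i)) (int J - p - 1) v = 0"
proof -
  let ?u = "gvec G i"
  obtain R0 where R0: "0 < R0" "\<And>r. R0 \<le> r \<Longrightarrow> (N ^^ r) ?u = 0" using alive_bound by blast
  have "\<forall>t. \<exists>b. \<forall>n\<ge>b. Y_op V ((N ^^ t) ?u) n v = 0" using Y_truncation by (rule allI)
  from choice[OF this] obtain b where b: "\<And>t n. b t \<le> n \<Longrightarrow> Y_op V ((N ^^ t) ?u) n v = 0" by (elim exE) blast
  have "Y_op V ((N ^^ t) ?u) (int J - p - 1) v = 0" if "nat (Max (b ` {..<R0}) + p + 1) \<le> J" "t < R0" for J t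
  proof (rule b)
    have "b t \<le> Max (b ` {..<R0})" using that(2) by (intro Max_ge) auto
    then show "b t \<le> int J - p - 1" using that(1) by linarith
  qed
  moreover have "Y_op V ((N ^^ t) ?u) n v = 0" if "\<not> t < R0" for t n
    using R0(2)[of t] that clinear_0[OF Y_lin1] by simp
  ultimately show ?thesis by blast
qed

text \<open>The ranges may be enlarged at will, so that both sides can later be cut off at bounds
  dictated by other series. The exponent \<open>M\<close> depends on the two fields only, the bounds
  also on the vector and the powers of the variables.\<close>

lemma psi_swap_finite:
  assumes i: "i \<in> I_set G" and a: "a \<in> A_set W"
  shows "\<exists>M::nat. \<forall>v p q. \<exists>T0 B0. \<forall>T\<ge>T0. \<forall>B\<ge>B0. let A = gal G i + of_nat M in
    (\<Sum>t<T. \<Sum>m<B. (fps_nth (kerL A t) m / fact t) *\<^sub>C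
        phiN i t (A - of_int p - 1 - of_nat m) (psi_W W a (of_nat m - q - 1) 0 v))
    = parity_sign (gpar G i) (psi_par W a) *\<^sub>C
      (\<Sum>t<T. \<Sum>m<B. (fps_nth (kerR A t) m / fact t) *\<^sub>C
        psi_W W a (A - q - 1 - of_nat m) 0 (Y_op V ((N ^^ t) (gvec G i)) (int m - p - 1) v))"
proof -
  obtain M where M: "\<forall>v p q. let A = gal G i + of_nat M in
    Sum_any (\<lambda>t. (1 / fact t) *\<^sub>C fconv (kerL A t)
        (\<lambda>J. phiN i t (A - of_int p - 1 - of_nat J) (psi_W W a (of_nat J - q - 1) 0 v)) 0)
    = parity_sign (gpar G i) (psi_par W a) *\<^sub>C
      Sum_any (\<lambda>t. (1 / fact t) *\<^sub>C fconv (kerR A t)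
        (\<lambda>J. psi_W W a (A - q - 1 - of_nat J) 0 (Y_op V ((N ^^ t) (gvec G i)) (int J - p - 1) v)) 0)"
    using psi_swap[OF i a] by (elim exE)
  obtain R0 where R0: "0 < R0" "\<And>r. R0 \<le> r \<Longrightarrow> (N ^^ r) (gvec G i) = 0" using alive_bound by blast
  show ?thesis
  proof (rule exI[of _ M], intro allI)
    fix v p q
    define A where "A = gal G i + of_nat M"
    obtain b where b: "\<And>n. b < Re n \<Longrightarrow> psi_W W a n 0 v = 0" using psi_truncation[OF a] by blast
    obtain B1 :: nat where B1: "b + Re q + 1 < real B1" using reals_Archimedean2 by blast
    obtain B2 where B2: "\<And>J t. B2 \<le> J \<Longrightarrow> Y_op V ((N ^^ t) (gvec G i)) (int J - p - 1) v = 0"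
      using gvec_truncation by blast
    have "(\<Sum>t<T. \<Sum>m<B. (fps_nth (kerL A t) m / fact t) *\<^sub>C
        phiN i t (A - of_int p - 1 - of_nat m) (psi_W W a (of_nat m - q - 1) 0 v))
      = parity_sign (gpar G i) (psi_par W a) *\<^sub>C
      (\<Sum>t<T. \<Sum>m<B. (fps_nth (kerR A t) m / fact t) *\<^sub>C
        psi_W W a (A - q - 1 - of_nat m) 0 (Y_op V ((N ^^ t) (gvec G i)) (int m - p - 1) v))"
      if T: "R0 \<le> T" and B: "max B1 B2 \<le> B" for T B
    proof -
      have 1: "phiN i t (A - of_int p - 1 - of_nat J) (psi_W W a (of_nat J - q - 1) 0 v) = 0"
        if "B \<le> J" for t J
      proof -
        have "psi_W W a (of_nat J - q - 1) 0 v = 0" by (rule b) (use B1 B that in simp)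
        then show ?thesis by (simp add: clinear_0[OF phiN_lin[OF i]])
      qed
      have 2: "psi_W W a (A - q - 1 - of_nat J) 0 (Y_op V ((N ^^ t) (gvec G i)) (int J - p - 1) v) = 0"
        if "B \<le> J" for t J
        using B2[of J t] that B by (simp add: clinear_0[OF psi_lin[OF a]])
      have "Sum_any (\<lambda>t. (1 / fact t) *\<^sub>C fconv (kerL A t)
        (\<lambda>J. phiN i t (A - of_int p - 1 - of_nat J) (psi_W W a (of_nat J - q - 1) 0 v)) 0)
        = (\<Sum>t<T. (1 / fact t) *\<^sub>C fconv (kerL A t)
        (\<lambda>J. phiN i t (A - of_int p - 1 - of_nat J) (psi_W W a (of_nat J - q - 1) 0 v)) 0)"
        by (rule Sum_any_lessThan) (use T R0 in \<open>simp add: phiN_zero[OF i] fconv_def\<close>)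
      moreover have "Sum_any (\<lambda>t. (1 / fact t) *\<^sub>C fconv (kerR A t)
        (\<lambda>J. psi_W W a (A - q - 1 - of_nat J) 0 (Y_op V ((N ^^ t) (gvec G i)) (int J - p - 1) v)) 0)
        = (\<Sum>t<T. (1 / fact t) *\<^sub>C fconv (kerR A t)
        (\<lambda>J. psi_W W a (A - q - 1 - of_nat J) 0 (Y_op V ((N ^^ t) (gvec G i)) (int J - p - 1) v)) 0)"
        by (rule Sum_any_lessThan)
           (use T R0 in \<open>simp add: clinear_0[OF Y_lin1] clinear_0[OF psi_lin[OF a]] fconv_def\<close>)
      ultimately show ?thesis
        using M[THEN spec[of _ v], THEN spec[of _ p], THEN spec[of _ q], unfolded Let_def, folded A_def]
        by (simp add: fconv_sum[of B, OF 1] fconv_sum[of B, OF 2] scaleC_sum_right)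
    qed
    then show "\<exists>T0 B0. \<forall>T\<ge>T0. \<forall>B\<ge>B0. let A = gal G i + of_nat M in
    (\<Sum>t<T. \<Sum>m<B. (fps_nth (kerL A t) m / fact t) *\<^sub>C
        phiN i t (A - of_int p - 1 - of_nat m) (psi_W W a (of_nat m - q - 1) 0 v))
    = parity_sign (gpar G i) (psi_par W a) *\<^sub>C
      (\<Sum>t<T. \<Sum>m<B. (fps_nth (kerR A t) m / fact t) *\<^sub>C
        psi_W W a (A - q - 1 - of_nat m) 0 (Y_op V ((N ^^ t) (gvec G i)) (int m - p - 1) v))"
      unfolding Let_def A_def by blast
  qed
qed

text \<open>Since \<open>x d/dx\<close> mixes neighbouring powers of the logarithm, \<open>(L0 - e)
  phi_(n,k) w = phi_(n,k) (L0 - c) w + (k + 1) phi_(n,k+1) w\<close>. The powers of the logarithm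
  are bounded by \<open>R\<close>, so each step lowers \<open>K + (R - k)\<close>.\<close>

lemma phi_W_weight:
  assumes i: "i \<in> I_set G" and w: "w \<in> W_wt W c"
  shows "phi_W W i n k w \<in> W_wt W (c + of_real (gwt G i) - n - 1)"
proof -
  define e where "e = c + of_real (gwt G i) - n - 1"
  obtain R where R: "0 < R" "\<And>r. R \<le> r \<Longrightarrow> (N ^^ r) (gvec G i) = 0" using alive_bound by blast
  have z: "phi_W W i n k w = 0" if "R \<le> k" for k w
    unfolding phi_W_phiN[OF i, of n k] using R that by (simp add: phiN_zero[OF i])
  have step: "shiftop (L0_W W) e (phi_W W i n k w)
      = phi_W W i n k (shiftop (L0_W W) c w) + of_nat (k + 1) *\<^sub>C phi_W W i n (k + 1) w" for k w
  proof -
    have "\<forall>i\<in>I_set G. \<forall>n k w. L0_W W (phi_W W i n k w) - phi_W W i n k (L0_W W w)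
       = xddx (\<lambda>n k. phi_W W i n k w) n k + complex_of_real (gwt G i) *\<^sub>C phi_W W i n k w"
      using weight unfolding weight_property_def by (elim conjE)
    then have "L0_W W (phi_W W i n k w) - phi_W W i n k (L0_W W w)
       = xddx (\<lambda>n k. phi_W W i n k w) n k + complex_of_real (gwt G i) *\<^sub>C phi_W W i n k w"
      using i by blast
    then have "L0_W W (phi_W W i n k w) = phi_W W i n k (L0_W W w) +
       ((- n - 1) *\<^sub>C phi_W W i n k w + of_nat (k + 1) *\<^sub>C phi_W W i n (k + 1) w + complex_of_real (gwt G i) *\<^sub>C phi_W W i n k w)"
      unfolding xddx_def diff_eq_eq by (simp only: add.commute)
    moreover have "e = c + ((- n - 1) + of_real (gwt G i))" by (simp add: e_def)
    ultimately show ?thesis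
      by (simp only: clinear_diff[OF phi_lin[OF i]] clinear_scale[OF phi_lin[OF i]] scaleC_add_left) simp
  qed
  note lin = clinear_funpow[OF clinear_shiftop[OF L0_lin, of e]]
  have "(shiftop (L0_W W) c ^^ K) w = 0 \<Longrightarrow> (shiftop (L0_W W) e ^^ (K + (R - k))) (phi_W W i n k w) = 0" for K k w
  proof (induction "K + (R - k)" arbitrary: K k w)
    case 0
    then show ?case by (simp add: z)
  next
    case (Suc m)
    have 1: "(shiftop (L0_W W) e ^^ m) (phi_W W i n k (shiftop (L0_W W) c w)) = 0"
    proof (cases K)
      case 0
      then have "w = 0" using Suc.prems by simp
      then show ?thesis
        by (simp add: clinear_0[OF L0_lin] clinear_0[OF phi_lin[OF i]] clinear_0[OF lin])
    next
      case (Suc K')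
      then have "(shiftop (L0_W W) c ^^ K') (shiftop (L0_W W) c w) = 0"
        using Suc.prems by (simp only: funpow_Suc_right o_apply)
      then show ?thesis using Suc.hyps(1)[of K' k] Suc.hyps(2) Suc by simp
    qed
    have 2: "(shiftop (L0_W W) e ^^ m) (phi_W W i n (k + 1) w) = 0"
    proof (cases "R \<le> k")
      case True
      then show ?thesis by (simp add: z clinear_0[OF lin])
    next
      case False
      then have "m = K + (R - (k + 1))" using Suc.hyps(2) by simp
      then show ?thesis using Suc.hyps(1)[of K "k + 1" w] Suc.prems by simp
    qed
    have "(shiftop (L0_W W) e ^^ Suc m) (phi_W W i n k w)
        = (shiftop (L0_W W) e ^^ m) (shiftop (L0_W W) e (phi_W W i n k w))"
      by (simp only: funpow_Suc_right o_apply)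
    also have "\<dots> = 0"
      unfolding step clinear_add[OF lin] clinear_scale[OF lin] 1 2 by simp
    finally show ?case using Suc.hyps(2) by simp
  qed
  then show ?thesis
    using w unfolding W_wt_eigen gen_eigenspace_iff e_def[symmetric] by blast
qed

lemma phiN_weight:
  assumes i: "i \<in> I_set G" and w: "w \<in> W_wt W c"
  shows "phiN i r n w \<in> W_wt W (c + of_real (gwt G i) - n - 1)"
proof (cases "alive i r")
  case True
  then show ?thesis
    using phi_W_weight[OF alive_chain(1)[OF i True] w, of n 0] alive_chain(4)[OF i True]
    by (simp add: phiN_chain[OF i])
qed (simp add: phiN_chain[OF i] csubspace_0[OF W_wt_subspace])

section \<open>Weights of the coefficients of twist fields\<close>

lemma psi_vac_zero:
  assumes "a \<in> A_set W" "k \<noteq> 0 \<or> - n - 1 \<notin> \<nat>"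
  shows "psi_W W a n k (vac V) = 0"
  using vacuum assms unfolding vacuum_property_def by blast

text \<open>On the vacuum \<open>L_V(-1)\<close> and the logarithms drop out of the derivative
  property. Iteration gives \<open>psi_(-1-j) 1 = L(-1)^j / j! psi_(-1) 1\<close>.\<close>

lemma psi_vac_step:
  assumes a: "a \<in> A_set W"
  shows "of_nat (Suc j) *\<^sub>C psi_W W a (- 1 - of_nat (Suc j)) 0 (vac V) = Lm1_W W (psi_W W a (- 1 - of_nat j) 0 (vac V))"
proof -
  have "\<forall>a\<in>A_set W. \<forall>n k v. Lm1_W W (psi_W W a n k v) - psi_W W a n k (Lm1_V V v)
       = ddx (\<lambda>n k. psi_W W a n k v) n k"
    using deriv unfolding derivative_property_def by (elim conjE)
  then have "Lm1_W W (psi_W W a (- 1 - of_nat j) 0 (vac V)) - psi_W W a (- 1 - of_nat j) 0 (Lm1_V V (vac V))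
       = ddx (\<lambda>n k. psi_W W a n k (vac V)) (- 1 - of_nat j) 0" using a by blast
  moreover have "Lm1_V V (vac V) = 0"
  proof -
    have "\<forall>n v. Y_op V (vac V) n v = (if n = - 1 then v else 0)"
      using vsa unfolding vertex_superalgebra_def by (elim conjE)
    then show ?thesis by (simp add: Lm1_V_def)
  qed
  ultimately have "Lm1_W W (psi_W W a (- 1 - of_nat j) 0 (vac V))
      = (- (- 1 - of_nat j)) *\<^sub>C psi_W W a (- 1 - of_nat j - 1) 0 (vac V)"
    by (simp only: ddx_def clinear_0[OF psi_lin[OF a]] psi_vac_zero[OF a, of 1] diff_zero
        add_0_left one_neq_zero complex_vector.scale_zero_right add_0_right simp_thms not_False_eq_True)
  moreover have "- (- 1 - of_nat j) = (of_nat (Suc j) :: complex)" "- 1 - of_nat j - 1 = (- 1 - of_nat (Suc j) :: complex)"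
    by simp_all
  ultimately show ?thesis by simp
qed

lemma L0_V_vac: "L0_V V (vac V) = 0"
  using V_gr_V_wt[OF vsa_vac] by (simp add: V_wt_iff)

text \<open>On the vacuum \<open>L_V(0)\<close> and the logarithms vanish, so \<open>x d/dx\<close>
  is multiplication by \<open>j\<close> on the coefficient of \<open>x^j\<close>.\<close>

lemma psi_vac_L0:
  assumes a: "a \<in> A_set W"
  shows "\<exists>h. (\<forall>j. L0_W W (psi_W W a (- 1 - of_nat j) 0 (vac V)) = (of_nat j + h) *\<^sub>C psi_W W a (- 1 - of_nat j) 0 (vac V)) \<or>
    (\<exists>b\<in>A_set W. \<forall>j. L0_W W (psi_W W a (- 1 - of_nat j) 0 (vac V))
       = (of_nat j + h) *\<^sub>C psi_W W a (- 1 - of_nat j) 0 (vac V) + psi_W W b (- 1 - of_nat j) 0 (vac V))"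
proof -
  have all: "\<forall>a\<in>A_set W. \<exists>h.
       if \<forall>n k v. L0_W_nil W (psi_W W a n k v) = 0
       then \<forall>n k v. L0_W W (psi_W W a n k v) - psi_W W a n k (L0_V V v)
         = xddx (\<lambda>n k. psi_W W a n k v) n k + h *\<^sub>C psi_W W a n k v
       else \<exists>b\<in>A_set W. \<forall>n k v. L0_W W (psi_W W a n k v) - psi_W W a n k (L0_V V v)
         = xddx (\<lambda>n k. psi_W W a n k v) n k + h *\<^sub>C psi_W W a n k v + psi_W W b n k v"
    using weight unfolding weight_property_def by (elim conjE)
  have if_disj: "P \<or> Q" if "if R then P else Q" for P Q R using that by (simp split: if_splits)
  have "\<exists>h. (\<forall>n k v. L0_W W (psi_W W a n k v) - psi_W W a n k (L0_V V v)
         = xddx (\<lambda>n k. psi_W W a n k v) n k + h *\<^sub>C psi_W W a n k v) \<or>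
      (\<exists>b\<in>A_set W. \<forall>n k v. L0_W W (psi_W W a n k v) - psi_W W a n k (L0_V V v)
         = xddx (\<lambda>n k. psi_W W a n k v) n k + h *\<^sub>C psi_W W a n k v + psi_W W b n k v)"
    using bspec[OF all a] by (rule ex_forward) (erule if_disj)
  then obtain h where h: "(\<forall>n k v. L0_W W (psi_W W a n k v) - psi_W W a n k (L0_V V v)
         = xddx (\<lambda>n k. psi_W W a n k v) n k + h *\<^sub>C psi_W W a n k v) \<or>
      (\<exists>b\<in>A_set W. \<forall>n k v. L0_W W (psi_W W a n k v) - psi_W W a n k (L0_V V v)
         = xddx (\<lambda>n k. psi_W W a n k v) n k + h *\<^sub>C psi_W W a n k v + psi_W W b n k v)"
    by (elim exE)
  have x: "xddx (\<lambda>n k. psi_W W a n k (vac V)) (- 1 - of_nat j) 0 + h *\<^sub>C psi_W W a (- 1 - of_nat j) 0 (vac V)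
     = (of_nat j + h) *\<^sub>C psi_W W a (- 1 - of_nat j) 0 (vac V)" for j
    by (simp add: xddx_def psi_vac_zero[OF a] scaleC_add_left)
  have l: "L0_W W (psi_W W a n k (vac V)) - psi_W W a n k (L0_V V (vac V)) = L0_W W (psi_W W a n k (vac V))" for n k
    by (simp add: L0_V_vac clinear_0[OF psi_lin[OF a]])
  from h show ?thesis
  proof
    assume "\<forall>n k v. L0_W W (psi_W W a n k v) - psi_W W a n k (L0_V V v)
         = xddx (\<lambda>n k. psi_W W a n k v) n k + h *\<^sub>C psi_W W a n k v"
    then have "L0_W W (psi_W W a (- 1 - of_nat j) 0 (vac V)) - psi_W W a (- 1 - of_nat j) 0 (L0_V V (vac V))
       = xddx (\<lambda>n k. psi_W W a n k (vac V)) (- 1 - of_nat j) 0 + h *\<^sub>C psi_W W a (- 1 - of_nat j) 0 (vac V)" for j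
      by (elim allE)
    then have "L0_W W (psi_W W a (- 1 - of_nat j) 0 (vac V)) = (of_nat j + h) *\<^sub>C psi_W W a (- 1 - of_nat j) 0 (vac V)" for j
      unfolding l x .
    then show ?thesis by (intro exI[of _ h] disjI1 allI)
  next
    assume "\<exists>b\<in>A_set W. \<forall>n k v. L0_W W (psi_W W a n k v) - psi_W W a n k (L0_V V v)
         = xddx (\<lambda>n k. psi_W W a n k v) n k + h *\<^sub>C psi_W W a n k v + psi_W W b n k v"
    then obtain b where b: "b \<in> A_set W" "\<And>n k v. L0_W W (psi_W W a n k v) - psi_W W a n k (L0_V V v)
         = xddx (\<lambda>n k. psi_W W a n k v) n k + h *\<^sub>C psi_W W a n k v + psi_W W b n k v"
      by blast
    have "L0_W W (psi_W W a (- 1 - of_nat j) 0 (vac V))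
       = (of_nat j + h) *\<^sub>C psi_W W a (- 1 - of_nat j) 0 (vac V) + psi_W W b (- 1 - of_nat j) 0 (vac V)" for j
      using b(2)[of "- 1 - of_nat j" 0 "vac V"] unfolding l x .
    then show ?thesis using b(1) by (intro exI[of _ h] disjI2 bexI[of _ b] allI)
  qed
qed

text \<open>The weights of the various \<open>\<psi>^b\<close> occurring in the \<open>L(0)\<close>-property of \<open>\<psi>^a\<close> are not
  related to each other; on the span of the \<open>\<psi>^b_{-1} 1\<close> the operators \<open>L(-1)^j / j!\<close> shift the weight
  by \<open>j\<close>.\<close>
lemma psi_vac_weight:
  assumes a: "a \<in> A_set W"
  shows "\<exists>c. \<forall>n. psi_W W a n 0 (vac V) \<in> W_wt W (c - n - 1)"
proof -
  let ?S = "cspan ((\<lambda>a. psi_W W a (- 1) 0 (vac V)) ` A_set W)"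
  define D where "D j w = (1 / fact j) *\<^sub>C (Lm1_W W ^^ j) w" for j w
  have Lm1_lin: "clinear (Lm1_W W)" using struct unfolding twist_structure_def by (elim conjE)
  have Dlin: "clinear (D j)" for j
    unfolding D_def[abs_def] by (intro clinear_scaleC clinear_funpow Lm1_lin)
  have D: "psi_W W a (- 1 - of_nat j) 0 (vac V) = D j (psi_W W a (- 1) 0 (vac V))" if "a \<in> A_set W" for a j
  proof (induction j)
    case (Suc j)
    have "of_nat (Suc j) *\<^sub>C psi_W W a (- 1 - of_nat (Suc j)) 0 (vac V)
        = of_nat (Suc j) *\<^sub>C D (Suc j) (psi_W W a (- 1) 0 (vac V))"
      unfolding psi_vac_step[OF that] Suc.IH
      by (simp add: D_def clinear_scale[OF Lm1_lin] field_simps del: of_nat_Suc)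
    then show ?case unfolding complex_vector.scale_cancel_left by (simp del: of_nat_Suc)
  qed (simp add: D_def)
  \<comment> \<open>The correction \<open>y\<close> is zero or the lowest coefficient of another
    twist field, and lies in \<open>?S\<close> in both cases. So \<open>L0\<close> preserves
    \<open>?S\<close>, and \<open>[L0, D j] = j D j\<close> holds on it.\<close>
  have gen: "L0_W W x \<in> ?S \<and> (\<forall>j. L0_W W (D j x) = of_nat j *\<^sub>C D j x + D j (L0_W W x))"
    if "x \<in> (\<lambda>a. psi_W W a (- 1) 0 (vac V)) ` A_set W" for x
  proof -
    obtain a where a: "a \<in> A_set W" "x = psi_W W a (- 1) 0 (vac V)" using \<open>x \<in> _\<close> by blast
    obtain h y where hy: "y \<in> ?S" "\<And>j. L0_W W (D j x) = (of_nat j + h) *\<^sub>C D j x + D j y"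
    proof -
      from psi_vac_L0[OF a(1)] obtain h where "(\<forall>j. L0_W W (psi_W W a (- 1 - of_nat j) 0 (vac V)) = (of_nat j + h) *\<^sub>C psi_W W a (- 1 - of_nat j) 0 (vac V)) \<or>
        (\<exists>b\<in>A_set W. \<forall>j. L0_W W (psi_W W a (- 1 - of_nat j) 0 (vac V))
       = (of_nat j + h) *\<^sub>C psi_W W a (- 1 - of_nat j) 0 (vac V) + psi_W W b (- 1 - of_nat j) 0 (vac V))"
        by (elim exE)
      then show thesis
      proof
        assume "\<forall>j. L0_W W (psi_W W a (- 1 - of_nat j) 0 (vac V)) = (of_nat j + h) *\<^sub>C psi_W W a (- 1 - of_nat j) 0 (vac V)"
        then show thesis
          unfolding D[OF a(1)] a(2)[symmetric]
          by (intro that[of 0 h] complex_vector.span_zero) (simp add: clinear_0[OF Dlin])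
      next
        assume "\<exists>b\<in>A_set W. \<forall>j. L0_W W (psi_W W a (- 1 - of_nat j) 0 (vac V))
       = (of_nat j + h) *\<^sub>C psi_W W a (- 1 - of_nat j) 0 (vac V) + psi_W W b (- 1 - of_nat j) 0 (vac V)"
        then obtain b where b: "b \<in> A_set W" "\<forall>j. L0_W W (psi_W W a (- 1 - of_nat j) 0 (vac V))
       = (of_nat j + h) *\<^sub>C psi_W W a (- 1 - of_nat j) 0 (vac V) + psi_W W b (- 1 - of_nat j) 0 (vac V)"
          by (elim bexE)
        show thesis
        proof (rule that)
          show "psi_W W b (- 1) 0 (vac V) \<in> ?S" using b(1) by (intro complex_vector.span_base) blast
          show "L0_W W (D j x) = (of_nat j + h) *\<^sub>C D j x + D j (psi_W W b (- 1) 0 (vac V))" for j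
            using b(2)[THEN spec[of _ j]] unfolding D[OF a(1)] D[OF b(1)] a(2) .
        qed
      qed
    qed
    have L: "L0_W W x = h *\<^sub>C x + y" using hy(2)[of 0] by (simp add: D_def)
    have xS: "x \<in> ?S" using \<open>x \<in> _\<close> by (rule complex_vector.span_base)
    show ?thesis
    proof (intro conjI allI)
      show "L0_W W x \<in> ?S" unfolding L
        by (intro complex_vector.span_add complex_vector.span_scale xS hy(1))
      show "L0_W W (D j x) = of_nat j *\<^sub>C D j x + D j (L0_W W x)" for j
        unfolding hy(2) L by (simp add: clinear_add[OF Dlin] clinear_scale[OF Dlin] scaleC_add_left add.assoc)
    qed
  qed
  have S: "L0_W W x \<in> ?S" if "x \<in> ?S" for x
    by (rule clinear_cspan_image[OF L0_lin complex_vector.subspace_span _ that]) (use gen in blast)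
  have comm: "L0_W W (D j x) = of_nat j *\<^sub>C D j x + D j (L0_W W x)" if "x \<in> ?S" for j x
  proof -
    have "clinear (\<lambda>x. L0_W W (D j x) - (of_nat j *\<^sub>C D j x + D j (L0_W W x)))"
      by (rule clinear_minus[OF clinear_compose[OF L0_lin Dlin]
          clinear_plus[OF clinear_scaleC[OF Dlin] clinear_compose[OF Dlin L0_lin]]])
    then have "L0_W W (D j x) - (of_nat j *\<^sub>C D j x + D j (L0_W W x)) \<in> {0}"
      by (rule clinear_cspan_image[OF _ csubspace_singleton_0 _ that]) (use gen in simp)
    then show ?thesis by simp
  qed
  have "\<exists>n s \<alpha>. psi_W W a (- 1) 0 (vac V) \<in> W_gr W n s \<alpha>"
    using vacuum a unfolding vacuum_property_def by blast
  then obtain c s \<alpha> where c: "psi_W W a (- 1) 0 (vac V) \<in> W_gr W c s \<alpha>" by (elim exE)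
  have "psi_W W a (- 1) 0 (vac V) \<in> W_wt W c"
    unfolding W_wt_def by (rule complex_vector.span_base) (use c in blast)
  then obtain K where K: "(shiftop (L0_W W) c ^^ K) (psi_W W a (- 1) 0 (vac V)) = 0"
    by (auto simp: W_wt_eigen gen_eigenspace_iff)
  \<comment> \<open>On \<open>?S\<close> the operator \<open>D j\<close> intertwines
    \<open>L0 - c\<close> with \<open>L0 - (c + j)\<close>, so nilpotency on the lowest coefficient
    carries over to all the others.\<close>
  have pow: "(shiftop (L0_W W) (c + of_nat j) ^^ k) (D j x) = D j ((shiftop (L0_W W) c ^^ k) x)
      \<and> (shiftop (L0_W W) c ^^ k) x \<in> ?S" if "x \<in> ?S" for j x k
  proof (induction k)
    case (Suc k)
    let ?y = "(shiftop (L0_W W) c ^^ k) x"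
    have y: "?y \<in> ?S" using Suc by blast
    have "shiftop (L0_W W) c ?y \<in> ?S"
      by (intro complex_vector.span_diff complex_vector.span_scale S y)
    moreover have "shiftop (L0_W W) (c + of_nat j) (D j ?y) = D j (shiftop (L0_W W) c ?y)"
      using comm[OF y, of j]
      by (simp add: clinear_diff[OF Dlin] clinear_scale[OF Dlin] scaleC_add_left)
    ultimately show ?case using Suc by simp
  qed (use that in simp)
  have "psi_W W a n 0 (vac V) \<in> W_wt W (c - n - 1)" for n
  proof (cases "- n - 1 \<in> \<nat>")
    case True
    then obtain j where "- n - 1 = of_nat j" by (auto elim: Nats_cases)
    moreover have "n = - 1 - (- n - 1)" by simp
    ultimately have n: "n = - 1 - of_nat j" by simp
    have "(shiftop (L0_W W) (c + of_nat j) ^^ K) (psi_W W a n 0 (vac V)) = 0"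
      using pow[where x = "psi_W W a (- 1) 0 (vac V)" and j = j and k = K] a
      by (simp add: n D K clinear_0[OF Dlin] complex_vector.span_base)
    then show ?thesis by (auto simp: W_wt_eigen gen_eigenspace_iff n)
  qed (simp add: psi_vac_zero[OF a] csubspace_0[OF W_wt_subspace])
  then show ?thesis by blast
qed

lemma kerR_0_0: "fps_nth (kerR A 0) 0 = exp (pi * \<i> * A)"
  by (simp add: kerR_def fps_pow1m_def)

text \<open>Solve the weak commutativity relation for the coefficient with the lowest power of \<open>x1\<close>.\<close>
lemma psi_weight:
  assumes a: "a \<in> A_set W"
  shows "\<exists>c. \<forall>d \<beta> u. gen_product d \<beta> u \<longrightarrow> (\<forall>n. psi_W W a n 0 u \<in> W_wt W (c + of_real d - n - 1))"
proof -
  obtain c where c: "\<And>n. psi_W W a n 0 (vac V) \<in> W_wt W (c - n - 1)" using psi_vac_weight[OF a] by blast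
  have "gen_product d \<beta> u \<Longrightarrow> psi_W W a n 0 u \<in> W_wt W (c + of_real d - n - 1)" for d \<beta> u n
  proof (induction arbitrary: n rule: gen_product.induct)
    case vac
    show ?case using c by simp
  next
    case (Y d \<beta> u i n0 n)
    note i = Y(2)
    let ?Wt = "\<lambda>p n. W_wt W (c + of_real d + of_real (gwt G i) + of_int p - n - 1)"
    obtain R0 where R0: "0 < R0" "\<And>r. R0 \<le> r \<Longrightarrow> (N ^^ r) (gvec G i) = 0" using alive_bound by blast
    obtain B1 where B1: "\<And>J t. B1 \<le> J \<Longrightarrow> Y_op V ((N ^^ t) (gvec G i)) (int J - 0 - 1) u = 0"
      using gvec_truncation[where i = i and p = 0 and v = u] by blast
    have base: "Y_op V ((N ^^ t) (gvec G i)) (- p - 1) u = 0" if "p \<le> - int B1" for p t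
      using B1[of "nat (- p)" t] that by simp
    \<comment> \<open>The outer induction lowers \<open>p\<close> until the truncation of the fields
      on V makes everything zero; the inner one raises the power \<open>r\<close> of
      \<open>N\<close> up to its nilpotency bound \<open>R0\<close>.\<close>
    have main: "psi_W W a n 0 (Y_op V ((N ^^ r) (gvec G i)) (- p - 1) u) \<in> ?Wt p n" for p n r
    proof (induction "nat (p + int B1)" arbitrary: p n r rule: less_induct)
      case less
      note outer = this
      show ?case
      proof (cases "p \<le> - int B1")
        case True
        then show ?thesis by (simp add: base clinear_0[OF psi_lin[OF a]] csubspace_0[OF W_wt_subspace])
      next
        case False
        show ?thesis
        proof (induction "R0 - r" arbitrary: n r rule: less_induct)
          case less
          note inner = this
          show ?case
          proof (cases "(N ^^ r) (gvec G i) = 0 \<and> r \<noteq> 0")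
            case True
            then show ?thesis
              by (simp add: clinear_0[OF Y_lin1] clinear_0[OF psi_lin[OF a]] csubspace_0[OF W_wt_subspace])
          next
            case False
            then have al: "alive i r" by (auto simp: alive_def)
            let ?j = "(gN G ^^ r) i"
            note j = alive_chain[OF i al]
            obtain M where M: "\<forall>v p q. \<exists>T0 B0. \<forall>T\<ge>T0. \<forall>B\<ge>B0. let A = gal G ?j + of_nat M in
              (\<Sum>t<T. \<Sum>m<B. (fps_nth (kerL A t) m / fact t) *\<^sub>C
                  phiN ?j t (A - of_int p - 1 - of_nat m) (psi_W W a (of_nat m - q - 1) 0 v))
              = parity_sign (gpar G ?j) (psi_par W a) *\<^sub>C
                (\<Sum>t<T. \<Sum>m<B. (fps_nth (kerR A t) m / fact t) *\<^sub>C
                  psi_W W a (A - q - 1 - of_nat m) 0 (Y_op V ((N ^^ t) (gvec G ?j)) (int m - p - 1) v))"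
              using psi_swap_finite[OF j(1) a] by (elim exE)
            define A where "A = gal G ?j + of_nat M"
            \<comment> \<open>With this \<open>q\<close> the term \<open>t = 0\<close>,
              \<open>m = 0\<close> on the right carries exactly the mode \<open>n\<close> of the
              twist field.\<close>
            define q where "q = A - 1 - n"
            let ?s = "parity_sign (gpar G ?j) (psi_par W a)"
            let ?x = "\<lambda>t m. (fps_nth (kerR A t) m / fact t) *\<^sub>C
                  psi_W W a (A - q - 1 - of_nat m) 0 (Y_op V ((N ^^ t) (gvec G ?j)) (int m - p - 1) u)"
            have "\<exists>T0 B0. \<forall>T\<ge>T0. \<forall>B\<ge>B0.
              (\<Sum>t<T. \<Sum>m<B. (fps_nth (kerL A t) m / fact t) *\<^sub>C
                  phiN ?j t (A - of_int p - 1 - of_nat m) (psi_W W a (of_nat m - q - 1) 0 u))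
              = ?s *\<^sub>C (\<Sum>t<T. \<Sum>m<B. ?x t m)"
              using M[THEN spec[of _ u], THEN spec[of _ p], THEN spec[of _ q]] unfolding Let_def A_def[symmetric] .
            then obtain T0 B0 where TB: "\<forall>T\<ge>T0. \<forall>B\<ge>B0.
              (\<Sum>t<T. \<Sum>m<B. (fps_nth (kerL A t) m / fact t) *\<^sub>C
                  phiN ?j t (A - of_int p - 1 - of_nat m) (psi_W W a (of_nat m - q - 1) 0 u))
              = ?s *\<^sub>C (\<Sum>t<T. \<Sum>m<B. ?x t m)"
              by (elim exE)
            define T B where "T = Suc T0" and "B = Suc B0"
            have TB': "(\<Sum>t<T. \<Sum>m<B. (fps_nth (kerL A t) m / fact t) *\<^sub>C
                  phiN ?j t (A - of_int p - 1 - of_nat m) (psi_W W a (of_nat m - q - 1) 0 u))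
              = ?s *\<^sub>C (\<Sum>t<T. \<Sum>m<B. ?x t m)"
              by (rule TB[THEN spec[of _ T], THEN mp, THEN spec[of _ B], THEN mp]) (simp_all add: T_def B_def)
            have "phiN ?j t (A - of_int p - 1 - of_nat m) (psi_W W a (of_nat m - q - 1) 0 u) \<in> ?Wt p n" for t m
            proof -
              have e: "c + of_real d - (of_nat m - q - 1) - 1 + of_real (gwt G ?j) - (A - of_int p - 1 - of_nat m) - 1
                = c + of_real d + of_real (gwt G i) + of_int p - n - 1"
                unfolding j(4) by (simp add: q_def)
              show ?thesis
                using phiN_weight[OF j(1) Y(3)[of "of_nat m - q - 1"], of t "A - of_int p - 1 - of_nat m"]
                unfolding e .
            qed
            then have "?s *\<^sub>C (\<Sum>t<T. \<Sum>m<B. ?x t m) \<in> ?Wt p n"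
              unfolding TB'[symmetric] by (intro csubspace_sum W_wt_subspace csubspace_scale)
            then have tot: "(\<Sum>t<T. \<Sum>m<B. ?x t m) \<in> ?Wt p n"
              by (subst (asm) csubspace_scale_iff[OF W_wt_subspace]) (auto simp: parity_sign_def)
            \<comment> \<open>For \<open>m > 0\<close> the value of \<open>p\<close> drops; for
              \<open>m = 0\<close> and \<open>t > 0\<close> the power of \<open>N\<close> grows. One
              of the two induction hypotheses applies to every term but the one to be
              isolated.\<close>
            have small: "psi_W W a (A - q - 1 - of_nat m) 0 (Y_op V ((N ^^ t) (gvec G ?j)) (int m - p - 1) u) \<in> ?Wt p n"
              if "t \<noteq> 0 \<or> m \<noteq> 0" for t m
            proof -
              have e: "A - q - 1 - of_nat m = n - of_nat m" by (simp add: q_def)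
              have e2: "int m - p - 1 = - (p - int m) - 1" by simp
              have e3: "(N ^^ t) (gvec G ?j) = (N ^^ (t + r)) (gvec G i)" by (simp add: j(2) funpow_add)
              have e4: "c + of_real d + of_real (gwt G i) + of_int (p - int m) - (n - of_nat m) - 1
                 = c + of_real d + of_real (gwt G i) + of_int p - n - 1" by simp
              show ?thesis
              proof (cases "m = 0")
                case False
                have "nat (p - int m + int B1) < nat (p + int B1)"
                  using False \<open>\<not> p \<le> - int B1\<close> by simp
                from outer[OF this, of "n - of_nat m" "t + r"] show ?thesis unfolding e e2 e3 e4 .
              next
                case True
                then have t: "t \<noteq> 0" using that by simp
                show ?thesis
                proof (cases "R0 \<le> r")
                  case True
                  then have "(N ^^ (t + r)) (gvec G i) = 0" by (intro R0(2)) simp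
                  then show ?thesis unfolding e3
                    by (simp add: clinear_0[OF Y_lin1] clinear_0[OF psi_lin[OF a]] csubspace_0[OF W_wt_subspace])
                next
                  case False
                  then have "R0 - (t + r) < R0 - r" using t by simp
                  from inner[OF this, of n] show ?thesis unfolding e e3 using \<open>m = 0\<close> by simp
                qed
              qed
            qed
            let ?R = "(\<Sum>m<B0. ?x 0 (Suc m)) + (\<Sum>t<T0. \<Sum>m<B. ?x (Suc t) m)"
            have "(\<Sum>t<T. \<Sum>m<B. ?x t m) = ?x 0 0 + ?R"
              unfolding T_def B_def sum.lessThan_Suc_shift[of _ T0] sum.lessThan_Suc_shift[of "?x 0" B0]
              by (simp only: add.assoc)
            then have "?x 0 0 = (\<Sum>t<T. \<Sum>m<B. ?x t m) - ?R" by (simp only: add_diff_cancel_right')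
            also have "\<dots> \<in> ?Wt p n"
              by (intro csubspace_diff[OF W_wt_subspace tot] csubspace_add csubspace_sum W_wt_subspace csubspace_scale small) auto
            finally have "?x 0 0 \<in> ?Wt p n" .
            \<comment> \<open>The isolated term has the coefficient \<open>exp (pi i A)\<close>,
              which is invertible.\<close>
            then have "psi_W W a (A - q - 1 - of_nat 0) 0 (Y_op V ((N ^^ 0) (gvec G ?j)) (int 0 - p - 1) u) \<in> ?Wt p n"
              by (subst (asm) csubspace_scale_iff[OF W_wt_subspace]) (simp_all only: kerR_0_0, simp)
            then show ?thesis by (simp add: q_def j(2))
          qed
        qed
      qed
    qed
    have "c + complex_of_real (d + gwt G i - of_int n0 - 1) - n - 1
        = c + of_real d + of_real (gwt G i) + of_int (- n0 - 1) - n - 1" by simp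
    then show ?case using main[of n 0 "- n0 - 1"] by simp
  qed
  then show ?thesis by blast
qed

end

section \<open>Multivariable series\<close>

text \<open>A series in the variables \<open>x_j\<close> whose coefficients depend on a multi-index \<open>r\<close>: the value at
  \<open>e\<close> and \<open>r\<close> is the coefficient of \<open>\<Prod> x_j^(e j)\<close>. The multi-index records the powers of \<open>N_g\<close>
  applied to the individual fields.\<close>
type_synonym mser = "(nat \<Rightarrow> int) \<Rightarrow> (nat \<Rightarrow> nat) \<Rightarrow> complex"

definition mv :: "nat \<Rightarrow> int \<Rightarrow> (nat \<Rightarrow> int) \<Rightarrow> nat \<Rightarrow> int"
  where "mv i m e = e(i := e i + m)"

definition up :: "nat \<Rightarrow> nat \<Rightarrow> (nat \<Rightarrow> nat) \<Rightarrow> nat \<Rightarrow> nat"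
  where "up l s r = r(l := r l + s)"

lemma mv_apply: "mv i m e k = e k + (if k = i then m else 0)"
  by (simp add: mv_def)

lemma mv_mv [simp]: "mv i a (mv i b e) = mv i (a + b) e"
  by (simp add: mv_def add_ac)

lemma mv_0 [simp]: "mv i 0 e = e"
  by (simp add: mv_def)

lemma mv_commute: "mv i a (mv j b e) = mv j b (mv i a e)"
  by (rule ext) (simp only: mv_apply add_ac)

lemma up_up [simp]: "up l a (up l b r) = up l (a + b) r"
  by (simp add: up_def add_ac)

lemma up_0 [simp]: "up l 0 r = r"
  by (simp add: up_def)

lemma up_commute: "up l a (up k b r) = up k b (up l a r)"
  by (auto simp: up_def fun_eq_iff)

lemma sum_mv: "finite A \<Longrightarrow> sum (mv i m e) A = sum e A + (if i \<in> A then m else 0)"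
  by (induction A rule: finite_induct) (auto simp: mv_def)

text \<open>The exponent whose coefficient reaches \<open>e\<close> under multiplication by
  \<open>(x_j / x_i)^m\<close>.\<close>

definition mvs :: "nat \<Rightarrow> nat \<Rightarrow> nat \<Rightarrow> (nat \<Rightarrow> int) \<Rightarrow> nat \<Rightarrow> int"
  where "mvs i j m e = mv i (int m) (mv j (- int m) e)"

lemma mvs_mvs: "mvs i j a (mvs i j b e) = mvs i j (a + b) e"
  by (rule ext) (simp add: mvs_def mv_apply)

lemma mvs_0 [simp]: "mvs i j 0 e = e"
  by (simp add: mvs_def)

lemma mvs_commute: "mvs i j a (mvs i' j' b e) = mvs i' j' b (mvs i j a e)"
  by (rule ext) (simp only: mvs_def mv_apply add_ac)

lemma mvs_mv: "mvs i j a (mv k b e) = mv k b (mvs i j a e)"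
  by (rule ext) (simp only: mvs_def mv_apply add_ac)

text \<open>Multiplication by \<open>\<Sum> b s $ m (x_j / x_i)^m T_l^s\<close>, where \<open>T_l\<close> raises the \<open>l\<close>-th entry of the
  multi-index.\<close>
definition opr :: "(nat \<Rightarrow> complex fps) \<Rightarrow> nat \<Rightarrow> nat \<Rightarrow> nat \<Rightarrow> mser \<Rightarrow> mser"
  where "opr b i j l D e r = Sum_any (\<lambda>s. Sum_any (\<lambda>m. fps_nth (b s) m * D (mvs i j m e) (up l s r)))"

text \<open>Multiplication by \<open>x_i - x_j\<close>\<close>
definition pd :: "nat \<Rightarrow> nat \<Rightarrow> mser \<Rightarrow> mser"
  where "pd i j D e r = D (mv i (- 1) e) r - D (mv j (- 1) e) r"

definition shx :: "nat \<Rightarrow> mser \<Rightarrow> mser"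
  where "shx i D e r = D (mv i (- 1) e) r"

text \<open>The truncation natural for the order \<open>w\<close>: fields act from the right, so
  every suffix has degree bounded below, while the functional bounds the total degree above. The
  same constant bounds the powers of \<open>N_g\<close>.\<close>

definition bounded_by :: "nat list \<Rightarrow> int \<Rightarrow> mser \<Rightarrow> bool"
  where "bounded_by w c D \<longleftrightarrow> (\<forall>e r. D e r \<noteq> 0 \<longrightarrow> (\<forall>j. j \<notin> set w \<longrightarrow> e j = 0) \<and>
    (\<forall>j\<in>set w. int (r j) \<le> c) \<and> sum e (set w) \<le> c \<and> (\<forall>xs ys. w = xs @ ys \<longrightarrow> - c \<le> sum e (set ys)))"

definition trunc :: "nat list \<Rightarrow> mser \<Rightarrow> bool"
  where "trunc w D \<longleftrightarrow> (\<exists>c. bounded_by w c D)"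

definition before :: "nat list \<Rightarrow> nat \<Rightarrow> nat \<Rightarrow> bool"
  where "before w i j \<longleftrightarrow> distinct w \<and> (\<exists>xs ys zs. w = xs @ i # ys @ j # zs)"

lemma before_set: "before w i j \<Longrightarrow> i \<in> set w \<and> j \<in> set w \<and> i \<noteq> j"
  by (auto simp: before_def)

text \<open>For \<open>i\<close> before \<open>j\<close> a suffix containing \<open>i\<close> also
  contains \<open>j\<close>, so multiplication by a power of \<open>x_j / x_i\<close> draws on
  exponents with no larger suffix degrees. This makes \<open>opr\<close> a finite sum on truncated
  series.\<close>

lemma sum_mvs:
  assumes "before w i j" "w = xs @ ys"
  shows "sum (mvs i j m e) (set ys) = sum e (set ys) - (if j \<in> set ys \<and> i \<notin> set ys then int m else 0)"
proof -
  obtain us vs zs where w: "w = us @ i # vs @ j # zs" "distinct w" using assms(1) by (auto simp: before_def)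
  have "i \<in> set ys \<longrightarrow> j \<in> set ys"
  proof
    assume "i \<in> set ys"
    then obtain ps qs where ys: "ys = ps @ i # qs" by (meson split_list)
    have "(xs @ ps) @ i # qs = us @ i # vs @ j # zs" using w(1) assms(2) ys by simp
    moreover have "i \<notin> set (xs @ ps)" "i \<notin> set qs" using w(2) assms(2) ys by auto
    ultimately have "qs = vs @ j # zs"
      using append_Cons_eq_iff[of i "xs @ ps" qs us "vs @ j # zs"] by blast
    then show "j \<in> set ys" using ys by simp
  qed
  then show ?thesis by (auto simp: mvs_def sum_mv)
qed

lemma sum_mvs_le: "before w i j \<Longrightarrow> w = xs @ ys \<Longrightarrow> sum (mvs i j m e) (set ys) \<le> sum e (set ys)"
  by (simp add: sum_mvs)

lemma sum_mvs_total: "before w i j \<Longrightarrow> sum (mvs i j m e) (set w) = sum e (set w)"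
  using sum_mvs[of w i j "[]" w m e] before_set[of w i j] by simp

text \<open>For \<open>i\<close> before \<open>j\<close> the suffix starting at \<open>j\<close>
  loses exactly the degree \<open>m\<close> under \<open>mvs i j m\<close>; together with the lower
  bound this limits \<open>m\<close>.\<close>

definition tail_sum :: "nat list \<Rightarrow> nat \<Rightarrow> (nat \<Rightarrow> int) \<Rightarrow> int"
  where "tail_sum w j e = sum e (set (dropWhile (\<lambda>x. x \<noteq> j) w))"

lemma tail_decomp: "\<exists>xs. w = xs @ dropWhile (\<lambda>x. x \<noteq> j) w"
  by (metis takeWhile_dropWhile_id)

lemma tail_sum_mvs:
  assumes "before w i j"
  shows "tail_sum w j (mvs i j m e) = tail_sum w j e - int m"
proof -
  obtain us vs zs where w: "w = us @ i # vs @ j # zs" "distinct w" using assms by (auto simp: before_def)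
  have "dropWhile (\<lambda>x. x \<noteq> j) ((us @ i # vs) @ j # zs) = dropWhile (\<lambda>x. x \<noteq> j) (j # zs)"
    by (rule dropWhile_append2) (use w(2)[unfolded w(1)] in auto)
  then have "dropWhile (\<lambda>x. x \<noteq> j) w = j # zs" unfolding w(1) by simp
  moreover obtain xs where "w = xs @ dropWhile (\<lambda>x. x \<noteq> j) w" by (rule exE[OF tail_decomp])
  ultimately show ?thesis
    using sum_mvs[OF assms, of xs "j # zs" m e] w(2)[unfolded w(1)] unfolding tail_sum_def by simp
qed

lemma tail_sum_mvs_le: "before w i' j' \<Longrightarrow> tail_sum w j (mvs i' j' m e) \<le> tail_sum w j e"
proof -
  assume bf: "before w i' j'"
  obtain xs where "w = xs @ dropWhile (\<lambda>x. x \<noteq> j) w" by (rule exE[OF tail_decomp])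
  then show ?thesis unfolding tail_sum_def by (rule sum_mvs_le[OF bf])
qed

lemma bounded_tail: "bounded_by w c D \<Longrightarrow> D e r \<noteq> 0 \<Longrightarrow> - c \<le> tail_sum w j e"
proof -
  assume D: "bounded_by w c D" "D e r \<noteq> 0"
  obtain xs where "w = xs @ dropWhile (\<lambda>x. x \<noteq> j) w" by (rule exE[OF tail_decomp])
  then show ?thesis using D unfolding tail_sum_def bounded_by_def by blast
qed

lemma bounded_zero_m:
  assumes "bounded_by w c D" "before w i j" "c + tail_sum w j e < int m"
  shows "D (mvs i j m e) r = 0"
proof (rule ccontr)
  assume "\<not> ?thesis"
  then have "- c \<le> tail_sum w j (mvs i j m e)" by (rule bounded_tail[OF assms(1)])
  then show False using tail_sum_mvs[OF assms(2), of m e] assms(3) by simp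
qed

lemma bounded_zero_s:
  assumes "bounded_by w c D" "l \<in> set w" "c < int s"
  shows "D e (up l s r) = 0"
proof (rule ccontr)
  assume "D e (up l s r) \<noteq> 0"
  then have "int (up l s r l) \<le> c" using assms unfolding bounded_by_def by blast
  then show False using assms(3) by (simp add: up_def)
qed

lemma opr_sum:
  assumes "\<And>s m. S \<le> s \<or> M \<le> m \<Longrightarrow> D (mvs i j m e) (up l s r) = 0"
  shows "opr b i j l D e r = (\<Sum>s<S. \<Sum>m<M. fps_nth (b s) m * D (mvs i j m e) (up l s r))"
proof -
  have "Sum_any (\<lambda>m. fps_nth (b s) m * D (mvs i j m e) (up l s r)) = (\<Sum>m<M. fps_nth (b s) m * D (mvs i j m e) (up l s r))" for s
    by (rule Sum_any_lessThan) (simp add: assms)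
  then show ?thesis unfolding opr_def by (simp, subst Sum_any_lessThan[of S]) (auto simp: assms)
qed

lemma opr_bounded:
  assumes D: "bounded_by w c D" and bf: "before w i j" and l: "l \<in> set w"
  shows "bounded_by w c (opr b i j l D)"
  unfolding bounded_by_def
proof (intro allI impI)
  fix e r assume "opr b i j l D e r \<noteq> 0"
  then obtain s m where "D (mvs i j m e) (up l s r) \<noteq> 0"
    unfolding opr_def
    by (elim Sum_any.not_neutral_obtains_not_neutral) (auto elim!: Sum_any.not_neutral_obtains_not_neutral)
  with D have 1: "\<And>k. k \<notin> set w \<Longrightarrow> mvs i j m e k = 0" "\<And>k. k \<in> set w \<Longrightarrow> int (up l s r k) \<le> c"
    "sum (mvs i j m e) (set w) \<le> c" "\<And>xs ys. w = xs @ ys \<Longrightarrow> - c \<le> sum (mvs i j m e) (set ys)"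
    unfolding bounded_by_def by blast+
  show "(\<forall>j. j \<notin> set w \<longrightarrow> e j = 0) \<and> (\<forall>j\<in>set w. int (r j) \<le> c) \<and> sum e (set w) \<le> c \<and>
    (\<forall>xs ys. w = xs @ ys \<longrightarrow> - c \<le> sum e (set ys))"
  proof (intro conjI allI impI ballI)
    show "e k = 0" if "k \<notin> set w" for k
      using 1(1)[OF that] that before_set[OF bf] by (auto simp: mvs_def mv_def split: if_splits)
    show "int (r k) \<le> c" if "k \<in> set w" for k
      using 1(2)[OF that] by (auto simp: up_def split: if_splits)
    show "sum e (set w) \<le> c" using 1(3) by (simp add: sum_mvs_total[OF bf])
    show "- c \<le> sum e (set ys)" if "w = xs @ ys" for xs ys
      using 1(4)[OF that] sum_mvs_le[OF bf that, of m e] by simp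
  qed
qed

lemma opr_trunc: "trunc w D \<Longrightarrow> before w i j \<Longrightarrow> l \<in> set w \<Longrightarrow> trunc w (opr b i j l D)"
  unfolding trunc_def using opr_bounded by blast

lemma opr_bounded_sum:
  assumes D: "bounded_by w c D" and bf: "before w i j" and l: "l \<in> set w"
    and S: "c < int S" and M: "c + tail_sum w j e < int M"
  shows "opr b i j l D e r = (\<Sum>s<S. \<Sum>m<M. fps_nth (b s) m * D (mvs i j m e) (up l s r))"
proof (rule opr_sum)
  fix s m assume "S \<le> s \<or> M \<le> m"
  then have "c < int s \<or> c + tail_sum w j e < int m" using S M by auto
  then show "D (mvs i j m e) (up l s r) = 0"
    using bounded_zero_s[OF D l] bounded_zero_m[OF D bf] by blast
qed

lemma sum4_swap:
  fixes f :: "'a \<Rightarrow> 'b \<Rightarrow> 'c \<Rightarrow> 'd \<Rightarrow> 'e::comm_monoid_add"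
  shows "(\<Sum>s\<in>A. \<Sum>m\<in>B. \<Sum>s'\<in>C. \<Sum>m'\<in>E. f s m s' m') = (\<Sum>s'\<in>C. \<Sum>m'\<in>E. \<Sum>s\<in>A. \<Sum>m\<in>B. f s m s' m')"
proof -
  have "(\<Sum>s\<in>A. \<Sum>m\<in>B. \<Sum>s'\<in>C. \<Sum>m'\<in>E. f s m s' m') = (\<Sum>s\<in>A. \<Sum>s'\<in>C. \<Sum>m\<in>B. \<Sum>m'\<in>E. f s m s' m')"
    by (intro sum.cong refl sum.swap)
  also have "\<dots> = (\<Sum>s'\<in>C. \<Sum>s\<in>A. \<Sum>m\<in>B. \<Sum>m'\<in>E. f s m s' m')"
    by (rule sum.swap)
  also have "\<dots> = (\<Sum>s'\<in>C. \<Sum>s\<in>A. \<Sum>m'\<in>E. \<Sum>m\<in>B. f s m s' m')"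
    by (intro sum.cong refl sum.swap)
  also have "\<dots> = (\<Sum>s'\<in>C. \<Sum>m'\<in>E. \<Sum>s\<in>A. \<Sum>m\<in>B. f s m s' m')"
    by (intro sum.cong refl sum.swap)
  finally show ?thesis .
qed

lemma opr_commute:
  assumes D: "trunc w D" and bf: "before w i j" "before w i' j'" and l: "l \<in> set w" "l' \<in> set w"
  shows "opr b i j l (opr b' i' j' l' D) = opr b' i' j' l' (opr b i j l D)"
proof (intro ext)
  fix e r
  obtain c where c: "bounded_by w c D" using D by (auto simp: trunc_def)
  define S where "S = nat c + 1"
  \<comment> \<open>One range must serve both operators in either order. The tail sums only decrease
    under the shift by the other operator, so their values at \<open>e\<close> suffice.\<close>
  define M where "M = nat (c + tail_sum w j e) + nat (c + tail_sum w j' e) + 1"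
  have S: "c < int S" by (simp add: S_def)
  have M1: "c + tail_sum w j (mvs i' j' m' e) < int M" for m'
    using tail_sum_mvs_le[OF bf(2), of j m' e] by (simp add: M_def)
  have M2: "c + tail_sum w j' (mvs i j m e) < int M" for m
    using tail_sum_mvs_le[OF bf(1), of j' m e] by (simp add: M_def)
  note c1 = opr_bounded[OF c bf(1) l(1), of b] and c2 = opr_bounded[OF c bf(2) l(2), of b']
  have "opr b i j l (opr b' i' j' l' D) e r = (\<Sum>s<S. \<Sum>m<M. \<Sum>s'<S. \<Sum>m'<M.
      fps_nth (b s) m * (fps_nth (b' s') m' * D (mvs i' j' m' (mvs i j m e)) (up l' s' (up l s r))))"
    using M1[of 0] unfolding mvs_0
    by (subst opr_bounded_sum[OF c2 bf(1) l(1) S], assumption)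
       (simp only: opr_bounded_sum[OF c bf(2) l(2) S M2] sum_distrib_left)
  also have "\<dots> = (\<Sum>s'<S. \<Sum>m'<M. \<Sum>s<S. \<Sum>m<M.
      fps_nth (b s) m * (fps_nth (b' s') m' * D (mvs i' j' m' (mvs i j m e)) (up l' s' (up l s r))))"
    by (rule sum4_swap)
  also have "\<dots> = (\<Sum>s'<S. \<Sum>m'<M. \<Sum>s<S. \<Sum>m<M.
      fps_nth (b' s') m' * (fps_nth (b s) m * D (mvs i j m (mvs i' j' m' e)) (up l s (up l' s' r))))"
    by (intro sum.cong refl) (simp only: mvs_commute[of i j _ i' j'] up_commute[of l _ l'] mult.left_commute)
  also have "\<dots> = opr b' i' j' l' (opr b i j l D) e r"
    using M2[of 0] unfolding mvs_0
    by (subst opr_bounded_sum[OF c1 bf(2) l(2) S], assumption)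
       (simp only: opr_bounded_sum[OF c bf(1) l(1) S M1] sum_distrib_left)
  finally show "opr b i j l (opr b' i' j' l' D) e r = opr b' i' j' l' (opr b i j l D) e r" .
qed

text \<open>A kernel family is a power series in two commuting variables, the ratio
  \<open>x_j / x_i\<close> and the raising operator \<open>T_l\<close>. Composition multiplies them,
  by a Cauchy product in each variable.\<close>

lemma opr_mult:
  assumes D: "trunc w D" and bf: "before w i j" and l: "l \<in> set w"
  shows "opr b i j l (opr b' i j l D) = opr (\<lambda>p. \<Sum>s\<le>p. b s * b' (p - s)) i j l D"
proof (intro ext)
  fix e r
  obtain c where c: "bounded_by w c D" using D by (auto simp: trunc_def)
  define S where "S = nat c + 1"
  define M where "M = nat (c + tail_sum w j e) + 1"
  have S: "c < int S" by (simp add: S_def)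
  have M: "c + tail_sum w j (mvs i j m e) < int M" for m
    using tail_sum_mvs_le[OF bf, of j m e] by (simp add: M_def)
  note c' = opr_bounded[OF c bf l, of b']
  have z: "D (mvs i j m e) (up l s r) = 0" if "S \<le> s \<or> M \<le> m" for s m
  proof -
    have "c < int s \<or> c + tail_sum w j e < int m" using that S M[of 0] by auto
    then show ?thesis using bounded_zero_s[OF c l] bounded_zero_m[OF c bf] by blast
  qed
  have "opr b i j l (opr b' i j l D) e r = (\<Sum>s<S. \<Sum>m<M. \<Sum>s'<S. \<Sum>m'<M.
      fps_nth (b s) m * fps_nth (b' s') m' * D (mvs i j (m + m') e) (up l (s + s') r))"
    using M[of 0] unfolding mvs_0
    by (subst opr_bounded_sum[OF c' bf l S], assumption)
       (simp only: opr_bounded_sum[OF c bf l S M] sum_distrib_left mvs_mvs up_up mult.assoc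
          add.commute[of _ "_::nat"])
  also have "\<dots> = (\<Sum>s<S. \<Sum>s'<S. \<Sum>m<M. \<Sum>m'<M.
      fps_nth (b s) m * fps_nth (b' s') m' * D (mvs i j (m + m') e) (up l (s + s') r))"
    by (intro sum.cong refl sum.swap)
  also have "\<dots> = (\<Sum>s<S. \<Sum>s'<S. \<Sum>p<M. \<Sum>m\<le>p.
      fps_nth (b s) m * fps_nth (b' s') (p - m) * D (mvs i j (m + (p - m)) e) (up l (s + s') r))"
    by (intro sum.cong refl sum_box_triangle) (auto simp: z)
  also have "\<dots> = (\<Sum>s<S. \<Sum>s'<S. \<Sum>p<M. fps_nth (b s * b' s') p * D (mvs i j p e) (up l (s + s') r))"
    by (simp add: fps_mult_nth atLeast0AtMost sum_distrib_right)
  also have "\<dots> = (\<Sum>q<S. \<Sum>s\<le>q. \<Sum>p<M. fps_nth (b s * b' (q - s)) p * D (mvs i j p e) (up l (s + (q - s)) r))"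
    by (rule sum_box_triangle) (auto simp: z)
  also have "\<dots> = (\<Sum>q<S. \<Sum>p<M. \<Sum>s\<le>q. fps_nth (b s * b' (q - s)) p * D (mvs i j p e) (up l q r))"
    by (subst sum.swap[of _ "{..<M}"]) simp
  also have "\<dots> = (\<Sum>q<S. \<Sum>p<M. fps_nth (\<Sum>s\<le>q. b s * b' (q - s)) p * D (mvs i j p e) (up l q r))"
    by (simp add: fps_sum_nth sum_distrib_right)
  also have "\<dots> = opr (\<lambda>p. \<Sum>s\<le>p. b s * b' (p - s)) i j l D e r"
    by (rule opr_sum[symmetric]) (rule z)
  finally show "opr b i j l (opr b' i j l D) e r = opr (\<lambda>p. \<Sum>s\<le>p. b s * b' (p - s)) i j l D e r" .
qed

lemma opr_one: "opr (\<lambda>s. if s = 0 then 1 else 0) i j l D = D"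
proof (intro ext)
  fix e r
  have "opr (\<lambda>s. if s = 0 then 1 else 0) i j l D e r
      = Sum_any (\<lambda>m. fps_nth 1 m * D (mvs i j m e) (up l 0 r))"
    unfolding opr_def by (subst Sum_any_single[of 0]) auto
  also have "\<dots> = D e r" by (subst Sum_any_single[of 0]) auto
  finally show "opr (\<lambda>s. if s = 0 then 1 else 0) i j l D e r = D e r" .
qed

lemma opr_inverse:
  assumes "trunc w D" "before w i j" "l \<in> set w" "\<And>p. (\<Sum>s\<le>p. b' s * b (p - s)) = (if p = 0 then 1 else 0)"
  shows "opr b' i j l (opr b i j l D) = D"
  unfolding opr_mult[OF assms(1-3)] assms(4) by (rule opr_one)

lemma opr_add:
  assumes "trunc w D" "trunc w D'" "before w i j" "l \<in> set w"
  shows "opr b i j l (\<lambda>e r. k * D e r + k' * D' e r) e r = k * opr b i j l D e r + k' * opr b i j l D' e r"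
proof -
  obtain c c' where c: "bounded_by w c D" "bounded_by w c' D'" using assms by (auto simp: trunc_def)
  define S where "S = nat c + nat c' + 1"
  define M where "M = nat (c + tail_sum w j e) + nat (c' + tail_sum w j e) + 1"
  have z: "D (mvs i j m e) (up l s r) = 0 \<and> D' (mvs i j m e) (up l s r) = 0" if "S \<le> s \<or> M \<le> m" for s m
  proof -
    have "(c < int s \<and> c' < int s) \<or> (c + tail_sum w j e < int m \<and> c' + tail_sum w j e < int m)"
      using that by (auto simp: S_def M_def)
    then show ?thesis
      using bounded_zero_s[OF c(1) assms(4)] bounded_zero_s[OF c(2) assms(4)]
        bounded_zero_m[OF c(1) assms(3)] bounded_zero_m[OF c(2) assms(3)] by blast
  qed
  show ?thesis
    by (subst (1 2 3) opr_sum[of S M]) (auto simp: z sum_distrib_left sum.distrib algebra_simps)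
qed

section \<open>Multiplication by variables and by differences\<close>

lemma trunc_shx:
  assumes "trunc w D" "i \<in> set w"
  shows "trunc w (shx i D)"
proof -
  obtain c where c: "bounded_by w c D" using assms by (auto simp: trunc_def)
  have "bounded_by w (c + 1) (shx i D)"
    unfolding bounded_by_def
  proof (intro allI impI)
    fix e r assume "shx i D e r \<noteq> 0"
    with c have 1: "\<And>k. k \<notin> set w \<Longrightarrow> mv i (- 1) e k = 0" "\<And>k. k \<in> set w \<Longrightarrow> int (r k) \<le> c"
      "sum (mv i (- 1) e) (set w) \<le> c" "\<And>xs ys. w = xs @ ys \<Longrightarrow> - c \<le> sum (mv i (- 1) e) (set ys)"
      unfolding bounded_by_def shx_def by blast+
    show "(\<forall>j. j \<notin> set w \<longrightarrow> e j = 0) \<and> (\<forall>j\<in>set w. int (r j) \<le> c + 1) \<and> sum e (set w) \<le> c + 1 \<and>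
      (\<forall>xs ys. w = xs @ ys \<longrightarrow> - (c + 1) \<le> sum e (set ys))"
    proof (intro conjI allI impI ballI)
      show "e k = 0" if "k \<notin> set w" for k
        using 1(1)[OF that] that assms(2) by (auto simp: mv_def split: if_splits)
      show "int (r k) \<le> c + 1" if "k \<in> set w" for k using 1(2)[OF that] by simp
      show "sum e (set w) \<le> c + 1" using 1(3) assms(2) by (simp add: sum_mv)
      show "- (c + 1) \<le> sum e (set ys)" if "w = xs @ ys" for xs ys
        using 1(4)[OF that] by (simp add: sum_mv split: if_splits)
    qed
  qed
  then show ?thesis by (auto simp: trunc_def)
qed

lemma trunc_diff: "trunc w D \<Longrightarrow> trunc w D' \<Longrightarrow> trunc w (\<lambda>e r. D e r - D' e r)"
proof -
  assume "trunc w D" "trunc w D'"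
  then obtain c c' where c: "bounded_by w c D" "bounded_by w c' D'" by (auto simp: trunc_def)
  have "bounded_by w (max c c') (\<lambda>e r. D e r - D' e r)"
    unfolding bounded_by_def
  proof (intro allI impI)
    fix e r assume "D e r - D' e r \<noteq> 0"
    then consider "D e r \<noteq> 0" | "D' e r \<noteq> 0" by (cases "D e r = 0") auto
    then show "(\<forall>j. j \<notin> set w \<longrightarrow> e j = 0) \<and> (\<forall>j\<in>set w. int (r j) \<le> max c c') \<and> sum e (set w) \<le> max c c' \<and>
      (\<forall>xs ys. w = xs @ ys \<longrightarrow> - (max c c') \<le> sum e (set ys))"
    proof cases
      case 1
      with c(1) have "(\<forall>j. j \<notin> set w \<longrightarrow> e j = 0) \<and> (\<forall>j\<in>set w. int (r j) \<le> c) \<and> sum e (set w) \<le> c \<and>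
        (\<forall>xs ys. w = xs @ ys \<longrightarrow> - c \<le> sum e (set ys))"
        unfolding bounded_by_def by blast
      then show ?thesis by (force simp: le_max_iff_disj min_le_iff_disj)
    next
      case 2
      with c(2) have "(\<forall>j. j \<notin> set w \<longrightarrow> e j = 0) \<and> (\<forall>j\<in>set w. int (r j) \<le> c') \<and> sum e (set w) \<le> c' \<and>
        (\<forall>xs ys. w = xs @ ys \<longrightarrow> - c' \<le> sum e (set ys))"
        unfolding bounded_by_def by blast
      then show ?thesis by (force simp: le_max_iff_disj min_le_iff_disj)
    qed
  qed
  then show ?thesis by (auto simp: trunc_def)
qed

lemma pd_shx: "pd i j D = (\<lambda>e r. shx i D e r - shx j D e r)"
  by (simp add: pd_def shx_def fun_eq_iff)

lemma trunc_pd: "trunc w D \<Longrightarrow> i \<in> set w \<Longrightarrow> j \<in> set w \<Longrightarrow> trunc w (pd i j D)"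
  unfolding pd_shx by (intro trunc_diff trunc_shx)

lemma opr_shx: "opr b i j l (shx k D) = shx k (opr b i j l D)"
  by (simp add: fun_eq_iff opr_def shx_def mvs_mv)

lemma opr_pd:
  assumes "trunc w D" "before w i j" "l \<in> set w" "i' \<in> set w" "j' \<in> set w"
  shows "opr b i j l (pd i' j' D) = pd i' j' (opr b i j l D)"
proof (intro ext)
  fix e r
  show "opr b i j l (pd i' j' D) e r = pd i' j' (opr b i j l D) e r"
    using opr_add[OF trunc_shx[OF assms(1,4)] trunc_shx[OF assms(1,5)] assms(2,3), of b 1 "- 1" e r]
    by (simp add: pd_shx opr_shx)
qed

lemma opr_pd_pow:
  assumes "trunc w D" "before w i j" "l \<in> set w" "i' \<in> set w" "j' \<in> set w"
  shows "opr b i j l ((pd i' j' ^^ M) D) = (pd i' j' ^^ M) (opr b i j l D)"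
proof (induction M)
  case (Suc M)
  have "trunc w ((pd i' j' ^^ M) D)" by (induction M) (simp_all add: assms trunc_pd)
  then show ?case using Suc opr_pd[OF _ assms(2-5)] by simp
qed simp

lemma pd_commute: "pd i j (pd i' j' D) = pd i' j' (pd i j D)"
  by (simp add: fun_eq_iff pd_def mv_commute[of i] mv_commute[of j])

lemma pd_scale: "pd i j (\<lambda>e r. k * D e r) = (\<lambda>e r. k * pd i j D e r)"
  by (simp add: fun_eq_iff pd_def right_diff_distrib)

lemma pd_pow_scale: "(pd i j ^^ M) (\<lambda>e r. k * D e r) = (\<lambda>e r. k * (pd i j ^^ M) D e r)"
  by (induction M) (simp_all add: pd_scale)

lemma opr_scale:
  assumes "trunc w D" "before w i j" "l \<in> set w"
  shows "opr b i j l (\<lambda>e r. k * D e r) = (\<lambda>e r. k * opr b i j l D e r)"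
  using opr_add[OF assms(1) assms(1) assms(2,3), of b k 0] by (simp add: fun_eq_iff)

text \<open>\<open>(x_i - x_j) b = x_i (1 - x_j / x_i) b\<close>\<close>
lemma pd_opr:
  assumes "trunc w D" "before w i j" "l \<in> set w"
  shows "pd i j (opr b i j l D) = shx i (opr (\<lambda>s. (1 - fps_X) * b s) i j l D)"
proof -
  let ?u = "\<lambda>s. if s = 0 then 1 - fps_X else (0 :: complex fps)"
  have "opr ?u i j l E e r = E e r - E (mvs i j 1 e) r" for E e r
  proof -
    have "opr ?u i j l E e r = Sum_any (\<lambda>m. fps_nth (1 - fps_X) m * E (mvs i j m e) (up l 0 r))"
      unfolding opr_def by (subst Sum_any_single[of 0]) auto
    also have "\<dots> = (\<Sum>m<2. fps_nth (1 - fps_X) m * E (mvs i j m e) (up l 0 r))"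
      by (rule Sum_any_lessThan) (simp add: fps_X_def)
    finally show ?thesis by (simp add: fps_X_def numeral_2_eq_2)
  qed
  moreover have "(\<Sum>s\<le>p. ?u s * b (p - s)) = (1 - fps_X) * b p" for p
  proof -
    have "(\<Sum>s\<le>p. ?u s * b (p - s)) = (\<Sum>s\<in>{0}. ?u s * b (p - s))"
      by (rule sum.mono_neutral_right) auto
    then show ?thesis by simp
  qed
  ultimately have "opr (\<lambda>s. (1 - fps_X) * b s) i j l D e r = opr b i j l D e r - opr b i j l D (mvs i j 1 e) r" for e r
    using fun_cong[OF fun_cong[OF opr_mult[OF assms, of ?u b], of e], of r] by simp
  then show ?thesis
    by (simp add: fun_eq_iff pd_def shx_def mvs_def mv_commute[of i])
qed

text \<open>Powers of \<open>1 - X\<close> are absorbed into the kernel. A kernel with the factor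
  \<open>(1 - X)^\<alpha>\<close> acquires \<open>(1 - X)^(\<alpha> + M)\<close>, the form in which
  weak commutativity is stated.\<close>

lemma pd_pow_opr:
  assumes "trunc w D" "before w i j" "l \<in> set w"
  shows "(pd i j ^^ M) (opr b i j l D) = (shx i ^^ M) (opr (\<lambda>s. (1 - fps_X) ^ M * b s) i j l D)"
proof (induction M)
  case (Suc M)
  have "pd i j (shx i E) = shx i (pd i j E)" for E
    by (simp add: fun_eq_iff pd_def shx_def mv_commute[of i])
  then have ps: "pd i j ((shx i ^^ M) E) = (shx i ^^ M) (pd i j E)" for E
    by (rule funpow_commute_apply)
  show ?case
    by (simp add: Suc ps pd_opr[OF assms] mult.assoc funpow_swap1)
qed simp

lemma shx_pow: "(shx i ^^ M) D e r = D (mv i (- int M) e) r"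
  by (induction M arbitrary: e) (simp_all add: shx_def add.commute)

lemma pd_pow:
  "(pd i j ^^ M) D e r = (\<Sum>m\<le>M. (- 1) ^ m * of_nat (M choose m) * D (mv i (int m - int M) (mv j (- int m) e)) r)"
proof (induction M arbitrary: e)
  case (Suc M)
  let ?F = "\<lambda>a b. D (mv i a (mv j b e)) r"
  have "(pd i j ^^ Suc M) D e r = (pd i j ^^ M) D (mv i (- 1) e) r - (pd i j ^^ M) D (mv j (- 1) e) r"
    by (simp add: pd_def)
  also have "\<dots> = (\<Sum>m\<le>M. (- 1) ^ m * of_nat (M choose m) * ?F (int m - int (Suc M)) (- int m))
      - (\<Sum>m\<le>M. (- 1) ^ m * of_nat (M choose m) * ?F (int (Suc m) - int (Suc M)) (- int (Suc m)))"
    unfolding Suc.IH by (simp add: mv_commute[of j _ i] algebra_simps)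
  also have "(\<Sum>m\<le>M. (- 1) ^ m * of_nat (M choose m) * ?F (int m - int (Suc M)) (- int m))
      = (\<Sum>m\<le>Suc M. (- 1) ^ m * of_nat (M choose m) * ?F (int m - int (Suc M)) (- int m))"
    by simp
  also have "\<dots> - (\<Sum>m\<le>M. (- 1) ^ m * of_nat (M choose m) * ?F (int (Suc m) - int (Suc M)) (- int (Suc m)))
     = (\<Sum>m\<le>Suc M. (- 1) ^ m * of_nat (Suc M choose m) * ?F (int m - int (Suc M)) (- int m))"
  proof -
    define H where "H m = ?F (int m - int (Suc M)) (- int m)" for m
    have "(\<Sum>m\<le>M. (- 1) ^ Suc m * of_nat (M choose Suc m) * H (Suc m)) - (\<Sum>m\<le>M. (- 1) ^ m * of_nat (M choose m) * H (Suc m))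
      = (\<Sum>m\<le>M. (- 1) ^ Suc m * of_nat (Suc M choose Suc m) * H (Suc m))"
      unfolding sum_subtractf[symmetric] by (rule sum.cong) (simp_all add: algebra_simps)
    then have "(\<Sum>m\<le>Suc M. (- 1) ^ m * of_nat (M choose m) * H m) - (\<Sum>m\<le>M. (- 1) ^ m * of_nat (M choose m) * H (Suc m))
      = (\<Sum>m\<le>Suc M. (- 1) ^ m * of_nat (Suc M choose m) * H m)"
      unfolding sum.atMost_Suc_shift by (simp del: of_nat_Suc binomial_Suc_Suc)
    then show ?thesis unfolding H_def .
  qed
  finally show ?case .
qed simp

section \<open>Convergence\<close>

definition zpow :: "nat set \<Rightarrow> (nat \<Rightarrow> complex) \<Rightarrow> (nat \<Rightarrow> int) \<Rightarrow> complex"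
  where "zpow A z e = (\<Prod>j\<in>A. z j powi e j)"

lemma zpow_mv:
  assumes "finite A" "i \<in> A" "z i \<noteq> 0"
  shows "zpow A z (mv i m e) = z i powi m * zpow A z e"
proof -
  have "zpow A z (mv i m e) = z i powi (e i + m) * (\<Prod>j\<in>A - {i}. z j powi mv i m e j)"
    unfolding zpow_def using assms by (subst prod.remove[of A i]) (auto simp: mv_def)
  also have "(\<Prod>j\<in>A - {i}. z j powi mv i m e j) = (\<Prod>j\<in>A - {i}. z j powi e j)"
    by (rule prod.cong) (auto simp: mv_def)
  also have "z i powi (e i + m) * (\<Prod>j\<in>A - {i}. z j powi e j) = z i powi m * zpow A z e"
    unfolding zpow_def prod.remove[OF assms(1,2), of "\<lambda>j. z j powi e j"] using assms by (simp add: power_int_add)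
  finally show ?thesis .
qed

lemma zpow_mvs:
  assumes "finite A" "i \<in> A" "j \<in> A" "z i \<noteq> 0" "z j \<noteq> 0"
  shows "(z j / z i) ^ m * zpow A z (mvs i j m e) = zpow A z e"
  using assms by (simp add: mvs_def zpow_mv power_int_minus power_divide field_simps)

lemma has_sum_product_complex:
  fixes f :: "'a \<Rightarrow> complex" and h :: "'b \<Rightarrow> complex"
  assumes f: "(f has_sum a) A" and h: "(h has_sum b) B"
  shows "((\<lambda>(x, y). f x * h y) has_sum (a * b)) (A \<times> B)"
proof (rule has_sum_SigmaI)
  show "((\<lambda>y. case (x, y) of (x, y) \<Rightarrow> f x * h y) has_sum (f x * b)) B" for x
    using has_sum_cmult_right[OF h] by simp
  show "((\<lambda>x. f x * b) has_sum (a * b)) A" by (rule has_sum_cmult_left[OF f])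
  have nf: "(\<lambda>x. norm (f x)) summable_on A" and nh: "(\<lambda>x. norm (h x)) summable_on B"
    by (rule summable_on_iff_abs_summable_on_complex[THEN iffD1, OF has_sum_imp_summable], rule f h)+
  have "(\<lambda>p. norm (f (fst p)) * norm (h (snd p))) summable_on (A \<times> B)"
  proof (rule summable_on_SigmaI)
    show "((\<lambda>y. norm (f (fst (x, y))) * norm (h (snd (x, y)))) has_sum (norm (f x) * infsum (\<lambda>y. norm (h y)) B)) B" for x
      using has_sum_cmult_right[OF has_sum_infsum[OF nh]] by simp
    show "(\<lambda>x. norm (f x) * infsum (\<lambda>y. norm (h y)) B) summable_on A"
      using summable_on_cmult_left[OF nf] .
  qed auto
  then have "(\<lambda>p. norm (case p of (x, y) \<Rightarrow> f x * h y)) summable_on (A \<times> B)"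
    by (simp add: case_prod_beta norm_mult)
  then show "(\<lambda>(x, y). f x * h y) summable_on A \<times> B"
    by (rule abs_summable_summable)
qed

lemma has_sum_finite_sum:
  fixes f :: "'a \<Rightarrow> 'b \<Rightarrow> complex"
  assumes "finite S" "\<And>s. s \<in> S \<Longrightarrow> (f s has_sum a s) A"
  shows "((\<lambda>e. \<Sum>s\<in>S. f s e) has_sum (\<Sum>s\<in>S. a s)) A"
  using assms by (induction S rule: finite_induct) (auto intro!: has_sum_add)

text \<open>The inverse kernel recovers \<open>D\<close> from the product, for each exponent by a
  finite sum. The product series and the inverse kernel at \<open>z j / z i\<close> both converge
  absolutely, so the double series can be rearranged and \<open>D\<close> converges too.\<close>

lemma has_sum_peel:
  assumes D: "bounded_by w c D" and bf: "before w i j" and l: "l \<in> set w"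
    and inv: "\<And>p. (\<Sum>s\<le>p. b' s * b (p - s)) = (if p = 0 then 1 else 0)"
    and z: "\<And>k. k \<in> set w \<Longrightarrow> z k \<noteq> 0"
    and S: "\<And>r. ((\<lambda>e. opr b i j l D e r * zpow (set w) z e) has_sum S r) UNIV"
    and \<beta>: "\<And>s. ((\<lambda>m. fps_nth (b' s) m * (z j / z i) ^ m) has_sum \<beta> s) UNIV"
    and K: "c < int K"
  shows "((\<lambda>e. D e r * zpow (set w) z e) has_sum (\<Sum>s<K. \<beta> s * S (up l s r))) UNIV"
proof -
  let ?A = "set w" and ?E = "opr b i j l D"
  note ij = before_set[OF bf]
  have E: "bounded_by w c ?E" by (rule opr_bounded[OF D bf l])
  \<comment> \<open>The contribution of the \<open>s\<close>-th coefficient of the inverse kernel to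
    \<open>D e r\<close>; the range exhausts the nonzero terms.\<close>
  define F where "F s e = (\<Sum>m<nat (c + tail_sum w j e) + 1. fps_nth (b' s) m * ?E (mvs i j m e) (up l s r))" for s e
  have "((\<lambda>e. F s e * zpow ?A z e) has_sum (\<beta> s * S (up l s r))) UNIV" for s
  proof (rule has_sum_Sigma')
    have "((\<lambda>(m, e). (fps_nth (b' s) m * (z j / z i) ^ m) * (?E e (up l s r) * zpow ?A z e))
        has_sum (\<beta> s * S (up l s r))) (UNIV \<times> UNIV)"
      by (rule has_sum_product_complex[OF \<beta> S])
    also have "?this \<longleftrightarrow> ((\<lambda>(e, m). (fps_nth (b' s) m * ?E (mvs i j m e) (up l s r)) * zpow ?A z e)
        has_sum (\<beta> s * S (up l s r))) (UNIV \<times> UNIV)"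
    \<comment> \<open>A term of the product series at an exponent reappears at the one moved by
      \<open>(x_j / x_i)^m\<close>; \<open>mvs j i m\<close> undoes
      \<open>mvs i j m\<close>.\<close>
    proof (rule has_sum_reindex_bij_witness[where i = "\<lambda>(e, m). (m, mvs i j m e)" and j = "\<lambda>(m, e). (mvs j i m e, m)"], goal_cases)
      case (5 a)
      obtain m e where a: "a = (m, e)" by fastforce
      have inv: "mvs i j m (mvs j i m e) = e" by (simp add: mvs_def mv_commute[of i _ j])
      show ?case
        using zpow_mvs[of ?A i j z m "mvs j i m e"] z ij unfolding a inv by (simp add: inv mult_ac)
    qed (auto simp: mvs_def mv_commute[of i _ j])
    finally show "((\<lambda>(e, m). (fps_nth (b' s) m * ?E (mvs i j m e) (up l s r)) * zpow ?A z e)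
        has_sum (\<beta> s * S (up l s r))) (Sigma UNIV (\<lambda>_. UNIV))" .
    show "((\<lambda>m. case (e, m) of (e, m) \<Rightarrow> fps_nth (b' s) m * ?E (mvs i j m e) (up l s r) * zpow ?A z e)
        has_sum (F s e * zpow ?A z e)) UNIV" for e
    proof (rule has_sum_finite_neutralI)
      show "finite {..<nat (c + tail_sum w j e) + 1}" by simp
      fix m assume "m \<in> UNIV - {..<nat (c + tail_sum w j e) + 1}"
      then have "c + tail_sum w j e < int m" by auto
      then show "(case (e, m) of (e, m) \<Rightarrow> fps_nth (b' s) m * ?E (mvs i j m e) (up l s r) * zpow ?A z e) = 0"
        by (simp add: bounded_zero_m[OF E bf])
    qed (simp_all add: F_def sum_distrib_right del: sum.lessThan_Suc)
  qed
  then have "((\<lambda>e. \<Sum>s<K. F s e * zpow ?A z e) has_sum (\<Sum>s<K. \<beta> s * S (up l s r))) UNIV"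
    by (intro has_sum_finite_sum) auto
  moreover have "(\<Sum>s<K. F s e * zpow ?A z e) = D e r * zpow ?A z e" for e
  proof -
    have "D e r = opr b' i j l ?E e r"
    proof -
      have "trunc w D" using D by (auto simp: trunc_def)
      then show ?thesis by (simp only: opr_inverse[OF _ bf l inv])
    qed
    also have "\<dots> = (\<Sum>s<K. F s e)"
      unfolding F_def by (rule opr_bounded_sum[OF E bf l K]) simp
    finally show ?thesis by (simp add: sum_distrib_right)
  qed
  ultimately show ?thesis by simp
qed

lemma has_sum_geometric:
  assumes "norm (y :: complex) < 1"
  shows "((\<lambda>m::nat. y ^ m) has_sum (1 / (1 - y))) UNIV"
proof (rule norm_summable_imp_has_sum)
  show "summable (\<lambda>m. norm (y ^ m))" using assms by (simp add: norm_power summable_geometric)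
  show "(\<lambda>m. y ^ m) sums (1 / (1 - y))" using assms by (rule geometric_sums)
qed

text \<open>Division by \<open>x_i - x_j\<close> is multiplication by a geometric series in
  \<open>x_j / x_i\<close>. Applied to the coefficients of \<open>pd i j D\<close> it telescopes,
  and truncation makes the remainder vanish, so the quotient is \<open>D\<close> itself.\<close>

lemma has_sum_peel_pd:
  assumes D: "trunc w D" and bf: "before w i j"
    and z: "\<And>k. k \<in> set w \<Longrightarrow> z k \<noteq> 0" and lt: "norm (z j) < norm (z i)"
    and S: "((\<lambda>e. pd i j D e r * zpow (set w) z e) has_sum S) UNIV"
  shows "((\<lambda>e. D e r * zpow (set w) z e) has_sum (S / (z i - z j))) UNIV"
proof -
  let ?A = "set w" and ?E = "pd i j D"
  note ij = before_set[OF bf]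
  have E: "trunc w ?E" using trunc_pd[OF D] ij by blast
  obtain c where c: "bounded_by w c ?E" using E by (auto simp: trunc_def)
  obtain c0 where c0: "bounded_by w c0 D" using D by (auto simp: trunc_def)
  have zi: "z i \<noteq> 0" "z j \<noteq> 0" using z ij by auto
  have ge: "((\<lambda>m. (z j / z i) ^ m) has_sum (1 / (1 - z j / z i))) UNIV"
    by (rule has_sum_geometric) (use lt zi in \<open>simp add: norm_divide divide_less_eq\<close>)
  \<comment> \<open>The range covers the support of the terms, bounded through \<open>c\<close>, as
    well as the remainder of the telescoping sum, bounded through \<open>c0\<close>.\<close>
  define F where "F e = (\<Sum>m<nat (c + tail_sum w j e) + nat (c0 + tail_sum w j e) + 1. ?E (mvs i j m e) r)" for e
  have telescope: "F (mv i 1 e) = D e r" for e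
  proof -
    let ?B = "nat (c + tail_sum w j (mv i 1 e)) + nat (c0 + tail_sum w j (mv i 1 e)) + 1"
    obtain us vs zs where w: "w = us @ i # vs @ j # zs" "distinct w" using bf by (auto simp: before_def)
    have "dropWhile (\<lambda>x. x \<noteq> j) ((us @ i # vs) @ j # zs) = dropWhile (\<lambda>x. x \<noteq> j) (j # zs)"
      by (rule dropWhile_append2) (use w(2)[unfolded w(1)] in auto)
    then have dw: "dropWhile (\<lambda>x. x \<noteq> j) w = j # zs" unfolding w(1) by simp
    have "i \<notin> set (j # zs)" using w(2)[unfolded w(1)] by auto
    then have ts: "tail_sum w j (mv i 1 e) = tail_sum w j e"
      unfolding tail_sum_def dw by (simp add: sum_mv del: set_simps(2))
    have tm: "?E (mvs i j m (mv i 1 e)) r = D (mvs i j m e) r - D (mvs i j (Suc m) e) r" for m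
    proof -
      have "mv i (- 1) (mvs i j m (mv i 1 e)) = mvs i j m e"
        by (simp add: mvs_def mv_commute[of j _ i])
      moreover have "mv j (- 1) (mvs i j m (mv i 1 e)) = mvs i j (Suc m) e"
        by (simp add: mvs_def mv_commute[of j _ i] algebra_simps)
      ultimately show ?thesis by (simp add: pd_def)
    qed
    have "F (mv i 1 e) = D (mvs i j 0 e) r - D (mvs i j ?B e) r"
      unfolding F_def tm by (rule sum_lessThan_telescope')
    also have "D (mvs i j ?B e) r = 0"
      by (rule bounded_zero_m[OF c0 bf]) (simp add: ts)
    finally show ?thesis by simp
  qed
  have "((\<lambda>e. F e * zpow ?A z e) has_sum (1 / (1 - z j / z i) * S)) UNIV"
  proof (rule has_sum_Sigma')
    have "((\<lambda>(m, e). (z j / z i) ^ m * (?E e r * zpow ?A z e)) has_sum (1 / (1 - z j / z i) * S)) (UNIV \<times> UNIV)"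
      by (rule has_sum_product_complex[OF ge S])
    also have "?this \<longleftrightarrow> ((\<lambda>(e, m). ?E (mvs i j m e) r * zpow ?A z e) has_sum (1 / (1 - z j / z i) * S)) (UNIV \<times> UNIV)"
    proof (rule has_sum_reindex_bij_witness[where i = "\<lambda>(e, m). (m, mvs i j m e)" and j = "\<lambda>(m, e). (mvs j i m e, m)"], goal_cases)
      case (5 a)
      obtain m e where a: "a = (m, e)" by fastforce
      have inv: "mvs i j m (mvs j i m e) = e" by (simp add: mvs_def mv_commute[of i _ j])
      show ?case
        using zpow_mvs[of ?A i j z m "mvs j i m e"] zi ij unfolding a inv by (simp add: inv mult_ac)
    qed (auto simp: mvs_def mv_commute[of i _ j])
    finally show "((\<lambda>(e, m). ?E (mvs i j m e) r * zpow ?A z e) has_sum (1 / (1 - z j / z i) * S)) (Sigma UNIV (\<lambda>_. UNIV))" .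
    show "((\<lambda>m. case (e, m) of (e, m) \<Rightarrow> ?E (mvs i j m e) r * zpow ?A z e) has_sum (F e * zpow ?A z e)) UNIV" for e
    proof (rule has_sum_finite_neutralI)
      let ?B = "nat (c + tail_sum w j e) + nat (c0 + tail_sum w j e) + 1"
      show "finite {..<?B}" by simp
      fix m assume "m \<in> UNIV - {..<?B}"
      then have "c + tail_sum w j e < int m" by auto
      then show "(case (e, m) of (e, m) \<Rightarrow> ?E (mvs i j m e) r * zpow ?A z e) = 0"
        by (simp add: bounded_zero_m[OF c bf])
    qed (simp_all add: F_def sum_distrib_right del: sum.lessThan_Suc)
  qed
  also have "?this \<longleftrightarrow> ((\<lambda>e. F (mv i 1 e) * zpow ?A z (mv i 1 e)) has_sum (1 / (1 - z j / z i) * S)) UNIV"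
    by (rule has_sum_reindex_bij_witness[where i = "mv i 1" and j = "mv i (- 1)"]) auto
  also have "(\<lambda>e. F (mv i 1 e) * zpow ?A z (mv i 1 e)) = (\<lambda>e. z i * (D e r * zpow ?A z e))"
    using ij zi by (auto simp: telescope zpow_mv)
  finally have "((\<lambda>e. D e r * zpow ?A z e) has_sum (1 / (1 - z j / z i) * S) / z i) UNIV"
    unfolding has_sum_cmult_right_iff[OF zi(1)] .
  also have "(1 / (1 - z j / z i) * S) / z i = S / (z i - z j)"
  proof -
    have "z i - z j \<noteq> 0" using lt by auto
    then have "z i * z i - z i * z j \<noteq> 0" using zi by (metis mult_eq_0_iff right_diff_distrib)
    with \<open>z i - z j \<noteq> 0\<close> show ?thesis using zi by (simp add: divide_simps)
  qed
  finally show ?thesis .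
qed

lemma has_sum_peel_pd_pow:
  assumes D: "trunc w D" and bf: "before w i j"
    and z: "\<And>k. k \<in> set w \<Longrightarrow> z k \<noteq> 0" and lt: "norm (z j) < norm (z i)"
    and S: "((\<lambda>e. (pd i j ^^ M) D e r * zpow (set w) z e) has_sum S) UNIV"
  shows "((\<lambda>e. D e r * zpow (set w) z e) has_sum (S / (z i - z j) ^ M)) UNIV"
  using S
proof (induction M arbitrary: S)
  case (Suc M)
  have "trunc w ((pd i j ^^ M) D)" using before_set[OF bf] by (induction M) (simp_all add: D trunc_pd)
  from has_sum_peel_pd[OF this bf z lt, of r S] Suc.prems
  have "((\<lambda>e. (pd i j ^^ M) D e r * zpow (set w) z e) has_sum (S / (z i - z j))) UNIV" by simp
  from Suc.IH[OF this] show ?case by (simp add: mult.commute)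
qed simp

text \<open>An exponential generating function: with \<open>T_j\<close> raising the
  \<open>j\<close>-th index, the value of \<open>exp (\<Sum> \<mu>_j T_j) S\<close> at the index
  that is zero on \<open>J\<close>, cut off at \<open>K\<close>.\<close>

definition egf :: "nat set \<Rightarrow> nat \<Rightarrow> ((nat \<Rightarrow> nat) \<Rightarrow> complex) \<Rightarrow> (nat \<Rightarrow> complex) \<Rightarrow> complex"
  where "egf J K S \<mu> = (\<Sum>r\<in>J \<rightarrow>\<^sub>E {..<K}. (\<Prod>j\<in>J. \<mu> j ^ r j / fact (r j)) * S r)"

text \<open>In the variable \<open>T_l\<close> this is
  \<open>exp (\<mu> T) exp (\<tau> T) = exp ((\<mu> + \<tau>) T)\<close>; the vanishing of
  \<open>S\<close> from \<open>K\<close> on keeps the cut-off harmless.\<close>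

lemma egf_shift:
  assumes J: "finite J" "l \<in> J" and z: "\<And>r. K \<le> r l \<Longrightarrow> S r = 0"
    and S': "\<And>r. S' r = \<kappa> * (\<Sum>s<K. (\<tau> ^ s / fact s) * S (up l s r))"
  shows "egf J K S' \<mu> = \<kappa> * egf J K S (\<mu>(l := \<mu> l + \<tau>))"
proof -
  let ?J = "J - {l}"
  have JJ: "J = insert l ?J" using J by auto
  have split: "egf J K T \<nu> = (\<Sum>r\<in>?J \<rightarrow>\<^sub>E {..<K}. (\<Prod>j\<in>?J. \<nu> j ^ r j / fact (r j)) *
      (\<Sum>x<K. \<nu> l ^ x / fact x * T (r(l := x))))" for T \<nu>
  proof -
    have inj: "inj_on (\<lambda>(x, r). r(l := x)) ({..<K} \<times> (?J \<rightarrow>\<^sub>E {..<K}))"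
      using inj_combinator[of l ?J "\<lambda>_. {..<K}"] by simp
    have "egf J K T \<nu> = (\<Sum>r\<in>(\<lambda>(x, r). r(l := x)) ` ({..<K} \<times> (?J \<rightarrow>\<^sub>E {..<K})). (\<Prod>j\<in>J. \<nu> j ^ r j / fact (r j)) * T r)"
      unfolding egf_def by (subst JJ, subst PiE_insert_eq) simp
    also have "\<dots> = (\<Sum>(x, r)\<in>{..<K} \<times> (?J \<rightarrow>\<^sub>E {..<K}). (\<Prod>j\<in>J. \<nu> j ^ (r(l := x)) j / fact ((r(l := x)) j)) * T (r(l := x)))"
      by (subst sum.reindex[OF inj]) (simp add: case_prod_beta)
    also have "\<dots> = (\<Sum>(x, r)\<in>{..<K} \<times> (?J \<rightarrow>\<^sub>E {..<K}). (\<Prod>j\<in>?J. \<nu> j ^ r j / fact (r j)) * (\<nu> l ^ x / fact x * T (r(l := x))))"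
    proof (intro sum.cong refl, clarify)
      fix x r
      have "(\<Prod>j\<in>J. \<nu> j ^ (r(l := x)) j / fact ((r(l := x)) j))
        = \<nu> l ^ x / fact x * (\<Prod>j\<in>?J. \<nu> j ^ (r(l := x)) j / fact ((r(l := x)) j))"
        using J by (subst prod.remove[of J l]) auto
      also have "(\<Prod>j\<in>?J. \<nu> j ^ (r(l := x)) j / fact ((r(l := x)) j)) = (\<Prod>j\<in>?J. \<nu> j ^ r j / fact (r j))"
        by (rule prod.cong) auto
      finally show "(\<Prod>j\<in>J. \<nu> j ^ (r(l := x)) j / fact ((r(l := x)) j)) * T (r(l := x))
        = (\<Prod>j\<in>?J. \<nu> j ^ r j / fact (r j)) * (\<nu> l ^ x / fact x * T (r(l := x)))"
        by (simp only: mult_ac)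
    qed
    also have "\<dots> = (\<Sum>r\<in>?J \<rightarrow>\<^sub>E {..<K}. \<Sum>x<K. (\<Prod>j\<in>?J. \<nu> j ^ r j / fact (r j)) * (\<nu> l ^ x / fact x * T (r(l := x))))"
      by (subst sum.swap) (simp add: sum.cartesian_product)
    finally show ?thesis by (simp add: sum_distrib_left)
  qed
  have inner: "(\<Sum>x<K. \<mu> l ^ x / fact x * S' (r(l := x))) = \<kappa> * (\<Sum>x<K. (\<mu> l + \<tau>) ^ x / fact x * S (r(l := x)))" for r
  proof -
    have "(\<Sum>x<K. \<mu> l ^ x / fact x * S' (r(l := x)))
      = \<kappa> * (\<Sum>x<K. \<Sum>s<K. \<mu> l ^ x / fact x * (\<tau> ^ s / fact s) * S (r(l := x + s)))"
      unfolding S' up_def by (simp add: sum_distrib_left mult_ac)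
    also have "(\<Sum>x<K. \<Sum>s<K. \<mu> l ^ x / fact x * (\<tau> ^ s / fact s) * S (r(l := x + s)))
      = (\<Sum>p<K. \<Sum>x\<le>p. \<mu> l ^ x / fact x * (\<tau> ^ (p - x) / fact (p - x)) * S (r(l := x + (p - x))))"
      by (rule sum_box_triangle) (auto simp: z)
    also have "\<dots> = (\<Sum>p<K. (\<mu> l + \<tau>) ^ p / fact p * S (r(l := p)))"
      by (simp add: binomial_fact_sum[symmetric] sum_distrib_right)
    finally show ?thesis .
  qed
  have "(\<Prod>j\<in>?J. (\<mu>(l := \<mu> l + \<tau>)) j ^ r j / fact (r j)) = (\<Prod>j\<in>?J. \<mu> j ^ r j / fact (r j))" for r :: "nat \<Rightarrow> nat"
    by (rule prod.cong) auto
  then show ?thesis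
    unfolding split inner by (simp add: sum_distrib_left mult_ac)
qed

section \<open>Signs of permutations\<close>

text \<open>The Koszul sign of a word against increasing order, with one factor for each inversion;
  the recursive form suits exchanges of adjacent letters.\<close>

fun ksgn :: "(nat \<Rightarrow> bit) \<Rightarrow> nat list \<Rightarrow> complex" where
  "ksgn par [] = 1"
| "ksgn par (x # w) = (\<Prod>y | y \<in> set w \<and> y < x. parity_sign (par x) (par y)) * ksgn par w"

lemma parity_sign_sq [simp]: "parity_sign s t * parity_sign s t = 1"
  by (simp add: parity_sign_def)

lemma parity_sign_sym: "parity_sign s t = parity_sign t s"
  by (simp add: parity_sign_def)

lemma ksgn_sq: "ksgn par w * ksgn par w = 1"
proof (induction w)
  case (Cons x w)
  have "(\<Prod>y | y \<in> set w \<and> y < x. parity_sign (par x) (par y)) * (\<Prod>y | y \<in> set w \<and> y < x. parity_sign (par x) (par y)) = 1"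
    unfolding prod.distrib[symmetric] by simp
  then have "(\<Prod>y | y \<in> set w \<and> y < x. parity_sign (par x) (par y)) * (\<Prod>y | y \<in> set w \<and> y < x. parity_sign (par x) (par y)) * (ksgn par w * ksgn par w) = 1"
    using Cons by simp
  then show ?case by (simp add: mult_ac)
qed simp

text \<open>Exactly one of the two words has an inversion at the exchanged pair, and all other
  inversions agree.\<close>

lemma ksgn_swap:
  assumes "distinct (us @ x # y # zs)"
  shows "ksgn par (us @ x # y # zs) = parity_sign (par x) (par y) * ksgn par (us @ y # x # zs)"
  using assms
proof (induction us)
  case Nil
  define P where "P a = (\<Prod>u | u \<in> set zs \<and> u < a. parity_sign (par a) (par u))" for a
  have ins: "(\<Prod>u | u \<in> set (b # zs) \<and> u < a. parity_sign (par a) (par u))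
      = (if b < a then parity_sign (par a) (par b) else 1) * P a" if "b \<notin> set zs" for a b
  proof (cases "b < a")
    case True
    then have "{u. u \<in> set (b # zs) \<and> u < a} = insert b {u. u \<in> set zs \<and> u < a}" by auto
    then show ?thesis using True that by (simp add: P_def)
  next
    case False
    then have "{u. u \<in> set (b # zs) \<and> u < a} = {u. u \<in> set zs \<and> u < a}" by auto
    then show ?thesis using False by (simp add: P_def)
  qed
  have xy: "x \<noteq> y" "y \<notin> set zs" "x \<notin> set zs" using Nil by auto
  have "ksgn par (x # y # zs) = (if y < x then parity_sign (par x) (par y) else 1) * P x * (P y * ksgn par zs)"
    by (simp only: ksgn.simps(2) ins[OF xy(2)] P_def)
  moreover have "ksgn par (y # x # zs) = (if x < y then parity_sign (par y) (par x) else 1) * P y * (P x * ksgn par zs)"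
    by (simp only: ksgn.simps(2) ins[OF xy(3)] P_def)
  ultimately show ?case using xy(1) parity_sign_sym[of "par y" "par x"]
    by (cases "x < y") (auto simp: mult_ac)
next
  case (Cons u us)
  then show ?case by (simp add: insert_commute mult_ac)
qed

lemma koszul_ksgn:
  "distinct w \<Longrightarrow> ksgn par w = (\<Prod>(i, j)\<in>{(i, j). i < j \<and> j < length w \<and> w ! i > w ! j}. parity_sign (par (w ! i)) (par (w ! j)))"
proof (induction w)
  case (Cons x w)
  let ?Q = "\<lambda>w. {(i, j). i < j \<and> j < length w \<and> w ! i > w ! j}"
  let ?f = "\<lambda>w (i, j). parity_sign (par (w ! i)) (par (w ! j))"
  let ?A = "(\<lambda>j. (0, Suc j)) ` {j. j < length w \<and> w ! j < x}"
  let ?B = "(\<lambda>(i, j). (Suc i, Suc j)) ` ?Q w"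
  have fin: "finite (?Q w)" by (rule finite_subset[of _ "{..<length w} \<times> {..<length w}"]) auto
  have split: "?Q (x # w) = ?A \<union> ?B"
  proof (intro set_eqI iffI)
    fix p assume "p \<in> ?Q (x # w)"
    then obtain i j where p: "p = (i, j)" "i < j" "j < Suc (length w)" "(x # w) ! i > (x # w) ! j" by auto
    then obtain j' where j: "j = Suc j'" by (cases j) auto
    show "p \<in> ?A \<union> ?B"
    proof (cases i)
      case 0
      then show ?thesis using p j by auto
    next
      case (Suc i')
      then have "(i', j') \<in> ?Q w" using p j by auto
      then show ?thesis using p j Suc by (auto intro!: image_eqI[of _ _ "(i', j')"])
    qed
  qed auto
  have "(\<Prod>p\<in>?Q (x # w). ?f (x # w) p) = (\<Prod>p\<in>?A. ?f (x # w) p) * (\<Prod>p\<in>?B. ?f (x # w) p)"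
    unfolding split by (rule prod.union_disjoint) (use fin in auto)
  also have "(\<Prod>p\<in>?A. ?f (x # w) p) = (\<Prod>j | j < length w \<and> w ! j < x. parity_sign (par x) (par (w ! j)))"
    by (subst prod.reindex) (auto simp: inj_on_def)
  also have "\<dots> = (\<Prod>y | y \<in> set w \<and> y < x. parity_sign (par x) (par y))"
  proof (rule prod.reindex_bij_betw)
    have "inj_on ((!) w) {j. j < length w \<and> w ! j < x}"
      using Cons.prems by (auto simp: inj_on_def nth_eq_iff_index_eq)
    then show "bij_betw ((!) w) {j. j < length w \<and> w ! j < x} {y. y \<in> set w \<and> y < x}"
      unfolding bij_betw_def by (auto simp: in_set_conv_nth)
  qed
  also have "(\<Prod>p\<in>?B. ?f (x # w) p) = (\<Prod>p\<in>?Q w. ?f w p)"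
    by (subst prod.reindex) (auto simp: inj_on_def intro!: prod.cong)
  finally show ?case using Cons by simp
qed simp

text \<open>Adjacent exchanges generate all rearrangements: the wanted first letter is carried to
  the front, and the rest is arranged by induction behind the prefix \<open>us\<close>.\<close>

lemma adjacent_swaps_const:
  assumes swap: "\<And>us x y zs. distinct (us @ x # y # zs) \<Longrightarrow> set (us @ x # y # zs) = S
      \<Longrightarrow> f (us @ x # y # zs) = f (us @ y # x # zs)"
    and "distinct xs" "set xs = S" "distinct ys" "set ys = S"
  shows "f xs = f ys"
proof -
  have front: "distinct (us @ xs @ y # zs) \<Longrightarrow> set (us @ xs @ y # zs) = S
      \<Longrightarrow> f (us @ xs @ y # zs) = f (us @ y # xs @ zs)" for us xs y zs
  proof (induction xs arbitrary: us)
    case (Cons x xs)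
    have "f (us @ (x # xs) @ y # zs) = f ((us @ [x]) @ xs @ y # zs)" by simp
    also have "\<dots> = f ((us @ [x]) @ y # xs @ zs)" by (rule Cons.IH) (use Cons.prems in auto)
    also have "\<dots> = f (us @ x # y # xs @ zs)" by simp
    also have "\<dots> = f (us @ y # x # xs @ zs)" by (rule swap) (use Cons.prems in auto)
    finally show ?case by simp
  qed simp
  have "distinct (us @ xs) \<Longrightarrow> set (us @ xs) = S \<Longrightarrow> mset xs = mset ys \<Longrightarrow> f (us @ xs) = f (us @ ys)" for us
  proof (induction ys arbitrary: us xs)
    case (Cons y ys)
    then have "y \<in> set xs" by (metis list.set_intros(1) mset_eq_setD)
    then obtain x1 x2 where xs: "xs = x1 @ y # x2" by (meson split_list)
    have "f (us @ xs) = f (us @ y # x1 @ x2)" unfolding xs by (rule front) (use Cons.prems xs in auto)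
    also have "\<dots> = f ((us @ [y]) @ x1 @ x2)" by simp
    also have "\<dots> = f ((us @ [y]) @ ys)" by (rule Cons.IH) (use Cons.prems xs in auto)
    finally show ?case by simp
  qed simp
  from this[of "[]"] show ?thesis using assms by (simp add: set_eq_iff_mset_eq_distinct[symmetric])
qed

section \<open>Words of fields\<close>

lemma fps_pow1m_add_nat: "fps_pow1m (\<beta> + of_nat M) = (1 - fps_X) ^ M * fps_pow1m \<beta>"
proof (induction M)
  case (Suc M)
  have "fps_pow1m (\<gamma> + 1) = (1 - fps_X) * fps_pow1m \<gamma>" for \<gamma>
  proof (rule fps_ext)
    fix n show "fps_nth (fps_pow1m (\<gamma> + 1)) n = fps_nth ((1 - fps_X) * fps_pow1m \<gamma>) n"
    proof (cases n)
      case (Suc l)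
      have "fps_nth (fps_pow1m (\<gamma> + 1)) (Suc l) = (- 1) ^ Suc l * ((\<gamma> gchoose l) + (\<gamma> gchoose Suc l))"
        by (simp only: fps_pow1m_def fps_nth_Abs_fps gbinomial_Suc_Suc)
      then show ?thesis unfolding Suc by (simp add: fps_pow1m_def left_diff_distrib) (simp add: algebra_simps)
    qed (simp add: fps_pow1m_def left_diff_distrib)
  qed
  from this[of "\<beta> + of_nat M"] Suc show ?case by (simp add: algebra_simps)
qed simp

text \<open>Summed against \<open>T^s\<close> these are
  \<open>exp ((\<alpha> + T) log (1 - X))\<close>; for \<open>BR\<close> the logarithm is replaced
  by \<open>pi i + log (1 - X)\<close>.\<close>

definition BL :: "complex \<Rightarrow> nat \<Rightarrow> complex fps"
  where "BL \<alpha> s = fps_const (1 / fact s) * kerL \<alpha> s"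

definition BR :: "complex \<Rightarrow> nat \<Rightarrow> complex fps"
  where "BR \<alpha> s = fps_const (1 / fact s) * kerR \<alpha> s"

lemma BL_add: "(1 - fps_X) ^ M * BL \<alpha> s = BL (\<alpha> + of_nat M) s"
  by (simp add: BL_def kerL_def fps_pow1m_add_nat mult_ac)

text \<open>The sign is \<open>exp (pi i M)\<close>. It is cancelled later, when
  \<open>x_b - x_m\<close> is rewritten as \<open>-(x_m - x_b)\<close>.\<close>

lemma BR_add: "(1 - fps_X) ^ M * BR \<alpha> s = fps_const ((- 1) ^ M) * BR (\<alpha> + of_nat M) s"
proof -
  have "exp (pi * \<i> * (\<alpha> + of_nat M)) = exp (pi * \<i> * \<alpha>) * (- 1) ^ M"
    unfolding distrib_left exp_add exp_of_nat2_mult exp_pi_i ..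
  then have "fps_const (exp (pi * \<i> * \<alpha>)) = fps_const ((- 1) ^ M) * fps_const (exp (pi * \<i> * (\<alpha> + of_nat M)))"
    by (simp add: power_mult_distrib[symmetric])
  then show ?thesis by (simp add: BR_def kerR_def fps_pow1m_add_nat mult_ac)
qed

locale correlator = twisted_data V g N G W
  for V :: "'v::complex_vector vertex_data" and g N :: "'v \<Rightarrow> 'v" and G :: "('v, 'i) generators"
    and W :: "('v, 'w::complex_vector, 'i, 'a) twist_data" +
  fixes k :: nat and \<phi> :: "nat \<Rightarrow> ('i, 'a) field_label" and m :: nat and a :: 'a
    and al :: complex and v :: 'v and w' :: "'w \<Rightarrow> complex"
  assumes m: "m < k" "\<phi> m = Twist a" "a \<in> A_set W"
    and gens: "\<And>j. j < k \<Longrightarrow> j \<noteq> m \<Longrightarrow> \<exists>i\<in>I_set G. \<phi> j = Gen i"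
    and dual: "w' \<in> graded_dual (W_wt W)"
begin

definition gi :: "nat \<Rightarrow> 'i" where "gi j = (case \<phi> j of Gen i \<Rightarrow> i | Twist _ \<Rightarrow> undefined)"
definition aj :: "nat \<Rightarrow> complex" where "aj j = gal G (gi j)"
definition par :: "nat \<Rightarrow> bit" where "par j = label_par G W (\<phi> j)"

lemma gi: "j < k \<Longrightarrow> j \<noteq> m \<Longrightarrow> gi j \<in> I_set G" and phi_gi: "j < k \<Longrightarrow> j \<noteq> m \<Longrightarrow> \<phi> j = Gen (gi j)"
  using gens[of j] by (auto simp: gi_def)

lemma par_gi: "j < k \<Longrightarrow> j \<noteq> m \<Longrightarrow> par j = gpar G (gi j)" and par_m: "par m = psi_par W a"
  by (simp_all add: par_def phi_gi m)

text \<open>Letters keep their field and their variable. A reordering of the product only changes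
  the word, so the series of different orders live in the same variables.\<close>

definition word :: "nat list \<Rightarrow> bool" where "word w \<longleftrightarrow> distinct w \<and> set w = {..<k}"

text \<open>The fields on V have integral exponents, so the fractional exponents belonging to the
  letters behind the twist field, and to the vector, collect in the variable of the twist
  field.\<close>

definition sal :: "nat list \<Rightarrow> complex" where "sal w = al + sum_list (map aj w)"

primrec VV :: "nat list \<Rightarrow> (nat \<Rightarrow> int) \<Rightarrow> (nat \<Rightarrow> nat) \<Rightarrow> 'v \<Rightarrow> 'v" where
  "VV [] e r u = u"
| "VV (j # w) e r u = Y_op V ((N ^^ r j) (gvec G (gi j))) (- e j - 1) (VV w e r u)"

primrec WW :: "nat list \<Rightarrow> (nat \<Rightarrow> int) \<Rightarrow> (nat \<Rightarrow> nat) \<Rightarrow> 'v \<Rightarrow> 'w" where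
  "WW [] e r u = 0"
| "WW (j # w) e r u = (if j = m then psi_W W a (sal w - of_int (e m) - 1) 0 (VV w e r u)
     else phiN (gi j) (r j) (aj j - of_int (e j) - 1) (WW w e r u))"

text \<open>The coefficients of the logarithm-free part of the product in the order \<open>w\<close>, with the field
  \<open>j\<close> replaced by that of \<open>N_g^(r j)\<close> applied to its generator, and \<open>v\<close> by \<open>N_g^(r m) v\<close>. The
  exponent of \<open>x_j\<close> is normalized to be an integer.\<close>
definition C :: "nat list \<Rightarrow> mser"
  where "C w e r = (if \<forall>j\<ge>k. e j = 0 then w' (WW w e r ((N ^^ r m) v)) else 0)"

section \<open>Linearity, weights and truncation of words\<close>

lemma w'_lin: "clinear w'"
  using dual by (simp add: graded_dual_def)

lemma VV_lin: "clinear (VV w e r)"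
  by (induction w) (simp_all add: clinear_id clinear_compose[OF Y_lin2])

lemma WW_lin: "set w \<subseteq> {..<k} \<Longrightarrow> clinear (WW w e r)"
proof (induction w)
  case (Cons j w)
  have "clinear (\<lambda>u. WW (j # w) e r u)"
  proof (cases "j = m")
    case True
    then show ?thesis using clinear_compose[OF psi_lin[OF m(3)] VV_lin] by simp
  next
    case False
    then show ?thesis using clinear_compose[OF phiN_lin[OF gi] Cons.IH] Cons.prems by simp
  qed
  then show ?case .
qed (simp add: clinear_iff)

lemma VV_cong: "(\<And>j. j \<in> set w \<Longrightarrow> e j = e' j) \<Longrightarrow> (\<And>j. j \<in> set w \<Longrightarrow> r j = r' j) \<Longrightarrow> VV w e r u = VV w e' r' u"
  by (induction w) auto

lemma WW_cong: "(\<And>j. j \<in> set w \<Longrightarrow> e j = e' j) \<Longrightarrow> (\<And>j. j \<in> set w \<Longrightarrow> r j = r' j) \<Longrightarrow> WW w e r u = WW w e' r' u"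
  by (induction w) (auto intro!: arg_cong[of _ _ "psi_W W a _ 0"] VV_cong)

primrec LL :: "nat list \<Rightarrow> (nat \<Rightarrow> int) \<Rightarrow> (nat \<Rightarrow> nat) \<Rightarrow> 'w \<Rightarrow> 'w" where
  "LL [] e r x = x"
| "LL (j # w) e r x = phiN (gi j) (r j) (aj j - of_int (e j) - 1) (LL w e r x)"

lemma LL_lin: "set w \<subseteq> {..<k} - {m} \<Longrightarrow> clinear (LL w e r)"
proof (induction w)
  case (Cons j w)
  then have "clinear (\<lambda>x. phiN (gi j) (r j) (aj j - of_int (e j) - 1) (LL w e r x))"
    by (intro clinear_compose[OF phiN_lin[OF gi]]) auto
  then show ?case by (simp add: LL.simps(2)[abs_def])
qed (simp add: clinear_id LL.simps(1)[abs_def])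

lemma LL_cong: "(\<And>j. j \<in> set w \<Longrightarrow> e j = e' j) \<Longrightarrow> (\<And>j. j \<in> set w \<Longrightarrow> r j = r' j) \<Longrightarrow> LL w e r u = LL w e' r' u"
  by (induction w) auto

lemma WW_append: "m \<notin> set us \<Longrightarrow> WW (us @ w) e r u = LL us e r (WW w e r u)"
  by (induction us) auto

text \<open>A power of \<open>N\<close> on a generator gives a generator of the same weight or zero,
  so a word on V is again a product of generators unless it vanishes.\<close>

lemma VV_gen_product:
  assumes u: "gen_product d \<beta> u"
  shows "set w \<subseteq> {..<k} - {m} \<Longrightarrow> VV w e r u = 0 \<or>
    (\<exists>\<beta>. gen_product (d + (\<Sum>j\<leftarrow>w. gwt G (gi j) + of_int (e j))) \<beta> (VV w e r u))"
proof (induction w)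
  case Nil
  then show ?case using u by auto
next
  case (Cons j w)
  have j: "gi j \<in> I_set G" using gi Cons.prems by simp
  from Cons consider "VV w e r u = 0" | \<beta> where "gen_product (d + (\<Sum>j\<leftarrow>w. gwt G (gi j) + of_int (e j))) \<beta> (VV w e r u)"
    by auto
  then show ?case
  proof cases
    case 1
    then show ?thesis by (simp add: clinear_0[OF Y_lin2])
  next
    case (2 \<beta>)
    show ?thesis
    proof (cases "alive (gi j) (r j)")
      case True
      note al = alive_chain[OF j True]
      from gen_product.Y[OF 2 al(1), of "- e j - 1"]
      have "gen_product (d + (\<Sum>j\<leftarrow>w. gwt G (gi j) + of_int (e j)) + gwt G (gi j) - of_int (- e j - 1) - 1)
        (\<beta> + gal G ((gN G ^^ r j) (gi j))) (VV (j # w) e r u)"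
        unfolding al(2) al(4) by simp
      moreover have "d + (\<Sum>j\<leftarrow>w. gwt G (gi j) + of_int (e j)) + gwt G (gi j) - of_int (- e j - 1) - 1
        = d + (\<Sum>j\<leftarrow>(j # w). gwt G (gi j) + of_int (e j))" by simp
      ultimately show ?thesis by metis
    next
      case False
      then show ?thesis by (simp add: alive_def clinear_0[OF Y_lin1])
    qed
  qed
qed

text \<open>The letter \<open>m\<close> has no weight or exponent of its own: \<open>gi m\<close> is
  undefined, and the two terms with it outside the sum cancel those inside.\<close>

lemma WW_weight:
  assumes c: "\<And>d \<beta> u n. gen_product d \<beta> u \<Longrightarrow> psi_W W a n 0 u \<in> W_wt W (c + of_real d - n - 1)"
    and u: "gen_product d \<beta> u"
  shows "distinct w \<Longrightarrow> set w \<subseteq> {..<k} \<Longrightarrow> m \<in> set w \<Longrightarrow> WW w e r u \<in> W_wt W (c + of_real d - al - of_real (gwt G (gi m)) + aj m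
     + (\<Sum>j\<leftarrow>w. of_real (gwt G (gi j)) - aj j + of_int (e j)))"
proof (induction w)
  case (Cons j w)
  show ?case
  proof (cases "j = m")
    case True
    let ?D = "d + (\<Sum>j\<leftarrow>w. gwt G (gi j) + of_int (e j))"
    have w: "set w \<subseteq> {..<k} - {m}" using Cons.prems True by auto
    have e: "c + complex_of_real ?D - (sal w - of_int (e m) - 1) - 1
      = c + of_real d - al - of_real (gwt G (gi m)) + aj m + (\<Sum>j\<leftarrow>(j # w). of_real (gwt G (gi j)) - aj j + of_int (e j))"
    proof -
      have "complex_of_real (\<Sum>j\<leftarrow>w. gwt G (gi j) + of_int (e j)) - (\<Sum>j\<leftarrow>w. aj j)
        = (\<Sum>j\<leftarrow>w. of_real (gwt G (gi j)) - aj j + of_int (e j))"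
        by (induction w) (simp_all add: algebra_simps)
      then show ?thesis using True by (simp add: sal_def algebra_simps)
    qed
    from VV_gen_product[OF u w, of e r] show ?thesis
    proof
      assume "VV w e r u = 0"
      then show ?thesis using True by (simp add: clinear_0[OF psi_lin[OF m(3)]] csubspace_0[OF W_wt_subspace])
    next
      assume "\<exists>\<beta>. gen_product ?D \<beta> (VV w e r u)"
      then obtain \<beta> where "gen_product ?D \<beta> (VV w e r u)" by (elim exE)
      from c[OF this, of "sal w - of_int (e m) - 1"] show ?thesis unfolding e using True by simp
    qed
  next
    case False
    then have mw: "m \<in> set w" "distinct w" "set w \<subseteq> {..<k}" "gi j \<in> I_set G" using Cons.prems gi by auto
    let ?c = "c + of_real d - al - of_real (gwt G (gi m)) + aj m"
    have e: "?c + (\<Sum>j\<leftarrow>w. of_real (gwt G (gi j)) - aj j + of_int (e j)) + of_real (gwt G (gi j)) - (aj j - of_int (e j) - 1) - 1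
       = ?c + (\<Sum>j\<leftarrow>(j # w). of_real (gwt G (gi j)) - aj j + of_int (e j))" by simp
    show ?thesis
      using phiN_weight[OF mw(4) Cons.IH[OF mw(2,3,1)], of "r j" "aj j - of_int (e j) - 1"] False unfolding e by simp
  qed
qed simp

text \<open>Linear maps send zero to zero, so a nonvanishing coefficient of the whole word tests the
  weight of every suffix.\<close>

lemma suffix_nonzero:
  assumes "WW (us @ w) e r u \<noteq> 0" "set (us @ w) \<subseteq> {..<k}"
  shows "if m \<in> set us then VV w e r u \<noteq> 0 else WW w e r u \<noteq> 0"
  using assms
proof (induction us)
  case (Cons j us)
  have "VV w e r u = 0 \<Longrightarrow> VV (us @ w) e r u = 0" for us
    by (induction us) (simp_all add: clinear_0[OF Y_lin2])
  then have VVs: "VV (us @ w) e r u \<noteq> 0 \<Longrightarrow> VV w e r u \<noteq> 0" for us by blast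
  show ?case
  proof (cases "j = m")
    case True
    then have "VV (us @ w) e r u \<noteq> 0" using Cons.prems(1) clinear_0[OF psi_lin[OF m(3)]] by auto
    then show ?thesis using True VVs by simp
  next
    case False
    then have "WW (us @ w) e r u \<noteq> 0" using Cons.prems clinear_0[OF phiN_lin[OF gi]] by auto
    then show ?thesis using Cons False by auto
  qed
qed simp

text \<open>The weights of V and W are bounded below, which bounds the degree of every suffix below.
  The functional \<open>w'\<close> sees finitely many weights, which bounds the total degree above.
  For general \<open>u\<close> the bounds of finitely many products of generators are
  combined.\<close>

lemma exponent_bounds:
  assumes w: "word w"
  shows "\<exists>c::int. \<forall>e r. w' (WW w e r u) \<noteq> 0 \<longrightarrow> sum e (set w) \<le> c \<and> (\<forall>xs ys. w = xs @ ys \<longrightarrow> - c \<le> sum e (set ys))"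
proof -
  have wlin: "clinear (WW w e r)" for e r using w by (intro WW_lin) (simp add: word_def)
  obtain c0 where c0: "\<And>d \<beta> u n. gen_product d \<beta> u \<Longrightarrow> psi_W W a n 0 u \<in> W_wt W (c0 + of_real d - n - 1)"
    using psi_weight[OF m(3)] by blast
  obtain bW where bW: "\<And>n x. x \<in> W_wt W n \<Longrightarrow> x \<noteq> 0 \<Longrightarrow> bW \<le> Re n" using W_wt_bounded by blast
  obtain bV where bV: "\<And>d x. x \<in> V_wt V d \<Longrightarrow> x \<noteq> 0 \<Longrightarrow> bV \<le> d" using V_wt_bounded by blast
  have fin: "finite {n. \<exists>x\<in>W_wt W n. w' x \<noteq> 0}" using dual by (simp add: graded_dual_def)
  have "u \<in> cspan {u. \<exists>d \<beta>. gen_product d \<beta> u}" by (simp add: span_gen_product)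
  then show ?thesis
  proof (induction rule: complex_vector.span_induct_alt)
    case base
    then show ?case by (simp add: clinear_0[OF wlin] clinear_0[OF w'_lin])
  next
    case (step k1 x y)
    then obtain d \<beta> where x: "gen_product d \<beta> x" by blast
    let ?k0 = "c0 + of_real d - al - of_real (gwt G (gi m)) + aj m"
    define lo where "lo ys = bW - Re ?k0 - Re (\<Sum>j\<leftarrow>ys. of_real (gwt G (gi j)) - aj j)" for ys
    define lo' where "lo' ys = bV - d - (\<Sum>j\<leftarrow>ys. gwt G (gi j))" for ys
    define hi where "hi = Max (insert 0 (Re ` {n. \<exists>x\<in>W_wt W n. w' x \<noteq> 0})) - Re ?k0 - Re (\<Sum>j\<leftarrow>w. of_real (gwt G (gi j)) - aj j)"
    \<comment> \<open>A single number above all individual bounds: a pair for each suffix and one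
      for the total degree.\<close>
    define L where "L = (\<Sum>q\<le>length w. \<bar>lo (drop q w)\<bar> + \<bar>lo' (drop q w)\<bar>) + \<bar>hi\<bar>"
    have sums: "(\<Sum>j\<leftarrow>ys. of_real (gwt G (gi j)) - aj j + of_int (e j)) = (\<Sum>j\<leftarrow>ys. of_real (gwt G (gi j)) - aj j) + of_int (sum e (set ys))"
      "(\<Sum>j\<leftarrow>ys. gwt G (gi j) + of_int (e j)) = (\<Sum>j\<leftarrow>ys. gwt G (gi j)) + of_int (sum e (set ys))"
      if "distinct ys" for ys and e :: "nat \<Rightarrow> int"
      using that by (induction ys) (simp_all add: algebra_simps)
    have X: "\<lceil>L\<rceil> \<ge> sum e (set w) \<and> (\<forall>xs ys. w = xs @ ys \<longrightarrow> - \<lceil>L\<rceil> \<le> sum e (set ys))" if nz: "w' (WW w e r x) \<noteq> 0" for e r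
    proof (intro conjI allI impI)
      have wd: "distinct w" "set w \<subseteq> {..<k}" "m \<in> set w" using w m by (auto simp: word_def)
      have Wx: "WW w e r x \<noteq> 0" using nz clinear_0[OF w'_lin] by auto
      have wt: "WW w e r x \<in> W_wt W (?k0 + (\<Sum>j\<leftarrow>w. of_real (gwt G (gi j)) - aj j + of_int (e j)))"
        by (rule WW_weight[OF c0 x wd])
      have "Re (?k0 + (\<Sum>j\<leftarrow>w. of_real (gwt G (gi j)) - aj j + of_int (e j))) \<le> Max (insert 0 (Re ` {n. \<exists>x\<in>W_wt W n. w' x \<noteq> 0}))"
      proof -
        have "?k0 + (\<Sum>j\<leftarrow>w. of_real (gwt G (gi j)) - aj j + of_int (e j)) \<in> {n. \<exists>x\<in>W_wt W n. w' x \<noteq> 0}"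
          using wt nz by blast
        then show ?thesis using fin by (intro Max_ge) (simp, blast)
      qed
      then have "of_int (sum e (set w)) \<le> hi" unfolding sums(1)[OF wd(1)] hi_def by simp
      moreover have "hi \<le> L"
      proof -
        have "0 \<le> (\<Sum>q\<le>length w. \<bar>lo (drop q w)\<bar> + \<bar>lo' (drop q w)\<bar>)" by (rule sum_nonneg) simp
        then show ?thesis unfolding L_def by linarith
      qed
      ultimately show "sum e (set w) \<le> \<lceil>L\<rceil>" by linarith
      fix xs ys assume wxy: "w = xs @ ys"
      have Lys: "\<bar>lo ys\<bar> + \<bar>lo' ys\<bar> \<le> L"
      proof -
        have "\<bar>lo (drop (length xs) w)\<bar> + \<bar>lo' (drop (length xs) w)\<bar> \<le> (\<Sum>q\<le>length w. \<bar>lo (drop q w)\<bar> + \<bar>lo' (drop q w)\<bar>)"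
          by (rule member_le_sum[of "length xs" "{..length w}" "\<lambda>q. \<bar>lo (drop q w)\<bar> + \<bar>lo' (drop q w)\<bar>"]) (auto simp: wxy)
        then show ?thesis by (simp add: L_def wxy)
      qed
      have yd: "distinct ys" "set ys \<subseteq> {..<k}" using wd wxy by auto
      have sn: "if m \<in> set xs then VV ys e r x \<noteq> 0 else WW ys e r x \<noteq> 0"
        by (rule suffix_nonzero) (use Wx wd wxy in auto)
      show "- \<lceil>L\<rceil> \<le> sum e (set ys)"
      \<comment> \<open>A suffix without the twist field yields a vector of V, one with it a vector
        of W; each has its own lower bound.\<close>
      proof (cases "m \<in> set xs")
        case True
        then have ys: "set ys \<subseteq> {..<k} - {m}" "VV ys e r x \<noteq> 0" using wd wxy sn by auto
        then obtain \<beta>' where "gen_product (d + (\<Sum>j\<leftarrow>ys. gwt G (gi j) + of_int (e j))) \<beta>' (VV ys e r x)"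
          using VV_gen_product[OF x ys(1), of e r] by blast
        from bV[OF gen_product_weight[OF this] ys(2)] have "lo' ys \<le> of_int (sum e (set ys))"
          unfolding sums(2)[OF yd(1)] lo'_def by simp
        then show ?thesis using Lys by linarith
      next
        case False
        then have ys: "m \<in> set ys" "WW ys e r x \<noteq> 0" using wd wxy sn by auto
        have wy: "WW ys e r x \<in> W_wt W (?k0 + (\<Sum>j\<leftarrow>ys. of_real (gwt G (gi j)) - aj j + of_int (e j)))"
          by (rule WW_weight[OF c0 x yd ys(1)])
        from bW[OF wy ys(2)] have "lo ys \<le> of_int (sum e (set ys))"
          unfolding sums(1)[OF yd(1)] lo_def by simp
        then show ?thesis using Lys by linarith
      qed
    qed
    obtain cy where cy: "\<And>e r. w' (WW w e r y) \<noteq> 0 \<Longrightarrow> sum e (set w) \<le> cy \<and> (\<forall>xs ys. w = xs @ ys \<longrightarrow> - cy \<le> sum e (set ys))"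
      using step by blast
    show ?case
    proof (intro exI[of _ "max \<lceil>L\<rceil> cy"] allI impI)
      fix e r assume "w' (WW w e r (k1 *\<^sub>C x + y)) \<noteq> 0"
      then have "w' (WW w e r x) \<noteq> 0 \<or> w' (WW w e r y) \<noteq> 0"
        by (auto simp: clinear_add[OF wlin] clinear_scale[OF wlin] clinear_add[OF w'_lin] clinear_scale[OF w'_lin])
      then have "(sum e (set w) \<le> \<lceil>L\<rceil> \<and> (\<forall>xs ys. w = xs @ ys \<longrightarrow> - \<lceil>L\<rceil> \<le> sum e (set ys))) \<or>
         (sum e (set w) \<le> cy \<and> (\<forall>xs ys. w = xs @ ys \<longrightarrow> - cy \<le> sum e (set ys)))" using X cy by blast
      then show "sum e (set w) \<le> max \<lceil>L\<rceil> cy \<and> (\<forall>xs ys. w = xs @ ys \<longrightarrow> - (max \<lceil>L\<rceil> cy) \<le> sum e (set ys))"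
        by (elim disjE) (auto intro: order_trans[rotated] le_max_iff_disj[THEN iffD2] simp: minus_le_iff)
    qed
  qed
qed

text \<open>Positivity matters: an index \<open>r \<ge> RB\<close> must not be zero, since an index
  whose generator is the zero vector may still name a nonzero field on W.\<close>

definition RB :: nat
  where "RB = (SOME R. (\<forall>r\<ge>R. (N ^^ r) v = 0) \<and> (\<forall>j<k. \<forall>r\<ge>R. (N ^^ r) (gvec G (gi j)) = 0) \<and> 0 < R)"

lemma RB: "r \<ge> RB \<Longrightarrow> (N ^^ r) v = 0" "j < k \<Longrightarrow> r \<ge> RB \<Longrightarrow> (N ^^ r) (gvec G (gi j)) = 0" "0 < RB"
proof -
  obtain R where R: "\<forall>x\<in>insert v ((\<lambda>j. gvec G (gi j)) ` {..<k}). \<forall>r\<ge>R. (N ^^ r) x = 0"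
    using finite_nilpotent_bound[OF N_nil N_lin, of "insert v ((\<lambda>j. gvec G (gi j)) ` {..<k})"] by auto
  have "\<exists>R. (\<forall>r\<ge>R. (N ^^ r) v = 0) \<and> (\<forall>j<k. \<forall>r\<ge>R. (N ^^ r) (gvec G (gi j)) = 0) \<and> 0 < R"
    by (rule exI[of _ "Suc R"]) (use R in auto)
  from someI_ex[OF this, folded RB_def]
  show "r \<ge> RB \<Longrightarrow> (N ^^ r) v = 0" "j < k \<Longrightarrow> r \<ge> RB \<Longrightarrow> (N ^^ r) (gvec G (gi j)) = 0" "0 < RB" by blast+
qed

lemma C_zero_large:
  assumes w: "word w" and j: "j < k" "RB \<le> r j"
  shows "C w e r = 0"
proof (cases "j = m")
  case True
  have lin: "clinear (WW w e r)" using w by (intro WW_lin) (simp add: word_def)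
  then show ?thesis using RB(1) True j by (simp add: C_def clinear_0[OF lin] clinear_0[OF w'_lin])
next
  case False
  have z: "(N ^^ r j) (gvec G (gi j)) = 0" "0 < r j" using RB(2)[OF j(1) j(2)] RB(3) j by auto
  have V0: "j \<in> set ys \<Longrightarrow> VV ys e r u = 0" for ys u
    by (induction ys) (auto simp: clinear_0[OF Y_lin2] clinear_0[OF Y_lin1] z)
  have W0: "j \<in> set ys \<Longrightarrow> set ys \<subseteq> {..<k} \<Longrightarrow> WW ys e r u = 0" for ys u
  proof (induction ys)
    case (Cons y ys)
    show ?case
    proof (cases "y = m")
      case True
      then show ?thesis using Cons False V0 by (auto simp: clinear_0[OF psi_lin[OF m(3)]])
    next
      case False
      then have y: "gi y \<in> I_set G" using Cons gi by auto
      show ?thesis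
      proof (cases "y = j")
        case True
        then show ?thesis using False phiN_zero[OF y] z by simp
      next
        case neq: False
        then have "WW ys e r u = 0" using Cons by auto
        then show ?thesis using False by (simp add: clinear_0[OF phiN_lin[OF y]])
      qed
    qed
  qed simp
  have "WW w e r ((N ^^ r m) v) = 0" using W0 w j by (simp add: word_def)
  then show ?thesis by (simp add: C_def clinear_0[OF w'_lin])
qed

lemma C_trunc:
  assumes w: "word w"
  shows "trunc w (C w)"
proof -
  have "\<forall>s. \<exists>c::int. \<forall>e r. w' (WW w e r ((N ^^ s) v)) \<noteq> 0 \<longrightarrow> sum e (set w) \<le> c \<and> (\<forall>xs ys. w = xs @ ys \<longrightarrow> - c \<le> sum e (set ys))"
    using exponent_bounds[OF w] by blast
  from choice[OF this] obtain cs where cs: "\<forall>s. \<forall>e r. w' (WW w e r ((N ^^ s) v)) \<noteq> 0 \<longrightarrow>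
    sum e (set w) \<le> cs s \<and> (\<forall>xs ys. w = xs @ ys \<longrightarrow> - (cs s) \<le> sum e (set ys))" by (elim exE)
  define c where "c = int RB + (\<Sum>s<RB. \<bar>cs s\<bar>)"
  have "bounded_by w c (C w)"
    unfolding bounded_by_def
  proof (intro allI impI)
    fix e r assume nz: "C w e r \<noteq> 0"
    then have nz': "w' (WW w e r ((N ^^ r m) v)) \<noteq> 0" and e0: "\<forall>j\<ge>k. e j = 0" by (auto simp: C_def split: if_splits)
    have rb: "r j < RB" if "j < k" for j
      using C_zero_large[OF w that, of r e] nz by (cases "r j < RB") auto
    have "\<bar>cs (r m)\<bar> \<le> (\<Sum>s<RB. \<bar>cs s\<bar>)"
      by (rule member_le_sum) (use rb m in auto)
    then have cm: "\<bar>cs (r m)\<bar> \<le> c" by (simp add: c_def)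
    have b: "sum e (set w) \<le> cs (r m)" "\<And>xs ys. w = xs @ ys \<Longrightarrow> - (cs (r m)) \<le> sum e (set ys)" using cs nz' by blast+
    show "(\<forall>j. j \<notin> set w \<longrightarrow> e j = 0) \<and> (\<forall>j\<in>set w. int (r j) \<le> c) \<and> sum e (set w) \<le> c \<and>
      (\<forall>xs ys. w = xs @ ys \<longrightarrow> - c \<le> sum e (set ys))"
    proof (intro conjI allI impI ballI)
      show "e j = 0" if "j \<notin> set w" for j using that e0 w by (simp add: word_def)
      show "int (r j) \<le> c" if "j \<in> set w" for j
      proof -
        have "r j < RB" using rb that w by (simp add: word_def)
        moreover have "0 \<le> (\<Sum>s<RB. \<bar>cs s\<bar>)" by (simp add: sum_nonneg)
        ultimately show ?thesis unfolding c_def by linarith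
      qed
      show "sum e (set w) \<le> c" using b(1) cm by linarith
      show "- c \<le> sum e (set ys)" if "w = xs @ ys" for xs ys using b(2)[OF that] cm by linarith
    qed
  qed
  then show ?thesis by (auto simp: trunc_def)
qed

end

section \<open>Independence of the order\<close>

lemma sign_cancel: "s * s = 1 \<Longrightarrow> (s * x) * (s * y) = x * (y :: complex)"
  by (metis mult.assoc mult.left_commute mult_1)

lemma before_split: "distinct (us @ i # vs @ j # zs) \<Longrightarrow> before (us @ i # vs @ j # zs) i j"
  unfolding before_def by blast

lemma pd_neg: "pd j i D = (\<lambda>e r. - 1 * pd i j D e r)"
  by (simp add: fun_eq_iff pd_def)

lemma pd_neg_pow: "(pd j i ^^ M) D e r = (- 1) ^ M * (pd i j ^^ M) D e r"
proof (induction M arbitrary: e r)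
  case (Suc M)
  then have "(pd j i ^^ M) D = (\<lambda>e r. (- 1) ^ M * (pd i j ^^ M) D e r)" by (simp add: fun_eq_iff)
  then have "(pd j i ^^ Suc M) D = pd j i (\<lambda>e r. (- 1) ^ M * (pd i j ^^ M) D e r)" by simp
  also have "\<dots> = (\<lambda>e r. (- 1) ^ M * (- 1 * pd i j ((pd i j ^^ M) D) e r))"
    unfolding pd_scale pd_neg[of j i] ..
  finally show ?case by simp
qed simp

lemma pd_pow_mono:
  assumes "\<And>e. (pd i j ^^ M0) D e r = c * (pd i j ^^ M0) D' e r" "M0 \<le> M"
  shows "(pd i j ^^ M) D e r = c * (pd i j ^^ M) D' e r"
  using assms(2)
proof (induction M arbitrary: e rule: dec_induct)
  case (step M)
  then show ?case by (simp add: pd_def right_diff_distrib)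
qed (rule assms(1))

lemma pd_pow_zero: "(\<And>e. D e r = 0) \<Longrightarrow> (pd i j ^^ M) D e r = 0"
  by (simp add: pd_pow)

text \<open>The operators to which this is applied are known to commute on truncated series;
  \<open>H\<close> is the class on which commutation holds.\<close>

lemma foldr_extract:
  assumes "j \<in> set js" "H D" and H: "\<And>i D. i \<in> set js \<Longrightarrow> H D \<Longrightarrow> H (f i D)"
    and comm: "\<And>i i' D. i \<in> set js \<Longrightarrow> i' \<in> set js \<Longrightarrow> H D \<Longrightarrow> f i (f i' D) = f i' (f i D)"
  shows "foldr f js D = foldr f (remove1 j js) (f j D)"
proof -
  have "set us \<subseteq> set js \<Longrightarrow> H D \<Longrightarrow> H (foldr f us D)" for us D
    by (induction us) (simp_all add: H)
  moreover have "set us \<subseteq> set js \<Longrightarrow> j \<in> set us \<Longrightarrow> foldr f us D = foldr f (remove1 j us) (f j D)" for us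
  proof (induction us)
    case (Cons u us)
    show ?case
    proof (cases "u = j")
      case True
      have "set us \<subseteq> set js \<Longrightarrow> f j (foldr f us D) = foldr f us (f j D)" for us
      proof (induction us)
        case (Cons x us)
        then have "H (foldr f us D)" using calculation[of us D] assms(2) by simp
        then have "f j (f x (foldr f us D)) = f x (f j (foldr f us D))" using comm Cons.prems assms(1) by simp
        then show ?case using Cons by simp
      qed simp
      then show ?thesis using True Cons.prems by simp
    qed (use Cons in simp)
  qed simp
  ultimately show ?thesis using assms(1) by simp
qed

lemma foldr_cong_class:
  "(\<And>j D. j \<in> set js \<Longrightarrow> f j D = h j D) \<Longrightarrow> foldr f js D = foldr h js D"
  by (induction js) simp_all

context correlator
begin

lemma C_append:
  assumes "m \<notin> set us" "\<forall>j\<ge>k. e j = 0"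
  shows "C (us @ w) e r = w' (LL us e r (WW w e r ((N ^^ r m) v)))"
  using assms by (simp add: C_def WW_append)

lemma C_dead:
  assumes w: "word w" and j: "j < k" "j \<noteq> m" "0 < r j" "(N ^^ r j) (gvec G (gi j)) = 0"
  shows "C w e r = 0"
proof -
  have V0: "j \<in> set ys \<Longrightarrow> VV ys e r u = 0" for ys u
    by (induction ys) (auto simp: clinear_0[OF Y_lin2] clinear_0[OF Y_lin1] j)
  have W0: "j \<in> set ys \<Longrightarrow> set ys \<subseteq> {..<k} \<Longrightarrow> WW ys e r u = 0" for ys u
  proof (induction ys)
    case (Cons y ys)
    show ?case
    proof (cases "y = m")
      case True
      then show ?thesis using Cons j V0 by (auto simp: clinear_0[OF psi_lin[OF m(3)]])
    next
      case False
      then have y: "gi y \<in> I_set G" using Cons gi by auto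
      show ?thesis
      proof (cases "y = j")
        case True
        then show ?thesis using False phiN_zero[OF y] j by simp
      next
        case neq: False
        then have "WW ys e r u = 0" using Cons by auto
        then show ?thesis using False by (simp add: clinear_0[OF phiN_lin[OF y]])
      qed
    qed
  qed simp
  have "WW w e r ((N ^^ r m) v) = 0" using W0 w j by (simp add: word_def)
  then show ?thesis by (simp add: C_def clinear_0[OF w'_lin])
qed

text \<open>With the powers of \<open>N_g\<close> fixed, the two letters are generating fields
  further along their chains, and property 6 provides an exponent for this pair. If a chain has
  ended, both series vanish.\<close>

lemma C_swap_phi_at:
  assumes w: "word (us @ x # y # zs)" and mz: "m \<in> set zs"
  shows "\<exists>M0. \<forall>e r. r x = s \<longrightarrow> r y = t \<longrightarrow> (pd x y ^^ M0) (C (us @ x # y # zs)) e r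
    = parity_sign (par x) (par y) * (pd x y ^^ M0) (C (us @ y # x # zs)) e r"
proof -
  have d: "distinct (us @ x # y # zs)" "set (us @ x # y # zs) = {..<k}" using w by (auto simp: word_def)
  have xy: "x < k" "y < k" "x \<noteq> m" "y \<noteq> m" "m \<notin> set us" "x \<notin> set us" "y \<notin> set us" "x \<notin> set zs" "y \<notin> set zs" "x \<noteq> y"
    using d mz by auto
  have us: "set us \<subseteq> {..<k} - {m}" using d xy by auto
  have w2: "word (us @ y # x # zs)" using w by (auto simp: word_def)
  note gx = gi[OF xy(1,3)] and gy = gi[OF xy(2,4)]
  show ?thesis
  proof (cases "alive (gi x) s \<and> alive (gi y) t")
    case False
    have "C (us @ x # y # zs) e r = 0 \<and> C (us @ y # x # zs) e r = 0" if "r x = s" "r y = t" for e r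
      using C_dead[OF w xy(1,3), of r e] C_dead[OF w2 xy(1,3), of r e] C_dead[OF w xy(2,4), of r e] C_dead[OF w2 xy(2,4), of r e]
        False that by (auto simp: alive_def)
    then show ?thesis by (intro exI[of _ 0]) simp
  next
    case True
    let ?i = "(gN G ^^ s) (gi x)" and ?j = "(gN G ^^ t) (gi y)"
    note ax = alive_chain[OF gx True[THEN conjunct1]] and ay = alive_chain[OF gy True[THEN conjunct2]]
    obtain M where M: "\<forall>w p q.
      (\<Sum>l\<le>M. ((- 1) ^ l * of_nat (M choose l)) *\<^sub>C
        phi_W W ?i (of_nat M - p - 1 - of_nat l) 0 (phi_W W ?j (of_nat l - q - 1) 0 w))
      = parity_sign (gpar G ?i) (gpar G ?j) *\<^sub>C (\<Sum>l\<le>M. ((- 1) ^ l * of_nat (M choose l)) *\<^sub>C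
        phi_W W ?j (of_nat l - q - 1) 0 (phi_W W ?i (of_nat M - p - 1 - of_nat l) 0 w))"
      using phi_swap[OF ax(1) ay(1)] by (elim exE)
    have px: "phiN (gi x) s n u = phi_W W ?i n 0 u" "phiN (gi y) t n u = phi_W W ?j n 0 u" for n u
      using True by (simp_all add: phiN_chain[OF gx] phiN_chain[OF gy])
    have main: "(pd x y ^^ M) (C (us @ x # y # zs)) e r = parity_sign (par x) (par y) * (pd x y ^^ M) (C (us @ y # x # zs)) e r"
      if r: "r x = s" "r y = t" for e r
    proof (cases "\<forall>j\<ge>k. e j = 0")
      case e0: True
      define U where "U = WW zs e r ((N ^^ r m) v)"
      define F where "F x = w' (LL us e r x)" for x
      have Flin: "clinear F" unfolding F_def[abs_def] by (rule clinear_compose[OF w'_lin LL_lin[OF us]])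
      \<comment> \<open>The true exponents of \<open>x_x\<close> and \<open>x_y\<close>, undoing the
        normalization of \<open>C\<close> to integers.\<close>
      define p q where "p = of_int (e x) - aj x" and "q = of_int (e y) - aj y"
      let ?e = "\<lambda>l. mv x (int l - int M) (mv y (- int l) e)"
      have el: "\<forall>j\<ge>k. ?e l j = 0" for l using e0 xy by (simp add: mv_apply)
      have eq: "LL us (?e l) r u = LL us e r u" "WW zs (?e l) r u' = WW zs e r u'" for l u u'
        by (intro LL_cong WW_cong; use xy in \<open>auto simp: mv_apply\<close>)+
      have ex: "aj x - of_int (?e l x) - 1 = of_nat M - p - 1 - of_nat l" "aj y - of_int (?e l y) - 1 = of_nat l - q - 1" for l
        using xy by (simp_all add: mv_apply p_def q_def)
      have 1: "C (us @ x # y # zs) (?e l) r = F (phi_W W ?i (of_nat M - p - 1 - of_nat l) 0 (phi_W W ?j (of_nat l - q - 1) 0 U))" for l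
        unfolding C_append[OF xy(5) el] F_def U_def
        using xy by (simp only: WW.simps if_False ex px eq r) 
      have 2: "C (us @ y # x # zs) (?e l) r = F (phi_W W ?j (of_nat l - q - 1) 0 (phi_W W ?i (of_nat M - p - 1 - of_nat l) 0 U))" for l
        unfolding C_append[OF xy(5) el] F_def U_def
        using xy by (simp only: WW.simps if_False ex px eq r)
      have "(pd x y ^^ M) (C (us @ x # y # zs)) e r = F (\<Sum>l\<le>M. ((- 1) ^ l * of_nat (M choose l)) *\<^sub>C
          phi_W W ?i (of_nat M - p - 1 - of_nat l) 0 (phi_W W ?j (of_nat l - q - 1) 0 U))"
        unfolding pd_pow 1 clinear_sum[OF Flin] clinear_scale[OF Flin] by simp
      also have "\<dots> = F (parity_sign (gpar G ?i) (gpar G ?j) *\<^sub>C (\<Sum>l\<le>M. ((- 1) ^ l * of_nat (M choose l)) *\<^sub>C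
          phi_W W ?j (of_nat l - q - 1) 0 (phi_W W ?i (of_nat M - p - 1 - of_nat l) 0 U)))"
        using M[THEN spec[of _ U], THEN spec[of _ p], THEN spec[of _ q]] by simp
      also have "\<dots> = parity_sign (par x) (par y) * (pd x y ^^ M) (C (us @ y # x # zs)) e r"
        unfolding pd_pow 2 clinear_sum[OF Flin] clinear_scale[OF Flin] ax(5) ay(5) par_gi[OF xy(1,3)] par_gi[OF xy(2,4)] by simp
      finally show ?thesis .
    next
      case False
      then obtain j where j: "j \<ge> k" "e j \<noteq> 0" by blast
      have "C w (mv x a (mv y b e)) r = 0" for w a b
        using j xy by (auto simp: C_def mv_apply)
      then show ?thesis by (simp add: pd_pow)
    qed
    then show ?thesis by (intro exI[of _ M]) blast
  qed
qed

text \<open>Only powers of \<open>N_g\<close> below \<open>RB\<close> contribute, so the exponents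
  for the individual pairs have a common upper bound.\<close>

lemma C_swap_phi:
  assumes w: "word (us @ x # y # zs)" and mz: "m \<in> set zs"
  shows "\<exists>M0. \<forall>M\<ge>M0. (pd x y ^^ M) (C (us @ x # y # zs))
    = (\<lambda>e r. parity_sign (par x) (par y) * (pd x y ^^ M) (C (us @ y # x # zs)) e r)"
proof -
  have w2: "word (us @ y # x # zs)" using w by (auto simp: word_def)
  have xy: "x < k" "y < k" using w by (auto simp: word_def)
  define Q where "Q s t M0 \<longleftrightarrow> (\<forall>e r. r x = s \<longrightarrow> r y = t \<longrightarrow> (pd x y ^^ M0) (C (us @ x # y # zs)) e r
    = parity_sign (par x) (par y) * (pd x y ^^ M0) (C (us @ y # x # zs)) e r)" for s t M0
  define f where "f s t = (SOME M0. Q s t M0)" for s t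
  have f: "Q s t (f s t)" for s t
    unfolding f_def by (rule someI_ex) (use C_swap_phi_at[OF w mz, of s t] in \<open>simp add: Q_def\<close>)
  define M0 where "M0 = (\<Sum>s<RB. \<Sum>t<RB. f s t)"
  have "(pd x y ^^ M) (C (us @ x # y # zs)) e r = parity_sign (par x) (par y) * (pd x y ^^ M) (C (us @ y # x # zs)) e r"
    if M: "M0 \<le> M" for M e r
  proof (cases "r x < RB \<and> r y < RB")
    case True
    have "f (r x) (r y) \<le> (\<Sum>t<RB. f (r x) t)" by (rule member_le_sum) (use True in auto)
    also have "\<dots> \<le> M0" unfolding M0_def by (rule member_le_sum[of "r x" _ "\<lambda>s. \<Sum>t<RB. f s t"]) (use True in auto)
    finally have le: "f (r x) (r y) \<le> M" using M by simp
    show ?thesis by (rule pd_pow_mono[OF _ le]) (use f[of "r x" "r y"] in \<open>simp add: Q_def\<close>)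
  next
    case False
    then obtain j where "j < k" "RB \<le> r j" using xy by (auto simp: not_less)
    then have "C (us @ x # y # zs) e r = 0" "C (us @ y # x # zs) e r = 0" for e
      using C_zero_large w w2 by blast+
    then show ?thesis by (simp add: pd_pow_zero)
  qed
  then show ?thesis by (intro exI[of _ M0]) (simp add: fun_eq_iff)
qed

text \<open>The kernels are expanded in \<open>x_m / x_b\<close> on one side and in
  \<open>x_b / x_m\<close> on the other, as in property 7. Multiplication by
  \<open>(x_b - x_m)^M\<close> raises their exponent to the one occurring there, and the raising of
  the index in \<open>opr\<close> stands for the iterated commutators.\<close>

lemma C_swap_psi_at:
  assumes w: "word (us @ b # m # zs)"
  shows "\<exists>M0. \<forall>e r. r b = s \<longrightarrow> (pd b m ^^ M0) (opr (BL (aj b)) b m b (C (us @ b # m # zs))) e r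
    = parity_sign (par b) (par m) * (pd b m ^^ M0) (opr (BR (aj b)) m b b (C (us @ m # b # zs))) e r"
proof -
  have d: "distinct (us @ b # m # zs)" "set (us @ b # m # zs) = {..<k}" using w by (auto simp: word_def)
  have b: "b < k" "b \<noteq> m" "m \<notin> set us" "b \<notin> set us" "m \<notin> set zs" "b \<notin> set zs" "m < k"
    using d by auto
  have us: "set us \<subseteq> {..<k} - {m}" using d by auto
  let ?w = "us @ b # m # zs" and ?w2 = "us @ m # b # zs"
  have w2: "word ?w2" using w by (auto simp: word_def)
  have bf: "before ?w b m" "before ?w2 m b"
    using d(1) before_split[of us b "[]" m zs] before_split[of us m "[]" b zs] by auto
  have bs: "b \<in> set ?w" "b \<in> set ?w2" by auto
  note g = gi[OF b(1,2)]
  show ?thesis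
  proof (cases "alive (gi b) s")
    case False
    have z: "C ?w e (up b t r) = 0" "C ?w2 e (up b t r) = 0" if "r b = s" for e r t
    proof -
      have "(N ^^ (t + s)) (gvec G (gi b)) = 0" "0 < t + s"
        using False clinear_0[OF clinear_funpow[OF N_lin]] by (auto simp: alive_def funpow_add)
      then show "C ?w e (up b t r) = 0" "C ?w2 e (up b t r) = 0"
        using C_dead[OF w b(1,2), of "up b t r" e] C_dead[OF w2 b(1,2), of "up b t r" e] that
        by (simp_all add: up_def add.commute)
    qed
    then show ?thesis by (intro exI[of _ 0]) (simp add: opr_def)
  next
    case True
    let ?i = "(gN G ^^ s) (gi b)"
    note ab = alive_chain[OF g True]
    obtain M where M: "\<forall>v p q. \<exists>T0 B0. \<forall>T\<ge>T0. \<forall>B\<ge>B0. let A = gal G ?i + of_nat M in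
      (\<Sum>t<T. \<Sum>l<B. (fps_nth (kerL A t) l / fact t) *\<^sub>C
          phiN ?i t (A - of_int p - 1 - of_nat l) (psi_W W a (of_nat l - q - 1) 0 v))
      = parity_sign (gpar G ?i) (psi_par W a) *\<^sub>C
        (\<Sum>t<T. \<Sum>l<B. (fps_nth (kerR A t) l / fact t) *\<^sub>C
          psi_W W a (A - q - 1 - of_nat l) 0 (Y_op V ((N ^^ t) (gvec G ?i)) (int l - p - 1) v))"
      using psi_swap_finite[OF ab(1) m(3)] by (elim exE)
    define A where "A = aj b + of_nat M"
    have A: "A = gal G ?i + of_nat M" by (simp add: A_def aj_def ab(3))
    obtain c where c: "bounded_by ?w c (C ?w)" using C_trunc[OF w] by (auto simp: trunc_def)
    obtain c2 where c2: "bounded_by ?w2 c2 (C ?w2)" using C_trunc[OF w2] by (auto simp: trunc_def)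
    have main: "(pd b m ^^ M) (opr (BL (aj b)) b m b (C ?w)) e r
      = parity_sign (par b) (par m) * (pd b m ^^ M) (opr (BR (aj b)) m b b (C ?w2)) e r" if r: "r b = s" for e r
    proof -
      have L: "(pd b m ^^ M) (opr (BL (aj b)) b m b (C ?w)) e r = opr (BL A) b m b (C ?w) (mv b (- int M) e) r"
        unfolding pd_pow_opr[OF C_trunc[OF w] bf(1) bs(1)] shx_pow BL_add A_def ..
      have R: "(pd b m ^^ M) (opr (BR (aj b)) m b b (C ?w2)) e r
          = opr (\<lambda>t. fps_const ((- 1) ^ M) * BR A t) m b b (C ?w2) (mv m (- int M) e) r * (- 1) ^ M"
        unfolding pd_neg_pow[where j = b and i = m] pd_pow_opr[OF C_trunc[OF w2] bf(2) bs(2)] shx_pow BR_add A_def by simp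
      show ?thesis
      proof (cases "\<forall>j\<ge>k. e j = 0")
        case False
        then obtain j where j: "j \<ge> k" "e j \<noteq> 0" by blast
        have "C w (mvs b m l (mv b c' e)) r' = 0" "C w (mvs m b l (mv m c' e)) r' = 0" for w l c' r'
          using j b by (auto simp: C_def mv_apply mvs_def)
        then show ?thesis unfolding L R by (simp add: opr_def)
      next
        case e0: True
        define U where "U = VV zs e r ((N ^^ r m) v)"
        define F where "F x = w' (LL us e r x)" for x
        have Flin: "clinear F" unfolding F_def[abs_def] by (rule clinear_compose[OF w'_lin LL_lin[OF us]])
        \<comment> \<open>Removing \<open>sal zs\<close> undoes the normalization of
          \<open>x_m\<close> without the letter \<open>b\<close>. With \<open>b\<close> behind the
          twist field the shift grows by \<open>aj b\<close>, which is the fractional part of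
          \<open>A\<close>.\<close>
        define p q where "p = e b" and "q = of_int (e m) - sal zs"
        have "\<exists>T0 B0. \<forall>T\<ge>T0. \<forall>B\<ge>B0.
          (\<Sum>t<T. \<Sum>l<B. (fps_nth (kerL A t) l / fact t) *\<^sub>C
              phiN ?i t (A - of_int p - 1 - of_nat l) (psi_W W a (of_nat l - q - 1) 0 U))
          = parity_sign (gpar G ?i) (psi_par W a) *\<^sub>C
            (\<Sum>t<T. \<Sum>l<B. (fps_nth (kerR A t) l / fact t) *\<^sub>C
              psi_W W a (A - q - 1 - of_nat l) 0 (Y_op V ((N ^^ t) (gvec G ?i)) (int l - p - 1) U))"
          using M[THEN spec[of _ U], THEN spec[of _ p], THEN spec[of _ q]] unfolding Let_def A .
        then obtain T0 B0 where TB: "\<forall>T\<ge>T0. \<forall>B\<ge>B0.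
          (\<Sum>t<T. \<Sum>l<B. (fps_nth (kerL A t) l / fact t) *\<^sub>C
              phiN ?i t (A - of_int p - 1 - of_nat l) (psi_W W a (of_nat l - q - 1) 0 U))
          = parity_sign (gpar G ?i) (psi_par W a) *\<^sub>C
            (\<Sum>t<T. \<Sum>l<B. (fps_nth (kerR A t) l / fact t) *\<^sub>C
              psi_W W a (A - q - 1 - of_nat l) 0 (Y_op V ((N ^^ t) (gvec G ?i)) (int l - p - 1) U))"
          by (elim exE)
        \<comment> \<open>Beyond the thresholds of the commutation identity and beyond the supports
          of both operators, so that all sums share one range.\<close>
        define T where "T = T0 + nat c + nat c2 + 1"
        define B where "B = B0 + nat (c + tail_sum ?w m (mv b (- int M) e)) + nat (c2 + tail_sum ?w2 b (mv m (- int M) e)) + 1"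
        have TB': "(\<Sum>t<T. \<Sum>l<B. (fps_nth (kerL A t) l / fact t) *\<^sub>C
              phiN ?i t (A - of_int p - 1 - of_nat l) (psi_W W a (of_nat l - q - 1) 0 U))
          = parity_sign (gpar G ?i) (psi_par W a) *\<^sub>C
            (\<Sum>t<T. \<Sum>l<B. (fps_nth (kerR A t) l / fact t) *\<^sub>C
              psi_W W a (A - q - 1 - of_nat l) 0 (Y_op V ((N ^^ t) (gvec G ?i)) (int l - p - 1) U))"
          by (rule TB[THEN spec[of _ T], THEN mp, THEN spec[of _ B], THEN mp]) (simp_all add: T_def B_def)
        let ?e = "\<lambda>l. mvs b m l (mv b (- int M) e)" and ?f = "\<lambda>l. mvs m b l (mv m (- int M) e)"
        have up: "up b t r b = s + t" "up b t r m = r m" "j \<noteq> b \<Longrightarrow> up b t r j = r j" for t j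
          using b r by (simp_all add: up_def)
        have el: "\<forall>j\<ge>k. ?e l j = 0" "\<forall>j\<ge>k. ?f l j = 0" for l
          using e0 b by (simp_all add: mv_apply mvs_def)
        have eb: "?e l b = e b - int M + int l" "?e l m = e m - int l" "?f l m = e m - int M + int l" "?f l b = e b - int l"
          "j \<noteq> b \<Longrightarrow> j \<noteq> m \<Longrightarrow> ?e l j = e j" "j \<noteq> b \<Longrightarrow> j \<noteq> m \<Longrightarrow> ?f l j = e j" for l j
          using b by (simp_all add: mv_apply mvs_def)
        have eq: "LL us (?e l) (up b t r) u = LL us e r u" "VV zs (?e l) (up b t r) u' = VV zs e r u'"
          "LL us (?f l) (up b t r) u = LL us e r u" "VV zs (?f l) (up b t r) u' = VV zs e r u'" for l t u u'
          by (intro LL_cong VV_cong; use b in \<open>auto simp: eb up intro!: eb(5,6) up(3)\<close>)+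
        have 1: "C ?w (?e l) (up b t r) = F (phiN ?i t (A - of_int p - 1 - of_nat l) (psi_W W a (of_nat l - q - 1) 0 U))" for t l
        proof -
          have x: "aj b - of_int (e b - int M + int l) - 1 = A - of_int p - 1 - of_nat l"
            "sal zs - of_int (e m - int l) - 1 = of_nat l - q - 1"
            by (simp_all add: A_def p_def q_def)
          show ?thesis
            unfolding C_append[OF b(3) el(1)] F_def U_def phiN_add[OF g True]
            using b by (simp only: WW.simps if_False if_True eb(1,2) up(1,2) x eq refl)
        qed
        have 2: "C ?w2 (?f l) (up b t r) = F (psi_W W a (A - q - 1 - of_nat l) 0 (Y_op V ((N ^^ t) (gvec G ?i)) (int l - p - 1) U))" for t l
        proof -
          have x: "sal (b # zs) - of_int (e m - int M + int l) - 1 = A - q - 1 - of_nat l"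
            "- (e b - int l) - 1 = int l - p - 1"
            by (simp_all add: A_def p_def q_def sal_def)
          have y: "(N ^^ t) (gvec G ?i) = (N ^^ (s + t)) (gvec G (gi b))"
            unfolding ab(2) by (subst add.commute) (simp add: funpow_add)
          show ?thesis
            unfolding C_append[OF b(3) el(2)] F_def U_def y
            by (simp only: WW.simps VV.simps if_True eb(3,4) up(1,2) x eq refl)
        qed
        have "opr (BL A) b m b (C ?w) (mv b (- int M) e) r
          = (\<Sum>t<T. \<Sum>l<B. fps_nth (BL A t) l * C ?w (?e l) (up b t r))"
          by (rule opr_bounded_sum[OF c bf(1) bs(1)]) (simp_all add: T_def B_def)
        also have "\<dots> = F (\<Sum>t<T. \<Sum>l<B. (fps_nth (kerL A t) l / fact t) *\<^sub>C
              phiN ?i t (A - of_int p - 1 - of_nat l) (psi_W W a (of_nat l - q - 1) 0 U))"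
          unfolding 1 clinear_sum[OF Flin] clinear_scale[OF Flin] by (simp add: BL_def)
        also have "\<dots> = parity_sign (par b) (par m) *
           (\<Sum>t<T. \<Sum>l<B. (fps_nth (kerR A t) l / fact t) * C ?w2 (?f l) (up b t r))"
          unfolding TB' 2 clinear_sum[OF Flin] clinear_scale[OF Flin] ab(5) par_gi[OF b(1,2)] par_m by simp
        \<comment> \<open>Two signs \<open>(-1)^M\<close> are inserted, one belonging to the kernel
          and one to the reversed difference; they cancel.\<close>
        also have "(\<Sum>t<T. \<Sum>l<B. (fps_nth (kerR A t) l / fact t) * C ?w2 (?f l) (up b t r))
           = (\<Sum>t<T. \<Sum>l<B. fps_nth (fps_const ((- 1) ^ M) * BR A t) l * C ?w2 (?f l) (up b t r)) * (- 1) ^ M"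
        proof -
          have "(- 1) ^ M * ((- 1) ^ M * x) = x" for x :: complex
            by (metis left_minus_one_mult_self)
          then show ?thesis by (simp add: BR_def sum_distrib_left sum_distrib_right mult_ac)
        qed
        also have "(\<Sum>t<T. \<Sum>l<B. fps_nth (fps_const ((- 1) ^ M) * BR A t) l * C ?w2 (?f l) (up b t r))
           = opr (\<lambda>t. fps_const ((- 1) ^ M) * BR A t) m b b (C ?w2) (mv m (- int M) e) r"
          by (rule opr_bounded_sum[OF c2 bf(2) bs(2), symmetric]) (simp_all add: T_def B_def)
        finally show ?thesis unfolding L R .
      qed
    qed
    then show ?thesis by (intro exI[of _ M]) blast
  qed
qed

lemma C_swap_psi:
  assumes w: "word (us @ b # m # zs)"
  shows "\<exists>M0. \<forall>M\<ge>M0. (pd b m ^^ M) (opr (BL (aj b)) b m b (C (us @ b # m # zs)))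
    = (\<lambda>e r. parity_sign (par b) (par m) * (pd b m ^^ M) (opr (BR (aj b)) m b b (C (us @ m # b # zs))) e r)"
proof -
  have w2: "word (us @ m # b # zs)" using w by (auto simp: word_def)
  have b: "b < k" using w by (auto simp: word_def)
  have "\<forall>s. \<exists>M0. \<forall>e r. r b = s \<longrightarrow> (pd b m ^^ M0) (opr (BL (aj b)) b m b (C (us @ b # m # zs))) e r
    = parity_sign (par b) (par m) * (pd b m ^^ M0) (opr (BR (aj b)) m b b (C (us @ m # b # zs))) e r"
    using C_swap_psi_at[OF w] by (intro allI)
  from choice[OF this] obtain f where f: "\<forall>s. \<forall>e r. r b = s \<longrightarrow> (pd b m ^^ f s) (opr (BL (aj b)) b m b (C (us @ b # m # zs))) e r
    = parity_sign (par b) (par m) * (pd b m ^^ f s) (opr (BR (aj b)) m b b (C (us @ m # b # zs))) e r"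
    by (elim exE)
  define M0 where "M0 = (\<Sum>s<RB. f s)"
  have "(pd b m ^^ M) (opr (BL (aj b)) b m b (C (us @ b # m # zs))) e r
    = parity_sign (par b) (par m) * (pd b m ^^ M) (opr (BR (aj b)) m b b (C (us @ m # b # zs))) e r"
    if M: "M0 \<le> M" for M e r
  proof (cases "r b < RB")
    case True
    have "f (r b) \<le> M0" unfolding M0_def by (rule member_le_sum) (use True in auto)
    then have le: "f (r b) \<le> M" using M by simp
    show ?thesis by (rule pd_pow_mono[OF _ le]) (use f in blast)
  next
    case False
    then have "RB \<le> up b t r b" for t by (simp add: up_def)
    then have "C (us @ b # m # zs) e (up b t r) = 0" "C (us @ m # b # zs) e (up b t r) = 0" for e t
      using C_zero_large[OF w b] C_zero_large[OF w2 b] by blast+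
    then have "opr (BL (aj b)) b m b (C (us @ b # m # zs)) e r = 0" "opr (BR (aj b)) m b b (C (us @ m # b # zs)) e r = 0" for e
      by (simp_all add: opr_def)
    then show ?thesis by (simp add: pd_pow_zero)
  qed
  then show ?thesis by (intro exI[of _ M0]) (simp add: fun_eq_iff)
qed

section \<open>Clearing all kernels and differences at once\<close>

definition left :: "nat list \<Rightarrow> nat \<Rightarrow> bool"
  where "left w j \<longleftrightarrow> j \<in> set (takeWhile (\<lambda>x. x \<noteq> m) w)"

definition ops :: "nat list \<Rightarrow> nat \<Rightarrow> mser \<Rightarrow> mser"
  where "ops w j = (if left w j then opr (BL (aj j)) j m j else opr (BR (aj j)) m j j)"

definition js :: "nat list" where "js = filter (\<lambda>j. j \<noteq> m) [0..<k]"

text \<open>Both orientations of each pair are listed, so that the difference required by an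
  exchange is present whichever letter stands first.\<close>

definition prs :: "(nat \<times> nat) list"
  where "prs = filter (\<lambda>(i, j). i \<noteq> j) (List.product [0..<k] [0..<k])"

definition pds :: "nat \<Rightarrow> (nat \<times> nat) list \<Rightarrow> mser \<Rightarrow> mser"
  where "pds M ps = foldr (\<lambda>(i, j). pd i j ^^ M) ps"

text \<open>All kernels with the twist field, expanded as \<open>w\<close> prescribes, and all
  differences to the power \<open>M\<close> are multiplied into the series, so that for large
  \<open>M\<close> every exchange becomes an equality up to sign.\<close>

definition T :: "nat \<Rightarrow> nat list \<Rightarrow> mser"
  where "T M w = pds M prs (foldr (ops w) js (C w))"

lemma js_set: "set js = {..<k} - {m}" "distinct js"
  by (auto simp: js_def)

lemma prs_set: "set prs = {(i, j). i < k \<and> j < k \<and> i \<noteq> j}"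
  by (auto simp: prs_def)

lemma left_before:
  assumes w: "word w" and j: "j < k" "j \<noteq> m"
  shows "if left w j then before w j m else before w m j"
proof -
  have "m \<in> set w" using w m by (simp add: word_def)
  then obtain us zs where s: "w = us @ m # zs" "m \<notin> set us" by (meson split_list_first)
  have tw: "takeWhile (\<lambda>x. x \<noteq> m) w = us" using s by (simp add: takeWhile_append)
  have d: "distinct w" using w by (simp add: word_def)
  show ?thesis
  proof (cases "left w j")
    case True
    then have "j \<in> set us" by (simp add: left_def tw)
    then obtain u1 u2 where "us = u1 @ j # u2" by (meson split_list)
    then have "w = u1 @ j # u2 @ m # zs" using s by simp
    then show ?thesis using True d before_split[of u1 j u2 m zs] by simp
  next
    case False
    then have "j \<notin> set us" by (simp add: left_def tw)
    moreover have "j \<in> set (us @ m # zs)" using w j s(1) by (simp add: word_def)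
    ultimately have "j \<in> set zs" using j by simp
    then obtain u1 u2 where "zs = u1 @ j # u2" by (meson split_list)
    then have "w = us @ m # u1 @ j # u2" using s by simp
    then show ?thesis using False d before_split[of us m u1 j u2] by simp
  qed
qed

lemma in_word: "word w \<Longrightarrow> j < k \<Longrightarrow> j \<in> set w"
  by (simp add: word_def)

text \<open>Letters before the twist field use \<open>x_m / x_j\<close>, those behind it
  \<open>x_j / x_m\<close>. The ratio has the later variable in its numerator in both cases, so
  these operators preserve truncation for \<open>w\<close> and commute on truncated series.\<close>

lemma ops_facts:
  assumes w: "word w" and j: "j \<in> set js" and D: "trunc w D"
  shows "trunc w (ops w j D)"
    and "j' \<in> set js \<Longrightarrow> ops w j (ops w j' D) = ops w j' (ops w j D)"
    and "i < k \<Longrightarrow> i' < k \<Longrightarrow> ops w j ((pd i i' ^^ M) D) = (pd i i' ^^ M) (ops w j D)"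
    and "ops w j (\<lambda>e r. c * D e r) = (\<lambda>e r. c * ops w j D e r)"
proof -
  have jk: "j < k" "j \<noteq> m" "j \<in> set w" using j w by (auto simp: js_set word_def)
  note lb = left_before[OF w jk(1,2)]
  show "trunc w (ops w j D)" using lb opr_trunc[OF D _ jk(3)] by (simp add: ops_def split: if_splits)
  show "ops w j (ops w j' D) = ops w j' (ops w j D)" if j': "j' \<in> set js"
  proof -
    have jk': "j' < k" "j' \<noteq> m" "j' \<in> set w" using j' w by (auto simp: js_set word_def)
    note lb' = left_before[OF w jk'(1,2)]
    show ?thesis using lb lb' opr_commute[OF D _ _ jk(3) jk'(3)]
      by (simp add: ops_def split: if_splits)
  qed
  show "ops w j ((pd i i' ^^ M) D) = (pd i i' ^^ M) (ops w j D)" if "i < k" "i' < k"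
    using lb opr_pd_pow[OF D _ jk(3) in_word[OF w that(1)] in_word[OF w that(2)]] by (simp add: ops_def split: if_splits)
  show "ops w j (\<lambda>e r. c * D e r) = (\<lambda>e r. c * ops w j D e r)"
    using lb opr_scale[OF D _ jk(3)] by (simp add: ops_def split: if_splits)
qed

lemma trunc_pd_pow: "word w \<Longrightarrow> trunc w D \<Longrightarrow> i < k \<Longrightarrow> j < k \<Longrightarrow> trunc w ((pd i j ^^ M) D)"
  by (induction M) (simp_all add: trunc_pd in_word)

lemma fold_ops_trunc:
  assumes w: "word w" and us: "set us \<subseteq> set js" and D: "trunc w D"
  shows "trunc w (foldr (ops w) us D)"
  using us by (induction us) (simp_all add: D ops_facts(1)[OF w])

lemma fold_ops:
  assumes w: "word w" and us: "set us \<subseteq> set js" and D: "trunc w D"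
  shows "i < k \<Longrightarrow> i' < k \<Longrightarrow> foldr (ops w) us ((pd i i' ^^ M) D) = (pd i i' ^^ M) (foldr (ops w) us D)"
    and "foldr (ops w) us (\<lambda>e r. c * D e r) = (\<lambda>e r. c * foldr (ops w) us D e r)"
  using us
proof (induction us)
  case (Cons u us)
  {
    case 1
    then show ?case using Cons.IH(1) ops_facts(3)[OF w _ fold_ops_trunc[OF w _ D], of u us] by simp
  next
    case 2
    then show ?case using Cons.IH(2) ops_facts(4)[OF w _ fold_ops_trunc[OF w _ D], of u us] by simp
  }
qed simp_all

lemma pds_scale: "pds M ps (\<lambda>e r. c * D e r) = (\<lambda>e r. c * pds M ps D e r)"
  by (induction ps) (auto simp: pds_def pd_pow_scale)

lemma pd_pow_commute: "(pd i j ^^ M) ((pd i' j' ^^ M') D) = (pd i' j' ^^ M') ((pd i j ^^ M) D)"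
proof -
  have 1: "pd i j ((pd i' j' ^^ M') D) = (pd i' j' ^^ M') (pd i j D)" for D
    by (rule funpow_commute_apply) (rule pd_commute)
  show ?thesis by (rule funpow_commute_apply[symmetric]) (rule 1[symmetric])
qed

lemma pds_extract: "(i, j) \<in> set ps \<Longrightarrow> pds M ps D = pds M (remove1 (i, j) ps) ((pd i j ^^ M) D)"
  unfolding pds_def
  by (subst foldr_extract[where H = "\<lambda>_. True" and j = "(i, j)"]) (auto simp: pd_pow_commute)

lemma pds_trunc: "word w \<Longrightarrow> set ps \<subseteq> set prs \<Longrightarrow> trunc w D \<Longrightarrow> trunc w (pds M ps D)"
  by (induction ps) (auto simp: pds_def prs_set trunc_pd_pow)

text \<open>The exchange does not cross the twist field, so both words carry the same kernels. The
  factor \<open>pd x y ^^ M\<close> is moved innermost, where the commutation relation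
  applies.\<close>

lemma T_swap_phi:
  assumes w: "word (us @ x # y # zs)" and mz: "m \<in> set zs"
    and M: "(pd x y ^^ M) (C (us @ x # y # zs))
    = (\<lambda>e r. parity_sign (par x) (par y) * (pd x y ^^ M) (C (us @ y # x # zs)) e r)"
  shows "T M (us @ x # y # zs) = (\<lambda>e r. parity_sign (par x) (par y) * T M (us @ y # x # zs) e r)"
proof -
  let ?w = "us @ x # y # zs" and ?w2 = "us @ y # x # zs"
  have w2: "word ?w2" using w by (auto simp: word_def)
  have d: "distinct ?w" "set ?w = {..<k}" using w by (auto simp: word_def)
  have xy: "x < k" "y < k" "x \<noteq> m" "y \<noteq> m" "m \<notin> set us" "x \<noteq> y" using d mz by auto
  have "left ?w j = left ?w2 j" for j
    unfolding left_def using xy by (subst (1 2) takeWhile_append2) auto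
  then have ops: "ops ?w = ops ?w2" by (simp add: ops_def fun_eq_iff)
  have pr: "(x, y) \<in> set prs" using xy by (simp add: prs_set)
  have T: "T M w = pds M (remove1 (x, y) prs) (foldr (ops w) js ((pd x y ^^ M) (C w)))" if "word w" for w
    unfolding T_def pds_extract[OF pr] by (simp add: fold_ops(1)[OF that order_refl C_trunc[OF that] xy(1,2)])
  show ?thesis
    unfolding T[OF w] T[OF w2] M unfolding ops
    unfolding fold_ops(2)[OF w2 order_refl trunc_pd_pow[OF w2 C_trunc[OF w2] xy(1,2)]] pds_scale ..
qed

text \<open>Only the kernel of \<open>b\<close> changes its direction. It and the difference of
  \<open>b\<close> and \<open>m\<close> are moved innermost; the remaining operators agree for the
  two words.\<close>

lemma T_swap_psi:
  assumes w: "word (us @ b # m # zs)"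
    and M: "(pd b m ^^ M) (opr (BL (aj b)) b m b (C (us @ b # m # zs)))
    = (\<lambda>e r. parity_sign (par b) (par m) * (pd b m ^^ M) (opr (BR (aj b)) m b b (C (us @ m # b # zs))) e r)"
  shows "T M (us @ b # m # zs) = (\<lambda>e r. parity_sign (par b) (par m) * T M (us @ m # b # zs) e r)"
proof -
  let ?w = "us @ b # m # zs" and ?w2 = "us @ m # b # zs"
  have w2: "word ?w2" using w by (auto simp: word_def)
  have d: "distinct ?w" "set ?w = {..<k}" using w by (auto simp: word_def)
  have b: "b < k" "b \<noteq> m" "m < k" "m \<notin> set us" "b \<notin> set us" using d by auto
  have tw: "takeWhile (\<lambda>x. x \<noteq> m) ?w = us @ [b]" "takeWhile (\<lambda>x. x \<noteq> m) ?w2 = us"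
    using b by (subst takeWhile_append2; force)+
  have bj: "b \<in> set js" using b by (simp add: js_set)
  have sub: "set (remove1 b js) \<subseteq> set js" by (rule set_remove1_subset)
  have ops: "ops ?w j = ops ?w2 j" if "j \<in> set (remove1 b js)" for j
    using that js_set(2) by (simp add: ops_def left_def tw)
  have opb: "ops ?w b = opr (BL (aj b)) b m b" "ops ?w2 b = opr (BR (aj b)) m b b"
    using b by (simp_all add: ops_def left_def tw)
  have pr: "(b, m) \<in> set prs" using b by (simp add: prs_set)
  have T: "T M w = pds M (remove1 (b, m) prs) (foldr (ops w) (remove1 b js) ((pd b m ^^ M) (ops w b (C w))))" if ww: "word w" for w
  proof -
    have "foldr (ops w) js (C w) = foldr (ops w) (remove1 b js) (ops w b (C w))"
      by (rule foldr_extract[where H = "trunc w"]) (use bj C_trunc[OF ww] ops_facts(1,2)[OF ww] in auto)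
    then show ?thesis
      unfolding T_def pds_extract[OF pr]
      by (simp add: fold_ops(1)[OF ww sub ops_facts(1)[OF ww bj C_trunc[OF ww]] b(1,3)])
  qed
  have fold: "foldr (ops ?w) (remove1 b js) D = foldr (ops ?w2) (remove1 b js) D" for D
    by (rule foldr_cong_class) (simp add: ops)
  have tr: "trunc ?w2 ((pd b m ^^ M) (opr (BR (aj b)) m b b (C ?w2)))"
    using trunc_pd_pow[OF w2 ops_facts(1)[OF w2 bj C_trunc[OF w2]] b(1,3)] unfolding opb .
  show ?thesis
    unfolding T[OF w] T[OF w2] opb M fold fold_ops(2)[OF w2 sub tr] pds_scale ..
qed

text \<open>Finitely many exchanges are possible between words, each valid for all large
  \<open>M\<close>, so a common \<open>M\<close> exists. Multiplied by \<open>ksgn\<close>, the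
  cleared series is invariant under these exchanges, and they connect all words.\<close>

lemma T_common:
  "\<exists>M P. \<forall>w. word w \<longrightarrow> T M w = (\<lambda>e r. ksgn par w * P e r)"
proof -
  let ?U = "{us. set us \<subseteq> {..<k} \<and> length us \<le> k}"
  let ?X = "?U \<times> {..<k} \<times> {..<k} \<times> ?U"
  have finU: "finite ?U" by (rule finite_lists_length_le) simp
  have inU: "us \<in> ?U" "zs \<in> ?U" if "word (us @ xs @ zs)" for us xs zs
  proof -
    have "length (us @ xs @ zs) = k" using that unfolding word_def by (metis card_lessThan distinct_card)
    then show "us \<in> ?U" "zs \<in> ?U" using that unfolding word_def by auto
  qed
  have 1: "eventually (\<lambda>M. \<forall>(us, x, y, zs)\<in>?X. word (us @ x # y # zs) \<longrightarrow> m \<in> set zs \<longrightarrow>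
      T M (us @ x # y # zs) = (\<lambda>e r. parity_sign (par x) (par y) * T M (us @ y # x # zs) e r)) sequentially"
  proof (rule eventually_ball_finite)
    show "finite ?X" using finU by simp
    show "\<forall>p\<in>?X. eventually (\<lambda>M. case p of (us, x, y, zs) \<Rightarrow> word (us @ x # y # zs) \<longrightarrow> m \<in> set zs \<longrightarrow>
      T M (us @ x # y # zs) = (\<lambda>e r. parity_sign (par x) (par y) * T M (us @ y # x # zs) e r)) sequentially"
    proof clarify
      fix us x y zs
      show "eventually (\<lambda>M. word (us @ x # y # zs) \<longrightarrow> m \<in> set zs \<longrightarrow>
        T M (us @ x # y # zs) = (\<lambda>e r. parity_sign (par x) (par y) * T M (us @ y # x # zs) e r)) sequentially"
      proof (cases "word (us @ x # y # zs) \<and> m \<in> set zs")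
        case True
        then obtain M0 where "\<forall>M\<ge>M0. (pd x y ^^ M) (C (us @ x # y # zs))
          = (\<lambda>e r. parity_sign (par x) (par y) * (pd x y ^^ M) (C (us @ y # x # zs)) e r)"
          using C_swap_phi[of us x y zs] by blast
        then show ?thesis using True T_swap_phi[of us x y zs] unfolding eventually_sequentially by blast
      qed auto
    qed
  qed
  \<comment> \<open>The letter \<open>y\<close> is a placeholder that lets this case use the index
    set \<open>?X\<close> of the previous one.\<close>
  have 2: "eventually (\<lambda>M. \<forall>(us, x, y, zs)\<in>?X. word (us @ x # m # zs) \<longrightarrow>
      T M (us @ x # m # zs) = (\<lambda>e r. parity_sign (par x) (par m) * T M (us @ m # x # zs) e r)) sequentially"
  proof (rule eventually_ball_finite)
    show "finite ?X" using finU by simp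
    show "\<forall>p\<in>?X. eventually (\<lambda>M. case p of (us, x, y, zs) \<Rightarrow> word (us @ x # m # zs) \<longrightarrow>
      T M (us @ x # m # zs) = (\<lambda>e r. parity_sign (par x) (par m) * T M (us @ m # x # zs) e r)) sequentially"
    proof clarify
      fix us x y zs
      show "eventually (\<lambda>M. word (us @ x # m # zs) \<longrightarrow>
        T M (us @ x # m # zs) = (\<lambda>e r. parity_sign (par x) (par m) * T M (us @ m # x # zs) e r)) sequentially"
      proof (cases "word (us @ x # m # zs)")
        case True
        then obtain M0 where "\<forall>M\<ge>M0. (pd x m ^^ M) (opr (BL (aj x)) x m x (C (us @ x # m # zs)))
          = (\<lambda>e r. parity_sign (par x) (par m) * (pd x m ^^ M) (opr (BR (aj x)) m x x (C (us @ m # x # zs))) e r)"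
          using C_swap_psi[of us x zs] by blast
        then show ?thesis using True T_swap_psi[of us x zs] unfolding eventually_sequentially by blast
      qed auto
    qed
  qed
  have "\<exists>M. (\<forall>(us, x, y, zs)\<in>?X. word (us @ x # y # zs) \<longrightarrow> m \<in> set zs \<longrightarrow>
      T M (us @ x # y # zs) = (\<lambda>e r. parity_sign (par x) (par y) * T M (us @ y # x # zs) e r)) \<and>
    (\<forall>(us, x, y, zs)\<in>?X. word (us @ x # m # zs) \<longrightarrow>
      T M (us @ x # m # zs) = (\<lambda>e r. parity_sign (par x) (par m) * T M (us @ m # x # zs) e r))"
    by (rule eventually_happens'[OF sequentially_bot eventually_conj[OF 1 2]])
  then obtain M where M: "\<forall>(us, x, y, zs)\<in>?X. word (us @ x # y # zs) \<longrightarrow> m \<in> set zs \<longrightarrow>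
      T M (us @ x # y # zs) = (\<lambda>e r. parity_sign (par x) (par y) * T M (us @ y # x # zs) e r)"
    "\<forall>(us, x, y, zs)\<in>?X. word (us @ x # m # zs) \<longrightarrow>
      T M (us @ x # m # zs) = (\<lambda>e r. parity_sign (par x) (par m) * T M (us @ m # x # zs) e r)"
    by (elim exE conjE)
  define Q where "Q w e r = ksgn par w * T M w e r" for w e r
  have Qphi: "Q (us @ x # y # zs) = Q (us @ y # x # zs)" if w: "word (us @ x # y # zs)" and mz: "m \<in> set zs" for us x y zs
  proof -
    have inX: "(us, x, y, zs) \<in> ?X" using w inU[of us "[x, y]" zs] by (auto simp: word_def)
    have "T M (us @ x # y # zs) = (\<lambda>e r. parity_sign (par x) (par y) * T M (us @ y # x # zs) e r)"
      using bspec[OF M(1) inX] w mz by simp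
    moreover have "ksgn par (us @ x # y # zs) = parity_sign (par x) (par y) * ksgn par (us @ y # x # zs)"
      using w by (intro ksgn_swap) (simp add: word_def)
    ultimately show ?thesis unfolding Q_def by (simp only: sign_cancel[OF parity_sign_sq])
  qed
  have Qpsi: "Q (us @ m # b # zs) = Q (us @ b # m # zs)" if w': "word (us @ m # b # zs)" for us b zs
  proof -
    have w: "word (us @ b # m # zs)" using w' by (auto simp: word_def)
    have inX: "(us, b, b, zs) \<in> ?X" using w inU[of us "[b, m]" zs] by (auto simp: word_def)
    have "T M (us @ b # m # zs) = (\<lambda>e r. parity_sign (par b) (par m) * T M (us @ m # b # zs) e r)"
      using bspec[OF M(2) inX] w by simp
    moreover have "ksgn par (us @ b # m # zs) = parity_sign (par b) (par m) * ksgn par (us @ m # b # zs)"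
      using w by (intro ksgn_swap) (simp add: word_def)
    ultimately show ?thesis unfolding Q_def by (simp only: sign_cancel[OF parity_sign_sq])
  qed
  \<comment> \<open>The exchange relation for two generators is available to the left of the twist
    field, so \<open>m\<close> is moved to the end before the other letters are rearranged.\<close>
  have move: "word (us @ m # zs) \<Longrightarrow> Q (us @ m # zs) = Q (us @ zs @ [m])" for us zs
  proof (induction zs arbitrary: us)
    case (Cons b zs)
    have "Q (us @ m # b # zs) = Q ((us @ [b]) @ m # zs)" using Qpsi[OF Cons.prems] by simp
    also have "\<dots> = Q ((us @ [b]) @ zs @ [m])" by (rule Cons.IH) (use Cons.prems in \<open>auto simp: word_def\<close>)
    finally show ?case by simp
  qed simp
  have last: "Q (xs @ [m]) = Q (ys @ [m])" if "word (xs @ [m])" "word (ys @ [m])" for xs ys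
  proof (rule adjacent_swaps_const[of "{..<k} - {m}" "\<lambda>xs. Q (xs @ [m])"])
    show "Q ((us @ x # y # zs) @ [m]) = Q ((us @ y # x # zs) @ [m])"
      if "distinct (us @ x # y # zs)" "set (us @ x # y # zs) = {..<k} - {m}" for us x y zs
    proof -
      have "word (us @ x # y # zs @ [m])" using that m by (auto simp: word_def)
      from Qphi[OF this] show ?thesis by simp
    qed
  qed (use that in \<open>auto simp: word_def\<close>)
  define P where "P = Q (js @ [m])"
  have jm: "word (js @ [m])" using js_set m by (auto simp: word_def)
  have QP: "Q w = P" if w: "word w" for w
  proof -
    have "m \<in> set w" using w m by (simp add: word_def)
    then obtain us zs where s: "w = us @ m # zs" by (meson split_list)
    have "word ((us @ zs) @ [m])" using w s by (auto simp: word_def)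
    from last[OF this jm] show ?thesis using move[of us zs] w s by (simp add: P_def)
  qed
  show ?thesis
  proof (intro exI allI impI)
    fix w assume w: "word w"
    have "T M w e r = ksgn par w * P e r" for e r
      unfolding QP[OF w, symmetric] Q_def mult.assoc[symmetric] ksgn_sq by simp
    then show "T M w = (\<lambda>e r. ksgn par w * P e r)" by (simp add: fun_eq_iff)
  qed
qed

end

section \<open>Summation of the series\<close>

definition cv :: "complex fps \<Rightarrow> bool"
  where "cv f \<longleftrightarrow> 1 \<le> fps_conv_radius f"

lemma cv_mult: "cv f \<Longrightarrow> cv h \<Longrightarrow> cv (f * h)"
  unfolding cv_def using fps_conv_radius_mult[of f h] by (meson min.boundedI order_trans)

lemma cv_add: "cv f \<Longrightarrow> cv h \<Longrightarrow> cv (f + h)"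
  unfolding cv_def using fps_conv_radius_add[of f h] by (meson min.boundedI order_trans)

lemma cv_uminus: "cv f \<Longrightarrow> cv (- f)" and cv_const: "cv (fps_const c)"
  by (simp_all add: cv_def)

lemma cv_power: "cv f \<Longrightarrow> cv (f ^ q)"
  unfolding cv_def using fps_conv_radius_power[of f q] by (meson order_trans)

lemma cv_lt: "cv f \<Longrightarrow> norm y < 1 \<Longrightarrow> ereal (norm y) < fps_conv_radius f"
  unfolding cv_def by (rule less_le_trans[of _ 1]) (simp_all add: one_ereal_def)

lemma cv_has_sum:
  assumes "cv f" "norm y < 1"
  shows "((\<lambda>q. fps_nth f q * y ^ q) has_sum eval_fps f y) UNIV"
proof (rule norm_summable_imp_has_sum)
  show s: "summable (\<lambda>q. norm (fps_nth f q * y ^ q))"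
    by (rule abs_summable_in_conv_radius) (use cv_lt[OF assms] in \<open>simp add: fps_conv_radius_def\<close>)
  show "(\<lambda>q. fps_nth f q * y ^ q) sums eval_fps f y"
    unfolding eval_fps_def by (rule summable_sums[OF summable_norm_cancel[OF s]])
qed

lemma pow1m_sums: "norm y < 1 \<Longrightarrow> (\<lambda>q. fps_nth (fps_pow1m \<beta>) q * y ^ q) sums ((1 - y) powr \<beta>)"
  using gen_binomial_complex[of "- y" \<beta>] by (simp add: fps_pow1m_def power_minus[of y] mult_ac)

lemma log1m_sums:
  assumes "norm (y :: complex) < 1"
  shows "(\<lambda>q. fps_nth fps_log1m q * y ^ q) sums Ln (1 - y)"
proof -
  have "fps_nth fps_log1m q * y ^ q = - ((- (- y)) ^ q) / of_nat q" for q
    by (simp add: fps_log1m_def)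
  then show ?thesis using Ln_series'[of "- y"] assms by simp
qed

lemma cv_pow1m: "cv (fps_pow1m \<beta>)" and cv_log1m: "cv fps_log1m"
proof -
  have "summable (\<lambda>q. fps_nth (fps_pow1m \<beta>) q * of_real r ^ q)" "summable (\<lambda>q. fps_nth fps_log1m q * of_real r ^ q)"
    if "0 < r" "ereal r < 1" for r
    using sums_summable[OF pow1m_sums[of "of_real r" \<beta>]] sums_summable[OF log1m_sums[of "of_real r"]] that
    by (simp_all add: one_ereal_def)
  then show "cv (fps_pow1m \<beta>)" "cv fps_log1m"
    unfolding cv_def fps_conv_radius_def by (auto intro!: conv_radius_geI_ex')
qed

lemma eval_pow1m: "norm y < 1 \<Longrightarrow> eval_fps (fps_pow1m \<beta>) y = exp (\<beta> * Ln (1 - y))"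
  using sums_unique[OF pow1m_sums[of y \<beta>]] by (cases "y = 1") (simp_all add: eval_fps_def powr_def)

lemma eval_log1m: "norm (y :: complex) < 1 \<Longrightarrow> eval_fps fps_log1m y = Ln (1 - y)"
  using sums_unique[OF log1m_sums[of y]] by (simp add: eval_fps_def)

section \<open>Inverse kernels and their sums\<close>

lemma pow1m_inverse: "fps_pow1m (- \<beta>) * fps_pow1m \<beta> = 1"
proof (rule fps_ext)
  fix q
  have "fps_nth (fps_pow1m (- \<beta>) * fps_pow1m \<beta>) q
      = (\<Sum>i=0..q. (- 1) ^ q * ((- \<beta> gchoose i) * (\<beta> gchoose (q - i))))"
    unfolding fps_mult_nth
  proof (rule sum.cong)
    fix i assume "i \<in> {0..q}"
    then have "(- 1) ^ q = (- 1 :: complex) ^ i * (- 1) ^ (q - i)" by (simp flip: power_add)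
    then show "fps_nth (fps_pow1m (- \<beta>)) i * fps_nth (fps_pow1m \<beta>) (q - i)
        = (- 1) ^ q * ((- \<beta> gchoose i) * (\<beta> gchoose (q - i)))"
      by (simp only: fps_pow1m_def fps_nth_Abs_fps mult_ac)
  qed simp
  also have "\<dots> = (- 1) ^ q * (0 gchoose q)"
    using gbinomial_Vandermonde[of "- \<beta>" \<beta> q] by (simp flip: sum_distrib_left)
  also have "\<dots> = fps_nth 1 q" by (cases q) simp_all
  finally show "fps_nth (fps_pow1m (- \<beta>) * fps_pow1m \<beta>) q = fps_nth 1 q" .
qed

text \<open>The identity \<open>exp (-X T) exp (X T) = 1\<close>, coefficient by coefficient in
  \<open>T\<close>.\<close>

lemma inverse_kernel:
  fixes A A' X :: "complex fps"
  assumes "A' * A = 1"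
  shows "(\<Sum>s\<le>p. (fps_const (1 / fact s) * (A' * (- X) ^ s)) * (fps_const (1 / fact (p - s)) * (A * X ^ (p - s))))
    = (if p = 0 then 1 else 0)"
proof -
  have term_eq: "(fps_const (1 / fact s) * (A' * (- X) ^ s)) * (fps_const (1 / fact (p - s)) * (A * X ^ (p - s)))
     = fps_const (1 / fact p) * (of_nat (p choose s) * (- X) ^ s * X ^ (p - s))" if "s \<le> p" for s
  proof -
    have c: "fps_const (1 / fact s :: complex) * fps_const (1 / fact (p - s)) = fps_const (1 / fact p) * of_nat (p choose s)"
      unfolding fps_of_nat[symmetric] using that by (simp add: binomial_fact)
    have "(fps_const (1 / fact s) * (A' * (- X) ^ s)) * (fps_const (1 / fact (p - s)) * (A * X ^ (p - s)))
      = (fps_const (1 / fact s) * fps_const (1 / fact (p - s))) * (A' * A) * ((- X) ^ s * X ^ (p - s))"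
      by (simp only: mult_ac)
    then show ?thesis unfolding c assms by (simp only: mult_1_right mult.assoc)
  qed
  have "(\<Sum>s\<le>p. (fps_const (1 / fact s) * (A' * (- X) ^ s)) * (fps_const (1 / fact (p - s)) * (A * X ^ (p - s))))
    = fps_const (1 / fact p) * (\<Sum>s\<le>p. of_nat (p choose s) * (- X) ^ s * X ^ (p - s))"
    unfolding sum_distrib_left by (intro sum.cong refl term_eq) simp
  also have "\<dots> = fps_const (1 / fact p) * ((- X) + X) ^ p" unfolding binomial_ring ..
  also have "\<dots> = (if p = 0 then 1 else 0)" by (simp add: zero_power)
  finally show ?thesis .
qed

text \<open>The convolution inverse of \<open>BL\<close>, coming from
  \<open>(1 - X)^(-\<alpha>) exp (- log (1 - X) T)\<close>; \<open>IR\<close> is that of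
  \<open>BR\<close>.\<close>

definition IL :: "complex \<Rightarrow> nat \<Rightarrow> complex fps"
  where "IL \<alpha> s = fps_const (1 / fact s) * (fps_pow1m (- \<alpha>) * (- fps_log1m) ^ s)"

definition IR :: "complex \<Rightarrow> nat \<Rightarrow> complex fps"
  where "IR \<alpha> s = fps_const (1 / fact s) *
    ((fps_const (exp (- (pi * \<i> * \<alpha>))) * fps_pow1m (- \<alpha>)) * (- (fps_const (pi * \<i>) + fps_log1m)) ^ s)"

lemma IL_BL: "(\<Sum>s\<le>p. IL \<alpha> s * BL \<alpha> (p - s)) = (if p = 0 then 1 else 0)"
  unfolding IL_def BL_def kerL_def by (rule inverse_kernel[OF pow1m_inverse])

lemma IR_BR: "(\<Sum>s\<le>p. IR \<alpha> s * BR \<alpha> (p - s)) = (if p = 0 then 1 else 0)"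
  unfolding IR_def BR_def kerR_def
proof (rule inverse_kernel)
  have "fps_const (exp (- (pi * \<i> * \<alpha>))) * fps_const (exp (pi * \<i> * \<alpha>)) = 1"
    by (simp flip: exp_add)
  moreover have "(fps_const (exp (- (pi * \<i> * \<alpha>))) * fps_pow1m (- \<alpha>)) * (fps_const (exp (pi * \<i> * \<alpha>)) * fps_pow1m \<alpha>)
    = (fps_const (exp (- (pi * \<i> * \<alpha>))) * fps_const (exp (pi * \<i> * \<alpha>))) * (fps_pow1m (- \<alpha>) * fps_pow1m \<alpha>)"
    by (simp only: mult_ac)
  ultimately show "(fps_const (exp (- (pi * \<i> * \<alpha>))) * fps_pow1m (- \<alpha>)) * (fps_const (exp (pi * \<i> * \<alpha>)) * fps_pow1m \<alpha>) = 1"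
    by (simp only: pow1m_inverse mult_1)
qed

lemma IL_has_sum:
  assumes y: "norm y < 1"
  shows "((\<lambda>q. fps_nth (IL \<alpha> s) q * y ^ q) has_sum (exp (- \<alpha> * Ln (1 - y)) * ((- Ln (1 - y)) ^ s / fact s))) UNIV"
proof -
  have c: "cv (fps_pow1m (- \<alpha>))" "cv ((- fps_log1m) ^ s)" "cv (- fps_log1m)"
    by (intro cv_pow1m cv_power cv_uminus cv_log1m)+
  have "eval_fps (IL \<alpha> s) y = exp (- \<alpha> * Ln (1 - y)) * ((- Ln (1 - y)) ^ s / fact s)"
    unfolding IL_def
    by (simp add: eval_fps_mult eval_fps_power eval_fps_minus cv_lt[OF c(1) y] cv_lt[OF c(2) y] cv_lt[OF c(3) y]
       cv_lt[OF cv_log1m y] cv_lt[OF cv_mult[OF c(1,2)] y] eval_pow1m[OF y] eval_log1m[OF y])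
  then show ?thesis using cv_has_sum[OF _ y, of "IL \<alpha> s"] c by (simp add: IL_def cv_mult cv_const)
qed

lemma IR_has_sum:
  assumes y: "norm y < 1"
  shows "((\<lambda>q. fps_nth (IR \<alpha> s) q * y ^ q) has_sum
    (exp (- \<alpha> * (pi * \<i> + Ln (1 - y))) * ((- (pi * \<i> + Ln (1 - y))) ^ s / fact s))) UNIV"
proof -
  let ?X = "fps_const (pi * \<i>) + fps_log1m"
  have c: "cv (fps_const (exp (- (pi * \<i> * \<alpha>))) * fps_pow1m (- \<alpha>))" "cv ((- ?X) ^ s)" "cv (- ?X)" "cv ?X"
    by (intro cv_mult cv_const cv_pow1m cv_power cv_uminus cv_add cv_log1m)+
  have e: "exp (- (pi * \<i> * \<alpha>)) * exp (- \<alpha> * Ln (1 - y)) = exp (- \<alpha> * (pi * \<i> + Ln (1 - y)))"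
    unfolding exp_add[symmetric] by (simp add: algebra_simps)
  have X: "eval_fps (- ?X) y = - (pi * \<i> + Ln (1 - y))"
    unfolding eval_fps_minus[OF cv_lt[OF c(4) y]] eval_fps_add[OF cv_lt[OF cv_const y] cv_lt[OF cv_log1m y]] eval_log1m[OF y] by simp
  have "eval_fps (IR \<alpha> s) y = (exp (- (pi * \<i> * \<alpha>)) * exp (- \<alpha> * Ln (1 - y))) * ((- (pi * \<i> + Ln (1 - y))) ^ s / fact s)"
    unfolding IR_def eval_fps_mult[OF cv_lt[OF cv_const y] cv_lt[OF cv_mult[OF c(1,2)] y]]
      eval_fps_mult[OF cv_lt[OF c(1) y] cv_lt[OF c(2) y]] eval_fps_mult[OF cv_lt[OF cv_const y] cv_lt[OF cv_pow1m y]]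
      eval_fps_power[OF cv_lt[OF c(3) y]] X eval_pow1m[OF y] by simp
  moreover have "cv (IR \<alpha> s)" unfolding IR_def by (rule cv_mult[OF cv_const cv_mult[OF c(1,2)]])
  ultimately show ?thesis using cv_has_sum[OF _ y, of "IR \<alpha> s"] unfolding e by simp
qed

lemma egf_scale: "egf J K (\<lambda>r. c * S r) \<mu> = c * egf J K S \<mu>"
  by (simp add: egf_def sum_distrib_left mult_ac)

lemma egf_cong: "(\<And>j. j \<in> J \<Longrightarrow> \<mu> j = \<mu>' j) \<Longrightarrow> egf J K S \<mu> = egf J K S \<mu>'"
  unfolding egf_def by (intro sum.cong refl arg_cong2[of _ _ _ _ "(*)"] prod.cong) simp_all

lemma before_total:
  assumes "distinct w" "i \<in> set w" "j \<in> set w" "i \<noteq> j"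
  shows "before w i j \<or> before w j i"
proof -
  obtain us vs where w: "w = us @ i # vs" using assms(2) by (meson split_list)
  show ?thesis
  proof (cases "j \<in> set us")
    case True
    then obtain u1 u2 where "us = u1 @ j # u2" by (meson split_list)
    then show ?thesis using before_split[of u1 j u2 i vs] assms(1) w by simp
  next
    case False
    then have "j \<in> set vs" using assms w by simp
    then obtain v1 v2 where "vs = v1 @ j # v2" by (meson split_list)
    then show ?thesis using before_split[of us i v1 j v2] assms(1) w by simp
  qed
qed

context correlator
begin

definition decr :: "nat list \<Rightarrow> (nat \<Rightarrow> complex) \<Rightarrow> bool"
  where "decr w z \<longleftrightarrow> (\<forall>i<k. z i \<noteq> 0) \<and> (\<forall>i j. before w i j \<longrightarrow> norm (z j) < norm (z i))"

text \<open>The correction that turns the logarithm of the outer one of \<open>z j\<close> and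
  \<open>z m\<close> into a logarithm of \<open>z j - z m\<close>.\<close>

definition Lam :: "nat list \<Rightarrow> (nat \<Rightarrow> complex) \<Rightarrow> nat \<Rightarrow> complex"
  where "Lam w z j = (if left w j then Ln (1 - z m / z j) else pi * \<i> + Ln (1 - z j / z m))"

lemma peel_op:
  assumes w: "word w" and z: "decr w z" and j: "j \<in> set js" and D: "bounded_by w c D" and K: "c < int K"
    and S: "\<And>r. ((\<lambda>e. ops w j D e r * zpow {..<k} z e) has_sum S r) UNIV"
  shows "((\<lambda>e. D e r * zpow {..<k} z e) has_sum
    (exp (- aj j * Lam w z j) * (\<Sum>s<K. ((- Lam w z j) ^ s / fact s) * S (up j s r)))) UNIV"
proof -
  have sw: "set w = {..<k}" using w by (simp add: word_def)
  have jk: "j < k" "j \<noteq> m" using j by (auto simp: js_set)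
  have jw: "j \<in> set w" using jk sw by simp
  have zz: "\<And>i. i \<in> set w \<Longrightarrow> z i \<noteq> 0" using z sw by (simp add: decr_def)
  note lb = left_before[OF w jk]
  have nz: "z j \<noteq> 0" "z m \<noteq> 0" using z jk m by (auto simp: decr_def)
  let ?\<beta> = "\<lambda>s. exp (- aj j * Lam w z j) * ((- Lam w z j) ^ s / fact s)"
  have "((\<lambda>e. D e r * zpow (set w) z e) has_sum (\<Sum>s<K. ?\<beta> s * S (up j s r))) UNIV"
  proof (cases "left w j")
    case True
    then have bf: "before w j m" using lb by simp
    have y: "norm (z m / z j) < 1" using z bf nz by (simp add: decr_def norm_divide divide_less_eq)
    have S': "((\<lambda>e. opr (BL (aj j)) j m j D e r * zpow (set w) z e) has_sum S r) UNIV" for r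
      using S[of r] True by (simp add: ops_def sw)
    have b: "((\<lambda>q. fps_nth (IL (aj j) s) q * (z m / z j) ^ q) has_sum ?\<beta> s) UNIV" for s
      using IL_has_sum[OF y, of "aj j" s] True by (simp add: Lam_def)
    show ?thesis by (rule has_sum_peel[OF D bf jw IL_BL zz S' b K])
  next
    case False
    then have bf: "before w m j" using lb by simp
    have y: "norm (z j / z m) < 1" using z bf nz by (simp add: decr_def norm_divide divide_less_eq)
    have S': "((\<lambda>e. opr (BR (aj j)) m j j D e r * zpow (set w) z e) has_sum S r) UNIV" for r
      using S[of r] False by (simp add: ops_def sw)
    have b: "((\<lambda>q. fps_nth (IR (aj j) s) q * (z j / z m) ^ q) has_sum ?\<beta> s) UNIV" for s
      using IR_has_sum[OF y, of "aj j" s] False by (simp add: Lam_def)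
    show ?thesis by (rule has_sum_peel[OF D bf jw IR_BR zz S' b K])
  qed
  then show ?thesis unfolding sw by (simp add: sum_distrib_left mult.assoc)
qed

lemma ops_bounded:
  assumes w: "word w" and j: "j \<in> set js" and D: "bounded_by w c D"
  shows "bounded_by w c (ops w j D)"
proof -
  have jk: "j < k" "j \<noteq> m" "j \<in> set w" using j w by (auto simp: js_set word_def)
  show ?thesis using left_before[OF w jk(1,2)] opr_bounded[OF D _ jk(3)] by (simp add: ops_def split: if_splits)
qed

lemma fold_ops_bounded: "word w \<Longrightarrow> bounded_by w c D \<Longrightarrow> set us \<subseteq> set js \<Longrightarrow> bounded_by w c (foldr (ops w) us D)"
  by (induction us) (simp_all add: ops_bounded)

text \<open>Dividing by the kernel of \<open>j\<close> multiplies by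
  \<open>exp (- aj j * Lam w z j)\<close>. As the kernel also contains the exponential of a
  logarithm times \<open>T_j\<close>, the division translates the argument of \<open>egf\<close> by
  \<open>- Lam w z j\<close>.\<close>

lemma peel_ops:
  assumes w: "word w" and z: "decr w z" and D: "bounded_by w c (C w)" and K: "c < int K"
  shows "set us \<subseteq> set js \<Longrightarrow> distinct us \<Longrightarrow>
    (\<And>r. ((\<lambda>e. foldr (ops w) us (C w) e r * zpow {..<k} z e) has_sum S r) UNIV) \<Longrightarrow>
    \<exists>S0. (\<forall>r. ((\<lambda>e. C w e r * zpow {..<k} z e) has_sum S0 r) UNIV) \<and>
      (\<forall>\<mu>. egf {..<k} K S0 \<mu> = (\<Prod>j\<in>set us. exp (- aj j * Lam w z j)) *
        egf {..<k} K S (\<lambda>j. if j \<in> set us then \<mu> j - Lam w z j else \<mu> j))"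
proof (induction us arbitrary: S)
  case Nil
  then show ?case by (intro exI[of _ S]) simp
next
  case (Cons u us)
  have u: "u \<in> set js" "u < k" and us: "set us \<subseteq> set js" using Cons.prems(1) by (auto simp: js_set)
  have sw: "set w = {..<k}" using w by (simp add: word_def)
  let ?D = "foldr (ops w) us (C w)"
  have bD: "bounded_by w c ?D" by (rule fold_ops_bounded[OF w D us])
  define S1 where "S1 r = exp (- aj u * Lam w z u) * (\<Sum>s<K. ((- Lam w z u) ^ s / fact s) * S (up u s r))" for r
  have S: "((\<lambda>e. ops w u ?D e r * zpow {..<k} z e) has_sum S r) UNIV" for r using Cons.prems(3)[of r] by simp
  have "((\<lambda>e. ?D e r * zpow {..<k} z e) has_sum S1 r) UNIV" for r
    unfolding S1_def by (rule peel_op[OF w z u(1) bD K S])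
  from Cons.IH[OF us _ this] Cons.prems(2) obtain S0 where
    S0: "\<forall>r. ((\<lambda>e. C w e r * zpow {..<k} z e) has_sum S0 r) UNIV"
      "\<forall>\<mu>. egf {..<k} K S0 \<mu> = (\<Prod>j\<in>set us. exp (- aj j * Lam w z j)) *
        egf {..<k} K S1 (\<lambda>j. if j \<in> set us then \<mu> j - Lam w z j else \<mu> j)" by auto
  \<comment> \<open>Required by \<open>egf_shift\<close>: the bound on the powers of
    \<open>N_g\<close> passes from the coefficients to the sums.\<close>
  have zero: "S r = 0" if "K \<le> r u" for r
  proof -
    have "bounded_by w c (ops w u ?D)" by (rule ops_bounded[OF w u(1) bD])
    then have "ops w u ?D e r = 0" for e using that K u(2) unfolding bounded_by_def sw by force
    then have "((\<lambda>e::nat \<Rightarrow> int. 0::complex) has_sum S r) UNIV" using S[of r] by simp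
    then show ?thesis by (rule has_sum_unique[OF _ has_sum_0]) simp
  qed
  have sh: "egf {..<k} K S1 \<nu> = exp (- aj u * Lam w z u) * egf {..<k} K S (\<nu>(u := \<nu> u + - Lam w z u))" for \<nu>
    by (rule egf_shift) (use u zero S1_def in auto)
  have "egf {..<k} K S0 \<mu> = (\<Prod>j\<in>set (u # us). exp (- aj j * Lam w z j)) *
        egf {..<k} K S (\<lambda>j. if j \<in> set (u # us) then \<mu> j - Lam w z j else \<mu> j)" for \<mu>
  proof -
    let ?\<nu> = "\<lambda>j. if j \<in> set us then \<mu> j - Lam w z j else \<mu> j"
    have "?\<nu>(u := ?\<nu> u + - Lam w z u) = (\<lambda>j. if j \<in> set (u # us) then \<mu> j - Lam w z j else \<mu> j)"
      using Cons.prems(2) by (auto simp: fun_eq_iff)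
    then show ?thesis using S0(2) sh[of ?\<nu>] Cons.prems(2) by (simp add: mult_ac)
  qed
  then show ?case using S0(1) by blast
qed

lemma peel_pds:
  assumes w: "word w" and z: "decr w z" and D: "trunc w D"
  shows "set ps \<subseteq> set prs \<Longrightarrow> ((\<lambda>e. pds M ps D e r * zpow {..<k} z e) has_sum S) UNIV \<Longrightarrow>
    ((\<lambda>e. D e r * zpow {..<k} z e) has_sum (S / (\<Prod>(i, j)\<leftarrow>ps. (z i - z j) ^ M))) UNIV"
proof (induction ps arbitrary: S)
  case Nil
  then show ?case by (simp add: pds_def)
next
  case (Cons p ps)
  obtain i j where p: "p = (i, j)" by fastforce
  have ij: "i < k" "j < k" "i \<noteq> j" using Cons.prems(1) p by (auto simp: prs_set)
  have sw: "distinct w" "set w = {..<k}" using w by (auto simp: word_def)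
  have zz: "\<And>i. i \<in> set w \<Longrightarrow> z i \<noteq> 0" using z sw by (simp add: decr_def)
  let ?E = "pds M ps D"
  have tE: "trunc w ?E" by (rule pds_trunc[OF w _ D]) (use Cons.prems in auto)
  have S: "((\<lambda>e. (pd i j ^^ M) ?E e r * zpow (set w) z e) has_sum S) UNIV"
    using Cons.prems(2) by (simp add: p pds_def sw)
  have "((\<lambda>e. ?E e r * zpow (set w) z e) has_sum (S / (z i - z j) ^ M)) UNIV"
  proof (cases "before w i j")
    case True
    then show ?thesis using has_sum_peel_pd_pow[OF tE True zz _ S] z by (simp add: decr_def)
  next
    case False
    \<comment> \<open>\<open>prs\<close> also lists pairs against the order of \<open>w\<close>.
      Reversing the difference costs a sign, which cancels against that of the denominator.\<close>
    then have bf: "before w j i" using before_total[OF sw(1), of i j] ij sw by auto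
    have S': "((\<lambda>e. (pd j i ^^ M) ?E e r * zpow (set w) z e) has_sum ((- 1) ^ M * S)) UNIV"
      using has_sum_cmult_right[OF S, of "(- 1) ^ M"] by (simp add: pd_neg_pow[where j = j and i = i] mult.assoc)
    have "((\<lambda>e. ?E e r * zpow (set w) z e) has_sum ((- 1) ^ M * S / (z j - z i) ^ M)) UNIV"
      using has_sum_peel_pd_pow[OF tE bf zz _ S'] bf z by (simp add: decr_def)
    moreover have "(z j - z i) ^ M = (- 1) ^ M * (z i - z j) ^ M"
      unfolding power_mult_distrib[symmetric] by simp
    ultimately show ?thesis by simp
  qed
  from Cons.IH[OF _ this[unfolded sw]] Cons.prems(1) show ?case by (simp add: p)
qed

lemma T_trunc: "word w \<Longrightarrow> trunc w (T M w)"
  unfolding T_def by (intro pds_trunc fold_ops_trunc C_trunc order_refl)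

lemma ksgn_nz: "ksgn par w \<noteq> 0"
  using ksgn_sq[of par w] by auto

text \<open>One and the same series is truncated for all orders at once. A word ending in
  \<open>j\<close> bounds the exponent of \<open>x_j\<close> below, and the total degree is bounded
  above.\<close>

lemma P_finite:
  assumes P: "\<forall>w. word w \<longrightarrow> T M w = (\<lambda>e r. ksgn par w * P e r)"
  shows "finite {e. \<exists>r. P e r \<noteq> 0}"
proof -
  have b: "\<exists>c. \<forall>e r. P e r \<noteq> 0 \<longrightarrow> (\<forall>j. j \<notin> {..<k} \<longrightarrow> e j = 0) \<and> sum e {..<k} \<le> c \<and>
      (\<forall>xs ys. w = xs @ ys \<longrightarrow> - c \<le> sum e (set ys))" if w: "word w" for w
  proof -
    obtain c where "bounded_by w c (T M w)" using T_trunc[OF w] by (auto simp: trunc_def)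
    then show ?thesis using P w ksgn_nz[of w] unfolding bounded_by_def word_def by (intro exI[of _ c]) simp
  qed
  have "\<forall>j. \<exists>c. j < k \<longrightarrow> (\<forall>e r. P e r \<noteq> 0 \<longrightarrow> - c \<le> e j)"
  proof
    fix j
    show "\<exists>c. j < k \<longrightarrow> (\<forall>e r. P e r \<noteq> 0 \<longrightarrow> - c \<le> e j)"
    proof (cases "j < k")
      case True
      then have "word (remove1 j [0..<k] @ [j])" by (auto simp: word_def)
      from b[OF this] obtain c where c: "\<forall>e r. P e r \<noteq> 0 \<longrightarrow> (\<forall>j. j \<notin> {..<k} \<longrightarrow> e j = 0) \<and> sum e {..<k} \<le> c \<and>
        (\<forall>xs ys. remove1 j [0..<k] @ [j] = xs @ ys \<longrightarrow> - c \<le> sum e (set ys))" by blast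
      have "- c \<le> e j" if "P e r \<noteq> 0" for e r
      proof -
        have "- c \<le> sum e (set [j])" using c that by blast
        then show ?thesis by simp
      qed
      then show ?thesis by blast
    qed simp
  qed
  from choice[OF this] obtain c where c: "\<forall>j. j < k \<longrightarrow> (\<forall>e r. P e r \<noteq> 0 \<longrightarrow> - c j \<le> e j)" by (elim exE)
  have "word [0..<k]" by (auto simp: word_def)
  from b[OF this] obtain c0 where c0: "\<forall>e r. P e r \<noteq> 0 \<longrightarrow> (\<forall>j. j \<notin> {..<k} \<longrightarrow> e j = 0) \<and> sum e {..<k} \<le> c0 \<and>
      (\<forall>xs ys. [0..<k] = xs @ ys \<longrightarrow> - c0 \<le> sum e (set ys))" by blast
  define B where "B = \<bar>c0\<bar> + (\<Sum>j<k. \<bar>c j\<bar>)"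
  have "{e. \<exists>r. P e r \<noteq> 0} \<subseteq> {e. \<forall>j. (j \<in> {..<k} \<longrightarrow> e j \<in> {-B..B}) \<and> (j \<notin> {..<k} \<longrightarrow> e j = 0)}"
  proof clarify
    fix e r j assume nz: "P e r \<noteq> 0"
    have "e j \<in> {-B..B}" if j: "j < k"
    proof -
      have "\<bar>c j\<bar> \<le> (\<Sum>j<k. \<bar>c j\<bar>)" by (rule member_le_sum) (use j in auto)
      moreover have "- c j \<le> e j" using c nz j by blast
      ultimately have lo: "- B \<le> e j" unfolding B_def by linarith
      have "sum e {..<k} = e j + sum e ({..<k} - {j})" using j by (simp add: sum.remove)
      moreover have "(\<Sum>i\<in>{..<k} - {j}. - \<bar>c i\<bar>) \<le> sum e ({..<k} - {j})"
      proof (rule sum_mono)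
        fix i assume "i \<in> {..<k} - {j}"
        then have "- c i \<le> e i" using c nz by blast
        then show "- \<bar>c i\<bar> \<le> e i" by linarith
      qed
      moreover have "(\<Sum>i\<in>{..<k} - {j}. \<bar>c i\<bar>) \<le> (\<Sum>i<k. \<bar>c i\<bar>)" by (rule sum_mono2) auto
      moreover have "sum e {..<k} \<le> c0" using c0 nz by blast
      ultimately have "e j \<le> B" unfolding B_def by (simp add: sum_negf)
      then show ?thesis using lo by simp
    qed
    moreover have "e j = 0" if "j \<notin> {..<k}" using c0 nz that by blast
    ultimately show "(j \<in> {..<k} \<longrightarrow> e j \<in> {-B..B}) \<and> (j \<notin> {..<k} \<longrightarrow> e j = 0)" by simp
  qed
  then show ?thesis by (rule finite_subset) (rule finite_set_of_finite_funs; simp)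
qed

text \<open>Up to the sign of the order, the sum of the series multiplied by its kernels but not by
  the differences; it no longer depends on the order.\<close>

definition RR :: "nat \<Rightarrow> ((nat \<Rightarrow> int) \<Rightarrow> (nat \<Rightarrow> nat) \<Rightarrow> complex) \<Rightarrow> (nat \<Rightarrow> complex) \<Rightarrow> (nat \<Rightarrow> nat) \<Rightarrow> complex"
  where "RR M P z r = (\<Sum>e | \<exists>r. P e r \<noteq> 0. P e r * zpow {..<k} z e) / (\<Prod>(i, j)\<leftarrow>prs. (z i - z j) ^ M)"

text \<open>\<open>K\<close>, \<open>P\<close> and \<open>M\<close> are common to all words, so the
  value depends on the order only through the sign and the numbers \<open>Lam w z j\<close>.\<close>

lemma numeric:
  "\<exists>K P M. RB \<le> K \<and> finite {e. \<exists>r. P e r \<noteq> 0} \<and> (\<forall>w z. word w \<longrightarrow> decr w z \<longrightarrow>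
    (\<exists>S0. (\<forall>r. ((\<lambda>e. C w e r * zpow {..<k} z e) has_sum S0 r) UNIV) \<and>
      (\<forall>\<mu>. egf {..<k} K S0 \<mu> = ksgn par w * (\<Prod>j\<in>{..<k} - {m}. exp (- aj j * Lam w z j)) *
        egf {..<k} K (RR M P z) (\<lambda>j. if j = m then \<mu> m else \<mu> j - Lam w z j))))"
proof -
  obtain M P where P: "\<forall>w. word w \<longrightarrow> T M w = (\<lambda>e r. ksgn par w * P e r)" using T_common by blast
  have fin: "finite {e. \<exists>r. P e r \<noteq> 0}" by (rule P_finite[OF P])
  have "\<forall>w. \<exists>c. word w \<longrightarrow> bounded_by w c (C w)" using C_trunc by (auto simp: trunc_def)
  from choice[OF this] obtain c where c: "\<forall>w. word w \<longrightarrow> bounded_by w (c w) (C w)" by (elim exE)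
  let ?Wd = "{w. word w}"
  have finW: "finite ?Wd"
  proof (rule finite_subset)
    show "?Wd \<subseteq> {us. set us \<subseteq> {..<k} \<and> length us \<le> k}"
    proof
      fix u assume "u \<in> ?Wd"
      then have u: "distinct u" "set u = {..<k}" by (simp_all add: word_def)
      from distinct_card[OF u(1)] u(2) show "u \<in> {us. set us \<subseteq> {..<k} \<and> length us \<le> k}" by simp
    qed
  qed (rule finite_lists_length_le, simp)
  \<comment> \<open>Exceeds the truncation constant of every word, because the cut-off of
    \<open>egf\<close> must be the same for all orders.\<close>
  define K where "K = RB + Suc (\<Sum>w\<in>?Wd. nat (c w))"
  have K: "c w < int K" if "word w" for w
  proof -
    have "nat (c w) \<le> (\<Sum>w\<in>?Wd. nat (c w))" by (rule member_le_sum) (use that finW in auto)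
    then show ?thesis unfolding K_def by linarith
  qed
  have "\<exists>S0. (\<forall>r. ((\<lambda>e. C w e r * zpow {..<k} z e) has_sum S0 r) UNIV) \<and>
      (\<forall>\<mu>. egf {..<k} K S0 \<mu> = ksgn par w * (\<Prod>j\<in>{..<k} - {m}. exp (- aj j * Lam w z j)) *
        egf {..<k} K (RR M P z) (\<lambda>j. if j = m then \<mu> m else \<mu> j - Lam w z j))"
    if w: "word w" and z: "decr w z" for w z
  proof -
    have cw: "bounded_by w (c w) (C w)" using c w by blast
    have S: "((\<lambda>e. foldr (ops w) js (C w) e r * zpow {..<k} z e) has_sum (ksgn par w * RR M P z r)) UNIV" for r
    proof -
      have "((\<lambda>e. T M w e r * zpow {..<k} z e) has_sum (\<Sum>e | \<exists>r. P e r \<noteq> 0. ksgn par w * P e r * zpow {..<k} z e)) UNIV"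
        by (rule has_sum_finite_neutralI[OF fin]) (use P w in auto)
      from peel_pds[OF w z fold_ops_trunc[OF w order_refl C_trunc[OF w]] order_refl this[unfolded T_def]]
      show ?thesis by (simp add: RR_def sum_distrib_left mult.assoc)
    qed
    from peel_ops[OF w z cw K[OF w] order_refl js_set(2) S] obtain S0 where
      S0: "\<forall>r. ((\<lambda>e. C w e r * zpow {..<k} z e) has_sum S0 r) UNIV"
        "\<forall>\<mu>. egf {..<k} K S0 \<mu> = (\<Prod>j\<in>set js. exp (- aj j * Lam w z j)) *
          egf {..<k} K (\<lambda>r. ksgn par w * RR M P z r) (\<lambda>j. if j \<in> set js then \<mu> j - Lam w z j else \<mu> j)" by auto
    have eq: "egf {..<k} K (RR M P z) (\<lambda>j. if j \<in> set js then \<mu> j - Lam w z j else \<mu> j)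
      = egf {..<k} K (RR M P z) (\<lambda>j. if j = m then \<mu> m else \<mu> j - Lam w z j)" for \<mu>
      by (rule egf_cong) (auto simp: js_set)
    show ?thesis
      by (intro exI[of _ S0] conjI S0(1) allI) (simp only: S0(2) egf_scale eq, simp only: js_set mult_ac)
  qed
  then show ?thesis using fin by (intro exI[of _ K] exI[of _ P] exI[of _ M]) (simp add: K_def)
qed

end

section \<open>Rational functions and uniqueness of the continuation\<close>

definition disc :: "nat \<Rightarrow> (nat \<Rightarrow> complex) \<Rightarrow> complex"
  where "disc n z = (\<Prod>i<n. z i) * (\<Prod>i<n. \<Prod>j<i. (z i - z j))"

lemma disc_power: "disc n z ^ M = (\<Prod>i<n. z i ^ M) * (\<Prod>i<n. \<Prod>j<i. (z i - z j) ^ M)"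
  by (simp add: disc_def power_mult_distrib prod_power_distrib)

lemma disc_nz: "z \<in> config n \<Longrightarrow> disc n z \<noteq> 0"
  by (auto simp: disc_def config_def)

section \<open>Closure properties of polynomial and rational functions\<close>

lemma poly_fun_prod: "finite A \<Longrightarrow> (\<And>a. a \<in> A \<Longrightarrow> poly_fun n (f a)) \<Longrightarrow> poly_fun n (\<lambda>z. \<Prod>a\<in>A. f a z)"
  by (induction A rule: finite_induct) (auto intro: poly_fun.intros)

lemma poly_fun_diff: "i < n \<Longrightarrow> j < n \<Longrightarrow> poly_fun n (\<lambda>z. z i - z j)"
  using poly_fun.intros(3)[OF poly_fun.intros(2) poly_fun.intros(4)[OF poly_fun.intros(1)[of n "- 1"] poly_fun.intros(2)], of i j] by simp

lemma poly_fun_power: "poly_fun n P \<Longrightarrow> poly_fun n (\<lambda>z. P z ^ M)"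
  by (induction M) (auto intro: poly_fun.intros)

lemma poly_fun_disc: "poly_fun n (disc n)"
  unfolding disc_def[abs_def]
  by (intro poly_fun.intros(4) poly_fun_prod) (auto intro!: poly_fun_prod poly_fun_diff poly_fun.intros(2))

lemma poly_fun_cong: "poly_fun n P \<Longrightarrow> (\<And>i. i < n \<Longrightarrow> z i = z' i) \<Longrightarrow> P z = P z'"
  by (induction rule: poly_fun.induct) auto

lemma poly_fun_holomorphic:
  "poly_fun n P \<Longrightarrow> (\<And>i. i < n \<Longrightarrow> (\<lambda>t. c t i) holomorphic_on S) \<Longrightarrow> (\<lambda>t. P (c t)) holomorphic_on S"
  by (induction rule: poly_fun.induct) (auto intro!: holomorphic_intros)

lemma rat_fun_iff: "rat_fun n f \<longleftrightarrow> (\<exists>P M. poly_fun n P \<and> (\<forall>z\<in>config n. f z = P z / disc n z ^ M))"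
  by (simp add: rat_fun_def disc_power)

lemma rat_fun_poly: "poly_fun n P \<Longrightarrow> rat_fun n P"
  unfolding rat_fun_iff by (intro exI[of _ P] exI[of _ 0]) simp

lemma rat_fun_mult:
  assumes "rat_fun n f" "rat_fun n h"
  shows "rat_fun n (\<lambda>z. f z * h z)"
proof -
  from assms obtain P Q M M' where "poly_fun n P" "poly_fun n Q" "\<forall>z\<in>config n. f z = P z / disc n z ^ M"
    "\<forall>z\<in>config n. h z = Q z / disc n z ^ M'" unfolding rat_fun_iff by blast
  then show ?thesis unfolding rat_fun_iff
    by (intro exI[of _ "\<lambda>z. P z * Q z"] exI[of _ "M + M'"]) (auto simp: power_add intro: poly_fun.intros)
qed

lemma rat_fun_add:
  assumes "rat_fun n f" "rat_fun n h"
  shows "rat_fun n (\<lambda>z. f z + h z)"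
proof -
  from assms obtain P Q M M' where p: "poly_fun n P" "poly_fun n Q" "\<forall>z\<in>config n. f z = P z / disc n z ^ M"
    "\<forall>z\<in>config n. h z = Q z / disc n z ^ M'" unfolding rat_fun_iff by blast
  show ?thesis unfolding rat_fun_iff
  proof (intro exI conjI ballI)
    show "poly_fun n (\<lambda>z. P z * disc n z ^ M' + Q z * disc n z ^ M)"
      by (intro poly_fun.intros(3,4) p poly_fun_power poly_fun_disc)
    fix z assume z: "z \<in> config n"
    then show "f z + h z = (P z * disc n z ^ M' + Q z * disc n z ^ M) / disc n z ^ (M + M')"
      unfolding p(3)[rule_format, OF z] p(4)[rule_format, OF z] power_add
      using disc_nz[OF z] by (simp add: add_divide_distrib)
  qed
qed

lemma rat_fun_const: "rat_fun n (\<lambda>z. c)"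
  by (intro rat_fun_poly poly_fun.intros)

lemma rat_fun_sum: "finite A \<Longrightarrow> (\<And>a. a \<in> A \<Longrightarrow> rat_fun n (f a)) \<Longrightarrow> rat_fun n (\<lambda>z. \<Sum>a\<in>A. f a z)"
  by (induction A rule: finite_induct) (auto intro: rat_fun_add rat_fun_const)

lemma rat_fun_prod: "finite A \<Longrightarrow> (\<And>a. a \<in> A \<Longrightarrow> rat_fun n (f a)) \<Longrightarrow> rat_fun n (\<lambda>z. \<Prod>a\<in>A. f a z)"
  by (induction A rule: finite_induct) (auto intro: rat_fun_mult rat_fun_const)

lemma rat_fun_prod_list: "(\<And>a. a \<in> set as \<Longrightarrow> rat_fun n (f a)) \<Longrightarrow> rat_fun n (\<lambda>z. \<Prod>a\<leftarrow>as. f a z)"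
  by (induction as) (auto intro: rat_fun_mult rat_fun_const)

lemma rat_fun_power: "rat_fun n f \<Longrightarrow> rat_fun n (\<lambda>z. f z ^ M)"
  by (induction M) (auto intro: rat_fun_mult rat_fun_const)

lemma rat_fun_inverse:
  assumes "poly_fun n Q" "\<And>z. L z * Q z = disc n z"
  shows "rat_fun n (\<lambda>z. inverse (L z))"
  unfolding rat_fun_iff
proof (intro exI conjI ballI)
  fix z assume "z \<in> config n"
  then have "L z * Q z \<noteq> 0" using assms(2) disc_nz by simp
  then show "inverse (L z) = Q z / disc n z ^ 1" unfolding assms(2)[symmetric] by (simp add: field_simps)
qed (rule assms(1))

lemma rat_fun_inverse_coord:
  assumes "i < n"
  shows "rat_fun n (\<lambda>z. inverse (z i))"
proof (rule rat_fun_inverse)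
  show "poly_fun n (\<lambda>z. (\<Prod>j\<in>{..<n} - {i}. z j) * (\<Prod>i<n. \<Prod>j<i. (z i - z j)))"
    by (intro poly_fun.intros(4) poly_fun_prod) (auto intro!: poly_fun_prod poly_fun_diff poly_fun.intros(2))
  show "z i * ((\<Prod>j\<in>{..<n} - {i}. z j) * (\<Prod>i<n. \<Prod>j<i. (z i - z j))) = disc n z" for z :: "nat \<Rightarrow> complex"
    unfolding disc_def using assms prod.remove[of "{..<n}" i z] by simp
qed

lemma rat_fun_inverse_diff_less:
  assumes "i < n" "j < i"
  shows "rat_fun n (\<lambda>z. inverse (z i - z j))"
proof (rule rat_fun_inverse)
  show "poly_fun n (\<lambda>z. (\<Prod>i<n. z i) * ((\<Prod>j\<in>{..<i} - {j}. (z i - z j)) * (\<Prod>i\<in>{..<n} - {i}. \<Prod>j<i. (z i - z j))))"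
    using assms by (intro poly_fun.intros(4) poly_fun_prod) (auto intro!: poly_fun_prod poly_fun_diff poly_fun.intros(2))
  show "(z i - z j) * ((\<Prod>i<n. z i) * ((\<Prod>j\<in>{..<i} - {j}. (z i - z j)) * (\<Prod>i\<in>{..<n} - {i}. \<Prod>j<i. (z i - z j)))) = disc n z"
    for z :: "nat \<Rightarrow> complex"
  proof -
    have "(\<Prod>i<n. \<Prod>j<i. (z i - z j)) = (\<Prod>j<i. (z i - z j)) * (\<Prod>i\<in>{..<n} - {i}. \<Prod>j<i. (z i - z j))"
      using assms by (intro prod.remove) auto
    also have "(\<Prod>j<i. (z i - z j)) = (z i - z j) * (\<Prod>j\<in>{..<i} - {j}. (z i - z j))"
      using assms by (intro prod.remove) auto
    finally show ?thesis unfolding disc_def by (simp only: mult_ac)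
  qed
qed

lemma rat_fun_inverse_diff:
  assumes "i < n" "j < n" "i \<noteq> j"
  shows "rat_fun n (\<lambda>z. inverse (z i - z j))"
proof (cases "j < i")
  case False
  then have "rat_fun n (\<lambda>z. - 1 * inverse (z j - z i))"
    using assms by (intro rat_fun_mult rat_fun_const rat_fun_inverse_diff_less) auto
  moreover have "(\<lambda>z. - 1 * inverse (z j - z i)) = (\<lambda>z :: nat \<Rightarrow> complex. inverse (z i - z j))"
    by (simp add: fun_eq_iff flip: inverse_minus_eq)
  ultimately show ?thesis by simp
qed (use assms in \<open>simp add: rat_fun_inverse_diff_less\<close>)

lemma rat_fun_powi:
  assumes "i < n"
  shows "rat_fun n (\<lambda>z. z i powi q)"
proof (cases "0 \<le> q")
  case True
  then show ?thesis
    using rat_fun_power[OF rat_fun_poly[OF poly_fun.intros(2)[OF assms]], of "nat q"] by (simp add: power_int_def)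
next
  case False
  then show ?thesis unfolding power_int_def using assms by (auto intro!: rat_fun_power rat_fun_inverse_coord)
qed

section \<open>Branches of the logarithm and logarithmic coordinates\<close>

lemma exp_l_branch: "z \<noteq> 0 \<Longrightarrow> exp (l_branch p z) = z"
proof -
  assume z: "z \<noteq> 0"
  have "exp (2 * pi * \<i> * of_int p) = 1" by (auto simp: exp_eq_1 intro!: exI[of _ p])
  moreover have "exp (of_real (ln (norm z))) = complex_of_real (norm z)" using z by (simp add: exp_of_real)
  ultimately show ?thesis unfolding l_branch_def exp_add using Arg2pi_eq[of z] by simp
qed

lemma Im_l_branch: "Im (l_branch p z) = Arg2pi z + 2 * pi * of_int p"
  by (simp add: l_branch_def)

lemma Arg2pi_exp:
  assumes "2 * pi * of_int p \<le> Im u" "Im u < 2 * pi * of_int p + 2 * pi"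
  shows "Arg2pi (exp u) = Im u - 2 * pi * of_int p"
proof (rule Arg2pi_unique)
  have "exp (\<i> * of_real (Im u - 2 * pi * of_int p)) = exp (\<i> * of_real (Im u))"
    unfolding exp_eq by (rule exI[of _ "- p"]) (simp add: algebra_simps)
  then show "of_real (exp (Re u)) * exp (\<i> * of_real (Im u - 2 * pi * of_int p)) = exp u"
    by (metis complex_eq exp_add exp_of_real)
qed (use assms in auto)

text \<open>The half-open strip consists of the imaginary parts that the branch \<open>l_p\<close>
  takes.\<close>

lemma l_branch_exp:
  assumes "2 * pi * of_int p \<le> Im u" "Im u < 2 * pi * of_int p + 2 * pi"
  shows "l_branch p (exp u) = u"
  using Arg2pi_exp[OF assms] by (simp add: l_branch_def complex_eq_iff)

text \<open>The first half of \<open>is_correlation\<close>, detached from the fields.\<close>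

definition log_form :: "nat \<Rightarrow> nat \<Rightarrow> (nat \<Rightarrow> complex) \<Rightarrow> int \<Rightarrow> complex \<Rightarrow> ((nat \<Rightarrow> complex) \<Rightarrow> complex) \<Rightarrow> bool"
  where "log_form n m al p \<alpha> F \<longleftrightarrow> (\<exists>K f. (\<forall>r. rat_fun n (f r)) \<and>
        (\<forall>z\<in>config n. F z =
          (\<Sum>r \<in> {..<n} \<rightarrow>\<^sub>E {..K::nat}. f r z *
             (\<Prod>j\<in>{..<n} - {m}. exp (- al j * l_branch p (z j - z m))
                * l_branch p (z j - z m) ^ r j) *
             exp (- \<alpha> * l_branch p (z m)) * l_branch p (z m) ^ r m)))"

text \<open>In terms of the logarithms \<open>u m\<close> of \<open>z m\<close> and \<open>u j\<close> of \<open>z j - z m\<close>, a function of this form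
  times a power of \<open>disc\<close> is entire.\<close>
definition zu :: "nat \<Rightarrow> (nat \<Rightarrow> complex) \<Rightarrow> nat \<Rightarrow> complex"
  where "zu m u i = (if i = m then exp (u m) else exp (u m) + exp (u i))"

text \<open>On the strip where \<open>l_p\<close> inverts the exponential, the logarithms become the
  coordinates \<open>u\<close> themselves, and a power of \<open>disc\<close> clears the poles.
  Holomorphy along complex lines is what a continuation in one variable requires.\<close>

lemma log_form_entire:
  assumes F: "log_form n m al p \<alpha> F" and m: "m < n"
  shows "\<exists>M A. (\<forall>u0 d. (\<lambda>t. A (\<lambda>i. u0 i + t * d i)) holomorphic_on UNIV) \<and>
    (\<forall>u z. (\<forall>i<n. 2 * pi * of_int p \<le> Im (u i) \<and> Im (u i) < 2 * pi * of_int p + 2 * pi) \<longrightarrow>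
      z \<in> config n \<longrightarrow> (\<forall>i<n. z i = zu m u i) \<longrightarrow> F z * disc n z ^ M = A u)"
proof -
  obtain K f where f: "\<forall>r. rat_fun n (f r)" and Fz: "\<forall>z\<in>config n. F z =
          (\<Sum>r \<in> {..<n} \<rightarrow>\<^sub>E {..K::nat}. f r z *
             (\<Prod>j\<in>{..<n} - {m}. exp (- al j * l_branch p (z j - z m))
                * l_branch p (z j - z m) ^ r j) *
             exp (- \<alpha> * l_branch p (z m)) * l_branch p (z m) ^ r m)"
    using F unfolding log_form_def by blast
  have "\<forall>r. \<exists>P M. poly_fun n P \<and> (\<forall>z\<in>config n. f r z = P z / disc n z ^ M)" using f unfolding rat_fun_iff .
  then obtain P M where PM: "\<And>r. poly_fun n (P r)" "\<And>r z. z \<in> config n \<Longrightarrow> f r z = P r z / disc n z ^ M r" by metis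
  let ?R = "{..<n} \<rightarrow>\<^sub>E {..K}"
  have finR: "finite ?R" by (intro finite_PiE) auto
  define M0 where "M0 = (\<Sum>r\<in>?R. M r)"
  define A where "A u = (\<Sum>r\<in>?R. P r (zu m u) * disc n (zu m u) ^ (M0 - M r) *
      (\<Prod>j\<in>{..<n} - {m}. exp (- al j * u j) * u j ^ r j) * exp (- \<alpha> * u m) * u m ^ r m)" for u
  show ?thesis
  proof (intro exI conjI allI impI)
    fix u0 d :: "nat \<Rightarrow> complex"
    have z: "(\<lambda>t. zu m (\<lambda>i. u0 i + t * d i) i) holomorphic_on UNIV" for i
      unfolding zu_def by (cases "i = m") (auto intro!: holomorphic_intros)
    show "(\<lambda>t. A (\<lambda>i. u0 i + t * d i)) holomorphic_on UNIV"
      unfolding A_def by (intro holomorphic_intros poly_fun_holomorphic[OF PM(1)] poly_fun_holomorphic[OF poly_fun_disc] z)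
  next
    fix u z assume u: "\<forall>i<n. 2 * pi * of_int p \<le> Im (u i) \<and> Im (u i) < 2 * pi * of_int p + 2 * pi"
      and z: "z \<in> config n" "\<forall>i<n. z i = zu m u i"
    have lm: "l_branch p (z m) = u m" using u z m by (simp add: zu_def l_branch_exp)
    have lj: "l_branch p (z j - z m) = u j" if "j \<in> {..<n} - {m}" for j
      using u z m that by (simp add: zu_def l_branch_exp)
    have pe: "poly_fun n Q \<Longrightarrow> Q z = Q (zu m u)" for Q by (rule poly_fun_cong) (use z in auto)
    have d: "disc n z \<noteq> 0" by (rule disc_nz[OF z(1)])
    have "f r z * disc n z ^ M0 = P r (zu m u) * disc n (zu m u) ^ (M0 - M r)" if r: "r \<in> ?R" for r
    proof -
      have "M r \<le> M0" unfolding M0_def by (rule member_le_sum) (use r finR in auto)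
      then have "disc n z ^ M0 = disc n z ^ M r * disc n z ^ (M0 - M r)" by (simp flip: power_add)
      then show ?thesis using PM(2)[OF z(1), of r] d pe[OF PM(1)] pe[OF poly_fun_disc] by simp
    qed
    note fr = this
    have "F z * disc n z ^ M0 = (\<Sum>r\<in>?R. (f r z * disc n z ^ M0) *
      (\<Prod>j\<in>{..<n} - {m}. exp (- al j * u j) * u j ^ r j) * exp (- \<alpha> * u m) * u m ^ r m)"
      unfolding Fz[rule_format, OF z(1)] sum_distrib_right lm
      by (intro sum.cong refl) (simp add: lj mult_ac)
    also have "\<dots> = A u" unfolding A_def by (intro sum.cong refl) (simp only: fr)
    finally show "F z * disc n z ^ M0 = A u" .
  qed
qed

lemma Arg2pi_pos_i: "0 < x \<Longrightarrow> Arg2pi (\<i> * of_real x) = pi / 2"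
proof (rule Arg2pi_unique[of x])
  show "of_real x * exp (\<i> * of_real (pi / 2)) = \<i> * of_real x"
    unfolding cis_conv_exp[symmetric] cis_pi_half by (rule mult.commute)
qed simp_all

lemma Arg2pi_neg_i: "0 < x \<Longrightarrow> Arg2pi (- (\<i> * of_real x)) = 3 * pi / 2"
proof (rule Arg2pi_unique[of x])
  have "cis (3 * pi / 2) = cis pi * cis (pi / 2)" unfolding cis_mult by (simp add: field_simps)
  then show "of_real x * exp (\<i> * of_real (3 * pi / 2)) = - (\<i> * of_real x)"
    unfolding cis_conv_exp[symmetric] by simp
qed (simp_all add: pi_gt_zero)

lemma corr_region_config:
  assumes "z \<in> corr_region m n"
  shows "z \<in> config n"
proof -
  have z: "\<forall>i<n. z i \<noteq> 0" "\<forall>i j. i < j \<and> j < n \<longrightarrow> norm (z i) > norm (z j)"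
    using assms unfolding corr_region_def mem_Collect_eq by simp_all
  have "z i \<noteq> z j" if "i < n" "j < i" for i j
    using z(2)[THEN spec[of _ j], THEN spec[of _ i]] that by auto
  then show ?thesis using z(1) by (simp add: config_def)
qed

text \<open>Up to powers of \<open>disc\<close> both functions are entire in the logarithmic
  coordinates, so they can be compared along the complex line joining the coordinates of a point
  \<open>z0\<close> of the region to those of \<open>z\<close>. This line may leave both the region
  and the strip; the identity theorem bridges the gap.\<close>

lemma log_form_unique:
  assumes F1: "log_form n m al p \<alpha> F1" and F2: "log_form n m al p \<alpha> F2" and m: "m < n"
    and eq: "\<And>z. z \<in> corr_region m n \<Longrightarrow> F1 z = F2 z" and z: "z \<in> config n"
  shows "F1 z = F2 z"
proof -
  obtain M1 A1 where A1: "\<forall>u0 d. (\<lambda>t. A1 (\<lambda>i. u0 i + t * d i)) holomorphic_on UNIV"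
    "\<forall>u z. (\<forall>i<n. 2 * pi * of_int p \<le> Im (u i) \<and> Im (u i) < 2 * pi * of_int p + 2 * pi) \<longrightarrow>
      z \<in> config n \<longrightarrow> (\<forall>i<n. z i = zu m u i) \<longrightarrow> F1 z * disc n z ^ M1 = A1 u"
    using log_form_entire[OF F1 m] by blast
  obtain M2 A2 where A2: "\<forall>u0 d. (\<lambda>t. A2 (\<lambda>i. u0 i + t * d i)) holomorphic_on UNIV"
    "\<forall>u z. (\<forall>i<n. 2 * pi * of_int p \<le> Im (u i) \<and> Im (u i) < 2 * pi * of_int p + 2 * pi) \<longrightarrow>
      z \<in> config n \<longrightarrow> (\<forall>i<n. z i = zu m u i) \<longrightarrow> F2 z * disc n z ^ M2 = A2 u"
    using log_form_entire[OF F2 m] by blast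
  \<comment> \<open>Points of the imaginary axis with decreasing moduli: the arguments in the
    definition of the region are \<open>pi / 2\<close> or \<open>3 pi / 2\<close>, away from the cut
    of \<open>Arg2pi\<close>, so nearby points satisfy its strict inequalities too.\<close>
  define z0 :: "nat \<Rightarrow> complex" where "z0 i = \<i> * of_real (real n - real i)" for i
  define lg where "lg z i = l_branch p (if i = m then z m else z i - z m)" for z :: "nat \<Rightarrow> complex" and i
  define U where "U t i = lg z0 i + t * (lg z i - lg z0 i)" for t i
  have zmi: "z i - z m \<noteq> 0" "z m \<noteq> 0" if "i < n" "i \<noteq> m" for i
    using z that m by (auto simp: config_def) (metis linorder_neqE_nat)
  have zm: "z m \<noteq> 0" using z m by (auto simp: config_def)
  have z0d: "z0 i - z0 m = \<i> * of_real (real m - real i)" for i by (simp add: z0_def algebra_simps)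
  have nz0: "norm (z0 i) = real n - real i" if "i < n" for i
    unfolding z0_def norm_mult norm_ii norm_of_real using that by simp
  have z0nz: "z0 m \<noteq> 0" using m by (simp add: z0_def)
  have zu0: "zu m (lg z0) i = z0 i" if "i < n" for i
  proof (cases "i = m")
    case False
    then have "z0 i - z0 m \<noteq> 0" by (simp add: z0d)
    then show ?thesis using False z0nz by (simp add: zu_def lg_def exp_l_branch)
  qed (simp add: zu_def lg_def exp_l_branch z0nz)
  have zu1: "zu m (lg z) i = z i" if "i < n" for i
    using zmi[of i] zm that by (cases "i = m") (simp_all add: zu_def lg_def exp_l_branch)
  have argi: "Arg2pi (z0 i) = pi / 2" if "i < n" for i unfolding z0_def by (rule Arg2pi_pos_i) (use that in simp)
  have argl: "Arg2pi (z0 i - z0 m) = pi / 2" if "i < m" for i unfolding z0d by (rule Arg2pi_pos_i) (use that in simp)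
  have argr: "Arg2pi (z0 i - z0 m) = 3 * pi / 2" if "m < i" for i
  proof -
    have "z0 i - z0 m = - (\<i> * of_real (real i - real m))" by (simp add: z0_def algebra_simps)
    then show ?thesis using Arg2pi_neg_i[of "real i - real m"] that by simp
  qed
  have Iml: "Im (lg z0 i) = (if m < i then 3 * pi / 2 else pi / 2) + 2 * pi * of_int p" if "i < n" for i
  proof (cases i m rule: linorder_cases)
    case less
    then show ?thesis using argl by (simp add: lg_def Im_l_branch)
  next
    case equal
    then show ?thesis using argi m by (simp add: lg_def Im_l_branch)
  next
    case greater
    then show ?thesis using argr by (simp add: lg_def Im_l_branch)
  qed
  have Ut: "((\<lambda>t. U t i) \<longlongrightarrow> lg z0 i) (nhds 0)" for i
  proof -
    have "((\<lambda>t. U t i) \<longlongrightarrow> lg z0 i + 0 * (lg z i - lg z0 i)) (nhds 0)"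
      unfolding U_def by (intro tendsto_intros filterlim_ident)
    then show ?thesis by simp
  qed
  have zt: "((\<lambda>t. zu m (U t) i) \<longlongrightarrow> z0 i) (nhds 0)" if "i < n" for i
  proof -
    have "((\<lambda>t. zu m (U t) i) \<longlongrightarrow> zu m (lg z0) i) (nhds 0)"
      unfolding zu_def by (cases "i = m") (auto intro!: tendsto_intros Ut)
    then show ?thesis using zu0 that by simp
  qed
  have At: "((\<lambda>t. Arg2pi (h t)) \<longlongrightarrow> Arg2pi y) (nhds 0)" if "(h \<longlongrightarrow> y) (nhds 0)" "Re y = 0" "Im y \<noteq> 0" for h :: "complex \<Rightarrow> complex" and y
  proof (rule isCont_tendsto_compose[OF continuous_at_Arg2pi that(1)])
    show "y \<notin> \<real>\<^sub>\<ge>\<^sub>0" using that by (simp add: complex_nonneg_Reals_iff)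
  qed
  have ev1: "eventually (\<lambda>t. \<forall>i\<in>{..<n}. 2 * pi * of_int p < Im (U t i) \<and> Im (U t i) < 2 * pi * of_int p + 2 * pi) (nhds 0)"
  proof (rule eventually_ball_finite)
    show "\<forall>i\<in>{..<n}. eventually (\<lambda>t. 2 * pi * of_int p < Im (U t i) \<and> Im (U t i) < 2 * pi * of_int p + 2 * pi) (nhds 0)"
    proof
      fix i assume i: "i \<in> {..<n}"
      have "((\<lambda>t. Im (U t i)) \<longlongrightarrow> Im (lg z0 i)) (nhds 0)" by (intro tendsto_intros Ut)
      moreover have "2 * pi * of_int p < Im (lg z0 i)" "Im (lg z0 i) < 2 * pi * of_int p + 2 * pi"
        using Iml[of i] i pi_gt_zero by (auto simp: field_simps)
      ultimately show "eventually (\<lambda>t. 2 * pi * of_int p < Im (U t i) \<and> Im (U t i) < 2 * pi * of_int p + 2 * pi) (nhds 0)"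
        by (intro eventually_conj) (auto dest: order_tendstoD)
    qed
  qed simp
  have ev2: "eventually (\<lambda>t. \<forall>i\<in>{..<n}. zu m (U t) i \<noteq> 0) (nhds 0)"
    by (rule eventually_ball_finite) (auto intro!: tendsto_imp_eventually_ne[OF zt] simp: z0_def)
  have ev3: "eventually (\<lambda>t. \<forall>i\<in>{..<n}. \<forall>j\<in>{..<n}. i < j \<longrightarrow> norm (zu m (U t) j) < norm (zu m (U t) i)) (nhds 0)"
  proof (intro eventually_ball_finite ballI finite_lessThan)
    fix i j assume ij: "i \<in> {..<n}" "j \<in> {..<n}"
    show "eventually (\<lambda>t. i < j \<longrightarrow> norm (zu m (U t) j) < norm (zu m (U t) i)) (nhds 0)"
    proof (cases "i < j")
      case True
      have "((\<lambda>t. norm (zu m (U t) i) - norm (zu m (U t) j)) \<longlongrightarrow> norm (z0 i) - norm (z0 j)) (nhds 0)"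
        using ij by (intro tendsto_intros zt) auto
      moreover have "0 < norm (z0 i) - norm (z0 j)" using True ij by (simp add: nz0)
      ultimately have "eventually (\<lambda>t. 0 < norm (zu m (U t) i) - norm (zu m (U t) j)) (nhds 0)" by (rule order_tendstoD(1))
      then show ?thesis by (rule eventually_mono) simp
    qed simp
  qed
  have ev4: "eventually (\<lambda>t. \<forall>i\<in>{..<m}. \<bar>Arg2pi (zu m (U t) i - zu m (U t) m) - Arg2pi (zu m (U t) i)\<bar> < pi / 2) (nhds 0)"
  proof (intro eventually_ball_finite ballI finite_lessThan)
    fix i assume i: "i \<in> {..<m}"
    have i': "i < n" "i < m" using i m by auto
    have "((\<lambda>t. \<bar>Arg2pi (zu m (U t) i - zu m (U t) m) - Arg2pi (zu m (U t) i)\<bar>)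
      \<longlongrightarrow> \<bar>Arg2pi (z0 i - z0 m) - Arg2pi (z0 i)\<bar>) (nhds 0)"
    proof (intro tendsto_rabs tendsto_diff At zt i' m)
      show "Re (z0 i - z0 m) = 0" "Im (z0 i - z0 m) \<noteq> 0" "Re (z0 i) = 0" "Im (z0 i) \<noteq> 0" using i' by (simp_all add: z0_def)
    qed
    moreover have "\<bar>Arg2pi (z0 i - z0 m) - Arg2pi (z0 i)\<bar> < pi / 2"
      by (simp add: argl[OF i'(2)] argi[OF i'(1)])
    ultimately show "eventually (\<lambda>t. \<bar>Arg2pi (zu m (U t) i - zu m (U t) m) - Arg2pi (zu m (U t) i)\<bar> < pi / 2) (nhds 0)"
      by (rule order_tendstoD(2))
  qed
  have ev5: "eventually (\<lambda>t. \<forall>i\<in>{m<..<n}. pi / 2 < Arg2pi (zu m (U t) i - zu m (U t) m) - Arg2pi (zu m (U t) m) \<and>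
      Arg2pi (zu m (U t) i - zu m (U t) m) - Arg2pi (zu m (U t) m) < 3 * pi / 2) (nhds 0)"
  proof (intro eventually_ball_finite ballI finite_greaterThanLessThan)
    fix i assume i: "i \<in> {m<..<n}"
    have i': "i < n" "m < i" using i by auto
    have t: "((\<lambda>t. Arg2pi (zu m (U t) i - zu m (U t) m) - Arg2pi (zu m (U t) m))
      \<longlongrightarrow> Arg2pi (z0 i - z0 m) - Arg2pi (z0 m)) (nhds 0)"
    proof (intro tendsto_diff At zt i' m)
      show "Re (z0 i - z0 m) = 0" "Im (z0 i - z0 m) \<noteq> 0" "Re (z0 m) = 0" "Im (z0 m) \<noteq> 0" using i' m by (simp_all add: z0_def)
    qed
    have v: "Arg2pi (z0 i - z0 m) - Arg2pi (z0 m) = pi" by (simp add: argr[OF i'(2)] argi[OF m])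
    show "eventually (\<lambda>t. pi / 2 < Arg2pi (zu m (U t) i - zu m (U t) m) - Arg2pi (zu m (U t) m) \<and>
      Arg2pi (zu m (U t) i - zu m (U t) m) - Arg2pi (zu m (U t) m) < 3 * pi / 2) (nhds 0)"
      by (intro eventually_conj order_tendstoD[OF t[unfolded v]]) (use pi_gt_zero in \<open>simp_all add: field_simps\<close>)
  qed
  obtain B where B: "open B" "0 \<in> B" and BB: "\<forall>t\<in>B.
      (\<forall>i\<in>{..<n}. 2 * pi * of_int p < Im (U t i) \<and> Im (U t i) < 2 * pi * of_int p + 2 * pi) \<and>
      (\<forall>i\<in>{..<n}. zu m (U t) i \<noteq> 0) \<and>
      (\<forall>i\<in>{..<n}. \<forall>j\<in>{..<n}. i < j \<longrightarrow> norm (zu m (U t) j) < norm (zu m (U t) i)) \<and>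
      (\<forall>i\<in>{..<m}. \<bar>Arg2pi (zu m (U t) i - zu m (U t) m) - Arg2pi (zu m (U t) i)\<bar> < pi / 2) \<and>
      (\<forall>i\<in>{m<..<n}. pi / 2 < Arg2pi (zu m (U t) i - zu m (U t) m) - Arg2pi (zu m (U t) m) \<and>
        Arg2pi (zu m (U t) i - zu m (U t) m) - Arg2pi (zu m (U t) m) < 3 * pi / 2)"
    using eventually_conj[OF ev1 eventually_conj[OF ev2 eventually_conj[OF ev3 eventually_conj[OF ev4 ev5]]]]
    unfolding eventually_nhds by (elim exE conjE)
  \<comment> \<open>The exponents \<open>M1\<close> and \<open>M2\<close> may differ; cross
    multiplication makes the two entire functions comparable.\<close>
  define H1 where "H1 t = A1 (U t) * disc n (zu m (U t)) ^ M2" for t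
  define H2 where "H2 t = A2 (U t) * disc n (zu m (U t)) ^ M1" for t
  have zh: "(\<lambda>t. zu m (U t) i) holomorphic_on UNIV" for i
    unfolding zu_def U_def by (cases "i = m") (auto intro!: holomorphic_intros)
  have AU: "(\<lambda>t. A1 (U t)) holomorphic_on UNIV" "(\<lambda>t. A2 (U t)) holomorphic_on UNIV"
    unfolding U_def[abs_def]
    using A1(1)[rule_format, of "lg z0" "\<lambda>i. lg z i - lg z0 i"] A2(1)[rule_format, of "lg z0" "\<lambda>i. lg z i - lg z0 i"] .
  have hol: "H1 holomorphic_on UNIV" "H2 holomorphic_on UNIV"
    unfolding H1_def[abs_def] H2_def[abs_def]
    by (intro holomorphic_intros AU poly_fun_holomorphic[OF poly_fun_disc] zh)+
  have "H1 1 = H2 1"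
  proof (rule analytic_continuation_open[OF B(1) open_UNIV _ _ subset_UNIV hol])
    show "B \<noteq> {}" using B by auto
    fix t assume t: "t \<in> B"
    have reg: "zu m (U t) \<in> corr_region m n" using bspec[OF BB t] by (auto simp: corr_region_def)
    have g: "\<forall>i<n. 2 * pi * of_int p \<le> Im (U t i) \<and> Im (U t i) < 2 * pi * of_int p + 2 * pi"
      using bspec[OF BB t] by (auto intro: less_imp_le)
    have "F1 (zu m (U t)) * disc n (zu m (U t)) ^ M1 = A1 (U t)" "F2 (zu m (U t)) * disc n (zu m (U t)) ^ M2 = A2 (U t)"
      using A1(2) A2(2) g corr_region_config[OF reg] by blast+
    then show "H1 t = H2 t" unfolding H1_def H2_def using eq[OF reg] by (metis mult.assoc mult.commute)
  qed auto
  moreover have U1: "U 1 = lg z" by (simp add: fun_eq_iff U_def)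
  have g1: "\<forall>i<n. 2 * pi * of_int p \<le> Im (lg z i) \<and> Im (lg z i) < 2 * pi * of_int p + 2 * pi"
    using Arg2pi_ge_0 Arg2pi_lt_2pi by (simp add: lg_def Im_l_branch add.commute)
  have "F1 z * disc n z ^ M1 = A1 (lg z)" "F2 z * disc n z ^ M2 = A2 (lg z)"
    using A1(2) A2(2) g1 z zu1 by auto
  moreover have "disc n (zu m (lg z)) = disc n z" by (rule poly_fun_cong[OF poly_fun_disc zu1])
  ultimately have "F1 z * disc n z ^ M1 * disc n z ^ M2 = F2 z * disc n z ^ M2 * disc n z ^ M1"
    unfolding H1_def H2_def U1 by simp
  then show ?thesis using disc_nz[OF z] by simp
qed

section \<open>The series of modes\<close>

lemma sum_PiE_insert:
  assumes "x \<notin> A"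
  shows "(\<Sum>s\<in>insert x A \<rightarrow>\<^sub>E B. f s) = (\<Sum>i\<in>B. \<Sum>s\<in>A \<rightarrow>\<^sub>E B. f (s(x := i)))"
proof -
  have inj: "inj_on (\<lambda>(i, s). s(x := i)) (B \<times> (A \<rightarrow>\<^sub>E B))"
    using inj_combinator[OF assms, of "\<lambda>_. B"] by simp
  show ?thesis
    by (subst PiE_insert_eq, subst sum.reindex[OF inj]) (simp add: sum.cartesian_product case_prod_beta)
qed

lemma sum_PiE_singleton: "(\<Sum>s\<in>{x} \<rightarrow>\<^sub>E B. f s) = (\<Sum>i\<in>B. f ((\<lambda>_. undefined)(x := i)))"
  using sum_PiE_insert[where x = x and A = "{}" and B = B and f = f] by (simp add: fun_upd_def)

lemma sum_PiE_Un:
  assumes "A \<inter> B = {}"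
  shows "(\<Sum>r\<in>(A \<union> B) \<rightarrow>\<^sub>E X. f r) = (\<Sum>r\<in>A \<rightarrow>\<^sub>E X. \<Sum>s\<in>B \<rightarrow>\<^sub>E X. f (\<lambda>j. if j \<in> A then r j else s j))"
  unfolding sum.cartesian_product
proof (rule sum.reindex_bij_witness[where i = "\<lambda>(r, s) j. if j \<in> A then r j else s j"
      and j = "\<lambda>r. (restrict r A, restrict r B)"], goal_cases)
  case (1 r)
  then show ?case by (auto simp: fun_eq_iff PiE_def extensional_def)
next
  case (2 r)
  then show ?case by auto
next
  case (3 y)
  then show ?case using assms by (auto simp: fun_eq_iff PiE_def extensional_def)
next
  case (4 y)
  then show ?case by (auto simp: PiE_def extensional_def split: if_splits)
next
  case (5 r)
  have "(\<lambda>j. if j \<in> A then restrict r A j else restrict r B j) = r"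
    using 5 by (auto simp: fun_eq_iff PiE_def extensional_def)
  then show ?case by simp
qed

lemma has_sum_finite_times:
  fixes f :: "'a \<Rightarrow> 'b \<Rightarrow> complex"
  assumes "finite R" "\<And>r. r \<in> R \<Longrightarrow> (f r has_sum S r) Z"
  shows "((\<lambda>(r, e). f r e) has_sum (\<Sum>r\<in>R. S r)) (R \<times> Z)"
  using assms
proof (induction R rule: finite_induct)
  case (insert x R)
  have "inj_on (Pair x) Z" by (simp add: inj_on_def)
  from has_sum_reindex[OF this, of "\<lambda>(r, e). f r e" "S x"] insert.prems
  have "((\<lambda>(r, e). f r e) has_sum S x) (Pair x ` Z)" by (simp add: o_def)
  from has_sum_Un_disjoint[OF this insert.IH[OF insert.prems]] insert.hyps
  have "((\<lambda>(r, e). f r e) has_sum (S x + (\<Sum>r\<in>R. S r))) (Pair x ` Z \<union> R \<times> Z)" by auto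
  moreover have "Pair x ` Z \<union> R \<times> Z = insert x R \<times> Z" by auto
  ultimately show ?case using insert.hyps by simp
qed simp

lemma ex_map_eq: "distinct w \<Longrightarrow> length ms = length w \<Longrightarrow> \<exists>f. map f w = ms"
proof (induction w arbitrary: ms)
  case (Cons x w)
  then obtain y ys where ms: "ms = y # ys" by (cases ms) auto
  with Cons obtain f where "map f w = ys" by auto
  then have "map (f(x := y)) (x # w) = ms" using Cons.prems(1) ms by auto
  then show ?case by blast
qed simp

lemma exp_int_mult: "exp (of_int q * x) = exp (x :: complex) powi q"
proof (cases "0 \<le> q")
  case True
  then show ?thesis using exp_of_nat_mult[of "nat q" x] by (simp add: power_int_def)
next
  case False
  then have "exp (of_int q * x) = inverse (exp (of_nat (nat (- q)) * x))" by (simp flip: exp_minus)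
  then show ?thesis using False exp_of_nat_mult[of "nat (- q)" x] by (simp add: power_int_def power_inverse)
qed

lemma mono_branch_powi:
  assumes "z \<noteq> 0"
  shows "mono_branch p z (o' - of_int q - 1) c = z powi q * exp (- o' * l_branch p z) * l_branch p z ^ c"
proof -
  have "(- (o' - of_int q - 1) - 1) * l_branch p z = of_int q * l_branch p z + - o' * l_branch p z"
    by (simp add: algebra_simps)
  then show ?thesis unfolding mono_branch_def by (simp only: exp_add exp_int_mult exp_l_branch[OF assms])
qed

context vsa_generated
begin

text \<open>Divided powers, for which the Leibniz rule of the derivation \<open>N\<close> has no
  binomial coefficients.\<close>

definition Dn :: "nat \<Rightarrow> 'v \<Rightarrow> 'v" where "Dn q x = (1 / fact q) *\<^sub>C (N ^^ q) x"

lemma Dn_Suc: "of_nat (Suc q) *\<^sub>C Dn (Suc q) x = N (Dn q x)"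
proof -
  have "(of_nat (Suc q) * (1 / fact (Suc q)) :: complex) = 1 / fact q"
    by (simp only: fact_Suc of_nat_mult) (simp del: of_nat_Suc)
  then show ?thesis by (simp only: Dn_def scaleC_scaleC clinear_scale[OF N_lin] funpow.simps o_apply)
qed

lemma Dn_0 [simp]: "Dn 0 x = x"
  by (simp add: Dn_def scaleC_one)

lemma Dn_Y: "Dn q (Y_op V x n y) = (\<Sum>i\<le>q. Y_op V (Dn i x) n (Dn (q - i) y))"
proof (induction q)
  case (Suc q)
  define h where "h i j = Y_op V (Dn i x) n (Dn j y)" for i j
  have Nh: "N (h i j) = of_nat (Suc i) *\<^sub>C h (Suc i) j + of_nat (Suc j) *\<^sub>C h i (Suc j)" for i j
    unfolding h_def N_Y Dn_Suc[symmetric] clinear_scale[OF Y_lin1] clinear_scale[OF Y_lin2] ..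
  have "of_nat (Suc q) *\<^sub>C (\<Sum>i\<le>Suc q. h i (Suc q - i))
      = (\<Sum>i\<le>Suc q. of_nat i *\<^sub>C h i (Suc q - i)) + (\<Sum>i\<le>Suc q. of_nat (Suc q - i) *\<^sub>C h i (Suc q - i))"
    unfolding complex_vector.scale_sum_right sum.distrib[symmetric]
    by (intro sum.cong refl) (simp add: scaleC_add_left[symmetric] del: of_nat_Suc flip: of_nat_add)
  also have "(\<Sum>i\<le>Suc q. of_nat i *\<^sub>C h i (Suc q - i)) = (\<Sum>i\<le>q. of_nat (Suc i) *\<^sub>C h (Suc i) (q - i))"
    by (subst sum.atMost_Suc_shift) (simp del: of_nat_Suc)
  also have "(\<Sum>i\<le>Suc q. of_nat (Suc q - i) *\<^sub>C h i (Suc q - i)) = (\<Sum>i\<le>q. of_nat (Suc (q - i)) *\<^sub>C h i (Suc (q - i)))"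
    by (simp add: Suc_diff_le del: of_nat_Suc of_nat_diff)
  also have "(\<Sum>i\<le>q. of_nat (Suc i) *\<^sub>C h (Suc i) (q - i)) + (\<Sum>i\<le>q. of_nat (Suc (q - i)) *\<^sub>C h i (Suc (q - i)))
      = N (\<Sum>i\<le>q. h i (q - i))"
    unfolding clinear_sum[OF N_lin] Nh sum.distrib ..
  also have "\<dots> = of_nat (Suc q) *\<^sub>C Dn (Suc q) (Y_op V x n y)"
    unfolding Dn_Suc Suc h_def ..
  finally have "of_nat (Suc q) *\<^sub>C Dn (Suc q) (Y_op V x n y) = of_nat (Suc q) *\<^sub>C (\<Sum>i\<le>Suc q. h i (Suc q - i))" ..
  then show ?case unfolding h_def complex_vector.scale_cancel_left by (simp only: of_nat_eq_0_iff nat.simps simp_thms)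
qed simp

end

context correlator
begin

text \<open>The logarithms of the twist field apply a power of \<open>N\<close> to everything on its
  right. The Leibniz rule distributes it over the letters of \<open>zs\<close> and the vector, whose
  powers of \<open>N\<close> thereby enter the multi-index like those of the other letters.\<close>

lemma Dn_VV:
  assumes K: "RB \<le> K"
  shows "set zs \<subseteq> {..<k} - {m} \<Longrightarrow> distinct zs \<Longrightarrow>
    Dn q (VV zs e (\<lambda>_. 0) v) = (\<Sum>s\<in>insert m (set zs) \<rightarrow>\<^sub>E {..<K}.
      if sum s (insert m (set zs)) = q
      then (\<Prod>j\<in>insert m (set zs). 1 / fact (s j)) *\<^sub>C VV zs e s ((N ^^ s m) v) else 0)"
proof (induction zs arbitrary: q)
  case Nil
  have "(\<Sum>s\<in>insert m (set []) \<rightarrow>\<^sub>E {..<K}. if sum s (insert m (set [])) = q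
      then (\<Prod>j\<in>insert m (set []). 1 / fact (s j)) *\<^sub>C VV [] e s ((N ^^ s m) v) else 0)
    = (\<Sum>i<K. if i = q then Dn i v else 0)"
    unfolding list.set sum_PiE_singleton by (intro sum.cong refl) (simp add: Dn_def)
  also have "\<dots> = (if q < K then Dn q v else 0)" by simp
  also have "\<dots> = Dn q v"
  proof (cases "q < K")
    case False
    then have "(N ^^ q) v = 0" using K RB(1) by simp
    then show ?thesis using False by (simp add: Dn_def)
  qed simp
  finally show ?case by simp
next
  case (Cons j zs)
  have j: "j < k" "j \<noteq> m" "j \<notin> set zs" and zs: "set zs \<subseteq> {..<k} - {m}" "distinct zs" using Cons.prems by auto
  let ?J = "insert m (set zs)" and ?g = "gvec G (gi j)" and ?n = "- e j - 1"
  let ?t = "\<lambda>q s. if sum s ?J = q then (\<Prod>j\<in>?J. 1 / fact (s j)) *\<^sub>C VV zs e s ((N ^^ s m) v) else 0"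
  have term_eq: "(if sum (s(j := i)) (insert j ?J) = q
      then (\<Prod>l\<in>insert j ?J. 1 / fact ((s(j := i)) l)) *\<^sub>C VV (j # zs) e (s(j := i)) ((N ^^ (s(j := i)) m) v) else 0)
    = (if i \<le> q then Y_op V (Dn i ?g) ?n (?t (q - i) s) else 0)" for s i
  proof -
    have sm: "sum (s(j := i)) ?J = sum s ?J" by (rule sum.cong) (use j in auto)
    have pr: "(\<Prod>l\<in>?J. 1 / fact ((s(j := i)) l)) = (\<Prod>l\<in>?J. 1 / (fact (s l) :: complex))" by (rule prod.cong) (use j in auto)
    have jJ: "j \<notin> ?J" using j by auto
    have V: "VV zs e (s(j := i)) u = VV zs e s u" for u by (rule VV_cong) (use j in auto)
    have 1: "sum (s(j := i)) (insert j ?J) = i + sum s ?J" using jJ sm by simp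
    have 2: "(\<Prod>l\<in>insert j ?J. 1 / fact ((s(j := i)) l)) *\<^sub>C VV (j # zs) e (s(j := i)) ((N ^^ (s(j := i)) m) v)
      = Y_op V (Dn i ?g) ?n ((\<Prod>l\<in>?J. 1 / fact (s l)) *\<^sub>C VV zs e s ((N ^^ s m) v))"
    proof -
      have P: "(\<Prod>l\<in>insert j ?J. 1 / fact ((s(j := i)) l)) = 1 / fact i * (\<Prod>l\<in>?J. 1 / (fact (s l) :: complex))"
        unfolding prod.insert[OF finite.insertI[OF finite_set] jJ] pr by simp
      have "VV (j # zs) e (s(j := i)) ((N ^^ (s(j := i)) m) v) = Y_op V ((N ^^ i) ?g) ?n (VV zs e s ((N ^^ s m) v))"
        using j V by simp
      then show ?thesis
        unfolding P Dn_def by (simp only: clinear_scale[OF Y_lin1] clinear_scale[OF Y_lin2] scaleC_scaleC mult_ac)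
    qed
    show ?thesis unfolding 1 2 by (auto simp: clinear_0[OF Y_lin2])
  qed
  have "(\<Sum>s\<in>insert m (set (j # zs)) \<rightarrow>\<^sub>E {..<K}. if sum s (insert m (set (j # zs))) = q
      then (\<Prod>l\<in>insert m (set (j # zs)). 1 / fact (s l)) *\<^sub>C VV (j # zs) e s ((N ^^ s m) v) else 0)
    = (\<Sum>i<K. \<Sum>s\<in>?J \<rightarrow>\<^sub>E {..<K}. if i \<le> q then Y_op V (Dn i ?g) ?n (?t (q - i) s) else 0)"
    unfolding list.set insert_commute[of m j] using j by (subst sum_PiE_insert) (auto simp only: term_eq)
  also have "\<dots> = (\<Sum>i<K. if i \<le> q then Y_op V (Dn i ?g) ?n (Dn (q - i) (VV zs e (\<lambda>_. 0) v)) else 0)"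
    unfolding Cons.IH[OF zs] clinear_sum[OF Y_lin2] by (intro sum.cong refl) simp
  also have "\<dots> = (\<Sum>i\<le>q. Y_op V (Dn i ?g) ?n (Dn (q - i) (VV zs e (\<lambda>_. 0) v)))"
  proof (rule sum.mono_neutral_cong)
    fix i assume i: "i \<in> {..q} - {..<K}"
    then have "(N ^^ i) ?g = 0" using RB(2)[OF j(1), of i] K by simp
    then show "Y_op V (Dn i ?g) ?n (Dn (q - i) (VV zs e (\<lambda>_. 0) v)) = 0" by (simp add: Dn_def clinear_0[OF Y_lin1])
  qed auto
  also have "\<dots> = Dn q (VV (j # zs) e (\<lambda>_. 0) v)" by (simp add: Dn_Y)
  finally show ?case ..
qed

text \<open>The g-weight of the vector on which the twist field acts fixes its exponents modulo
  integers, hence the modes that can be nonzero.\<close>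

lemma VV_V_g:
  assumes al: "al \<in> P_V g" "v \<in> V_g g al"
  shows "set zs \<subseteq> {..<k} - {m} \<Longrightarrow> VV zs e (\<lambda>_. 0) v \<in> V_g g (frac_part (sal zs))"
proof (induction zs)
  case Nil
  have "frac_part al = al" using strip_unique[OF frac_part_strip[of al] P_V_strip[OF al(1)] frac_part_diff(2)] .
  then show ?case using al by (simp add: sal_def)
next
  case (Cons j zs)
  then have j: "gi j \<in> I_set G" using gi by auto
  have s: "0 \<le> Re (gal G (gi j))" "Re (gal G (gi j)) < 1" using P_V_strip[OF gvec(2)[OF j]] by auto
  have "Y_op V (gvec G (gi j)) (- e j - 1) (VV zs e (\<lambda>_. 0) v) \<in> V_g g (frac_part (gal G (gi j) + frac_part (sal zs)))"
    by (rule V_g_Y[OF gvec(3)[OF j] _ s frac_part_strip]) (use Cons in auto)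
  moreover have "frac_part (gal G (gi j) + frac_part (sal zs)) = frac_part (sal (j # zs))"
  proof (rule frac_part_cong)
    have eq: "gal G (gi j) + frac_part (sal zs) - sal (j # zs) = frac_part (sal zs) - sal zs" by (simp add: sal_def aj_def)
    show "gal G (gi j) + frac_part (sal zs) - sal (j # zs) \<in> \<int>" unfolding eq by (rule frac_part_diff(2))
  qed
  ultimately show ?case by simp
qed

lemma modes_V_eq:
  assumes "\<And>j. j \<in> set ys \<Longrightarrow> f j = (- of_int (e j) - 1, 0)"
  shows "set ys \<subseteq> {..<k} - {m} \<Longrightarrow> modes_V V G (map \<phi> ys) (map f ys) v = VV ys e (\<lambda>_. 0) v"
  using assms
proof (induction ys)
  case (Cons j ys)
  have fj: "f j = (of_int (- e j - 1), 0)" using Cons.prems(2)[of j] by simp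
  have "phi_V V G (gi j) (of_int (- e j - 1)) 0 u = Y_op V (gvec G (gi j)) (- e j - 1) u" for u
    unfolding phi_V_def by (simp del: of_int_diff of_int_minus)
  then show ?case using Cons phi_gi[of j] by (simp add: fj del: of_int_diff of_int_minus)
qed simp

lemma modes_V_nz:
  "set ys \<subseteq> {..<k} - {m} \<Longrightarrow> modes_V V G (map \<phi> ys) (map f ys) v \<noteq> 0 \<Longrightarrow>
    j \<in> set ys \<Longrightarrow> fst (f j) \<in> \<int> \<and> snd (f j) = 0"
proof (induction ys)
  case (Cons i ys)
  obtain n c where fi: "f i = (n, c)" by fastforce
  have "phi_V V G (gi i) n c (modes_V V G (map \<phi> ys) (map f ys) v) \<noteq> 0"
    using Cons.prems phi_gi[of i] by (simp add: fi)
  then have "n \<in> \<int> \<and> c = 0" "modes_V V G (map \<phi> ys) (map f ys) v \<noteq> 0"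
    by (auto simp: phi_V_def clinear_0[OF Y_lin2] split: if_splits)
  then show ?case using Cons fi by auto
qed simp

lemma modes_W_eq:
  "set us \<subseteq> {..<k} - {m} \<Longrightarrow> modes_W V G W (map \<phi> (us @ m # zs)) (map f (us @ m # zs)) v
    = foldr (\<lambda>j. phi_W W (gi j) (fst (f j)) (snd (f j))) us
      (psi_W W a (fst (f m)) (snd (f m)) (modes_V V G (map \<phi> zs) (map f zs) v))"
proof (induction us)
  case Nil
  then show ?case by (cases "f m") (simp add: m)
next
  case (Cons j us)
  then show ?case using phi_gi[of j] by (cases "f j") simp
qed

lemma fold_phi_LL:
  assumes "\<And>j. j \<in> set us \<Longrightarrow> f j = (aj j - of_int (e j) - 1, r j)"
  shows "set us \<subseteq> {..<k} - {m} \<Longrightarrow> distinct us \<Longrightarrow> foldr (\<lambda>j. phi_W W (gi j) (fst (f j)) (snd (f j))) us x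
    = (\<Prod>j\<in>set us. (- 1) ^ r j / fact (r j)) *\<^sub>C LL us e r x"
  using assms
proof (induction us)
  case (Cons j us)
  have j: "gi j \<in> I_set G" using Cons.prems(1) gi by auto
  then show ?case using Cons
    by (simp add: phi_W_phiN[OF j] clinear_scale[OF phiN_lin[OF j]] scaleC_scaleC mult.commute)
qed (simp add: scaleC_one)

lemma fold_phi_nz:
  "set us \<subseteq> {..<k} - {m} \<Longrightarrow> foldr (\<lambda>j. phi_W W (gi j) (fst (f j)) (snd (f j))) us x \<noteq> 0 \<Longrightarrow>
    x \<noteq> 0 \<and> (\<forall>j\<in>set us. fst (f j) - aj j \<in> \<int> \<and> snd (f j) < RB)"
proof (induction us)
  case (Cons j us)
  have j: "gi j \<in> I_set G" "j < k" using Cons.prems(1) gi by auto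
  let ?y = "foldr (\<lambda>j. phi_W W (gi j) (fst (f j)) (snd (f j))) us x"
  have nz: "phi_W W (gi j) (fst (f j)) (snd (f j)) ?y \<noteq> 0" using Cons.prems(2) by simp
  then have y: "?y \<noteq> 0" using clinear_0[OF phi_lin[OF j(1)]] by auto
  have "fst (f j) - aj j \<in> \<int>" using phi_ll[OF j(1), of ?y] nz unfolding log_laurent_def aj_def by blast
  moreover have "snd (f j) < RB"
  proof (rule ccontr)
    assume "\<not> snd (f j) < RB"
    then have "(N ^^ snd (f j)) (gvec G (gi j)) = 0" "0 < snd (f j)" using RB(2)[OF j(2)] RB(3) by auto
    then show False using nz by (simp add: phi_W_phiN[OF j(1)] phiN_zero[OF j(1)])
  qed
  ultimately show ?case using Cons.IH Cons.prems(1) y by auto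
qed simp

text \<open>The logarithm that the expansion puts on the letter \<open>j\<close>: that of its own
  variable if it acts on W. On V its field has none, but the logarithm of the twist field reaches it
  through \<open>N\<close>.\<close>

definition bs :: "nat list \<Rightarrow> int \<Rightarrow> (nat \<Rightarrow> complex) \<Rightarrow> nat \<Rightarrow> complex"
  where "bs w p z j = (if left w j then l_branch p (z j) else l_branch p (z m))"

text \<open>Nonzero modes are parametrized by integral exponents, a power of the logarithm for each
  letter before the twist field and one for the twist field itself. The latter spreads over the
  letters behind by the Leibniz rule, which turns the sum over powers into \<open>egf\<close> at
  minus the logarithms.\<close>

lemma series:
  assumes w: "word w" and z: "\<And>i. i < k \<Longrightarrow> z i \<noteq> 0" and al: "al \<in> P_V g" "v \<in> V_g g al" and K: "RB \<le> K"
    and S: "\<And>r. ((\<lambda>e. C w e r * zpow {..<k} z e) has_sum S r) UNIV"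
  shows "((\<lambda>ms. w' (modes_W V G W (map \<phi> w) ms v) * (\<Prod>x<k. mono_branch p (z (w ! x)) (fst (ms ! x)) (snd (ms ! x))))
    has_sum (exp (- al * l_branch p (z m)) * (\<Prod>j\<in>{..<k} - {m}. exp (- aj j * bs w p z j)) *
      egf {..<k} K S (\<lambda>j. - bs w p z j))) {ms. length ms = k}"
proof -
  have "m \<in> set w" using w m by (simp add: word_def)
  then obtain us zs where ws: "w = us @ m # zs" "m \<notin> set us" by (meson split_list_first)
  have d: "distinct us" "distinct zs" "m \<notin> set zs" "set us \<inter> set zs = {}" "distinct w" "set w = {..<k}"
    using w ws by (auto simp: word_def)
  have kk: "{..<k} = set us \<union> insert m (set zs)" using d(6) ws by auto
  have us: "set us \<subseteq> {..<k} - {m}" and zs: "set zs \<subseteq> {..<k} - {m}" using kk ws d by auto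
  have lw: "length w = k" using d(5,6) by (metis card_lessThan distinct_card)
  have left: "left w j \<longleftrightarrow> j \<in> set us" for j using ws by (simp add: left_def takeWhile_append)
  define J where "J = insert m (set zs)"
  have J: "finite J" "set us \<inter> J = {}" "{..<k} = set us \<union> J" using kk d ws by (auto simp: J_def)
  \<comment> \<open>The fractional shift between a mode and its integral exponent; letters on V have
    none.\<close>
  define off where "off j = (if j \<in> set us then aj j else if j = m then sal zs else 0)" for j
  define md where "md e r q j = (off j - of_int (e j) - 1, if j \<in> set us then r j else if j = m then q else 0)"
    for e :: "nat \<Rightarrow> int" and r :: "nat \<Rightarrow> nat" and q j
  \<comment> \<open>Bounds the power of the logarithm of \<open>z m\<close>: it is distributed over
    at most \<open>k\<close> entries, each below \<open>K\<close>.\<close>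
  define Q where "Q = Suc (k * K)"
  have Qs: "sum s J < Q" if "s \<in> J \<rightarrow>\<^sub>E {..<K}" for s
  proof -
    have "sum s J \<le> card J * K" by (rule sum_bounded_above[of J s K, simplified]) (use that in \<open>auto simp: PiE_def Pi_def less_imp_le\<close>)
    also have "card J \<le> card {..<k}" unfolding J(3) by (rule card_mono) (use J in auto)
    finally show ?thesis by (simp add: Q_def)
  qed
  define Z where "Z = {e :: nat \<Rightarrow> int. \<forall>j\<ge>k. e j = 0}"
  define R where "R = (set us \<rightarrow>\<^sub>E {..<K}) \<times> {..<Q}"
  have finR: "finite R" unfolding R_def by (intro finite_cartesian_product finite_PiE) auto
  let ?l = "\<lambda>j. l_branch p (z j)"
  define E0 where "E0 = (\<Prod>j<k. exp (- off j * ?l j))"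
  define mrg where "mrg r s j = (if j \<in> set us then r j else s j)" for r s :: "nat \<Rightarrow> nat" and j
  define cf where "cf r q s = (if sum s J = q then (\<Prod>j\<in>set us. (- ?l j) ^ r j / fact (r j)) * (- ?l m) ^ q *
      (\<Prod>j\<in>J. 1 / fact (s j)) else 0)" for r q and s :: "nat \<Rightarrow> nat"
  define gt where "gt ms = w' (modes_W V G W (map \<phi> w) ms v) * (\<Prod>x<k. mono_branch p (z (w ! x)) (fst (ms ! x)) (snd (ms ! x)))" for ms
  have mono: "(\<Prod>x<k. mono_branch p (z (w ! x)) (fst (map (md e r q) w ! x)) (snd (map (md e r q) w ! x)))
    = zpow {..<k} z e * E0 * (\<Prod>j\<in>set us. ?l j ^ r j) * ?l m ^ q" for e r q
  proof -
    have "(\<Prod>x<k. mono_branch p (z (w ! x)) (fst (map (md e r q) w ! x)) (snd (map (md e r q) w ! x)))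
      = (\<Prod>x<k. (\<lambda>j. mono_branch p (z j) (fst (md e r q j)) (snd (md e r q j))) (w ! x))"
      by (intro prod.cong refl) (simp add: lw)
    also have "\<dots> = (\<Prod>j<k. mono_branch p (z j) (fst (md e r q j)) (snd (md e r q j)))"
      by (rule prod.reindex_bij_betw) (use bij_betw_nth[OF d(5) refl refl] lw d(6) in simp)
    also have "\<dots> = (\<Prod>j<k. z j powi e j * exp (- off j * ?l j) * ?l j ^ (if j \<in> set us then r j else if j = m then q else 0))"
      by (intro prod.cong refl) (simp only: md_def fst_conv snd_conv mono_branch_powi[OF z] lessThan_iff)
    also have "\<dots> = zpow {..<k} z e * E0 * (\<Prod>j<k. ?l j ^ (if j \<in> set us then r j else if j = m then q else 0))"
      by (simp only: prod.distrib zpow_def E0_def)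
    also have "(\<Prod>j<k. ?l j ^ (if j \<in> set us then r j else if j = m then q else 0))
      = (\<Prod>j\<in>set us. ?l j ^ (if j \<in> set us then r j else if j = m then q else 0)) *
        (\<Prod>j\<in>J. ?l j ^ (if j \<in> set us then r j else if j = m then q else 0))"
      unfolding J(3) by (rule prod.union_disjoint) (use J in auto)
    also have "(\<Prod>j\<in>set us. ?l j ^ (if j \<in> set us then r j else if j = m then q else 0)) = (\<Prod>j\<in>set us. ?l j ^ r j)"
      by (rule prod.cong) auto
    also have "(\<Prod>j\<in>J. ?l j ^ (if j \<in> set us then r j else if j = m then q else 0)) = (\<Prod>j\<in>J. if j = m then ?l j ^ q else 1)"
      by (rule prod.cong) (use J(2) in auto)
    also have "\<dots> = ?l m ^ q" using J(1) by (simp add: J_def)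
    finally show ?thesis by (simp only: mult.assoc)
  qed
  have gt_eq: "gt (map (md e r q) w) = (\<Sum>s\<in>J \<rightarrow>\<^sub>E {..<K}. E0 * cf r q s * (C w e (mrg r s) * zpow {..<k} z e))"
    if e: "e \<in> Z" for e r q
  proof -
    have "modes_W V G W (map \<phi> w) (map (md e r q) w) v
      = foldr (\<lambda>j. phi_W W (gi j) (fst (md e r q j)) (snd (md e r q j))) us
        (psi_W W a (fst (md e r q m)) (snd (md e r q m)) (modes_V V G (map \<phi> zs) (map (md e r q) zs) v))"
      unfolding ws(1) by (rule modes_W_eq[OF us])
    also have "modes_V V G (map \<phi> zs) (map (md e r q) zs) v = VV zs e (\<lambda>_. 0) v"
      by (rule modes_V_eq[OF _ zs]) (use d in \<open>auto simp: md_def off_def\<close>)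
    also have "psi_W W a (fst (md e r q m)) (snd (md e r q m)) (VV zs e (\<lambda>_. 0) v)
      = (- 1) ^ q *\<^sub>C psi_W W a (sal zs - of_int (e m) - 1) 0 (Dn q (VV zs e (\<lambda>_. 0) v))"
      using ws(2) by (simp add: md_def off_def psi_W_log[OF m(3), of _ q] Dn_def clinear_scale[OF psi_lin[OF m(3)]] scaleC_scaleC)
    also have "foldr (\<lambda>j. phi_W W (gi j) (fst (md e r q j)) (snd (md e r q j))) us \<dots>
      = (\<Prod>j\<in>set us. (- 1) ^ r j / fact (r j)) *\<^sub>C LL us e r \<dots>"
      by (rule fold_phi_LL[OF _ us d(1)]) (simp add: md_def off_def)
    finally have "w' (modes_W V G W (map \<phi> w) (map (md e r q) w) v) = (\<Prod>j\<in>set us. (- 1) ^ r j / fact (r j)) * (- 1) ^ q *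
        w' (LL us e r (psi_W W a (sal zs - of_int (e m) - 1) 0 (Dn q (VV zs e (\<lambda>_. 0) v))))"
      by (simp add: clinear_scale[OF w'_lin] clinear_scale[OF LL_lin[OF us]] scaleC_complex_def)
    also have "w' (LL us e r (psi_W W a (sal zs - of_int (e m) - 1) 0 (Dn q (VV zs e (\<lambda>_. 0) v))))
      = (\<Sum>s\<in>J \<rightarrow>\<^sub>E {..<K}. if sum s J = q then (\<Prod>j\<in>J. 1 / fact (s j)) * C w e (mrg r s) else 0)"
    proof -
      have c: "w' (LL us e r (psi_W W a (sal zs - of_int (e m) - 1) 0 (VV zs e s ((N ^^ s m) v)))) = C w e (mrg r s)" for s
      proof -
        have "LL us e (mrg r s) x = LL us e r x" for x by (rule LL_cong) (auto simp: mrg_def)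
        moreover have "VV zs e (mrg r s) x = VV zs e s x" for x by (rule VV_cong) (use d in \<open>auto simp: mrg_def\<close>)
        moreover have "mrg r s m = s m" using ws by (simp add: mrg_def)
        ultimately show ?thesis using e by (simp add: C_def Z_def ws(1) WW_append[OF ws(2)])
      qed
      show ?thesis
        unfolding Dn_VV[OF K zs d(2), folded J_def] clinear_sum[OF psi_lin[OF m(3)]] clinear_sum[OF LL_lin[OF us]] clinear_sum[OF w'_lin]
        by (intro sum.cong refl) (simp add: clinear_scale[OF psi_lin[OF m(3)]] clinear_scale[OF LL_lin[OF us]] clinear_scale[OF w'_lin]
          clinear_0[OF psi_lin[OF m(3)]] clinear_0[OF LL_lin[OF us]] clinear_0[OF w'_lin] scaleC_complex_def c)
    qed
    finally have W: "w' (modes_W V G W (map \<phi> w) (map (md e r q) w) v) = (\<Prod>j\<in>set us. (- 1) ^ r j / fact (r j)) * (- 1) ^ q *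
      (\<Sum>s\<in>J \<rightarrow>\<^sub>E {..<K}. if sum s J = q then (\<Prod>j\<in>J. 1 / fact (s j)) * C w e (mrg r s) else 0)" .
    have neg: "(- x) ^ i = (- 1) ^ i * x ^ i" for x :: complex and i by (rule power_minus)
    have pr: "(\<Prod>j\<in>set us. (- ?l j) ^ r j / fact (r j)) = (\<Prod>j\<in>set us. (- 1) ^ r j / fact (r j)) * (\<Prod>j\<in>set us. ?l j ^ r j)"
      unfolding prod.distrib[symmetric] by (intro prod.cong refl) (simp add: neg[of "?l _"])
    show ?thesis
      unfolding gt_def mono W sum_distrib_left sum_distrib_right cf_def pr neg[of "?l m"]
      apply (intro sum.cong refl)
      subgoal for s by (cases "sum s J = q") (simp_all only: simp_thms if_True if_False mult_zero_left mult_zero_right mult_ac)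
      done
  qed
  have SZ: "((\<lambda>e. C w e r * zpow {..<k} z e) has_sum S r) Z" for r
  proof -
    have "((\<lambda>e. C w e r * zpow {..<k} z e) has_sum S r) UNIV \<longleftrightarrow> ((\<lambda>e. C w e r * zpow {..<k} z e) has_sum S r) Z"
      by (rule has_sum_cong_neutral) (auto simp: C_def Z_def)
    then show ?thesis using S[of r] by simp
  qed
  define \<tau> where "\<tau> = (\<lambda>(r, q). \<Sum>s\<in>J \<rightarrow>\<^sub>E {..<K}. E0 * cf r q s * S (mrg r s))"
  have "((\<lambda>(x, e). gt (map (md e (fst x) (snd x)) w)) has_sum (\<Sum>x\<in>R. \<tau> x)) (R \<times> Z)"
  proof (rule has_sum_finite_times[OF finR])
    fix x assume "x \<in> R"
    have "((\<lambda>e. \<Sum>s\<in>J \<rightarrow>\<^sub>E {..<K}. E0 * cf (fst x) (snd x) s * (C w e (mrg (fst x) s) * zpow {..<k} z e)) has_sum \<tau> x) Z"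
      unfolding \<tau>_def case_prod_beta
      by (intro has_sum_finite_sum has_sum_cmult_right SZ finite_PiE) (use J in auto)
    then show "((\<lambda>e. gt (map (md e (fst x) (snd x)) w)) has_sum \<tau> x) Z"
      by (rule has_sum_cong[THEN iffD1, rotated]) (simp add: gt_eq)
  qed
  moreover define hh where "hh = (\<lambda>(x :: (nat \<Rightarrow> nat) \<times> nat, e). map (md e (fst x) (snd x)) w)"
  ultimately have RZ: "((gt \<circ> hh) has_sum (\<Sum>x\<in>R. \<tau> x)) (R \<times> Z)" by (simp add: o_def case_prod_unfold)
  have inj: "inj_on hh (R \<times> Z)"
  proof (rule inj_onI)
    fix x y assume x: "x \<in> R \<times> Z" and y: "y \<in> R \<times> Z" and eq: "hh x = hh y"
    obtain r q e r' q' e' where xy: "x = ((r, q), e)" "y = ((r', q'), e')" by (metis surj_pair)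
    have mdeq: "md e r q j = md e' r' q' j" if "j < k" for j
      using eq that d(6) by (simp add: hh_def xy)
    have "e j = e' j" for j
    proof (cases "j < k")
      case True
      then show ?thesis using mdeq[of j] by (simp add: md_def)
    next
      case False
      then show ?thesis using x y xy by (simp add: Z_def)
    qed
    moreover have "q = q'" using mdeq[OF m(1)] ws(2) by (simp add: md_def)
    moreover have "r j = r' j" for j
    proof (cases "j \<in> set us")
      case True
      then show ?thesis using mdeq[of j] us by (auto simp: md_def)
    next
      case False
      then show ?thesis using x y xy by (auto simp: R_def PiE_def extensional_def)
    qed
    ultimately show "x = y" unfolding xy by (simp add: fun_eq_iff)
  qed
  have "(gt has_sum (\<Sum>x\<in>R. \<tau> x)) (hh ` (R \<times> Z))" using RZ has_sum_reindex[OF inj, of gt] by simp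
  also have "?this \<longleftrightarrow> (gt has_sum (\<Sum>x\<in>R. \<tau> x)) {ms. length ms = k}"
  \<comment> \<open>Tuples of modes outside the parametrized family contribute zero, since
    nonvanishing forces integrality of the shifted exponents and the bounds on the powers of the
    logarithms.\<close>
  proof (rule has_sum_cong_neutral)
    fix ms assume ms: "ms \<in> {ms. length ms = k} - hh ` (R \<times> Z)"
    show "gt ms = 0"
    proof (rule ccontr)
      assume nz: "gt ms \<noteq> 0"
      obtain f where f: "map f w = ms" using ex_map_eq[OF d(5), of ms] ms lw by auto
      define e where "e j = (if j < k then \<lfloor>Re (off j - fst (f j) - 1)\<rfloor> else 0)" for j
      define r where "r = restrict (\<lambda>j. snd (f j)) (set us)"
      have "modes_W V G W (map \<phi> w) (map f w) v \<noteq> 0" using nz clinear_0[OF w'_lin] unfolding gt_def f by auto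
      then have "foldr (\<lambda>j. phi_W W (gi j) (fst (f j)) (snd (f j))) us
         (psi_W W a (fst (f m)) (snd (f m)) (modes_V V G (map \<phi> zs) (map f zs) v)) \<noteq> 0"
        unfolding ws(1) modes_W_eq[OF us] .
      from fold_phi_nz[OF us this] have A: "psi_W W a (fst (f m)) (snd (f m)) (modes_V V G (map \<phi> zs) (map f zs) v) \<noteq> 0"
        "\<And>j. j \<in> set us \<Longrightarrow> fst (f j) - aj j \<in> \<int> \<and> snd (f j) < RB" by auto
      have AK: "snd (f j) < K" if "j \<in> set us" for j using A(2)[OF that] K by simp
      from A have mvnz: "modes_V V G (map \<phi> zs) (map f zs) v \<noteq> 0" using clinear_0[OF psi_lin[OF m(3)]] by auto
      have B: "fst (f j) \<in> \<int> \<and> snd (f j) = 0" if "j \<in> set zs" for j by (rule modes_V_nz[OF zs mvnz that])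
      have int: "fst (f j) = off j - of_int (e j) - 1" if oi: "off j - fst (f j) \<in> \<int>" and jk: "j < k" for j
      proof -
        obtain i where i: "off j - fst (f j) = of_int i" using oi by (rule Ints_cases)
        have re: "Re (off j - fst (f j) - 1) = of_int (i - 1)" unfolding i by simp
        have "e j = i - 1" unfolding e_def re floor_of_int using jk by simp
        then have "of_int i = (of_int (e j) + 1 :: complex)" by simp
        then show ?thesis using i by (simp add: algebra_simps)
      qed
      have oz: "off j = 0" if "j \<in> set zs" for j using that d by (auto simp: off_def)
      have zint: "f j = (- of_int (e j) - 1, 0)" if "j \<in> set zs" for j
        using int[of j] B[OF that] oz[OF that] that zs by (cases "f j") auto
      have mV: "modes_V V G (map \<phi> zs) (map f zs) v = VV zs e (\<lambda>_. 0) v" by (rule modes_V_eq[OF zint zs])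
      have Vg: "VV zs e (\<lambda>_. 0) v \<in> V_g g (frac_part (sal zs))" by (rule VV_V_g[OF al zs])
      then have PV: "frac_part (sal zs) \<in> P_V g" using mvnz unfolding mV V_g_def by (auto split: if_splits)
      have "fst (f m) - frac_part (sal zs) \<in> \<int>"
        using psi_ll[OF m(3) PV Vg] A(1) unfolding mV log_laurent_def by blast
      from Ints_diff[OF frac_part_diff(1) this, of "sal zs"] have mint: "off m - fst (f m) \<in> \<int>"
        using ws(2) by (simp add: off_def)
      have qQ: "snd (f m) < Q"
      proof (rule ccontr)
        assume "\<not> snd (f m) < Q"
        then have "Dn (snd (f m)) (VV zs e (\<lambda>_. 0) v) = 0"
          unfolding Dn_VV[OF K zs d(2), folded J_def] by (intro sum.neutral ballI) (use Qs in force)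
        then have "(N ^^ snd (f m)) (VV zs e (\<lambda>_. 0) v) = 0" by (simp add: Dn_def)
        then show False using A(1) unfolding mV psi_W_log[OF m(3), of _ "snd (f m)"] by (simp add: clinear_0[OF psi_lin[OF m(3)]])
      qed
      have "md e r (snd (f m)) j = f j" if j: "j < k" for j
      proof -
        have "off j - fst (f j) \<in> \<int>"
        proof -
          consider "j \<in> set us" | "j = m" | "j \<in> set zs" using j kk by auto
          then show ?thesis
          proof cases
            case 1
            then show ?thesis using A(2)[OF 1] Ints_minus[of "fst (f j) - aj j"] by (simp add: off_def)
          next
            case 2
            then show ?thesis using mint by simp
          next
            case 3
            then show ?thesis using B[OF 3] oz[OF 3] Ints_minus[of "fst (f j)"] by simp
          qed
        qed
        from int[OF this j] have "fst (md e r (snd (f m)) j) = fst (f j)" by (simp add: md_def)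
        moreover have "snd (md e r (snd (f m)) j) = snd (f j)"
          using j kk B by (auto simp: md_def r_def)
        ultimately show ?thesis by (simp add: prod_eq_iff)
      qed
      then have "map (md e r (snd (f m))) w = ms" unfolding f[symmetric] using d(6) by (intro map_cong) auto
      moreover have "((r, snd (f m)), e) \<in> R \<times> Z"
        using AK qQ by (auto simp: R_def Z_def r_def e_def)
      ultimately have "ms \<in> hh ` (R \<times> Z)" unfolding hh_def by (intro image_eqI[of _ _ "((r, snd (f m)), e)"]) auto
      then show False using ms by blast
    qed
  qed (auto simp: hh_def lw)
  finally have main: "(gt has_sum (\<Sum>x\<in>R. \<tau> x)) {ms. length ms = k}" .
  have "(\<Sum>x\<in>R. \<tau> x) = E0 * egf {..<k} K S (\<lambda>j. - bs w p z j)"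
  proof -
    let ?c = "\<lambda>r s. (\<Prod>j\<in>set us. (- ?l j) ^ r j / fact (r j)) * (\<Prod>j\<in>J. (- ?l m) ^ s j / fact (s j))"
    have "(\<Sum>x\<in>R. \<tau> x) = (\<Sum>r\<in>set us \<rightarrow>\<^sub>E {..<K}. \<Sum>q<Q. \<Sum>s\<in>J \<rightarrow>\<^sub>E {..<K}. E0 * cf r q s * S (mrg r s))"
      unfolding R_def \<tau>_def by (rule sum.cartesian_product[symmetric])
    also have "\<dots> = (\<Sum>r\<in>set us \<rightarrow>\<^sub>E {..<K}. \<Sum>s\<in>J \<rightarrow>\<^sub>E {..<K}. \<Sum>q<Q. E0 * cf r q s * S (mrg r s))"
      by (intro sum.cong refl) (rule sum.swap)
    also have "\<dots> = (\<Sum>r\<in>set us \<rightarrow>\<^sub>E {..<K}. \<Sum>s\<in>J \<rightarrow>\<^sub>E {..<K}. E0 * (?c r s * S (mrg r s)))"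
    proof (intro sum.cong refl)
      fix r s assume s: "s \<in> J \<rightarrow>\<^sub>E {..<K}"
      \<comment> \<open>The power of the logarithm of \<open>z m\<close> is determined by its
        distribution \<open>s\<close>, so one term of the sum over \<open>q\<close> remains.\<close>
      have "(\<Sum>q<Q. E0 * cf r q s * S (mrg r s)) = (\<Sum>q<Q. if q = sum s J then E0 * cf r q s * S (mrg r s) else 0)"
        by (intro sum.cong refl) (auto simp: cf_def)
      also have "\<dots> = E0 * cf r (sum s J) s * S (mrg r s)" using Qs[OF s] by simp
      also have "cf r (sum s J) s = ?c r s"
        by (simp add: cf_def power_sum prod.distrib[symmetric] mult.assoc)
      finally show "(\<Sum>q<Q. E0 * cf r q s * S (mrg r s)) = E0 * (?c r s * S (mrg r s))" by (simp only: mult.assoc)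
    qed
    also have "\<dots> = E0 * egf {..<k} K S (\<lambda>j. - bs w p z j)"
    proof -
      have p: "(\<Prod>j<k. (- bs w p z j) ^ mrg r s j / fact (mrg r s j)) = ?c r s" for r s
      proof -
        have "(\<Prod>j<k. (- bs w p z j) ^ mrg r s j / fact (mrg r s j))
          = (\<Prod>j\<in>set us. (- bs w p z j) ^ mrg r s j / fact (mrg r s j)) * (\<Prod>j\<in>J. (- bs w p z j) ^ mrg r s j / fact (mrg r s j))"
          unfolding J(3) by (rule prod.union_disjoint) (use J in auto)
        also have "(\<Prod>j\<in>set us. (- bs w p z j) ^ mrg r s j / fact (mrg r s j)) = (\<Prod>j\<in>set us. (- ?l j) ^ r j / fact (r j))"
          by (intro prod.cong refl) (simp add: bs_def left mrg_def)
        also have "(\<Prod>j\<in>J. (- bs w p z j) ^ mrg r s j / fact (mrg r s j)) = (\<Prod>j\<in>J. (- ?l m) ^ s j / fact (s j))"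
        proof (intro prod.cong refl)
          fix j assume "j \<in> J"
          then have "j \<notin> set us" using J(2) by auto
          then show "(- bs w p z j) ^ mrg r s j / fact (mrg r s j) = (- ?l m) ^ s j / fact (s j)" by (simp add: bs_def left mrg_def)
        qed
        finally show ?thesis .
      qed
      have me: "(\<lambda>j. if j \<in> set us then r j else s j) = mrg r s" for r s by (simp add: mrg_def fun_eq_iff)
      have "egf {..<k} K S (\<lambda>j. - bs w p z j) = (\<Sum>r\<in>set us \<rightarrow>\<^sub>E {..<K}. \<Sum>s\<in>J \<rightarrow>\<^sub>E {..<K}. ?c r s * S (mrg r s))"
        unfolding egf_def J(3) sum_PiE_Un[OF J(2)] unfolding J(3)[symmetric] p[unfolded mrg_def] me ..
      then show ?thesis by (simp add: sum_distrib_left)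
    qed
    finally show ?thesis .
  qed
  moreover have "E0 = exp (- al * ?l m) * (\<Prod>j\<in>{..<k} - {m}. exp (- aj j * bs w p z j))"
  proof -
    have km: "{..<k} - {m} = set us \<union> set zs" using kk ws(2) d(3) by auto
    have "E0 = exp (- off m * ?l m) * (\<Prod>j\<in>{..<k} - {m}. exp (- off j * ?l j))"
      unfolding E0_def using m(1) by (intro prod.remove) auto
    also have "off m = al + sum aj (set zs)"
      using ws(2) d(2) by (simp add: off_def sal_def sum_list_distinct_conv_sum_set)
    also have "exp (- (al + sum aj (set zs)) * ?l m) = exp (- al * ?l m) * (\<Prod>j\<in>set zs. exp (- aj j * ?l m))"
    proof -
      have "- (al + sum aj (set zs)) * ?l m = - al * ?l m + (\<Sum>j\<in>set zs. - aj j * ?l m)"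
        by (simp add: algebra_simps sum_distrib_left sum_distrib_right sum_negf)
      then show ?thesis by (simp only: exp_add exp_sum[OF finite_set])
    qed
    also note km
    also have "(\<Prod>j\<in>set us \<union> set zs. exp (- off j * ?l j)) = (\<Prod>j\<in>set us. exp (- aj j * bs w p z j))"
    proof -
      have "(\<Prod>j\<in>set us \<union> set zs. exp (- off j * ?l j)) = (\<Prod>j\<in>set us. exp (- off j * ?l j)) * (\<Prod>j\<in>set zs. exp (- off j * ?l j))"
        by (rule prod.union_disjoint) (use d in auto)
      also have "(\<Prod>j\<in>set zs. exp (- off j * ?l j)) = 1" by (rule prod.neutral) (use d in \<open>auto simp: off_def\<close>)
      also have "(\<Prod>j\<in>set us. exp (- off j * ?l j)) = (\<Prod>j\<in>set us. exp (- aj j * bs w p z j))"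
        by (rule prod.cong) (auto simp: off_def bs_def left)
      finally show ?thesis by simp
    qed
    also have "(\<Prod>j\<in>set zs. exp (- aj j * ?l m)) = (\<Prod>j\<in>set zs. exp (- aj j * bs w p z j))"
      by (rule prod.cong) (use d in \<open>auto simp: bs_def left\<close>)
    finally show ?thesis
      using prod.union_disjoint[of "set us" "set zs" "\<lambda>j. exp (- aj j * bs w p z j)"] d(4)
      unfolding km by (simp add: mult_ac)
  qed
  ultimately show ?thesis using main unfolding gt_def by simp
qed

end

section \<open>Correlation functions\<close>

text \<open>Both sides have the same exponential, so they differ by \<open>2 pi i q\<close>. The
  imaginary part of \<open>Ln (1 - y / z)\<close> is below \<open>pi / 2\<close> in modulus, and so
  is the difference of arguments on the region; hence \<open>q = 0\<close>.\<close>

lemma l_branch_add_left: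
  assumes "z \<noteq> 0" "norm y < norm z" "\<bar>Arg2pi (z - y) - Arg2pi z\<bar> < pi / 2"
  shows "l_branch p z + Ln (1 - y / z) = l_branch p (z - y)"
proof (rule complex_eqI)
  have n: "norm (y / z) < 1" using assms by (simp add: norm_divide divide_less_eq)
  have zy: "z - y \<noteq> 0" using assms(2) by auto
  have nz: "1 - y / z \<noteq> 0" using n by auto
  have "exp (l_branch p z + Ln (1 - y / z)) = z * (1 - y / z)"
    by (simp only: exp_add exp_l_branch[OF assms(1)] exp_Ln[OF nz])
  also have "\<dots> = exp (l_branch p (z - y))" using assms(1) zy by (simp add: exp_l_branch right_diff_distrib)
  finally obtain q :: int where q: "l_branch p z + Ln (1 - y / z) = l_branch p (z - y) + (of_int (2 * q) * pi) * \<i>"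
    unfolding exp_eq by blast
  have "Re (y / z) < 1" using n complex_Re_le_cmod[of "y / z"] by linarith
  then have "\<bar>Im (Ln (1 - y / z))\<bar> < pi / 2" by (intro Re_Ln_pos_lt_imp) simp
  moreover have "Arg2pi z + Im (Ln (1 - y / z)) = Arg2pi (z - y) + 2 * pi * of_int q"
    using arg_cong[OF q, of Im] by (simp add: Im_l_branch)
  ultimately have "\<bar>2 * pi * of_int q\<bar> < pi" using assms(3) by linarith
  then have "2 * \<bar>of_int q :: real\<bar> < 1" by (simp add: abs_mult)
  then have "q = 0" by linarith
  then show "Re (l_branch p z + Ln (1 - y / z)) = Re (l_branch p (z - y))"
    "Im (l_branch p z + Ln (1 - y / z)) = Im (l_branch p (z - y))" using q by simp_all
qed

text \<open>The factor \<open>-1\<close> in \<open>y - z = - z (1 - y / z)\<close> contributes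
  \<open>pi i\<close>, and the condition on the arguments is centred at \<open>pi\<close>
  accordingly; the integer multiple of \<open>2 pi i\<close> is excluded as before.\<close>

lemma l_branch_add_right:
  assumes "z \<noteq> 0" "norm y < norm z" "pi / 2 < Arg2pi (y - z) - Arg2pi z" "Arg2pi (y - z) - Arg2pi z < 3 * pi / 2"
  shows "l_branch p z + (pi * \<i> + Ln (1 - y / z)) = l_branch p (y - z)"
proof (rule complex_eqI)
  have n: "norm (y / z) < 1" using assms by (simp add: norm_divide divide_less_eq)
  have zy: "y - z \<noteq> 0" using assms(2) by auto
  have nz: "1 - y / z \<noteq> 0" using n by auto
  have "exp (l_branch p z + (pi * \<i> + Ln (1 - y / z))) = z * (exp (pi * \<i>) * (1 - y / z))"
    by (simp only: exp_add exp_l_branch[OF assms(1)] exp_Ln[OF nz])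
  also have "\<dots> = exp (l_branch p (y - z))" using assms(1) zy by (simp add: exp_l_branch right_diff_distrib)
  finally obtain q :: int where q: "l_branch p z + (pi * \<i> + Ln (1 - y / z)) = l_branch p (y - z) + (of_int (2 * q) * pi) * \<i>"
    unfolding exp_eq by blast
  have "Re (y / z) < 1" using n complex_Re_le_cmod[of "y / z"] by linarith
  then have "\<bar>Im (Ln (1 - y / z))\<bar> < pi / 2" by (intro Re_Ln_pos_lt_imp) simp
  moreover have "Arg2pi z + (pi + Im (Ln (1 - y / z))) = Arg2pi (y - z) + 2 * pi * of_int q"
    using arg_cong[OF q, of Im] by (simp add: Im_l_branch)
  ultimately have "\<bar>2 * pi * of_int q\<bar> < pi" using assms(3,4) by linarith
  then have "2 * \<bar>of_int q :: real\<bar> < 1" by (simp add: abs_mult)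
  then have "q = 0" by linarith
  then show "Re (l_branch p z + (pi * \<i> + Ln (1 - y / z))) = Re (l_branch p (y - z))"
    "Im (l_branch p z + (pi * \<i> + Ln (1 - y / z))) = Im (l_branch p (y - z))" using q by simp_all
qed

text \<open>A change of summation variable; \<open>restrict\<close> keeps the permuted multi-index
  extensional, as the range of \<open>egf\<close> demands.\<close>

lemma egf_permute:
  assumes s: "\<sigma> permutes {..<k}"
  shows "egf {..<k} K S \<mu> = egf {..<k} K (\<lambda>r. S (restrict (\<lambda>j. r (inv \<sigma> j)) {..<k})) (\<lambda>x. \<mu> (\<sigma> x))"
  unfolding egf_def
proof (rule sum.reindex_bij_witness[where i = "\<lambda>r. restrict (\<lambda>j. r (inv \<sigma> j)) {..<k}" and j = "\<lambda>r. restrict (\<lambda>x. r (\<sigma> x)) {..<k}"])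
  have i: "inv \<sigma> x < k \<longleftrightarrow> x < k" "\<sigma> x < k \<longleftrightarrow> x < k" for x
    using permutes_in_image[OF permutes_inv[OF s], of x] permutes_in_image[OF s, of x] by auto
  note si = permutes_inverses[OF s]
  fix r assume r: "r \<in> {..<k} \<rightarrow>\<^sub>E {..<K}"
  show "restrict (\<lambda>j. restrict (\<lambda>x. r (\<sigma> x)) {..<k} (inv \<sigma> j)) {..<k} = r"
    "restrict (\<lambda>x. restrict (\<lambda>j. r (inv \<sigma> j)) {..<k} (\<sigma> x)) {..<k} = r"
    using r by (auto simp: fun_eq_iff i si PiE_def extensional_def)
  then have rr: "restrict (\<lambda>j. restrict (\<lambda>x. r (\<sigma> x)) {..<k} (inv \<sigma> j)) {..<k} = r" by simp
  show "restrict (\<lambda>x. r (\<sigma> x)) {..<k} \<in> {..<k} \<rightarrow>\<^sub>E {..<K}" "restrict (\<lambda>j. r (inv \<sigma> j)) {..<k} \<in> {..<k} \<rightarrow>\<^sub>E {..<K}"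
    using r i by (auto simp: PiE_def Pi_def)
  have "(\<Prod>x<k. \<mu> (\<sigma> x) ^ restrict (\<lambda>x. r (\<sigma> x)) {..<k} x / fact (restrict (\<lambda>x. r (\<sigma> x)) {..<k} x))
    = (\<Prod>x<k. (\<lambda>j. \<mu> j ^ r j / fact (r j)) (\<sigma> x))"
    by (rule prod.cong) auto
  also have "\<dots> = (\<Prod>j<k. \<mu> j ^ r j / fact (r j))"
    using prod.permute[OF s, of "\<lambda>j. \<mu> j ^ r j / fact (r j)"] by (simp add: o_def)
  finally show "(\<Prod>x<k. \<mu> (\<sigma> x) ^ restrict (\<lambda>x. r (\<sigma> x)) {..<k} x / fact (restrict (\<lambda>x. r (\<sigma> x)) {..<k} x)) *
      S (restrict (\<lambda>j. restrict (\<lambda>x. r (\<sigma> x)) {..<k} (inv \<sigma> j)) {..<k})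
    = (\<Prod>j<k. \<mu> j ^ r j / fact (r j)) * S r"
    unfolding rr by simp
qed

lemma inverse_prod_list: "inverse (\<Prod>a\<leftarrow>as. f a) = (\<Prod>a\<leftarrow>as. inverse (f a :: complex))"
  by (induction as) auto

context correlator
begin

definition LB :: "int \<Rightarrow> (nat \<Rightarrow> complex) \<Rightarrow> nat \<Rightarrow> complex"
  where "LB p z j = (if j = m then l_branch p (z m) else l_branch p (z j - z m))"

text \<open>\<open>\<Phi>\<close> is a function of the labelled variables. In the order
  \<open>\<sigma>\<close> position \<open>x\<close> carries the field \<open>\<sigma> x\<close>, so
  the positional variables are fed to it through \<open>inv \<sigma>\<close>; apart from this
  relabelling the order leaves only a sign.\<close>

lemma is_correlation_perm:
  assumes al: "al \<in> P_V g" "v \<in> V_g g al"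
  shows "\<exists>\<Phi>. \<forall>\<sigma>. \<sigma> permutes {..<k} \<longrightarrow> is_correlation V G W p w' (map (\<lambda>j. \<phi> (\<sigma> j)) [0..<k]) al v
    (\<lambda>z. ksgn par (map \<sigma> [0..<k]) * \<Phi> (\<lambda>j. z (inv \<sigma> j)))"
proof -
  obtain K P M where K: "RB \<le> K" and fin: "finite {e. \<exists>r. P e r \<noteq> 0}" and num: "\<forall>w z. word w \<longrightarrow> decr w z \<longrightarrow>
    (\<exists>S0. (\<forall>r. ((\<lambda>e. C w e r * zpow {..<k} z e) has_sum S0 r) UNIV) \<and>
      (\<forall>\<mu>. egf {..<k} K S0 \<mu> = ksgn par w * (\<Prod>j\<in>{..<k} - {m}. exp (- aj j * Lam w z j)) *
        egf {..<k} K (RR M P z) (\<lambda>j. if j = m then \<mu> m else \<mu> j - Lam w z j)))"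
    using numeric by blast
  define \<Phi> where "\<Phi> z = exp (- al * l_branch p (z m)) * (\<Prod>j\<in>{..<k} - {m}. exp (- aj j * LB p z j)) *
    egf {..<k} K (RR M P z) (\<lambda>j. - LB p z j)" for z
  have "is_correlation V G W p w' (map (\<lambda>j. \<phi> (\<sigma> j)) [0..<k]) al v
    (\<lambda>z. ksgn par (map \<sigma> [0..<k]) * \<Phi> (\<lambda>j. z (inv \<sigma> j)))" if s: "\<sigma> permutes {..<k}" for \<sigma>
  proof -
    let ?\<tau> = "inv \<sigma>" and ?w = "map \<sigma> [0..<k]" and ?fs = "map (\<lambda>j. \<phi> (\<sigma> j)) [0..<k]"
    have i: "?\<tau> x < k \<longleftrightarrow> x < k" "\<sigma> x < k \<longleftrightarrow> x < k" for x
      using permutes_in_image[OF permutes_inv[OF s], of x] permutes_in_image[OF s, of x] by auto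
    note si = permutes_inverses[OF s]
    define mp where "mp = ?\<tau> m"
    have mp: "mp < k" "\<sigma> mp = m" using m(1) i si by (auto simp: mp_def)
    have neq: "\<sigma> x = m \<longleftrightarrow> x = mp" for x
    proof
      assume "\<sigma> x = m"
      then have "?\<tau> (\<sigma> x) = mp" by (simp add: mp_def)
      then show "x = mp" by (simp add: si)
    qed (simp add: mp)
    have w: "word ?w"
      unfolding word_def distinct_map set_map set_upt atLeast0LessThan
      by (intro conjI distinct_upt permutes_inj_on[OF s] permutes_image[OF s])
    have fs: "?fs = map \<phi> ?w" by simp
    have tp: "twist_pos ?fs = mp"
      unfolding twist_pos_def
    proof (rule the_equality)
      show "mp < length ?fs \<and> is_twist (?fs ! mp)" using mp m by (auto simp: is_twist_def)
      fix x assume x: "x < length ?fs \<and> is_twist (?fs ! x)"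
      then have xk: "x < k" by simp
      then have tw: "is_twist (\<phi> (\<sigma> x))" using x by simp
      have "\<sigma> x < k" using xk by (simp only: i)
      have "\<sigma> x = m"
      proof (rule ccontr)
        assume "\<sigma> x \<noteq> m"
        with gens[OF \<open>\<sigma> x < k\<close>] obtain i' where "\<phi> (\<sigma> x) = Gen i'" by blast
        then show False using tw by (simp add: is_twist_def)
      qed
      then show "x = mp" by (simp only: neq)
    qed
    have form: "log_form k mp (\<lambda>j. label_al G (?fs ! j)) p al (\<lambda>z. ksgn par ?w * \<Phi> (\<lambda>j. z (?\<tau> j)))"
      unfolding log_form_def
    proof (intro exI conjI allI ballI)
      define f where "f r z = ksgn par ?w * (\<Prod>x<k. (- 1) ^ r x / fact (r x)) *
        RR M P (\<lambda>j. z (?\<tau> j)) (restrict (\<lambda>j. r (?\<tau> j)) {..<k})" for r :: "nat \<Rightarrow> nat" and z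
      show "rat_fun k (f r)" for r
      proof -
        have "rat_fun k (\<lambda>z. RR M P (\<lambda>j. z (?\<tau> j)) r')" for r'
          unfolding RR_def zpow_def divide_inverse inverse_prod_list
        proof (intro rat_fun_mult rat_fun_sum rat_fun_const rat_fun_prod rat_fun_prod_list fin finite_lessThan)
          show "rat_fun k (\<lambda>z. z (?\<tau> j) powi e j)" if "j \<in> {..<k}" for j and e :: "nat \<Rightarrow> int"
            using that i by (intro rat_fun_powi) auto
          fix a assume "a \<in> set prs"
          then obtain x y where a: "a = (x, y)" "x < k" "y < k" "x \<noteq> y" by (auto simp: prs_set)
          have "?\<tau> x \<noteq> ?\<tau> y" using a(4) si by metis
          then have "rat_fun k (\<lambda>z. inverse (z (?\<tau> x) - z (?\<tau> y)) ^ M)"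
            using a i by (intro rat_fun_power rat_fun_inverse_diff) auto
          then show "rat_fun k (\<lambda>z. inverse (case a of (i, j) \<Rightarrow> (z (?\<tau> i) - z (?\<tau> j)) ^ M))"
            by (simp add: a power_inverse)
        qed
        then show ?thesis unfolding f_def by (intro rat_fun_mult rat_fun_const)
      qed
      fix z assume "z \<in> config k"
      let ?z = "\<lambda>j. z (?\<tau> j)"
      define l where "l x = (if x = mp then l_branch p (z mp) else l_branch p (z x - z mp))" for x
      have LB: "LB p ?z (\<sigma> x) = l x" for x by (auto simp: LB_def l_def neq si mp_def[symmetric])
      \<comment> \<open>\<open>is_correlation\<close> sums over \<open>{..K}\<close> and
        \<open>egf\<close> over \<open>{..<K}\<close>; \<open>K\<close> is positive because
        \<open>RB\<close> is.\<close>
      have K1: "{..K - 1} = {..<K}" using K RB(3) by auto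
      have "(\<Prod>j\<in>{..<k} - {m}. exp (- aj j * LB p ?z j)) = (\<Prod>x\<in>{..<k} - {mp}. exp (- aj (\<sigma> x) * LB p ?z (\<sigma> x)))"
      proof (rule prod.reindex_bij_betw[symmetric])
        show "bij_betw \<sigma> ({..<k} - {mp}) ({..<k} - {m})"
          by (rule bij_betwI[where g = ?\<tau>]) (auto simp: i si neq mp_def inj_eq[OF permutes_inj[OF permutes_inv[OF s]]])
      qed
      also have "\<dots> = (\<Prod>x\<in>{..<k} - {mp}. exp (- label_al G (?fs ! x) * l_branch p (z x - z mp)))"
      proof (rule prod.cong)
        fix x assume x: "x \<in> {..<k} - {mp}"
        then have "\<sigma> x < k" "\<sigma> x \<noteq> m" using i neq by auto
        then have "label_al G (?fs ! x) = aj (\<sigma> x)" using phi_gi[of "\<sigma> x"] x by (simp add: aj_def)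
        then show "exp (- aj (\<sigma> x) * LB p ?z (\<sigma> x)) = exp (- label_al G (?fs ! x) * l_branch p (z x - z mp))"
          using x unfolding LB l_def by simp
      qed simp
      finally have p1: "(\<Prod>j\<in>{..<k} - {m}. exp (- aj j * LB p ?z j))
        = (\<Prod>x\<in>{..<k} - {mp}. exp (- label_al G (?fs ! x) * l_branch p (z x - z mp)))" .
      have p2: "(\<Prod>x<k. (- l x) ^ r x / fact (r x)) = (\<Prod>x<k. (- 1) ^ r x / fact (r x)) *
        ((\<Prod>x\<in>{..<k} - {mp}. l_branch p (z x - z mp) ^ r x) * l_branch p (z mp) ^ r mp)" for r :: "nat \<Rightarrow> nat"
      proof -
        have "(\<Prod>x<k. (- l x) ^ r x / fact (r x)) = (\<Prod>x<k. (- 1) ^ r x / fact (r x)) * (\<Prod>x<k. l x ^ r x)"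
          unfolding prod.distrib[symmetric] by (intro prod.cong refl) (simp add: power_minus[of "l _"])
        also have "(\<Prod>x<k. l x ^ r x) = l mp ^ r mp * (\<Prod>x\<in>{..<k} - {mp}. l x ^ r x)"
          using mp by (intro prod.remove) auto
        also have "(\<Prod>x\<in>{..<k} - {mp}. l x ^ r x) = (\<Prod>x\<in>{..<k} - {mp}. l_branch p (z x - z mp) ^ r x)"
          by (rule prod.cong) (auto simp: l_def)
        finally show ?thesis by (simp add: l_def mult_ac)
      qed
      have "egf {..<k} K (RR M P ?z) (\<lambda>j. - LB p ?z j) = egf {..<k} K (\<lambda>r. RR M P ?z (restrict (\<lambda>j. r (?\<tau> j)) {..<k})) (\<lambda>x. - l x)"
        unfolding egf_permute[OF s, of K "RR M P ?z"] LB ..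
      then have "ksgn par ?w * \<Phi> ?z = (\<Sum>r\<in>{..<k} \<rightarrow>\<^sub>E {..<K}. ksgn par ?w * (exp (- al * l_branch p (z mp)) *
          (\<Prod>x\<in>{..<k} - {mp}. exp (- label_al G (?fs ! x) * l_branch p (z x - z mp))) *
          ((\<Prod>x<k. (- l x) ^ r x / fact (r x)) * RR M P ?z (restrict (\<lambda>j. r (?\<tau> j)) {..<k}))))"
        unfolding \<Phi>_def p1 mp_def[symmetric] by (simp only: egf_def sum_distrib_left)
      also have "\<dots> = (\<Sum>r\<in>{..<k} \<rightarrow>\<^sub>E {..K - 1}. f r z *
             (\<Prod>j\<in>{..<k} - {mp}. exp (- label_al G (?fs ! j) * l_branch p (z j - z mp))
                * l_branch p (z j - z mp) ^ r j) *
             exp (- al * l_branch p (z mp)) * l_branch p (z mp) ^ r mp)"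
        unfolding K1 p2 f_def prod.distrib by (intro sum.cong refl) (simp only: mult_ac)
      finally show "ksgn par ?w * \<Phi> ?z = (\<Sum>r\<in>{..<k} \<rightarrow>\<^sub>E {..K - 1}. f r z *
             (\<Prod>j\<in>{..<k} - {mp}. exp (- label_al G (?fs ! j) * l_branch p (z j - z mp))
                * l_branch p (z j - z mp) ^ r j) *
             exp (- al * l_branch p (z mp)) * l_branch p (z mp) ^ r mp)" .
    qed
    have sum: "((\<lambda>ms. w' (modes_W V G W ?fs ms v) * (\<Prod>j<k. mono_branch p (z j) (fst (ms ! j)) (snd (ms ! j))))
          has_sum (ksgn par ?w * \<Phi> (\<lambda>j. z (?\<tau> j)))) {ms. length ms = k}" if z: "z \<in> corr_region mp k" for z
    proof -
      let ?z = "\<lambda>j. z (?\<tau> j)"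
      have nz: "\<forall>i<k. z i \<noteq> 0" and nm: "\<forall>i j. i < j \<and> j < k \<longrightarrow> norm (z i) > norm (z j)"
        and ag: "\<forall>i<mp. \<bar>Arg2pi (z i - z mp) - Arg2pi (z i)\<bar> < pi / 2"
          "\<forall>i. mp < i \<and> i < k \<longrightarrow> pi / 2 < Arg2pi (z i - z mp) - Arg2pi (z mp) \<and>
            Arg2pi (z i - z mp) - Arg2pi (z mp) < 3 * pi / 2"
        using z unfolding corr_region_def mem_Collect_eq by simp_all
      have bf: "?\<tau> x < ?\<tau> y" "x < k" "y < k" if bxy: "before ?w x y" for x y
      proof -
        obtain xs ys zs where e: "?w = xs @ x # ys @ y # zs" using bxy by (auto simp: before_def)
        have len: "length xs + length ys + 1 < k" using arg_cong[OF e, of length] by simp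
        have "?w ! length xs = x" "?w ! (length xs + length ys + 1) = y"
          unfolding e by (simp_all add: nth_append)
        then have "\<sigma> (length xs) = x" "\<sigma> (length xs + length ys + 1) = y" using len by auto
        then have "?\<tau> x = length xs" "?\<tau> y = length xs + length ys + 1" using si(2) by metis+
        then show "?\<tau> x < ?\<tau> y" by simp
        show "x < k" "y < k" using before_set[OF bxy] w by (auto simp: word_def)
      qed
      have dz: "decr ?w ?z"
        unfolding decr_def using nz nm bf i by (metis (no_types, lifting))
      from num w dz obtain S0 where S0: "\<And>r. ((\<lambda>e. C ?w e r * zpow {..<k} ?z e) has_sum S0 r) UNIV"
        "\<And>\<mu>. egf {..<k} K S0 \<mu> = ksgn par ?w * (\<Prod>j\<in>{..<k} - {m}. exp (- aj j * Lam ?w ?z j)) *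
          egf {..<k} K (RR M P ?z) (\<lambda>j. if j = m then \<mu> m else \<mu> j - Lam ?w ?z j)" by blast
      \<comment> \<open>Here the inequalities of the region enter: the logarithm from the expansion
        and the correction from the kernel combine to the branch at the difference.\<close>
      have LBe: "bs ?w p ?z j + Lam ?w ?z j = LB p ?z j" if j: "j < k" "j \<noteq> m" for j
      proof (cases "left ?w j")
        case True
        then have "before ?w j m" using left_before[OF w j] by simp
        note b = bf[OF this, folded mp_def]
        have "l_branch p (z (?\<tau> j)) + Ln (1 - z mp / z (?\<tau> j)) = l_branch p (z (?\<tau> j) - z mp)"
          by (rule l_branch_add_left) (use nz nm ag(1) b i mp in auto)
        then show ?thesis using True j by (simp add: bs_def Lam_def LB_def mp_def)
      next
        case False
        then have "before ?w m j" using left_before[OF w j] by simp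
        note b = bf[OF this, folded mp_def]
        have "l_branch p (z mp) + (pi * \<i> + Ln (1 - z (?\<tau> j) / z mp)) = l_branch p (z (?\<tau> j) - z mp)"
          by (rule l_branch_add_right) (use nz nm ag(2) b i mp in auto)
        then show ?thesis using False j by (simp add: bs_def Lam_def LB_def mp_def)
      qed
      have bm: "bs ?w p ?z m = LB p ?z m"
        using set_takeWhileD[of m "\<lambda>x. x \<noteq> m" ?w] by (auto simp: bs_def LB_def left_def)
      have zn: "?z x \<noteq> 0" if "x < k" for x using nz i that by simp
      have e1: "(\<lambda>ms. w' (modes_W V G W (map \<phi> ?w) ms v) * (\<Prod>x<k. mono_branch p (?z (?w ! x)) (fst (ms ! x)) (snd (ms ! x))))
        = (\<lambda>ms. w' (modes_W V G W ?fs ms v) * (\<Prod>j<k. mono_branch p (z j) (fst (ms ! j)) (snd (ms ! j))))"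
        by (intro ext arg_cong2[of _ _ _ _ "(*)"] prod.cong refl) (simp_all add: si o_def)
      have e2: "exp (- al * l_branch p (?z m)) * (\<Prod>j\<in>{..<k} - {m}. exp (- aj j * bs ?w p ?z j)) *
          egf {..<k} K S0 (\<lambda>j. - bs ?w p ?z j) = ksgn par ?w * \<Phi> ?z"
      proof -
        have AB: "(\<Prod>j\<in>{..<k} - {m}. exp (- aj j * bs ?w p ?z j)) * (\<Prod>j\<in>{..<k} - {m}. exp (- aj j * Lam ?w ?z j))
          = (\<Prod>j\<in>{..<k} - {m}. exp (- aj j * LB p ?z j))"
          unfolding prod.distrib[symmetric] exp_add[symmetric]
          by (intro prod.cong refl arg_cong[of _ _ exp]) (simp add: LBe[symmetric] distrib_left)
        have neg: "- bs ?w p ?z j - Lam ?w ?z j = - LB p ?z j" if "j < k" "j \<noteq> m" for j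
          unfolding LBe[OF that, symmetric] by simp
        have EE: "egf {..<k} K (RR M P ?z) (\<lambda>j. if j = m then - bs ?w p ?z m else - bs ?w p ?z j - Lam ?w ?z j)
          = egf {..<k} K (RR M P ?z) (\<lambda>j. - LB p ?z j)"
          by (rule egf_cong) (simp add: bm neg)
        show ?thesis unfolding S0(2) \<Phi>_def AB[symmetric] EE by (simp only: mult_ac)
      qed
      have "((\<lambda>ms. w' (modes_W V G W (map \<phi> ?w) ms v) * (\<Prod>x<k. mono_branch p (?z (?w ! x)) (fst (ms ! x)) (snd (ms ! x))))
        has_sum (exp (- al * l_branch p (?z m)) * (\<Prod>j\<in>{..<k} - {m}. exp (- aj j * bs ?w p ?z j)) *
          egf {..<k} K S0 (\<lambda>j. - bs ?w p ?z j))) {ms. length ms = k}"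
        by (rule series[OF w _ al K S0(1)]) (rule zn)
      then show ?thesis unfolding e1 e2 .
    qed
    show ?thesis
      unfolding is_correlation_def Let_def tp length_map length_upt diff_zero
      using form[unfolded log_form_def] sum by blast
  qed
  then show ?thesis by blast
qed

end

text \<open>Two candidates agree on the region as sums of the same series, hence on all of
  \<open>config\<close> by \<open>log_form_unique\<close>.\<close>

lemma is_correlation_the:
  assumes c: "is_correlation V G W p w' fs \<alpha> v F" and m: "twist_pos fs < length fs" and z: "z \<in> config (length fs)"
  shows "(THE c. \<exists>F. is_correlation V G W p w' fs \<alpha> v F \<and> c = F z) = F z"
proof (rule the_equality)
  show "\<exists>F'. is_correlation V G W p w' fs \<alpha> v F' \<and> F z = F' z" using c by blast
next
  fix c' assume "\<exists>F. is_correlation V G W p w' fs \<alpha> v F \<and> c' = F z"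
  then obtain F' where F': "is_correlation V G W p w' fs \<alpha> v F'" "c' = F' z" by blast
  have lf: "log_form (length fs) (twist_pos fs) (\<lambda>j. label_al G (fs ! j)) p \<alpha> H" if "is_correlation V G W p w' fs \<alpha> v H" for H
    using that unfolding is_correlation_def Let_def log_form_def by (rule conjunct1)
  have "F' z = F z"
  proof (rule log_form_unique[OF lf[OF F'(1)] lf[OF c] m _ z])
    fix x assume x: "x \<in> corr_region (twist_pos fs) (length fs)"
    show "F' x = F x"
      using F'(1)[unfolded is_correlation_def Let_def, THEN conjunct2, THEN bspec, OF x]
        c[unfolded is_correlation_def Let_def, THEN conjunct2, THEN bspec, OF x]
      by (rule has_sum_unique)
  qed
  then show "c' = F z" using F'(2) by simp
qed

theorem corollary3p3:
  fixes V :: "'v::complex_vector vertex_data"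
    and g N_V :: "'v \<Rightarrow> 'v"
    and G :: "('v, 'i) generators"
    and W :: "('v, 'w::complex_vector, 'i, 'a) twist_data"
    and v :: 'v and w' :: "'w \<Rightarrow> complex" and p :: int
    and k :: nat and \<sigma> :: "nat \<Rightarrow> nat"
    and \<phi> :: "nat \<Rightarrow> ('i, 'a) field_label" and z :: "nat \<Rightarrow> complex"
  assumes "vertex_superalgebra V"
    and "vsa_automorphism V g"
    and "log_nilpotent_part g (V_g g) N_V"
    and "generation_assumption V g N_V G"
    and "twist_structure V g G W"
    and "weight_property V G W"
    and "derivative_property V G W"
    and "vacuum_property V W"
    and "spanning_property G W"
    and "g_property V N_V G W"
    and "weak_commutativity_phi G W"
    and "weak_commutativity_psi V N_V G W"
    and "w' \<in> graded_dual (W_wt W)"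
    and "\<sigma> permutes {..<k}"
    and "labels_in G W (map \<phi> [0..<k])"
    and "\<exists>!j. j < k \<and> is_twist (\<phi> j)"
    and "z \<in> config k"
  shows "correlation V g G W p w' (map \<phi> [0..<k]) v z
    = koszul_sign k \<sigma> (\<lambda>j. label_par G W (\<phi> j))
      * correlation V g G W p w' (map (\<lambda>j. \<phi> (\<sigma> j)) [0..<k]) v (\<lambda>j. z (\<sigma> j))"
proof -
  interpret vsa_generated V g N_V G by unfold_locales (fact assms)+
  obtain m where m: "m < k" "is_twist (\<phi> m)" and um: "\<And>j. j < k \<Longrightarrow> is_twist (\<phi> j) \<Longrightarrow> j = m"
    using assms(16) by blast
  obtain a where a: "\<phi> m = Twist a" using m(2) by (auto simp: is_twist_def)
  have lab: "\<phi> j \<in> Gen ` I_set G \<union> Twist ` A_set W" if "j < k" for j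
  proof -
    have "\<phi> j \<in> \<phi> ` {0..<k}" using that by auto
    then show ?thesis using assms(15) unfolding labels_in_def set_map set_upt by blast
  qed
  have aA: "a \<in> A_set W" using lab[OF m(1)] a by auto
  have gens: "\<exists>i\<in>I_set G. \<phi> j = Gen i" if "j < k" "j \<noteq> m" for j
    using lab[OF that(1)] um[OF that(1)] that(2) by (auto simp: is_twist_def)
  note s = assms(14)
  let ?par = "\<lambda>j. label_par G W (\<phi> j)"
  have i: "\<sigma> x < k \<longleftrightarrow> x < k" for x using permutes_in_image[OF s, of x] by auto
  have zs: "(\<lambda>j. z (\<sigma> j)) \<in> config k"
  proof -
    have zz: "z x \<noteq> z y" if "x < k" "y < k" "x \<noteq> y" for x y
    proof (cases "y < x")
      case False
      then have "z y \<noteq> z x" using assms(17) that by (simp add: config_def)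
      then show ?thesis by simp
    qed (use assms(17) that in \<open>simp add: config_def\<close>)
    have "z (\<sigma> x) \<noteq> z (\<sigma> y)" if "x < k" "y < x" for x y
      using zz[of "\<sigma> x" "\<sigma> y"] that i permutes_inj[OF s] by (auto dest: injD)
    then show ?thesis using assms(17) i by (simp add: config_def)
  qed
  have tp: "twist_pos (map (\<lambda>j. \<phi> (\<rho> j)) [0..<k]) < k" if r: "\<rho> permutes {..<k}" for \<rho>
  proof -
    have ir: "\<rho> x < k \<longleftrightarrow> x < k" for x using permutes_in_image[OF r, of x] by auto
    have "\<exists>!x. x < k \<and> is_twist (\<phi> (\<rho> x))"
    proof (rule ex1I[of _ "inv \<rho> m"])
      show "inv \<rho> m < k \<and> is_twist (\<phi> (\<rho> (inv \<rho> m)))"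
        using m permutes_inverses[OF r] permutes_in_image[OF permutes_inv[OF r], of m] by auto
      show "x = inv \<rho> m" if "x < k \<and> is_twist (\<phi> (\<rho> x))" for x
        using um[of "\<rho> x"] that ir permutes_inverses[OF r] by metis
    qed
    then have "(THE x. x < k \<and> is_twist (\<phi> (\<rho> x))) < k" using theI'[of "\<lambda>x. x < k \<and> is_twist (\<phi> (\<rho> x))"] by blast
    moreover have "(\<lambda>x. x < length (map (\<lambda>j. \<phi> (\<rho> j)) [0..<k]) \<and> is_twist (map (\<lambda>j. \<phi> (\<rho> j)) [0..<k] ! x))
      = (\<lambda>x. x < k \<and> is_twist (\<phi> (\<rho> x)))" by auto
    ultimately show ?thesis unfolding twist_pos_def by simp
  qed
  have kos: "koszul_sign k \<rho> ?par = ksgn ?par (map \<rho> [0..<k])" if r: "\<rho> permutes {..<k}" for \<rho>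
  proof -
    have "distinct (map \<rho> [0..<k])" using permutes_inj_on[OF r] by (simp add: distinct_map)
    from koszul_ksgn[OF this, of ?par] show ?thesis
      unfolding koszul_sign_def by (auto intro!: prod.cong)
  qed
  have kid: "koszul_sign k id ?par = 1"
    unfolding koszul_sign_def by (rule prod.neutral) auto
  \<comment> \<open>Correlation functions are formed for each g-weight component of
    \<open>v\<close>; a nonzero component has its exponent in \<open>P_V\<close>.\<close>
  have main: "(THE c. \<exists>F. is_correlation V G W p w' (map \<phi> [0..<k]) \<alpha> (component (V_g g) v \<alpha>) F \<and> c = F z)
    = koszul_sign k \<sigma> ?par * (THE c. \<exists>F. is_correlation V G W p w' (map (\<lambda>j. \<phi> (\<sigma> j)) [0..<k]) \<alpha> (component (V_g g) v \<alpha>) F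
        \<and> c = F (\<lambda>j. z (\<sigma> j)))" if nz: "component (V_g g) v \<alpha> \<noteq> 0" for \<alpha>
  proof -
    let ?v = "component (V_g g) v \<alpha>"
    have vg: "?v \<in> V_g g \<alpha>" by (rule component_in[OF V_g_direct_sum])
    then have PV: "\<alpha> \<in> P_V g" using nz by (auto simp: V_g_def split: if_splits)
    interpret correlator V g N_V G W k \<phi> m a \<alpha> ?v w'
      by unfold_locales (fact assms m(1) a aA | (rule gens, assumption, assumption))+
    obtain \<Phi> where \<Phi>: "\<And>\<rho>. \<rho> permutes {..<k} \<Longrightarrow> is_correlation V G W p w' (map (\<lambda>j. \<phi> (\<rho> j)) [0..<k]) \<alpha> ?v
      (\<lambda>z. ksgn par (map \<rho> [0..<k]) * \<Phi> (\<lambda>j. z (inv \<rho> j)))"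
      using is_correlation_perm[OF PV vg, of p] by blast
    have par: "par = ?par" by (simp add: fun_eq_iff par_def)
    have id: "id permutes {..<k}" by (rule permutes_id)
    have the: "(THE c. \<exists>F. is_correlation V G W p w' (map (\<lambda>j. \<phi> (\<rho> j)) [0..<k]) \<alpha> ?v F \<and> c = F y)
      = koszul_sign k \<rho> ?par * \<Phi> (\<lambda>j. y (inv \<rho> j))" if "\<rho> permutes {..<k}" "y \<in> config k" for \<rho> y
      using is_correlation_the[OF \<Phi>[OF that(1)]] tp[OF that(1)] that(2) by (simp add: kos[OF that(1)] par)
    have sq: "koszul_sign k \<sigma> ?par * koszul_sign k \<sigma> ?par = 1" unfolding kos[OF s] by (rule ksgn_sq)
    \<comment> \<open>The permuted word at the permuted point gives back the value of
      \<open>\<Phi>\<close> at \<open>z\<close>, and the two equal signs multiply to 1.\<close>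
    have "(\<lambda>j. z (\<sigma> (inv \<sigma> j))) = z" using permutes_inverses[OF s] by simp
    then show ?thesis
      using the[OF id assms(17)] the[OF s zs] sq by (simp add: kid mult.assoc[symmetric])
  qed
  show ?thesis
    unfolding correlation_def sum_distrib_left by (rule sum.cong[OF refl]) (use main in auto)
qed

end
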